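(* Let $\Omega \subset\subset \mathbb{C}^n$ be a bounded domain with squeezing function $s_\Omega$. If $\lim_{z\to q} s_\Omega(z) = 1$ for every $q\in\partial\Omega$, then $\Omega$ admits a complete Kähler metric with negatively pinched holomorphic bisectional curvature on $\Omega$.
   Context: Squeezing function. Let $B(0,r)$ denote the open ball of radius $r$ centered at $0$ in $\mathbb{C}^n$. For $z\in\Omega$ let $\mathcal{F}^\Omega_z$ be the set of holomorphic embeddings $f:\Omega\to B(0,1)$ with $f(z)=0$. The squeezing function of $\Omega$ is $$s_\Omega(z)=\sup_{f\in\mathcal{F}^\Omega_z}\ \sup\{r>0 : B(0,r)\subset f(\Omega)\}.$$ Curvature. For a Hermitian metric $h$ on a complex manifold $M$, with local expression $h_{i\bar j}$ in holomorphic coordinates $(z_1,\dots,z_n)$ and inverse matrix $h^{i\bar j}$, the curvature tensor $R_h$ is $$R_{i\bar j k\bar l} = -\frac{\partial^2 h_{i\bar j}}{\partial z_k\partial \bar z_l} + \sum_{s,t} h^{s\bar t}\,\frac{\partial h_{i\bar t}}{\partial z_k}\,\frac{\partial h_{s\bar j}}{\partial \bar z_l},$$ and for $X,Y,Z,T\in T^{1,0}_pM$, $R_h(X,\overline Y,Z,\overline T)=\sum_{i,j,k,l} R_{i\bar jk\bar l}X_i\overline{Y}_jZ_k\overline{T}_l$. For nonzero $X,Y\in T^{1,0}_pM$ the holomorphic bisectional curvature is $$HBC(h)(X,Y)=\frac{R_h(X,\overline X,Y,\overline Y)}{h(X,\overline X)\,h(Y,\overline Y)}.$$ The metric $h$ is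 of negatively pinched holomorphic bisectional curvature on $M$ if there are constants $C,C'>0$ such that $-C'\le HBC(h)(X,Y)\le -C$ for all $p\in M$ and all nonzero $X,Y\in T_p^{1,0}M$. *)

theory Defs
  imports "HOL-Analysis.Analysis"
begin

definition holomorphic_map_on :: "(complex^'n \<Rightarrow> complex^'m) \<Rightarrow> (complex^'n) set \<Rightarrow> bool" where
  "holomorphic_map_on f S \<longleftrightarrow>
     (\<forall>z\<in>S. \<exists>D. (f has_derivative D) (at z) \<and> (\<forall>c v. D (c *s v) = c *s D v))"

definition holomorphic_embedding_on :: "(complex^'n \<Rightarrow> complex^'m) \<Rightarrow> (complex^'n) set \<Rightarrow> bool" where
  "holomorphic_embedding_on f S \<longleftrightarrow>
     holomorphic_map_on f S \<and>
     (\<forall>z\<in>S. inj (frechet_derivative f (at z))) \<and>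
     (\<exists>g. homeomorphism S (f ` S) f g)"

definition squeezing_maps :: "(complex^'n) set \<Rightarrow> complex^'n \<Rightarrow> (complex^'n \<Rightarrow> complex^'n) set" where
  "squeezing_maps \<Omega> z = {f. holomorphic_embedding_on f \<Omega> \<and> f ` \<Omega> \<subseteq> ball 0 1 \<and> f z = 0}"

text \<open>For a bounded domain and a point of it, both suprema are over nonempty sets of reals
  bounded above by 1.\<close>

definition squeezing_function :: "(complex^'n) set \<Rightarrow> complex^'n \<Rightarrow> real" where
  "squeezing_function \<Omega> z =
     (SUP f\<in>squeezing_maps \<Omega> z. Sup {r. 0 < r \<and> ball 0 r \<subseteq> f ` \<Omega>})"

primrec Ck_on :: "nat \<Rightarrow> ('a::euclidean_space \<Rightarrow> 'b::real_normed_vector) \<Rightarrow> 'a set \<Rightarrow> bool" where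
  "Ck_on 0 f S \<longleftrightarrow> continuous_on S f"
| "Ck_on (Suc k) f S \<longleftrightarrow>
     (\<forall>x\<in>S. f differentiable (at x)) \<and>
     (\<forall>v. Ck_on k (\<lambda>x. frechet_derivative f (at x) v) S)"

definition smooth_on :: "('a::euclidean_space \<Rightarrow> 'b::real_normed_vector) \<Rightarrow> 'a set \<Rightarrow> bool" where
  "smooth_on f S \<longleftrightarrow> (\<forall>k. Ck_on k f S)"

text \<open>The metric is given by its coefficient matrix in the global coordinates:
  the entry \<^term>\<open>h z $ i $ j\<close> is $h_{i\bar j}(z)$, and the form is conjugate-linear in the second
  argument. A vector \<open>X\<close> stands for the $(1,0)$-vector with components \<^term>\<open>X $ i\<close>, and,
  as a tangent vector of the underlying real manifold, for twice the real part of the latter.\<close>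

definition herm_form :: "complex^'n^'n \<Rightarrow> complex^'n \<Rightarrow> complex^'n \<Rightarrow> complex" where
  "herm_form H X Y = (\<Sum>i\<in>UNIV. \<Sum>j\<in>UNIV. H $ i $ j * X $ i * cnj (Y $ j))"

definition hermitian_metric_on :: "(complex^'n) set \<Rightarrow> (complex^'n \<Rightarrow> complex^'n^'n) \<Rightarrow> bool" where
  "hermitian_metric_on \<Omega> h \<longleftrightarrow>
     smooth_on h \<Omega> \<and>
     (\<forall>z\<in>\<Omega>. (\<forall>i j. h z $ j $ i = cnj (h z $ i $ j)) \<and>
             (\<forall>X. X \<noteq> 0 \<longrightarrow> 0 < Re (herm_form (h z) X X)))"

text \<open>The real 2-form $\frac{i}{2} \sum h_{i\bar j}\, dz_i \wedge d\bar z_j$.\<close>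

definition fundamental_form ::
  "(complex^'n \<Rightarrow> complex^'n^'n) \<Rightarrow> complex^'n \<Rightarrow> complex^'n \<Rightarrow> complex^'n \<Rightarrow> real" where
  "fundamental_form h z u v = - Im (herm_form (h z) u v)"

text \<open>Exterior derivative of a 2-form, evaluated on constant vector fields.\<close>

definition ext_deriv2 ::
  "('a::real_normed_vector \<Rightarrow> 'a \<Rightarrow> 'a \<Rightarrow> real) \<Rightarrow> 'a \<Rightarrow> 'a \<Rightarrow> 'a \<Rightarrow> 'a \<Rightarrow> real" where
  "ext_deriv2 \<omega> z u v w =
     frechet_derivative (\<lambda>x. \<omega> x v w) (at z) u
     - frechet_derivative (\<lambda>x. \<omega> x u w) (at z) v
     + frechet_derivative (\<lambda>x. \<omega> x u v) (at z) w"

definition kaehler_metric_on :: "(complex^'n) set \<Rightarrow> (complex^'n \<Rightarrow> complex^'n^'n) \<Rightarrow> bool" where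
  "kaehler_metric_on \<Omega> h \<longleftrightarrow>
     hermitian_metric_on \<Omega> h \<and>
     (\<forall>z\<in>\<Omega>. \<forall>u v w. ext_deriv2 (fundamental_form h) z u v w = 0)"

definition metric_speed ::
  "(complex^'n \<Rightarrow> complex^'n^'n) \<Rightarrow> (real \<Rightarrow> complex^'n) \<Rightarrow> real \<Rightarrow> real" where
  "metric_speed h \<gamma> t =
     sqrt (Re (herm_form (h (\<gamma> t)) (vector_derivative \<gamma> (at t)) (vector_derivative \<gamma> (at t))))"

text \<open>A valid path need not have one-sided derivatives at its finitely many exceptional points,
  so its speed may fail to be integrable, in which case \<^const>\<open>integral\<close> would return 0.
  Such paths of infinite length are therefore excluded explicitly.\<close>

definition metric_dist ::
  "(complex^'n) set \<Rightarrow> (complex^'n \<Rightarrow> complex^'n^'n) \<Rightarrow> complex^'n \<Rightarrow> complex^'n \<Rightarrow> real" where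
  "metric_dist \<Omega> h x y =
     (if x \<in> \<Omega> \<and> y \<in> \<Omega> then
        Inf {integral {0..1} (metric_speed h \<gamma>) | \<gamma>.
               valid_path \<gamma> \<and> path_image \<gamma> \<subseteq> \<Omega> \<and> pathstart \<gamma> = x \<and> pathfinish \<gamma> = y \<and>
               metric_speed h \<gamma> integrable_on {0..1}}
      else 0)"

text \<open>On a connected open set the distance of a Hermitian metric is a metric in the sense of
  \<^locale>\<open>Metric_space\<close>; the value 0 off the set only serves the locale's requirement that distances
  be nonnegative and symmetric on the whole type.\<close>

definition complete_metric_on :: "(complex^'n) set \<Rightarrow> (complex^'n \<Rightarrow> complex^'n^'n) \<Rightarrow> bool" where
  "complete_metric_on \<Omega> h \<longleftrightarrow> Metric_space.mcomplete \<Omega> (metric_dist \<Omega> h)"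

definition wirtinger_dz :: "'n \<Rightarrow> (complex^'n \<Rightarrow> complex) \<Rightarrow> complex^'n \<Rightarrow> complex" where
  "wirtinger_dz k f z = (frechet_derivative f (at z) (axis k 1)
               - \<i> * frechet_derivative f (at z) (axis k \<i>)) / 2"

definition wirtinger_dzbar :: "'n \<Rightarrow> (complex^'n \<Rightarrow> complex) \<Rightarrow> complex^'n \<Rightarrow> complex" where
  "wirtinger_dzbar k f z = (frechet_derivative f (at z) (axis k 1)
                  + \<i> * frechet_derivative f (at z) (axis k \<i>)) / 2"

text \<open>The coefficients $h^{s\bar t}$ satisfy $\sum_t h_{r\bar t} h^{s\bar t} = \delta_{rs}$, that is,
  $h^{s\bar t}$ is the entry of the inverse matrix in row $t$ and column $s$.\<close>

definition inverse_coeff :: "complex^'n^'n \<Rightarrow> 'n \<Rightarrow> 'n \<Rightarrow> complex" where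
  "inverse_coeff H s t = matrix_inv H $ t $ s"

definition curv_coeff ::
  "(complex^'n \<Rightarrow> complex^'n^'n) \<Rightarrow> complex^'n \<Rightarrow> 'n \<Rightarrow> 'n \<Rightarrow> 'n \<Rightarrow> 'n \<Rightarrow> complex" where
  "curv_coeff h z i j k l =
     - wirtinger_dz k (wirtinger_dzbar l (\<lambda>w. h w $ i $ j)) z
     + (\<Sum>s\<in>UNIV. \<Sum>t\<in>UNIV. inverse_coeff (h z) s t *
          wirtinger_dz k (\<lambda>w. h w $ i $ t) z * wirtinger_dzbar l (\<lambda>w. h w $ s $ j) z)"

text \<open>The second and fourth arguments are the vectors whose conjugates enter the curvature tensor.\<close>

definition curv_tensor ::
  "(complex^'n \<Rightarrow> complex^'n^'n) \<Rightarrow> complex^'n \<Rightarrow>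
     complex^'n \<Rightarrow> complex^'n \<Rightarrow> complex^'n \<Rightarrow> complex^'n \<Rightarrow> complex" where
  "curv_tensor h z X Y Z T =
     (\<Sum>i\<in>UNIV. \<Sum>j\<in>UNIV. \<Sum>k\<in>UNIV. \<Sum>l\<in>UNIV.
        curv_coeff h z i j k l * X $ i * cnj (Y $ j) * Z $ k * cnj (T $ l))"

text \<open>The quotient is real for every Hermitian metric; \<^const>\<open>Re\<close> only changes its type.\<close>

definition HBC :: "(complex^'n \<Rightarrow> complex^'n^'n) \<Rightarrow> complex^'n \<Rightarrow> complex^'n \<Rightarrow> complex^'n \<Rightarrow> real" where
  "HBC h z X Y =
     Re (curv_tensor h z X X Y Y / (herm_form (h z) X X * herm_form (h z) Y Y))"

definition negatively_pinched_HBC_on ::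
  "(complex^'n) set \<Rightarrow> (complex^'n \<Rightarrow> complex^'n^'n) \<Rightarrow> bool" where
  "negatively_pinched_HBC_on \<Omega> h \<longleftrightarrow>
     (\<exists>C>0. \<exists>C'>0. \<forall>p\<in>\<Omega>. \<forall>X Y. X \<noteq> 0 \<longrightarrow> Y \<noteq> 0 \<longrightarrow>
        - C' \<le> HBC h p X Y \<and> HBC h p X Y \<le> - C)"

end

theory Submission
  imports Defs "HOL-Complex_Analysis.Complex_Analysis"
begin

text \<open>Say that an embedding of \<open>\<Omega>\<close> is centred at \<open>p\<close> if it maps \<open>\<Omega>\<close> into the unit ball, \<open>p\<close> to \<open>0\<close>, and its image
contains the ball of radius \<open>1 - \<tau>\<close>. Since the squeezing function tends to 1 at the boundary, for every
\<open>\<tau> > 0\<close> such an embedding exists for each \<open>p\<close> outside a compact set. Pulled back along it, the Bergman metric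
of the ball has the potential \<open>log |det f'|\<^sup>2 - (n + 1) log (1 - |f|\<^sup>2)\<close> (called \<open>logvol f\<close>) and negatively pinched
curvature; the problem is that the embeddings depend on \<open>p\<close> in an uncontrolled way and have to be glued.

The potentials, and not the metrics, are averaged. For two embeddings \<open>f\<^sub>1\<close> and \<open>f\<^sub>2\<close> with nearby centres,
the Schwarz lemma applied to \<open>f\<^sub>2 \<circ> f\<^sub>1\<inverse>\<close> between balls, composed with automorphisms of the ball that move the two images of a
point to the origin, bounds the Jacobian determinant; this is exactly a bound for \<open>logvol f\<^sub>2 - logvol f\<^sub>1\<close>
that tends to 0 with \<open>\<tau>\<close> (\<open>logvol_le\<close>). Cauchy's estimates bound every derivative of this difference in the
chart \<open>f\<^sub>1\<close>, and interpolation between the two turns uniform smallness into smallness of the derivatives up to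
order four (\<open>logvol_difference_small\<close>). A maximal separated set of centres gives embeddings of which only a
bounded number matters near any given point, so a weighted mean \<open>\<phi>\<close> of their potentials is, in the chart
centred at a point off a compact set, equal to \<open>- (n + 1) log (1 - |w|\<^sup>2)\<close> plus a pluriharmonic function plus an
error with four small derivatives (\<open>chart_error\<close>, \<open>chart_levi\<close>).

Curvature is controlled through a quantity that is linear in the potential. For a metric \<open>h\<close> with potential \<open>u\<close>,
the complex Hessian \<open>lev u\<close> of the function \<open>(p, X) \<mapsto> h\<^sub>p(X, X)\<close> on the tangent bundle, taken in the direction
\<open>(Y, V)\<close>, satisfies \<open>- R(X, X, Y, Y) = min\<^sub>V lev u p X Y V\<close> by completing the square (\<open>curv_tensor_lev\<close>).
Hence lower bounds for \<open>lev\<close> for all \<open>V\<close> and upper bounds for a single \<open>V\<close> bound the bisectional curvature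
from both sides (\<open>HBC_bounds\<close>), and potentials with nonnegative \<open>lev\<close> can be added freely. The function
\<open>|z|\<^sup>2 + \<kappa> |z|\<^sup>4\<close> with small \<open>\<kappa>\<close> is such a potential (\<open>base_pot_lev_ge\<close>): a large multiple of it repairs \<open>\<phi>\<close>
on the compact set, and outside it Cauchy's estimates in the charts keep the sum comparable to the metric of the ball.

The resulting metric dominates, up to a constant, the pullback of the Euclidean metric along every holomorphic map
from \<open>\<Omega>\<close> to the unit ball. Applied to centred embeddings this shows that metric balls of one fixed radius
are relatively compact, which gives completeness.\<close>

section \<open>Uniform bounds for iterated directional derivatives\<close>

abbreviation dird :: "'a::real_normed_vector \<Rightarrow> ('a \<Rightarrow> 'b::real_normed_vector) \<Rightarrow> 'a \<Rightarrow> 'b" where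
  "dird v f \<equiv> (\<lambda>x. frechet_derivative f (at x) v)"

text \<open>The constant \<open>M\<close> bounds the derivatives of orders \<open>0, \<dots>, k\<close> as multilinear forms. Smallness and uniformity of such bounds are what
the argument is about, so they are carried in the predicate; working with directional derivatives avoids
spaces of multilinear maps.\<close>

primrec CB :: "nat \<Rightarrow> real \<Rightarrow> ('a::real_normed_vector \<Rightarrow> 'b::real_normed_vector) \<Rightarrow> 'a set \<Rightarrow> bool" where
  "CB 0 M f S \<longleftrightarrow> (\<forall>x\<in>S. norm (f x) \<le> M)"
| "CB (Suc k) M f S \<longleftrightarrow> (\<forall>x\<in>S. norm (f x) \<le> M) \<and> (\<forall>x\<in>S. f differentiable (at x)) \<and>
     (\<forall>v. CB k (M * norm v) (dird v f) S)"

lemma CB_norm: "CB k M f S \<Longrightarrow> x \<in> S \<Longrightarrow> norm (f x) \<le> M"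
  by (cases k) auto

lemma CB_mono: "CB k M f S \<Longrightarrow> M \<le> N \<Longrightarrow> T \<subseteq> S \<Longrightarrow> CB k N f T"
proof (induction k arbitrary: M N f)
  case (Suc k)
  have "CB k (N * norm v) (dird v f) T" for v
    by (rule Suc.IH[of "M * norm v"]) (use Suc.prems in \<open>auto intro: mult_right_mono\<close>)
  then show ?case using Suc.prems by force
qed force

lemma CB_Suc_le: "CB (Suc k) M f S \<Longrightarrow> CB k M f S"
proof (induction k arbitrary: M f)
  case (Suc k)
  have "CB k (M * norm v) (dird v f) S" for v
    by (rule Suc.IH) (use Suc.prems in auto)
  then show ?case using Suc.prems by auto
qed auto

lemma CB_le: "CB k M f S \<Longrightarrow> j \<le> k \<Longrightarrow> CB j M f S"
  by (induction k) (use CB_Suc_le le_Suc_eq in blast)+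

lemma frechet_derivative_eq_open:
  assumes "open S" "x \<in> S" "\<And>y. y \<in> S \<Longrightarrow> f y = g y"
  shows "frechet_derivative f (at x) = frechet_derivative g (at x)"
proof -
  have "(f has_derivative D) (at x) \<longleftrightarrow> (g has_derivative D) (at x)" for D
    using assms has_derivative_transform_within_open[of f D x UNIV S g] has_derivative_transform_within_open[of g D x UNIV S f]
    by auto
  then show ?thesis unfolding frechet_derivative_def by simp
qed

lemma differentiable_cong_open:
  assumes "open S" "x \<in> S" "\<And>y. y \<in> S \<Longrightarrow> f y = g y"
  shows "f differentiable (at x) \<longleftrightarrow> g differentiable (at x)"
  using assms has_derivative_transform_within_open[of f _ x UNIV S g] has_derivative_transform_within_open[of g _ x UNIV S f]
  unfolding differentiable_def by metis

lemma CB_cong: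
  assumes "open S" "\<And>y. y \<in> S \<Longrightarrow> f y = g y"
  shows "CB k M f S \<longleftrightarrow> CB k M g S"
  using assms(2)
proof (induction k arbitrary: M f g)
  case (Suc k)
  have "CB k (M * norm v) (dird v f) S = CB k (M * norm v) (dird v g) S" for v
    by (rule Suc.IH) (use frechet_derivative_eq_open[OF assms(1)] Suc.prems in metis)
  then show ?case using Suc.prems differentiable_cong_open[OF assms(1), of _ f g] by auto
qed auto

lemma dird_eqI: "(f has_derivative f') (at x) \<Longrightarrow> dird v f x = f' v"
  by (metis frechet_derivative_at)

lemma CB_SucI:
  assumes "open S" "\<And>x. x \<in> S \<Longrightarrow> norm (f x) \<le> M"
    "\<And>x. x \<in> S \<Longrightarrow> (f has_derivative f' x) (at x)" "\<And>v. CB k (M * norm v) (\<lambda>x. f' x v) S"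
  shows "CB (Suc k) M f S"
proof -
  have "CB k (M * norm v) (dird v f) S" for v
    using CB_cong[OF assms(1), of "dird v f" "\<lambda>x. f' x v"] dird_eqI[OF assms(3)] assms(4) by auto
  then show ?thesis using assms(2,3) by (auto simp: differentiable_def)
qed

lemma CB_has_derivative: "CB (Suc k) M f S \<Longrightarrow> x \<in> S \<Longrightarrow> (f has_derivative (\<lambda>v. dird v f x)) (at x)"
  using frechet_derivative_works by auto

lemma CB_dird: "CB (Suc k) M f S \<Longrightarrow> CB k (M * norm v) (dird v f) S"
  by simp

lemma CB_zero: "M \<ge> 0 \<Longrightarrow> CB k M (\<lambda>x. 0) S"
  by (induction k arbitrary: M) (auto simp: frechet_derivative_const)

lemma CB_const: "norm c \<le> M \<Longrightarrow> CB k M (\<lambda>x. c) S"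
proof (cases k)
  case (Suc j)
  assume "norm c \<le> M" then have "M \<ge> 0" using norm_ge_zero order_trans by blast
  then show ?thesis using \<open>norm c \<le> M\<close> Suc by (auto simp: frechet_derivative_const CB_zero)
qed auto

lemma CB_add:
  assumes "open S" shows "CB k M f S \<Longrightarrow> CB k N g S \<Longrightarrow> CB k (M + N) (\<lambda>x. f x + g x) S"
proof (induction k arbitrary: M N f g)
  case 0 then show ?case by (auto intro: norm_triangle_le add_mono)
next
  case (Suc k)
  show ?case
  proof (rule CB_SucI[OF assms, where f' = "\<lambda>x v. dird v f x + dird v g x"])
    fix x assume x: "x \<in> S"
    show "norm (f x + g x) \<le> M + N" using CB_norm[OF Suc.prems(1) x] CB_norm[OF Suc.prems(2) x] by norm
    show "((\<lambda>x. f x + g x) has_derivative (\<lambda>v. dird v f x + dird v g x)) (at x)"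
      by (intro has_derivative_add CB_has_derivative[OF Suc.prems(1) x] CB_has_derivative[OF Suc.prems(2) x])
  next
    fix v
    show "CB k ((M + N) * norm v) (\<lambda>x. dird v f x + dird v g x) S"
      using Suc.IH[of "M * norm v" "dird v f" "N * norm v" "dird v g"] Suc.prems by (simp add: distrib_right)
  qed
qed

lemma CB_linear:
  assumes "open S" "bounded_linear L" "\<And>y. norm (L y) \<le> B * norm y"  "B \<ge> 0"
  shows "CB k M f S \<Longrightarrow> CB k (B * M) (\<lambda>x. L (f x)) S"
proof (induction k arbitrary: M f)
  case 0
  have "norm (L (f x)) \<le> B * M" if "x \<in> S" for x
    by (rule order_trans[OF assms(3) mult_left_mono]) (use 0 that assms(4) in auto)
  then show ?case by simp
next
  case (Suc k)
  show ?case
  proof (rule CB_SucI[OF assms(1), where f' = "\<lambda>x v. L (dird v f x)"])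
    fix x assume x: "x \<in> S"
    show "norm (L (f x)) \<le> B * M" 
      using assms(3)[of "f x"] CB_norm[OF Suc.prems x] assms(4) by (meson mult_left_mono order_trans)
    show "((\<lambda>x. L (f x)) has_derivative (\<lambda>v. L (dird v f x))) (at x)"
      by (intro bounded_linear.has_derivative[OF assms(2)] CB_has_derivative[OF Suc.prems x])
  next
    fix v
    show "CB k (B * M * norm v) (\<lambda>x. L (dird v f x)) S"
      using Suc.IH[of "M * norm v" "dird v f"] Suc.prems by (simp add: mult.assoc)
  qed
qed

lemma CB_bilinear:
  assumes "open S" "bounded_bilinear B" "\<And>a b. norm (B a b) \<le> norm a * norm b"
  shows "0 \<le> M \<Longrightarrow> 0 \<le> N \<Longrightarrow> CB k M f S \<Longrightarrow> CB k N g S \<Longrightarrow> CB k (2 ^ k * (M * N)) (\<lambda>x. B (f x) (g x)) S"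
proof (induction k arbitrary: M N f g)
  case 0
  have "norm (B (f x) (g x)) \<le> M * N" if "x \<in> S" for x
    by (rule order_trans[OF assms(3) mult_mono']) (use 0 that in auto)
  then show ?case by simp
next
  case (Suc k)
  have MN: "0 \<le> M * N" using Suc.prems by simp
  show ?case
  proof (rule CB_SucI[OF assms(1), where f' = "\<lambda>x v. B (f x) (dird v g x) + B (dird v f x) (g x)"])
    fix x assume x: "x \<in> S"
    have "norm (B (f x) (g x)) \<le> M * N"
      using assms(3)[of "f x" "g x"] CB_norm[OF Suc.prems(3) x] CB_norm[OF Suc.prems(4) x]
      by (meson mult_mono' norm_ge_zero order_trans)
    also have "\<dots> \<le> 2 ^ Suc k * (M * N)"
      using mult_right_mono[OF one_le_power[of "2::real" "Suc k"] MN] by simp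
    finally show "norm (B (f x) (g x)) \<le> 2 ^ Suc k * (M * N)" .
    show "((\<lambda>x. B (f x) (g x)) has_derivative (\<lambda>v. B (f x) (dird v g x) + B (dird v f x) (g x))) (at x)"
      by (intro bounded_bilinear.FDERIV[OF assms(2)] CB_has_derivative[OF Suc.prems(3) x] CB_has_derivative[OF Suc.prems(4) x])
  next
    fix v
    have 1: "CB k (2 ^ k * (M * (N * norm v))) (\<lambda>x. B (f x) (dird v g x)) S"
      by (rule Suc.IH) (use Suc.prems CB_Suc_le in auto)
    have 2: "CB k (2 ^ k * (M * norm v * N)) (\<lambda>x. B (dird v f x) (g x)) S"
      by (rule Suc.IH) (use Suc.prems CB_Suc_le in auto)
    show "CB k (2 ^ Suc k * (M * N) * norm v) (\<lambda>x. B (f x) (dird v g x) + B (dird v f x) (g x)) S"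
      using CB_add[OF assms(1) 1 2] by (simp add: algebra_simps)
  qed
qed

lemmas CB_mult = CB_bilinear[OF _ bounded_bilinear_mult norm_mult_ineq]

lemma CB_scaleR: "open S \<Longrightarrow> 0 \<le> M \<Longrightarrow> 0 \<le> N \<Longrightarrow> CB k M f S \<Longrightarrow> CB k N g S 
   \<Longrightarrow> CB k (2 ^ k * (M * N)) (\<lambda>x. f x *\<^sub>R g x) S"
  by (rule CB_bilinear[OF _ bounded_bilinear_scaleR]) auto

lemma CB_inner: "open S \<Longrightarrow> 0 \<le> M \<Longrightarrow> 0 \<le> N \<Longrightarrow> CB k M f S \<Longrightarrow> CB k N g S 
   \<Longrightarrow> CB k (2 ^ k * (M * N)) (\<lambda>x. inner (f x) (g x)) S"
  by (rule CB_bilinear[OF _ bounded_bilinear_inner]) (auto simp: Cauchy_Schwarz_ineq2)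

lemma CB_sum:
  assumes "open S" "finite I" "\<And>i. i \<in> I \<Longrightarrow> CB k (M i) (f i) S"
  shows "CB k (\<Sum>i\<in>I. M i) (\<lambda>x. \<Sum>i\<in>I. f i x) S"
  using assms(2,3) by (induction I rule: finite_induct) (auto intro!: CB_zero CB_add[OF assms(1)])

lemma CB_minus: "open S \<Longrightarrow> CB k M f S \<Longrightarrow> CB k M (\<lambda>x. - f x) S"
  using CB_linear[of S uminus 1 k M f] by (simp add: bounded_linear_minus[OF bounded_linear_ident])

lemma CB_diff: "open S \<Longrightarrow> CB k M f S \<Longrightarrow> CB k N g S \<Longrightarrow> CB k (M + N) (\<lambda>x. f x - g x) S"
  using CB_add[OF _ _ CB_minus, of S k M f N g] by simp

text \<open>It matters that the constant depends only on the bounds of the two functions, and not on the functions: it will be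
applied to all transition maps between charts at once.\<close>

lemma CB_compose_real:
  "\<exists>C\<ge>0. \<forall>g f S T. open S \<longrightarrow> f ` S \<subseteq> T \<longrightarrow> CB k N g (T::real set) \<longrightarrow> CB k M f S \<longrightarrow> CB k C (\<lambda>x. g (f x) :: real) (S :: 'a::real_normed_vector set)"
  (is "\<exists>C\<ge>0. ?P k N C")
proof (induction k arbitrary: N)
  case 0
  show ?case by (rule exI[of _ "\<bar>N\<bar>"]) force
next
  case (Suc k)
  obtain C where C: "C \<ge> 0" "?P k N C" using Suc.IH[of N] by blast
  let ?C = "\<bar>N\<bar> + 2 ^ k * (C * \<bar>M\<bar>)"
  have "?P (Suc k) N ?C"
  proof (intro allI impI)
    fix g :: "real \<Rightarrow> real" and f :: "'a \<Rightarrow> real" and S T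
    assume op: "open S" and sub: "f ` S \<subseteq> T" and g: "CB (Suc k) N g T" and f: "CB (Suc k) M f S"
    have pos: "0 \<le> 2 ^ k * (C * \<bar>M\<bar>)" using C(1) by simp
    show "CB (Suc k) ?C (\<lambda>x. g (f x)) S"
    proof (rule CB_SucI[OF op, where f' = "\<lambda>x v. dird 1 g (f x) * dird v f x"])
      fix x assume x: "x \<in> S"
      show "norm (g (f x)) \<le> ?C" using CB_norm[OF g, of "f x"] sub x pos by auto
      have lin: "linear (frechet_derivative g (at (f x)))"
        using CB_has_derivative[OF g, of "f x"] sub x has_derivative_linear by blast
      have "((\<lambda>x. g (f x)) has_derivative (\<lambda>v. dird (dird v f x) g (f x))) (at x)"
        using has_derivative_compose[OF CB_has_derivative[OF f x] CB_has_derivative[OF g, of "f x"]] sub x by auto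
      moreover have "dird (dird v f x) g (f x) = dird 1 g (f x) * dird v f x" for v
        using linear_cmul[OF lin, of "dird v f x" 1] by simp
      ultimately show "((\<lambda>x. g (f x)) has_derivative (\<lambda>v. dird 1 g (f x) * dird v f x)) (at x)" by simp
    next
      fix v
      have g1: "CB k N (dird 1 g) T" using CB_dird[OF g, of 1] by simp
      have 1: "CB k C (\<lambda>x. dird 1 g (f x)) S" using C(2) op sub g1 CB_Suc_le[OF f] by blast
      have 2: "CB k (\<bar>M\<bar> * norm v) (dird v f) S"
        by (rule CB_mono[of k "M * norm v"]) (use f in \<open>auto intro: mult_right_mono\<close>)
      have "CB k (2 ^ k * (C * (\<bar>M\<bar> * norm v))) (\<lambda>x. dird 1 g (f x) * dird v f x) S"
        using CB_mult[OF op _ _ 1 2] C(1) by simp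
      then show "CB k (?C * norm v) (\<lambda>x. dird 1 g (f x) * dird v f x) S"
        by (rule CB_mono) (auto simp: algebra_simps)
    qed
  qed
  moreover have "?C \<ge> 0" using C(1) by simp
  ultimately show ?case by blast
qed

lemma CB_UN: "(\<And>i. i \<in> I \<Longrightarrow> CB k M f (U i)) \<Longrightarrow> CB k M f (\<Union>i\<in>I. U i)"
  by (induction k arbitrary: f M) auto

lemma line_derivative:
  fixes f :: "'a::real_normed_vector \<Rightarrow> real"
  assumes h: "(f has_derivative (\<lambda>v. dird v f (p + s *\<^sub>R u))) (at (p + s *\<^sub>R u))"
  shows "((\<lambda>s. f (p + s *\<^sub>R u)) has_field_derivative dird u f (p + s *\<^sub>R u)) (at s)"
proof -
  have "((\<lambda>s. f (p + s *\<^sub>R u)) has_derivative (\<lambda>h. dird (h *\<^sub>R u) f (p + s *\<^sub>R u))) (at s)"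
    by (rule has_derivative_compose[of "\<lambda>s. p + s *\<^sub>R u" "\<lambda>h. h *\<^sub>R u", OF _ h]) (auto intro!: derivative_eq_intros)
  moreover have "dird (h *\<^sub>R u) f (p + s *\<^sub>R u) = dird u f (p + s *\<^sub>R u) * h" for h
    using linear_cmul[OF has_derivative_linear[OF h], of h u] by simp
  ultimately show ?thesis unfolding has_field_derivative_def by simp
qed

text \<open>Along a line the derivative at \<open>x\<close> differs from a difference quotient over length \<open>t\<close> by at most \<open>t M\<close>, and
the difference quotient is at most \<open>2 d / t\<close>.\<close>

lemma CB_small_derivative:
  fixes f :: "'a::real_normed_vector \<Rightarrow> real"
  assumes f: "CB 2 M f (ball a r)" and small: "\<And>x. x \<in> ball a r \<Longrightarrow> \<bar>f x\<bar> \<le> d"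
    and M: "M \<ge> 0" and t: "0 < t" "s + t \<le> r" and x: "x \<in> ball a s"
  shows "\<bar>dird v f x\<bar> \<le> (2 * d / t + t * M) * norm v"
proof (cases "v = 0")
  case True
  have "(f has_derivative (\<lambda>v. dird v f x)) (at x)"
    by (rule CB_has_derivative[of 1 M f "ball a r"]) (use f x t in \<open>auto simp: numeral_2_eq_2\<close>)
  then show ?thesis using True has_derivative_linear linear_0 by fastforce
next
  case False
  define u where "u = (1 / norm v) *\<^sub>R v"
  have u: "norm u = 1" using False by (simp add: u_def)
  have f1: "CB (Suc 1) M f (ball a r)" using f by (simp add: numeral_2_eq_2)
  have f2: "CB 1 M (dird u f) (ball a r)" using CB_dird[OF f1, of u] u by simp
  have f3: "CB 0 M (dird u (dird u f)) (ball a r)" using CB_dird[of 0 M "dird u f" "ball a r" u] f2 u by simp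
  have inb: "x + c *\<^sub>R u \<in> ball a r" if "0 \<le> c" "c < t" for c
  proof -
    have "dist a (x + c *\<^sub>R u) \<le> dist a x + dist x (x + c *\<^sub>R u)" by (rule dist_triangle)
    also have "dist x (x + c *\<^sub>R u) = c" using u that by (simp add: dist_norm)
    finally show ?thesis using x t that by auto
  qed
  have xr: "x \<in> ball a r" using inb[of 0] t by simp
  have main: "\<bar>dird u f x\<bar> \<le> 2 * d / c + c * M" if c: "0 < c" "c < t" for c
  proof -
    have der: "((\<lambda>s. f (x + s *\<^sub>R u)) has_field_derivative dird u f (x + s *\<^sub>R u)) (at s)" if "0 \<le> s" "s \<le> c" for s
      by (rule line_derivative, rule CB_has_derivative[OF f1 inb]) (use that c in auto)
    obtain z where z: "0 < z" "z < c" "f (x + c *\<^sub>R u) - f (x + 0 *\<^sub>R u) = (c - 0) * dird u f (x + z *\<^sub>R u)"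
      using MVT2[of 0 c "\<lambda>s. f (x + s *\<^sub>R u)" "\<lambda>s. dird u f (x + s *\<^sub>R u)"] der c by auto
    have der2: "((\<lambda>s. dird u f (x + s *\<^sub>R u)) has_field_derivative dird u (dird u f) (x + s *\<^sub>R u)) (at s)" if "0 \<le> s" "s \<le> c" for s
      by (rule line_derivative, rule CB_has_derivative[of 0 M, OF _ inb]) (use f2 that c in auto)
    obtain y where y: "0 < y" "y < z" "dird u f (x + z *\<^sub>R u) - dird u f (x + 0 *\<^sub>R u) = (z - 0) * dird u (dird u f) (x + y *\<^sub>R u)"
      using MVT2[of 0 z "\<lambda>s. dird u f (x + s *\<^sub>R u)" "\<lambda>s. dird u (dird u f) (x + s *\<^sub>R u)"] der2 z by auto
    have a: "\<bar>dird u (dird u f) (x + y *\<^sub>R u)\<bar> \<le> M" using f3 inb[of y] y z c by auto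
    have "\<bar>c * dird u f (x + z *\<^sub>R u)\<bar> \<le> 2 * d"
      using z small[OF xr] small[OF inb[of c]] c by auto
    then have b: "\<bar>dird u f (x + z *\<^sub>R u)\<bar> \<le> 2 * d / c" using c by (simp add: abs_mult field_simps)
    have "\<bar>z * dird u (dird u f) (x + y *\<^sub>R u)\<bar> \<le> c * M" using a y z c by (simp add: abs_mult mult_mono)
    then show ?thesis using b y(3) by simp
  qed
  have "((\<lambda>c. 2 * d / c + c * M) \<longlongrightarrow> 2 * d / t + t * M) (at_left t)"
    using t by (auto intro!: tendsto_intros)
  (* The point x + t u may lie on the boundary of the ball, hence the limit c -> t. *)
  moreover have "\<forall>\<^sub>F c in at_left t. \<bar>dird u f x\<bar> \<le> 2 * d / c + c * M"
    using main eventually_at_left_real[OF t(1)] by (auto elim: eventually_mono)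
  ultimately have "\<bar>dird u f x\<bar> \<le> 2 * d / t + t * M"
    by (intro tendsto_lowerbound) auto
  moreover have "dird v f x = norm v * dird u f x"
  proof -
    have "linear (\<lambda>v. dird v f x)" using CB_has_derivative[OF f1 xr] has_derivative_linear by blast
    then show ?thesis using linear_cmul[of "\<lambda>v. dird v f x" "norm v" u] False by (simp add: u_def)
  qed
  ultimately show ?thesis by (simp add: abs_mult mult.commute mult_left_mono)
qed

text \<open>The compactness-free form of the fact that a bounded set in \<open>C\<^sup>k\<^sup>+\<^sup>1\<close> with small supremum norm is small in \<open>C\<^sup>k\<close>. By
induction: choosing \<open>t\<close> small and then \<open>d\<close> small compared to \<open>t\<close> makes the first derivatives small on a slightly smaller ball.\<close>

lemma CB_interpolation:
  assumes "M \<ge> 0" "\<eta> > 0" "s < r"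
  shows "\<exists>d>0. \<forall>f::'a::real_normed_vector\<Rightarrow>real. CB (Suc k) M f (ball a r) \<longrightarrow> (\<forall>x\<in>ball a r. \<bar>f x\<bar> \<le> d) \<longrightarrow> CB k \<eta> f (ball a s)"
  using assms
proof (induction k arbitrary: M \<eta> r)
  case 0
  then show ?case by (intro exI[of _ \<eta>]) auto
next
  case (Suc k)
  define r' where "r' = (s + r) / 2"
  have r': "s < r'" "r' < r" using Suc.prems by (auto simp: r'_def)
  obtain d1 where d1: "d1 > 0" and IH: "\<And>f::'a\<Rightarrow>real. CB (Suc k) M f (ball a r') \<Longrightarrow> (\<forall>x\<in>ball a r'. \<bar>f x\<bar> \<le> d1) \<Longrightarrow> CB k \<eta> f (ball a s)"
    using Suc.IH[OF Suc.prems(1,2) r'(1)] by blast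
  define t where "t = min (r - r') (d1 / (2 * (M + 1)))"
  have t: "0 < t" "r' + t \<le> r" "t \<le> d1 / (2 * (M + 1))" using r' d1 Suc.prems by (auto simp: t_def)
  have tM: "t * M \<le> d1 / 2"
  proof -
    have "t * (2 * (M+1)) \<le> d1" using t(3) Suc.prems(1) by (simp add: field_simps)
    moreover have "t * M * 2 \<le> t * (2 * (M+1))" using t(1) by (simp add: algebra_simps)
    ultimately show ?thesis by simp
  qed
  define d where "d = min \<eta> (d1 * t / 4)"
  have "d \<le> d1 * t / 4" by (simp add: d_def)
  then have "2 * d / t \<le> d1 / 2" using t(1) by (simp add: field_simps)
  then have d: "0 < d" "d \<le> \<eta>" "2 * d / t \<le> d1 / 2" 
    using t d1 Suc.prems by (auto simp: d_def)
  have "CB (Suc k) \<eta> f (ball a s)" if f: "CB (Suc (Suc k)) M f (ball a r)" and sm: "\<forall>x\<in>ball a r. \<bar>f x\<bar> \<le> d" for f :: "'a \<Rightarrow> real"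
  proof -
    have "CB k (\<eta> * norm v) (dird v f) (ball a s)" for v
    proof (cases "v = 0")
      case True
      have "dird v f x = 0" if "x \<in> ball a s" for x
      proof -
        have "linear (\<lambda>v. dird v f x)" 
          using CB_has_derivative[OF f, of x] that r' has_derivative_linear by fastforce
        then show ?thesis using True linear_0 by blast
      qed
      then show ?thesis using CB_cong[of "ball a s" "dird v f" "\<lambda>x. 0"] True CB_zero[of 0] by simp
    next
      case False
      define u where "u = (1 / norm v) *\<^sub>R v"
      have u: "norm u = 1" "v = norm v *\<^sub>R u" using False by (simp_all add: u_def)
      have "CB (Suc k) (M * norm u) (dird u f) (ball a r)" using f by simp
      then have "CB (Suc k) M (dird u f) (ball a r')"
        by (rule CB_mono) (use u r' in auto)
      moreover have "\<bar>dird u f x\<bar> \<le> d1" if "x \<in> ball a r'" for x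
      proof -
        have "CB 2 M f (ball a r)" by (rule CB_le[OF f]) simp
        from CB_small_derivative[OF this _ Suc.prems(1) t(1,2) that, of d u] sm u tM d
        show ?thesis by auto
      qed
      ultimately have "CB k \<eta> (dird u f) (ball a s)" using IH by blast
      then have "CB k (norm v * \<eta>) (\<lambda>x. norm v *\<^sub>R dird u f x) (ball a s)"
        by (intro CB_linear bounded_linear_scaleR_right) (auto simp: abs_mult)
      then have 1: "CB k (\<eta> * norm v) (\<lambda>x. norm v *\<^sub>R dird u f x) (ball a s)" by (simp only: mult.commute)
      have "dird v f x = norm v *\<^sub>R dird u f x" if "x \<in> ball a s" for x
      proof -
        have "linear (\<lambda>v. dird v f x)" 
          using CB_has_derivative[OF f, of x] that r' has_derivative_linear by fastforce
        then show ?thesis using u(2) linear_cmul[of "\<lambda>v. dird v f x"] by metis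
      qed
      then show ?thesis using 1 CB_cong[of "ball a s" "dird v f" "\<lambda>x. norm v *\<^sub>R dird u f x"] by simp
    qed
    moreover have "ball a s \<subseteq> ball a r" using r' by auto
    ultimately show ?thesis using f sm d by (auto intro: order_trans)
  qed
  then show ?case using d(1) by blast
qed

section \<open>Smooth functions\<close>

text \<open>Smoothness, in a form that comes with local bounds for all derivatives. It implies the pointwise notion (\<open>lsm_smooth_on\<close>), and the
bounds are available on neighbourhoods of compact sets (\<open>lsm_compact_CB\<close>).\<close>

definition lsm :: "('a::real_normed_vector \<Rightarrow> 'b::real_normed_vector) \<Rightarrow> 'a set \<Rightarrow> bool" where
  "lsm f S \<longleftrightarrow> open S \<and> (\<forall>k. \<forall>x\<in>S. \<exists>r>0. \<exists>M. ball x r \<subseteq> S \<and> CB k M f (ball x r))"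

lemma lsm_openD: "lsm f S \<Longrightarrow> open S" by (simp add: lsm_def)

lemma lsmE:
  assumes "lsm f S" "x \<in> S" obtains r M where "r > 0" "M \<ge> 0" "ball x r \<subseteq> S" "CB k M f (ball x r)"
proof -
  obtain r M where *: "r > 0" "ball x r \<subseteq> S" "CB k M f (ball x r)" using assms unfolding lsm_def by blast
  have "norm (f x) \<le> M" using CB_norm[OF *(3)] *(1) by simp
  then show ?thesis using that[of r M] * norm_ge_zero order_trans by blast
qed

lemma lsm_subset: assumes "lsm f S" "open T" "T \<subseteq> S" shows "lsm f T"
  unfolding lsm_def
proof (intro conjI allI ballI)
  fix k x assume x: "x \<in> T"
  obtain r M where r: "r > 0" "ball x r \<subseteq> S" "CB k M f (ball x r)" using assms x lsmE[of f S x k] by blast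
  obtain e where "e > 0" "ball x e \<subseteq> T" using assms(2) x open_contains_ball by blast
  then show "\<exists>r>0. \<exists>M. ball x r \<subseteq> T \<and> CB k M f (ball x r)"
    by (intro exI[of _ "min r e"] conjI exI[of _ M] CB_mono[OF r(3)]) (use r in auto)
qed (use assms in simp)

lemma lsm_cong: assumes "\<And>x. x \<in> S \<Longrightarrow> f x = g x" shows "lsm f S \<longleftrightarrow> lsm g S"
proof -
  have "lsm g S" if "lsm f S" "\<And>x. x \<in> S \<Longrightarrow> f x = g x" for f g
    unfolding lsm_def
  proof (intro conjI allI ballI)
    fix k x assume "x \<in> S"
    with that(1) obtain r M where r: "r > 0" "ball x r \<subseteq> S" "CB k M f (ball x r)" using lsmE by meson
    have "f y = g y" if "y \<in> ball x r" for y using \<open>\<And>x. x \<in> S \<Longrightarrow> f x = g x\<close> r(2) that by blast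
    then have "CB k M g (ball x r)" using CB_cong[OF open_ball, of x r f g k M] r(3) by blast
    then show "\<exists>r>0. \<exists>M. ball x r \<subseteq> S \<and> CB k M g (ball x r)" using r by blast
  qed (use that lsm_openD in blast)
  then show ?thesis using assms by metis
qed

lemma lsm_local: assumes "open S" "\<And>x. x \<in> S \<Longrightarrow> \<exists>U. open U \<and> x \<in> U \<and> U \<subseteq> S \<and> lsm f U" shows "lsm f S"
  unfolding lsm_def
proof (intro conjI allI ballI)
  fix k x assume "x \<in> S"
  then obtain U where U: "open U" "x \<in> U" "U \<subseteq> S" "lsm f U" using assms(2) by blast
  then show "\<exists>r>0. \<exists>M. ball x r \<subseteq> S \<and> CB k M f (ball x r)" unfolding lsm_def by blast
qed (use assms in simp)

lemma lsm_differentiable: "lsm f S \<Longrightarrow> x \<in> S \<Longrightarrow> f differentiable (at x)"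
  by (erule lsmE[of f S x "Suc 0"]) auto

lemma lsm_has_derivative: "lsm f S \<Longrightarrow> x \<in> S \<Longrightarrow> (f has_derivative (\<lambda>v. dird v f x)) (at x)"
  using lsm_differentiable frechet_derivative_works by blast

lemma lsm_linear_dird: "lsm f S \<Longrightarrow> x \<in> S \<Longrightarrow> linear (\<lambda>v. dird v f x)"
  using lsm_has_derivative has_derivative_linear by blast

lemma lsm_continuous_on: "lsm f S \<Longrightarrow> continuous_on S f"
  by (meson continuous_at_imp_continuous_on differentiable_imp_continuous_within lsm_differentiable)

lemma lsm_dird: assumes "lsm f S" shows "lsm (dird v f) S"
  unfolding lsm_def
proof (intro conjI allI ballI)
  fix k x assume "x \<in> S"
  with assms obtain r M where "r > 0" "ball x r \<subseteq> S" "CB (Suc k) M f (ball x r)" using lsmE by meson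
  then show "\<exists>r>0. \<exists>M. ball x r \<subseteq> S \<and> CB k M (dird v f) (ball x r)" using CB_dird by blast
qed (use assms lsm_openD in blast)

lemma lsm_smooth_on:
  fixes f :: "'a::euclidean_space \<Rightarrow> 'b::real_normed_vector"
  assumes "lsm f S" shows "smooth_on f S"
proof -
  have "Ck_on k f S" if "lsm f S" for k and f :: "'a \<Rightarrow> 'b" using that
    by (induction k arbitrary: f) (auto simp: lsm_continuous_on lsm_differentiable lsm_dird)
  then show ?thesis using assms by (simp add: smooth_on_def)
qed

lemma lsm_binary:
  assumes "lsm f S" "lsm g S"
    and "\<And>k M N U. open U \<Longrightarrow> M \<ge> 0 \<Longrightarrow> N \<ge> 0 \<Longrightarrow> CB k M f U \<Longrightarrow> CB k N g U \<Longrightarrow> \<exists>C. CB k C h U"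
  shows "lsm h S"
  unfolding lsm_def
proof (intro conjI allI ballI)
  fix k x assume x: "x \<in> S"
  obtain r M where r: "r > 0" "M \<ge> 0" "ball x r \<subseteq> S" "CB k M f (ball x r)" using assms(1) x lsmE by meson
  obtain s N where s: "s > 0" "N \<ge> 0" "ball x s \<subseteq> S" "CB k N g (ball x s)" using assms(2) x lsmE by meson
  have "CB k M f (ball x (min r s))" "CB k N g (ball x (min r s))"
    by (rule CB_mono[OF r(4)], auto) (rule CB_mono[OF s(4)], auto)
  then obtain C where "CB k C h (ball x (min r s))" using assms(3)[of "ball x (min r s)" M N k] r s by auto
  then show "\<exists>r>0. \<exists>M. ball x r \<subseteq> S \<and> CB k M h (ball x r)"
    by (intro exI[of _ "min r s"] conjI exI[of _ C]) (use r s in auto)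
qed (use assms lsm_openD in blast)

lemma lsm_const: "open S \<Longrightarrow> lsm (\<lambda>x. c) S"
  unfolding lsm_def using CB_const[OF order_refl] by (metis openE)

lemma lsm_add: "lsm f S \<Longrightarrow> lsm g S \<Longrightarrow> lsm (\<lambda>x. f x + g x) S"
  by (rule lsm_binary[of f S g]) (assumption+, rule exI, rule CB_add)

lemma lsm_diff: "lsm f S \<Longrightarrow> lsm g S \<Longrightarrow> lsm (\<lambda>x. f x - g x) S"
  by (rule lsm_binary[of f S g]) (assumption+, rule exI, rule CB_diff)

lemma lsm_mult: "lsm f S \<Longrightarrow> lsm g S \<Longrightarrow> lsm (\<lambda>x. f x * g x :: 'a::real_normed_algebra) S"
  by (rule lsm_binary[of f S g]) (assumption+, rule exI, erule (4) CB_mult)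

lemma lsm_inner: "lsm f S \<Longrightarrow> lsm g S \<Longrightarrow> lsm (\<lambda>x. inner (f x) (g x)) S"
  by (rule lsm_binary[of f S g]) (assumption+, rule exI, erule (4) CB_inner)

lemma lsm_linear: 
  assumes "bounded_linear L" "lsm f S" shows "lsm (\<lambda>x. L (f x)) S"
proof -
  obtain K where K: "K \<ge> 0" "\<And>x. norm (L x) \<le> norm x * K" using bounded_linear.nonneg_bounded[OF assms(1)] by blast
  show ?thesis using assms(2,2)
    by (rule lsm_binary) (use CB_linear[OF _ assms(1), of _ K] K in \<open>metis mult.commute\<close>)
qed

lemma lsm_minus: "lsm f S \<Longrightarrow> lsm (\<lambda>x. - f x) S"
  using lsm_linear[OF bounded_linear_minus[OF bounded_linear_ident]] .

lemma lsm_sum: "open S \<Longrightarrow> (\<And>i. i \<in> I \<Longrightarrow> lsm (f i) S) \<Longrightarrow> lsm (\<lambda>x. \<Sum>i\<in>I. f i x) S"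
  by (induction I rule: infinite_finite_induct) (auto intro: lsm_add lsm_const)

lemma CB_id: assumes "open S" "\<And>x. x \<in> S \<Longrightarrow> norm x \<le> R" "R \<ge> 1" shows "CB k R (\<lambda>x. x) S"
proof (cases k)
  case (Suc j)
  show ?thesis unfolding Suc
    by (rule CB_SucI[where f' = "\<lambda>x v. v"])
      (use assms in \<open>auto intro!: CB_const simp: mult_right_mono[of 1 R, simplified]\<close>)
qed (use assms in auto)

lemma lsm_id: assumes "open S" shows "lsm (\<lambda>x. x) S"
  unfolding lsm_def
proof (intro conjI allI ballI)
  fix k x assume "x \<in> S"
  then obtain e where e: "e > 0" "ball x e \<subseteq> S" using assms openE by blast
  have "CB k (norm x + e + 1) (\<lambda>x. x) (ball x e)"
  proof (rule CB_id)
    fix y assume "y \<in> ball x e"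
    then show "norm y \<le> norm x + e + 1" using norm_triangle_sub[of y x] by (simp add: dist_norm norm_minus_commute)
  qed (use e in auto)
  then show "\<exists>r>0. \<exists>M. ball x r \<subseteq> S \<and> CB k M (\<lambda>x. x) (ball x r)" using e by blast
qed (use assms in simp)

lemma lsm_compose_real:
  fixes g :: "real \<Rightarrow> real"
  assumes f: "lsm f S" and g: "lsm g T" and sub: "f ` S \<subseteq> T"
  shows "lsm (\<lambda>x. g (f x)) S"
  unfolding lsm_def
proof (intro conjI allI ballI)
  fix k x assume x: "x \<in> S"
  obtain r M where r: "r > 0" "M \<ge> 0" "ball x r \<subseteq> S" "CB k M f (ball x r)" using f x lsmE by meson
  obtain s N where s: "s > 0" "N \<ge> 0" "ball (f x) s \<subseteq> T" "CB k N g (ball (f x) s)" 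
    using lsmE[OF g, of "f x" k] sub x by blast
  have "isCont f x" using f x lsm_differentiable differentiable_imp_continuous_within by blast
  then obtain d where d: "d > 0" "\<And>y. dist y x < d \<Longrightarrow> dist (f y) (f x) < s" 
    using s(1) unfolding continuous_at_eps_delta by metis
  obtain C where C: "\<forall>g f S T. open S \<longrightarrow> f ` S \<subseteq> T \<longrightarrow> CB k N g (T::real set) \<longrightarrow> CB k M f S \<longrightarrow> CB k C (\<lambda>x. g (f x) :: real) (S :: 'a set)"
    using CB_compose_real[of k N M] by blast
  have "CB k M f (ball x (min r d))" by (rule CB_mono[OF r(4)]) auto
  moreover have "f ` ball x (min r d) \<subseteq> ball (f x) s" using d by (auto simp: dist_commute)
  ultimately have "CB k C (\<lambda>x. g (f x)) (ball x (min r d))" using C s(4) open_ball by blast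
  then show "\<exists>r>0. \<exists>M. ball x r \<subseteq> S \<and> CB k M (\<lambda>x. g (f x)) (ball x r)"
    by (intro exI[of _ "min r d"] conjI exI[of _ C]) (use r d in auto)
qed (use f lsm_openD in blast)

lemma lsm_compact_CB:
  assumes f: "lsm f S" and K: "compact K" "K \<subseteq> S"
  obtains M U where "M \<ge> 0" "open U" "K \<subseteq> U" "U \<subseteq> S" "CB k M f U"
proof -
  have "\<forall>x\<in>K. \<exists>r>0. \<exists>M\<ge>0. ball x r \<subseteq> S \<and> CB k M f (ball x r)" using lsmE[OF f, of _ k] K by (metis subsetD)
  then obtain r M where rM: "\<And>x. x \<in> K \<Longrightarrow> r x > 0 \<and> M x \<ge> 0 \<and> ball x (r x) \<subseteq> S \<and> CB k (M x) f (ball x (r x))" by metis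
  obtain F where F: "F \<subseteq> K" "finite F" "K \<subseteq> (\<Union>x\<in>F. ball x (r x))"
    using compactE_image[OF K(1), of K "\<lambda>x. ball x (r x)"] rM by (metis (no_types, lifting) UN_I centre_in_ball open_ball subsetI)
  define m where "m = (\<Sum>x\<in>F. M x)"
  have "CB k m f (ball x (r x))" if "x \<in> F" for x
  proof (rule CB_mono)
    show "CB k (M x) f (ball x (r x))" using rM that F by blast
    show "M x \<le> m" unfolding m_def using member_le_sum[of x F M] that F rM by auto
  qed simp
  then have "CB k m f (\<Union>x\<in>F. ball x (r x))" by (rule CB_UN)
  moreover have "m \<ge> 0" unfolding m_def using F rM by (auto intro: sum_nonneg)
  moreover have "(\<Union>x\<in>F. ball x (r x)) \<subseteq> S" using F rM by blast
  ultimately show ?thesis by (intro that[of m "\<Union>x\<in>F. ball x (r x)"] F(3)) auto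
qed

text \<open>By the mean value theorem the second difference over a parallelogram with sides \<open>t u\<close> and \<open>t v\<close> is \<open>t\<^sup>2\<close> times a value of
either mixed derivative near \<open>x\<close>; both are continuous.\<close>

lemma dird_commute_real:
  fixes f :: "'a::real_normed_vector \<Rightarrow> real"
  assumes f: "lsm f S" and x: "x \<in> S"
  shows "dird u (dird v f) x = dird v (dird u f) x"
proof (rule ccontr)
  assume ne: "dird u (dird v f) x \<noteq> dird v (dird u f) x"
  let ?a = "dird u (dird v f)" and ?b = "dird v (dird u f)"
  define e where "e = \<bar>?a x - ?b x\<bar> / 2"
  have e: "e > 0" using ne by (simp add: e_def)
  have ca: "continuous_on S ?a" "continuous_on S ?b" by (intro lsm_continuous_on lsm_dird f)+
  have op: "open S" using f lsm_openD by blast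
  have cat: "isCont ?a x" "isCont ?b x"
    using ca x by (simp_all add: continuous_on_eq_continuous_at[OF op])
  obtain d1 where d1: "d1 > 0" "\<And>y. dist y x < d1 \<Longrightarrow> dist (?a y) (?a x) < e"
    using cat(1) e unfolding continuous_at_eps_delta by blast
  obtain d2 where d2: "d2 > 0" "\<And>y. dist y x < d2 \<Longrightarrow> dist (?b y) (?b x) < e"
    using cat(2) e unfolding continuous_at_eps_delta by blast
  obtain d3 where d3: "d3 > 0" "ball x d3 \<subseteq> S" using op x openE by blast
  define d where "d = min d1 (min d2 d3)"
  have d: "d > 0" using d1 d2 d3 by (simp add: d_def)
  define t where "t = d / (2 * (norm u + norm v + 1))"
  have nuv: "0 < norm u + norm v + 1" using norm_ge_zero[of u] norm_ge_zero[of v] by linarith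
  have t: "t > 0" using d nuv by (simp add: t_def)
  have near: "dist (x + a *\<^sub>R u + b *\<^sub>R v) x < d" if "0 \<le> a" "a \<le> t" "0 \<le> b" "b \<le> t" for a b
  proof -
    have "dist (x + a *\<^sub>R u + b *\<^sub>R v) x \<le> norm (a *\<^sub>R u) + norm (b *\<^sub>R v)"
      by (simp add: dist_norm) (metis add.commute add.left_commute add_diff_cancel_left' norm_scaleR norm_triangle_ineq)
    also have "\<dots> \<le> t * norm u + t * norm v" using that by (auto intro!: add_mono mult_right_mono)
    also have "\<dots> \<le> t * (norm u + norm v + 1)" using t by (simp add: algebra_simps)
    also have "\<dots> = d / 2" using nuv unfolding t_def by (simp add: field_simps del: distrib_left_numeral)
    finally show ?thesis using d by simp
  qed
  have inS: "x + a *\<^sub>R u + b *\<^sub>R v \<in> S" if "0 \<le> a" "a \<le> t" "0 \<le> b" "b \<le> t" for a b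
    using near[OF that] d3 by (auto simp: d_def dist_commute)
  have deru: "((\<lambda>a. g (x + a *\<^sub>R u + b *\<^sub>R v)) has_field_derivative dird u g (x + a *\<^sub>R u + b *\<^sub>R v)) (at a)"
    and derv: "((\<lambda>b. g (x + a *\<^sub>R u + b *\<^sub>R v)) has_field_derivative dird v g (x + a *\<^sub>R u + b *\<^sub>R v)) (at b)"
    if "0 \<le> a" "a \<le> t" "0 \<le> b" "b \<le> t" "lsm g S" for g :: "'a \<Rightarrow> real" and a b
    using line_derivative[OF lsm_has_derivative[of g S "x + b *\<^sub>R v + a *\<^sub>R u"]] line_derivative[OF lsm_has_derivative[of g S "x + a *\<^sub>R u + b *\<^sub>R v"]] 
      inS[OF that(1-4)] that(5) by (simp_all add: algebra_simps)
  define P where "P a b = f (x + a *\<^sub>R u + b *\<^sub>R v)" for a b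
  define \<Delta> where "\<Delta> = P t t - P t 0 - P 0 t + P 0 0"
  have da: "((\<lambda>a. P a t - P a 0) has_field_derivative dird u f (x + a *\<^sub>R u + t *\<^sub>R v) - dird u f (x + a *\<^sub>R u + 0 *\<^sub>R v)) (at a)"
    if "0 \<le> a" "a \<le> t" for a
    unfolding P_def by (intro DERIV_diff deru f that) (use t in auto)
  have db: "((\<lambda>b. P t b - P 0 b) has_field_derivative dird v f (x + t *\<^sub>R u + b *\<^sub>R v) - dird v f (x + 0 *\<^sub>R u + b *\<^sub>R v)) (at b)"
    if "0 \<le> b" "b \<le> t" for b
    unfolding P_def by (intro DERIV_diff derv f that) (use t in auto)
  obtain a where a: "0 < a" "a < t" "(P t t - P t 0) - (P 0 t - P 0 0) = (t - 0) * (dird u f (x + a *\<^sub>R u + t *\<^sub>R v) - dird u f (x + a *\<^sub>R u + 0 *\<^sub>R v))"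
    using MVT2[OF t da] by blast
  obtain b where b: "0 < b" "b < t" "dird u f (x + a *\<^sub>R u + t *\<^sub>R v) - dird u f (x + a *\<^sub>R u + 0 *\<^sub>R v) = (t - 0) * ?b (x + a *\<^sub>R u + b *\<^sub>R v)"
    using MVT2[OF t, of "\<lambda>b. dird u f (x + a *\<^sub>R u + b *\<^sub>R v)" "\<lambda>b. ?b (x + a *\<^sub>R u + b *\<^sub>R v)"] derv[OF _ _ _ _ lsm_dird[OF f], of a] a by auto
  obtain b' where b': "0 < b'" "b' < t" "(P t t - P 0 t) - (P t 0 - P 0 0) = (t - 0) * (dird v f (x + t *\<^sub>R u + b' *\<^sub>R v) - dird v f (x + 0 *\<^sub>R u + b' *\<^sub>R v))"
    using MVT2[OF t db] by blast
  obtain a' where a': "0 < a'" "a' < t" "dird v f (x + t *\<^sub>R u + b' *\<^sub>R v) - dird v f (x + 0 *\<^sub>R u + b' *\<^sub>R v) = (t - 0) * ?a (x + a' *\<^sub>R u + b' *\<^sub>R v)"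
    using MVT2[OF t, of "\<lambda>a. dird v f (x + a *\<^sub>R u + b' *\<^sub>R v)" "\<lambda>a. ?a (x + a *\<^sub>R u + b' *\<^sub>R v)"] deru[OF _ _ _ _ lsm_dird[OF f], of _ b'] b' by auto
  have "t * (t * ?b (x + a *\<^sub>R u + b *\<^sub>R v)) = t * (t * ?a (x + a' *\<^sub>R u + b' *\<^sub>R v))"
  proof -
    have "P t t - P t 0 - (P 0 t - P 0 0) = t * (t * ?b (x + a *\<^sub>R u + b *\<^sub>R v))"
      using a(3) b(3) by simp
    moreover have "P t t - P 0 t - (P t 0 - P 0 0) = t * (t * ?a (x + a' *\<^sub>R u + b' *\<^sub>R v))"
      using a'(3) b'(3) by simp
    ultimately show ?thesis by linarith
  qed
  then have eq: "?b (x + a *\<^sub>R u + b *\<^sub>R v) = ?a (x + a' *\<^sub>R u + b' *\<^sub>R v)" using t by simp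
  have "dist (x + a *\<^sub>R u + b *\<^sub>R v) x < d" "dist (x + a' *\<^sub>R u + b' *\<^sub>R v) x < d"
    using near a b a' b' by auto
  then have "dist (?b (x + a *\<^sub>R u + b *\<^sub>R v)) (?b x) < e" "dist (?a (x + a' *\<^sub>R u + b' *\<^sub>R v)) (?a x) < e"
    using d1(2) d2(2) by (auto simp: d_def)
  then show False using eq by (auto simp: e_def dist_real_def abs_if split: if_splits)
qed

lemma dird_linear:
  assumes "bounded_linear L" "f differentiable (at x)"
  shows "dird v (\<lambda>x. L (f x)) x = L (dird v f x)"
  by (rule dird_eqI) (use assms in \<open>auto intro: bounded_linear.has_derivative simp: frechet_derivative_works[symmetric]\<close>)

lemma dird_commute:
  fixes f :: "'a::real_normed_vector \<Rightarrow> 'b::euclidean_space"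
  assumes f: "lsm f S" and x: "x \<in> S"
  shows "dird u (dird v f) x = dird v (dird u f) x"
proof (rule euclidean_eqI)
  fix b :: 'b assume "b \<in> Basis"
  have l: "bounded_linear (\<lambda>y. inner y b)" by (rule bounded_linear_inner_left)
  have 1: "dird u (dird v (\<lambda>x. inner (f x) b)) x = inner (dird u (dird v f) x) b" for u v
  proof -
    have "dird u (dird v (\<lambda>x. inner (f x) b)) x = dird u (\<lambda>x. inner (dird v f x) b) x"
      using frechet_derivative_eq_open[OF lsm_openD[OF f] x, of "dird v (\<lambda>x. inner (f x) b)" "\<lambda>x. inner (dird v f x) b"]
        dird_linear[OF l lsm_differentiable[OF f]] by simp
    then show ?thesis using dird_linear[OF l lsm_differentiable[OF lsm_dird[OF f] x]] by simp
  qed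
  show "inner (dird u (dird v f) x) b = inner (dird v (dird u f) x) b"
    using 1[of u v] 1[of v u] dird_commute_real[OF lsm_linear[OF l f] x, of u v] by simp
qed

section \<open>Holomorphic functions of several variables\<close>

text \<open>The scalar counterpart of \<^const>\<open>holomorphic_map_on\<close>.\<close>

definition chol :: "(complex^'n \<Rightarrow> complex) \<Rightarrow> (complex^'n) set \<Rightarrow> bool" where
  "chol f S \<longleftrightarrow> (\<forall>z\<in>S. \<exists>D. (f has_derivative D) (at z) \<and> (\<forall>c v. D (c *s v) = c * D v))"

lemma cscale_of_real: "complex_of_real r *s (v::complex^'n) = r *\<^sub>R v"
  unfolding vec_eq_iff vector_smult_component vector_scaleR_component by (simp add: scaleR_conv_of_real)

lemma norm_cscale: "norm (c *s (v::complex^'n)) = norm c * norm v"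
proof -
  have "(norm (c *s v))\<^sup>2 = (norm c * norm v)\<^sup>2"
    by (simp add: norm_vec_def L2_set_def sum_nonneg norm_mult power_mult_distrib sum_distrib_left)
  then show ?thesis by (rule power2_eq_imp_eq) auto
qed

lemma chol_subset: "chol f S \<Longrightarrow> T \<subseteq> S \<Longrightarrow> chol f T"
  unfolding chol_def by blast

lemma chol_has_derivative: "chol f S \<Longrightarrow> z \<in> S \<Longrightarrow> (f has_derivative (\<lambda>v. dird v f z)) (at z)"
  unfolding chol_def by (metis frechet_derivative_at)

lemma chol_cscale: "chol f S \<Longrightarrow> z \<in> S \<Longrightarrow> dird (c *s v) f z = c * dird v f z"
  unfolding chol_def by (metis frechet_derivative_at)

lemma cholI: "(\<And>z. z \<in> S \<Longrightarrow> (f has_derivative D z) (at z)) \<Longrightarrow> (\<And>z c v. z \<in> S \<Longrightarrow> D z (c *s v) = c * D z v) \<Longrightarrow> chol f S"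
  unfolding chol_def by blast

lemma chol_cong: "open S \<Longrightarrow> (\<And>x. x \<in> S \<Longrightarrow> f x = g x) \<Longrightarrow> chol f S \<longleftrightarrow> chol g S"
  unfolding chol_def using has_derivative_transform_within_open[of f _ _ UNIV S g] has_derivative_transform_within_open[of g _ _ UNIV S f]
  by metis

lemma chol_continuous_on: "chol f S \<Longrightarrow> continuous_on S f"
  using chol_has_derivative has_derivative_continuous by (metis continuous_at_imp_continuous_on)

lemma chol_const: "chol (\<lambda>z. c) S"
  by (rule cholI[where D = "\<lambda>z v. 0"]) auto

lemma chol_add: "chol f S \<Longrightarrow> chol g S \<Longrightarrow> chol (\<lambda>z. f z + g z) S"
  by (rule cholI[where D = "\<lambda>z v. dird v f z + dird v g z"])
    (auto intro!: has_derivative_add chol_has_derivative simp: chol_cscale algebra_simps)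

lemma chol_mult: "chol f S \<Longrightarrow> chol g S \<Longrightarrow> chol (\<lambda>z. f z * g z) S"
  by (rule cholI[where D = "\<lambda>z v. f z * dird v g z + dird v f z * g z"])
    (rule has_derivative_mult, (erule chol_has_derivative, assumption)+, simp add: chol_cscale algebra_simps)

lemma chol_diff: "chol f S \<Longrightarrow> chol g S \<Longrightarrow> chol (\<lambda>z. f z - g z) S"
  by (rule cholI[where D = "\<lambda>z v. dird v f z - dird v g z"])
    (auto intro!: has_derivative_diff chol_has_derivative simp: chol_cscale algebra_simps)

lemma chol_sum: "(\<And>i. i \<in> I \<Longrightarrow> chol (f i) S) \<Longrightarrow> chol (\<lambda>z. \<Sum>i\<in>I. f i z) S"
  by (induction I rule: infinite_finite_induct) (auto intro: chol_add chol_const)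

lemma chol_prod: "(\<And>i. i \<in> I \<Longrightarrow> chol (f i) S) \<Longrightarrow> chol (\<lambda>z. \<Prod>i\<in>I. f i z) S"
  by (induction I rule: infinite_finite_induct) (auto intro: chol_mult chol_const)

lemma chol_inverse:
  assumes f: "chol f S" and nz: "\<And>z. z \<in> S \<Longrightarrow> f z \<noteq> 0" shows "chol (\<lambda>z. inverse (f z)) S"
  by (rule cholI[where D = "\<lambda>z v. - (inverse (f z) * dird v f z * inverse (f z))"])
    (rule Deriv.has_derivative_inverse[OF nz chol_has_derivative[OF f]], assumption+, simp add: chol_cscale[OF f] algebra_simps)

lemma chol_component: "chol (\<lambda>z. z $ i) S"
  by (rule cholI[where D = "\<lambda>z v. v $ i"]) (auto intro!: bounded_linear_imp_has_derivative bounded_linear_vec_nth)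

lemma holomorphic_map_has_derivative: 
  "holomorphic_map_on f S \<Longrightarrow> z \<in> S \<Longrightarrow> (f has_derivative (\<lambda>v. dird v f z)) (at z)"
  unfolding holomorphic_map_on_def by (metis frechet_derivative_at)

lemma holomorphic_map_cscale: "holomorphic_map_on f S \<Longrightarrow> z \<in> S \<Longrightarrow> dird (c *s v) f z = c *s dird v f z"
  unfolding holomorphic_map_on_def by (metis frechet_derivative_at)

lemma holomorphic_mapI: "(\<And>z. z \<in> S \<Longrightarrow> (f has_derivative D z) (at z)) \<Longrightarrow> (\<And>z c v. z \<in> S \<Longrightarrow> D z (c *s v) = c *s D z v) \<Longrightarrow> holomorphic_map_on f S"
  unfolding holomorphic_map_on_def by blast

lemma holomorphic_map_subset: "holomorphic_map_on f S \<Longrightarrow> T \<subseteq> S \<Longrightarrow> holomorphic_map_on f T"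
  unfolding holomorphic_map_on_def by blast

lemma holomorphic_map_linear: "holomorphic_map_on f S \<Longrightarrow> z \<in> S \<Longrightarrow> linear (\<lambda>v. dird v f z)"
  using holomorphic_map_has_derivative has_derivative_linear by blast

lemma holomorphic_map_continuous_on: "holomorphic_map_on f S \<Longrightarrow> continuous_on S f"
  using holomorphic_map_has_derivative has_derivative_continuous by (metis continuous_at_imp_continuous_on)

lemma dird_component: 
  "holomorphic_map_on f S \<Longrightarrow> z \<in> S \<Longrightarrow> dird v (\<lambda>z. f z $ i) z = dird v f z $ i"
  by (rule dird_eqI) (auto intro!: bounded_linear.has_derivative[OF bounded_linear_vec_nth] holomorphic_map_has_derivative)

lemma chol_comp_nth: "holomorphic_map_on f S \<Longrightarrow> chol (\<lambda>z. f z $ i) S"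
  by (rule cholI[where D = "\<lambda>z v. dird v f z $ i"])
    (auto intro!: bounded_linear.has_derivative[OF bounded_linear_vec_nth] holomorphic_map_has_derivative simp: holomorphic_map_cscale)

lemma sum_axis: "(\<Sum>i\<in>UNIV. axis i (v $ i)) = (v :: 'a::comm_monoid_add^'n)"
  by (simp add: vec_eq_iff axis_def sum.delta' if_distrib cong: if_cong)

lemma bounded_linear_axis: "bounded_linear (\<lambda>x::'b::real_normed_vector. axis i x :: 'b^'m)"
  by (rule bounded_linear_intro[where K = 1]) (auto simp: axis_def vec_eq_iff norm_vec_def L2_set_def if_distrib[of norm] if_distrib[of "\<lambda>x. x\<^sup>2"] cong: if_cong)

lemma holomorphic_map_from_components:
  fixes f :: "complex^'n \<Rightarrow> complex^'m"
  assumes "\<And>i. chol (\<lambda>z. f z $ i) S" shows "holomorphic_map_on f S"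
proof (rule holomorphic_mapI[where D = "\<lambda>z v. \<Sum>i\<in>UNIV. axis i (dird v (\<lambda>z. f z $ i) z)"])
  fix z assume z: "z \<in> S"
  have "((\<lambda>z. \<Sum>i\<in>UNIV. axis i (f z $ i)) has_derivative (\<lambda>v. \<Sum>i\<in>UNIV. axis i (dird v (\<lambda>z. f z $ i) z))) (at z)"
    by (intro has_derivative_sum bounded_linear.has_derivative[OF bounded_linear_axis] chol_has_derivative[OF assms z])
  then show "(f has_derivative (\<lambda>v. \<Sum>i\<in>UNIV. axis i (dird v (\<lambda>z. f z $ i) z))) (at z)"
    by (simp add: sum_axis)
  show "(\<Sum>i\<in>UNIV. axis i (dird (c *s v) (\<lambda>z. f z $ i) z)) = c *s (\<Sum>i\<in>UNIV. axis i (dird v (\<lambda>z. f z $ i) z))" for c v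
    by (simp add: chol_cscale[OF assms z] vec_eq_iff axis_def if_distrib[of "\<lambda>x. _ * x"] sum_distrib_left cong: if_cong)
qed

lemma has_derivative_dird_compose:
  assumes "(f has_derivative (\<lambda>v. dird v f z)) (at z)" "(u has_derivative (\<lambda>v. dird v u (f z))) (at (f z))"
  shows "((\<lambda>z. u (f z)) has_derivative (\<lambda>v. dird (dird v f z) u (f z))) (at z)"
  using has_derivative_compose[OF assms] .

lemma chol_compose:
  assumes "chol u T" "holomorphic_map_on f S" "f ` S \<subseteq> T" shows "chol (\<lambda>z. u (f z)) S"
proof (rule cholI[where D = "\<lambda>z v. dird (dird v f z) u (f z)"])
  fix z assume z: "z \<in> S"
  then have fz: "f z \<in> T" using assms by blast
  show "((\<lambda>z. u (f z)) has_derivative (\<lambda>v. dird (dird v f z) u (f z))) (at z)"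
    by (intro has_derivative_dird_compose holomorphic_map_has_derivative[OF assms(2) z] chol_has_derivative[OF assms(1) fz])
  show "dird (dird (c *s v) f z) u (f z) = c * dird (dird v f z) u (f z)" for c v
    by (simp add: holomorphic_map_cscale[OF assms(2) z] chol_cscale[OF assms(1) fz])
qed

lemma holomorphic_map_compose:
  assumes "holomorphic_map_on g T" "holomorphic_map_on f S" "f ` S \<subseteq> T" shows "holomorphic_map_on (\<lambda>z. g (f z)) S"
  by (rule holomorphic_map_from_components) (rule chol_compose[OF chol_comp_nth[OF assms(1)] assms(2,3)])

lemma dird_map_compose:
  assumes "holomorphic_map_on g T" "holomorphic_map_on f S" "z \<in> S" "f z \<in> T"
  shows "dird v (\<lambda>z. g (f z)) z = dird (dird v f z) g (f z)"
  by (rule dird_eqI, rule has_derivative_dird_compose) (intro holomorphic_map_has_derivative[OF assms(2,3)] holomorphic_map_has_derivative[OF assms(1,4)])+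

subsection \<open>Cauchy estimates\<close>

lemma chol_line:
  assumes f: "chol f S" and z: "z + \<zeta> *s v \<in> S"
  shows "((\<lambda>\<zeta>. f (z + \<zeta> *s v)) has_field_derivative dird v f (z + \<zeta> *s v)) (at \<zeta>)"
proof -
  have bl: "bounded_linear (\<lambda>h::complex. h *s v)"
    by (rule bounded_linear_intro[where K = "norm v"]) (auto simp: vec_eq_iff algebra_simps norm_cscale)
  have "((\<lambda>\<zeta>. z + \<zeta> *s v) has_derivative (\<lambda>h. h *s v)) (at \<zeta>)"
    using has_derivative_add[OF has_derivative_const bounded_linear_imp_has_derivative[OF bl], of z "at \<zeta>"] by simp
  note d = has_derivative_compose[OF this chol_has_derivative[OF f z]]
  have "(\<lambda>h. dird (h *s v) f (z + \<zeta> *s v)) = (*) (dird v f (z + \<zeta> *s v))"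
    by (rule ext) (simp only: chol_cscale[OF f z] mult.commute)
  then show ?thesis using d unfolding has_field_derivative_def by simp
qed

text \<open>The one-variable Cauchy estimate on the disc in which the complex line through \<open>z\<close> in direction \<open>v\<close> meets the ball.\<close>

lemma chol_Cauchy_estimate:
  assumes f: "chol f (ball z d)" and d: "d > 0" and M: "\<And>w. w \<in> ball z d \<Longrightarrow> norm (f w) \<le> M"
  shows "norm (dird v f z) \<le> M / d * norm v"
proof (cases "v = 0")
  case True
  have "dird v f z = 0" using chol_has_derivative[OF f, of z] d True has_derivative_linear linear_0 by fastforce
  then show ?thesis using True by simp
next
  case False
  have M0: "M \<ge> 0" using M[of z] d norm_ge_zero order_trans by (metis centre_in_ball)
  define u where "u = complex_of_real (1 / norm v) *s v"
  have u: "norm u = 1" "v = complex_of_real (norm v) *s u" using False by (auto simp: u_def norm_cscale vec_eq_iff norm_divide)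
  have inb: "z + \<zeta> *s u \<in> ball z d" if "norm \<zeta> < d" for \<zeta>
    using that u by (simp add: dist_norm norm_cscale)
  let ?g = "\<lambda>\<zeta>. f (z + \<zeta> *s u)"
  have hol: "?g holomorphic_on ball 0 d"
    unfolding holomorphic_on_open[OF open_ball] using chol_line[OF f inb] by (metis dist_0_norm mem_ball)
  have *: "norm (dird u f z) \<le> M / r" if r: "0 < r" "r < d" for r
  proof -
    have "norm ((deriv ^^ 1) ?g 0) \<le> fact 1 * M / r ^ 1"
    proof (rule Cauchy_inequality)
      show "?g holomorphic_on ball 0 r" using hol r by (auto intro: holomorphic_on_subset)
      show "continuous_on (cball 0 r) ?g" using r
        by (intro holomorphic_on_imp_continuous_on holomorphic_on_subset[OF hol]) auto
      show "norm (?g x) \<le> M" if "norm (0 - x) = r" for x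
        using M[OF inb, of x] that r by simp
    qed (use r in auto)
    moreover have "deriv ?g 0 = dird u f z" using DERIV_imp_deriv[OF chol_line[OF f inb, of 0]] d by simp
    ultimately show ?thesis by simp
  qed
  have "((\<lambda>r. M / r) \<longlongrightarrow> M / d) (at_left d)" using d by (auto intro!: tendsto_intros)
  moreover have "\<forall>\<^sub>F r in at_left d. norm (dird u f z) \<le> M / r"
    using * eventually_at_left_real[OF d] by (auto elim: eventually_mono)
  ultimately have "norm (dird u f z) \<le> M / d" by (intro tendsto_lowerbound) auto
  moreover have "dird v f z = complex_of_real (norm v) * dird u f z"
    using chol_cscale[OF f, of z "complex_of_real (norm v)" u] u(2) d by simp
  ultimately show ?thesis using mult_right_mono[of "norm (dird u f z)" "M / d" "norm v"] by (simp add: norm_mult mult.commute)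
qed

text \<open>The sharp constant is essential for the first derivative: it is the Schwarz lemma that makes \<open>logvol_le\<close> nearly an
equality.\<close>

lemma Cauchy_estimate_map:
  fixes f :: "complex^'n \<Rightarrow> complex^'m"
  assumes f: "holomorphic_map_on f (ball z d)" and d: "d > 0" and M: "\<And>w. w \<in> ball z d \<Longrightarrow> norm (f w) \<le> M"
  shows "norm (dird v f z) \<le> M / d * norm v"
proof -
  let ?a = "dird v f z"
  have zb: "z \<in> ball z d" using d by simp
  have M0: "M \<ge> 0" using M[OF zb] norm_ge_zero order_trans by blast
  (* Pairing with the derivative itself reduces to the scalar estimate without losing a constant. *)
  define F where "F w = (\<Sum>i\<in>UNIV. cnj (?a $ i) * f w $ i)" for w
  have cs: "norm (\<Sum>i\<in>UNIV. cnj (a $ i) * b $ i) \<le> norm a * norm b" for a b :: "complex^'m"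
  proof -
    have "norm (\<Sum>i\<in>UNIV. cnj (a $ i) * b $ i) \<le> (\<Sum>i\<in>UNIV. norm (a $ i) * norm (b $ i))"
      by (rule order_trans[OF norm_sum]) (simp add: norm_mult)
    also have "\<dots> \<le> norm a * norm b" unfolding norm_vec_def
      using L2_set_mult_ineq[of "\<lambda>i. norm (a $ i)" "\<lambda>i. norm (b $ i)" UNIV] by simp
    finally show ?thesis .
  qed
  have cF: "chol F (ball z d)" unfolding F_def by (intro chol_sum chol_mult chol_const chol_comp_nth f)
  have "norm (F w) \<le> norm ?a * M" if "w \<in> ball z d" for w
    using cs[of ?a "f w"] M[OF that] unfolding F_def by (meson mult_left_mono norm_ge_zero order_trans)
  from chol_Cauchy_estimate[OF cF d this] have "norm (dird v F z) \<le> norm ?a * M / d * norm v" .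
  moreover have "dird v F z = (\<Sum>i\<in>UNIV. cnj (?a $ i) * ?a $ i)"
    unfolding F_def
    by (rule dird_eqI[of _ "\<lambda>v. \<Sum>i\<in>UNIV. cnj (?a $ i) * dird v f z $ i"])
      (intro has_derivative_sum has_derivative_mult_right bounded_linear.has_derivative[OF bounded_linear_vec_nth] holomorphic_map_has_derivative[OF f zb])
  moreover have "(\<Sum>i\<in>UNIV. cnj (?a $ i) * ?a $ i) = of_real ((norm ?a)\<^sup>2)"
    by (simp add: norm_vec_def L2_set_def sum_nonneg complex_norm_square[symmetric] mult.commute of_real_sum)
  ultimately have "(norm ?a)\<^sup>2 \<le> norm ?a * M / d * norm v" by (simp add: norm_power)
  then have "norm ?a * norm ?a \<le> norm ?a * (M / d * norm v)" by (simp add: power2_eq_square)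
  then have "norm ?a \<le> M / d * norm v" if "?a \<noteq> 0"
    using that mult_le_cancel_left_pos[of "norm ?a"] by (metis zero_less_norm_iff)
  moreover have "norm ?a \<le> M / d * norm v" if "?a = 0" using that M0 d by simp
  ultimately show ?thesis by blast
qed

text \<open>The Cauchy estimate for \<open>w \<mapsto> f (w + y - y\<^sub>0) - f w\<close> turns uniform continuity of \<open>f\<close> into continuity of the derivative.\<close>

lemma chol_derivative_continuous:
  assumes f: "chol f S" and op: "open S"
  shows "continuous_on S (\<lambda>y. Blinfun (\<lambda>v. dird v f y))"
  unfolding continuous_on_eq_continuous_at[OF op]
proof (intro ballI)
  fix y0 assume y0: "y0 \<in> S"
  obtain e where e: "e > 0" "cball y0 e \<subseteq> S" using op y0 open_contains_cball by blast
  define d where "d = e / 2"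
  have d: "d > 0" using e by (simp add: d_def)
  have uc: "uniformly_continuous_on (cball y0 e) f"
    using compact_uniformly_continuous[OF continuous_on_subset[OF chol_continuous_on[OF f] e(2)]] by simp
  have bl: "bounded_linear (\<lambda>v. dird v f y)" if "y \<in> S" for y
    using chol_has_derivative[OF f that] has_derivative_bounded_linear by blast
  show "isCont (\<lambda>y. Blinfun (\<lambda>v. dird v f y)) y0"
    unfolding continuous_at_eps_delta
  proof (intro allI impI)
    fix \<epsilon> :: real assume eps: "\<epsilon> > 0"
    obtain \<delta> where \<delta>: "\<delta> > 0" "\<And>x x'. x \<in> cball y0 e \<Longrightarrow> x' \<in> cball y0 e \<Longrightarrow> dist x' x < \<delta> \<Longrightarrow> dist (f x') (f x) < \<epsilon> / 2 * d"
      using uc eps d unfolding uniformly_continuous_on_def by (metis half_gt_zero mult_pos_pos)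
    show "\<exists>\<delta>>0. \<forall>y. dist y y0 < \<delta> \<longrightarrow> dist (Blinfun (\<lambda>v. dird v f y)) (Blinfun (\<lambda>v. dird v f y0)) < \<epsilon>"
    proof (intro exI[of _ "min \<delta> d"] conjI allI impI)
      fix y assume y: "dist y y0 < min \<delta> d"
      have inb: "w + (y - y0) \<in> cball y0 e" if "w \<in> ball y0 d" for w
      proof -
        have "dist y0 (w + (y - y0)) \<le> dist y0 w + dist w (w + (y-y0))" by (rule dist_triangle)
        also have "\<dots> < d + d" using that y by (intro add_strict_mono) (auto simp: dist_norm norm_minus_commute)
        finally show ?thesis by (simp add: d_def)
      qed
      have inb0: "w \<in> cball y0 e" if "w \<in> ball y0 d" for w using that e by (auto simp: d_def)
      let ?F = "\<lambda>w. f (w + (y - y0)) - f w"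
      have shift: "((\<lambda>w. f (w + (y-y0))) has_derivative (\<lambda>v. dird v f (w + (y-y0)))) (at w)" if "w \<in> ball y0 d" for w
        by (rule has_derivative_compose[of "\<lambda>w. w + (y-y0)" "\<lambda>v. v"]) 
          (use chol_has_derivative[OF f subsetD[OF e(2) inb[OF that]]] in \<open>auto intro!: derivative_eq_intros\<close>)
      have der: "(?F has_derivative (\<lambda>v. dird v f (w + (y-y0)) - dird v f w)) (at w)" if "w \<in> ball y0 d" for w
        by (intro has_derivative_diff shift that chol_has_derivative[OF f]) (use e inb0[OF that] in auto)
      have ch: "chol ?F (ball y0 d)"
        by (rule cholI[OF der]) (use chol_cscale[OF f] e inb inb0 in \<open>auto simp: algebra_simps subset_iff\<close>)
      have "norm (dird v ?F y0) \<le> \<epsilon> / 2 * d / d * norm v" for v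
      proof (rule chol_Cauchy_estimate[OF ch d])
        fix w assume w: "w \<in> ball y0 d"
        have "dist (w + (y - y0)) w < \<delta>" using y by (simp add: dist_norm)
        then show "norm (?F w) \<le> \<epsilon> / 2 * d" using \<delta>(2)[OF inb0[OF w] inb[OF w]] by (simp add: dist_norm)
      qed
      moreover have "dird v ?F y0 = dird v f y - dird v f y0" for v
        using dird_eqI[OF der[of y0]] d by simp
      ultimately have est: "norm (dird v f y - dird v f y0) \<le> \<epsilon> / 2 * norm v" for v using d by simp
      have yS: "y \<in> S" using y e by (auto simp: d_def subset_iff dist_commute)
      have "norm (Blinfun (\<lambda>v. dird v f y) - Blinfun (\<lambda>v. dird v f y0)) \<le> \<epsilon> / 2"
        by (rule norm_blinfun_bound) (use eps est in \<open>auto simp: blinfun.diff_left bounded_linear_Blinfun_apply[OF bl[OF yS]] bounded_linear_Blinfun_apply[OF bl[OF y0]]\<close>)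
      then show "dist (Blinfun (\<lambda>v. dird v f y)) (Blinfun (\<lambda>v. dird v f y0)) < \<epsilon>" using eps by (simp add: dist_norm)
    qed (use \<delta> d in auto)
  qed
qed

text \<open>The derivative in direction \<open>v\<close> is a Cauchy integral over a circle of fixed radius in the complex line spanned by \<open>v\<close>, and
differentiation under the integral sign shows that it is again holomorphic. With this, Cauchy estimates can be iterated.\<close>

lemma chol_dird:
  assumes f: "chol f S" and op: "open S"
  shows "chol (dird v f) S"
  unfolding chol_def
proof (intro ballI)
  fix z0 assume z0: "z0 \<in> S"
  obtain e where e: "e > 0" "cball z0 e \<subseteq> S" using op z0 open_contains_cball by blast
  define \<rho> where "\<rho> = e / (2 * (norm v + 1))"
  have nv: "norm v + 1 > 0" using norm_ge_zero[of v] by linarith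
  have \<rho>: "\<rho> > 0" using e nv by (simp add: \<rho>_def)
  have \<rho>v: "\<rho> * norm v < e / 2"
  proof -
    have "\<rho> * norm v < \<rho> * (norm v + 1)" using \<rho> by simp
    also have "\<dots> = e / 2" using nv unfolding \<rho>_def by (simp add: field_simps del: distrib_left_numeral)
    finally show ?thesis .
  qed
  define U where "U = ball z0 (e / 2)"
  have inS: "z + \<zeta> *s v \<in> S" if "z \<in> U" "norm \<zeta> \<le> \<rho>" for z \<zeta>
  proof -
    have "dist z0 (z + \<zeta> *s v) \<le> dist z0 z + dist z (z + \<zeta> *s v)" by (rule dist_triangle)
    also have "\<dots> = dist z0 z + norm \<zeta> * norm v" by (simp add: dist_norm norm_cscale)
    also have "\<dots> < e / 2 + e / 2" using that \<rho>v mult_right_mono[OF that(2) norm_ge_zero[of v]]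
      by (intro add_less_le_mono) (auto simp: U_def)
    finally show ?thesis using e by auto
  qed
  define E where "E t = complex_of_real \<rho> * exp (2 * of_real pi * \<i> * of_real t)" for t
  have nE: "norm (E t) = \<rho>" for t
  proof -
    have "2 * of_real pi * \<i> * of_real t = \<i> * complex_of_real (2 * pi * t)" by simp
    then show ?thesis using \<rho> unfolding E_def norm_mult by (simp only: norm_exp_i_times) simp
  qed
  have E0: "E t \<noteq> 0" for t using nE[of t] \<rho> by auto
  have contE: "continuous_on A E" for A unfolding E_def by (intro continuous_intros)
  define G where "G z t = inverse (E t) * f (z + E t *s v)" for z t
  have eq: "dird v f z = integral (cbox 0 1) (G z)" if z: "z \<in> U" for z
  proof -
    let ?g = "\<lambda>\<zeta>. f (z + \<zeta> *s v)"
    have der: "(?g has_field_derivative dird v f (z + \<zeta> *s v)) (at \<zeta>)" if "norm \<zeta> \<le> \<rho>" for \<zeta>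
      by (rule chol_line[OF f inS[OF z that]])
    have c: "continuous_on (cball 0 \<rho>) ?g"
      using der by (auto intro!: continuous_at_imp_continuous_on DERIV_isCont)
    have h: "?g holomorphic_on ball 0 \<rho>" using der by (force simp: holomorphic_on_open)
    have "(?g has_field_derivative 1 / (2 * of_real pi * \<i>) * contour_integral (circlepath 0 \<rho>) (\<lambda>u. ?g u / (u - 0)\<^sup>2)) (at 0)"
      by (rule Cauchy_derivative_integral_circlepath(2)[OF c h]) (use \<rho> in simp)
    then have "dird v f z = 1 / (2 * of_real pi * \<i>) * contour_integral (circlepath 0 \<rho>) (\<lambda>u. ?g u / (u - 0)\<^sup>2)"
      using DERIV_unique der[of 0] \<rho> by fastforce
    also have "contour_integral (circlepath 0 \<rho>) (\<lambda>u. ?g u / (u - 0)\<^sup>2) = integral {0..1} (\<lambda>t. (2 * of_real pi * \<i>) * G z t)"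
      unfolding contour_integral_integral
    proof (rule integral_cong)
      fix t :: real
      have "circlepath 0 \<rho> t = E t" by (simp add: circlepath E_def mult_ac)
      moreover have "vector_derivative (circlepath 0 \<rho>) (at t) = 2 * of_real pi * \<i> * E t"
        by (simp add: vector_derivative_circlepath E_def mult_ac)
      ultimately show "?g (circlepath 0 \<rho> t) / (circlepath 0 \<rho> t - 0)\<^sup>2 * vector_derivative (circlepath 0 \<rho>) (at t) = 2 * of_real pi * \<i> * G z t"
        using E0[of t] by (simp add: G_def power2_eq_square field_simps)
    qed
    finally show ?thesis by simp
  qed
  define fx where "fx z t = blinfun_mult_right (inverse (E t)) o\<^sub>L Blinfun (\<lambda>h. dird h f (z + E t *s v))" for z t
  have blf: "bounded_linear (\<lambda>h. dird h f y)" if "y \<in> S" for y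
    using chol_has_derivative[OF f that] has_derivative_bounded_linear by blast
  have fx_apply: "blinfun_apply (fx z t) h = inverse (E t) * dird h f (z + E t *s v)" if "z \<in> U" for z t h
    unfolding fx_def using bounded_linear_Blinfun_apply[OF blf[OF inS[OF that]], of "E t"] nE[of t] by simp
  have cs: "continuous_on A (\<lambda>x. g x *s v)" if "continuous_on A g" for A and g :: "'b::topological_space \<Rightarrow> complex"
  proof -
    have "bounded_linear (\<lambda>h::complex. h *s v)"
      by (rule bounded_linear_intro[where K = "norm v"]) (auto simp: vec_eq_iff algebra_simps norm_cscale)
    then show ?thesis using that by (rule bounded_linear.continuous_on)
  qed
  have cont1: "continuous_on (U \<times> cbox 0 1) (\<lambda>(z, t). fx z t)"
    unfolding fx_def split_beta
  proof (intro bounded_bilinear.continuous_on[OF bounded_bilinear_blinfun_compose])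
    have cE: "continuous_on (U \<times> cbox 0 1) (\<lambda>x. E (snd x))"
      by (rule continuous_on_compose2[OF contE[of UNIV]]) (auto intro: continuous_intros)
    show "continuous_on (U \<times> cbox 0 1) (\<lambda>x. blinfun_mult_right (inverse (E (snd x))))"
      by (intro bounded_linear.continuous_on[OF bounded_linear_blinfun_mult_right] continuous_on_inverse cE) (use E0 in auto)
    show "continuous_on (U \<times> cbox 0 1) (\<lambda>x. Blinfun (\<lambda>h. dird h f (fst x + E (snd x) *s v)))"
      by (rule continuous_on_compose2[OF chol_derivative_continuous[OF f op], of _ "\<lambda>x. fst x + E (snd x) *s v"])
        (use inS nE cE in \<open>auto intro!: continuous_intros cs\<close>)
  qed
  have z0U: "z0 \<in> U" using e by (simp add: U_def)
  have "((\<lambda>z. integral (cbox 0 1) (G z)) has_derivative integral (cbox 0 1) (fx z0)) (at z0 within U)"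
  proof (rule leibniz_rule)
    fix z t assume z: "z \<in> U"
    have "((\<lambda>z. f (z + E t *s v)) has_derivative (\<lambda>h. dird h f (z + E t *s v))) (at z)"
      by (rule has_derivative_compose[of "\<lambda>w. w + E t *s v" "\<lambda>v. v"]) 
          (use chol_has_derivative[OF f inS[OF z]] nE in \<open>auto intro!: derivative_eq_intros\<close>)
    then have "(G_z has_derivative (\<lambda>h. inverse (E t) * dird h f (z + E t *s v))) (at z)" if "G_z = (\<lambda>z. G z t)" for G_z
      unfolding that G_def by (rule has_derivative_mult_right)
    then show "((\<lambda>z. G z t) has_derivative blinfun_apply (fx z t)) (at z within U)"
      using fx_apply[OF z, of t] has_derivative_at_withinI by (metis (no_types, lifting) ext)
  next
    fix z assume z: "z \<in> U"
    have "continuous_on (cbox 0 1) (\<lambda>t. f (z + E t *s v))"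
      by (rule continuous_on_compose2[OF chol_continuous_on[OF f], of _ "\<lambda>t. z + E t *s v"]) 
        (use inS[OF z] nE in \<open>auto intro!: continuous_intros cs contE\<close>)
    then have "continuous_on (cbox 0 1) (G z)" unfolding G_def using E0 by (intro continuous_intros contE) auto
    then show "G z integrable_on cbox 0 1" by (rule integrable_continuous)
  qed (use cont1 z0U in \<open>auto simp: U_def\<close>)
  then have "((\<lambda>z. integral (cbox 0 1) (G z)) has_derivative integral (cbox 0 1) (fx z0)) (at z0)"
    using at_within_open[OF z0U] by (simp add: U_def)
  then have d: "(dird v f has_derivative blinfun_apply (integral (cbox 0 1) (fx z0))) (at z0)"
    by (rule has_derivative_transform_within_open[of _ _ _ UNIV U]) (use z0U eq in \<open>auto simp: U_def\<close>)
  have cfx: "continuous_on (cbox 0 1) (fx z0)"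
    by (rule continuous_on_compose2[OF cont1, of _ "\<lambda>t. (z0, t)", simplified]) (use z0U in \<open>auto intro!: continuous_intros\<close>)
  have app: "blinfun_apply (integral (cbox 0 1) (fx z0)) h = integral (cbox 0 1) (\<lambda>t. inverse (E t) * dird h f (z0 + E t *s v))" for h
    using blinfun_apply_integral[OF integrable_continuous[OF cfx], of h] fx_apply[OF z0U] by simp
  show "\<exists>D. (dird v f has_derivative D) (at z0) \<and> (\<forall>c h. D (c *s h) = c * D h)"
  proof (intro exI conjI allI)
    fix c h
    have "inverse (E t) * dird (c *s h) f (z0 + E t *s v) = c * (inverse (E t) * dird h f (z0 + E t *s v))" for t
      using chol_cscale[OF f inS[OF z0U], of "E t"] nE by simp
    then show "blinfun_apply (integral (cbox 0 1) (fx z0)) (c *s h) = c * blinfun_apply (integral (cbox 0 1) (fx z0)) h"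
      unfolding app by (simp only: integral_mult_right)
  qed (rule d)
qed

text \<open>Each derivative costs one Cauchy estimate on a slightly smaller ball.\<close>

lemma chol_CB:
  assumes "r < R"
  shows "\<exists>C\<ge>1. \<forall>f M. chol f (ball a R) \<longrightarrow> (\<forall>w\<in>ball a R. norm (f w) \<le> M) \<longrightarrow> M \<ge> 0 \<longrightarrow> CB k (C * M) f (ball a r)"
  using assms
proof (induction k arbitrary: R)
  case 0
  then show ?case by (intro exI[of _ 1]) auto
next
  case (Suc k)
  define m where "m = (r + R) / 2"
  have m: "r < m" "m < R" using Suc.prems by (auto simp: m_def)
  obtain C where C: "C \<ge> 1" "\<And>f M. chol f (ball a m) \<Longrightarrow> (\<And>w. w\<in>ball a m \<Longrightarrow> norm (f w) \<le> M) \<Longrightarrow> M \<ge> 0 \<Longrightarrow> CB k (C * M) f (ball a r)"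
    using Suc.IH[OF m(1)] by blast
  define C' where "C' = max 1 (C / (R - m))"
  show ?case
  proof (intro exI[of _ C'] conjI allI impI)
    show "C' \<ge> 1" by (simp add: C'_def)
    fix f M assume f: "chol f (ball a R)" and b: "\<forall>w\<in>ball a R. norm (f w) \<le> M" and M: "M \<ge> (0::real)"
    show "CB (Suc k) (C' * M) f (ball a r)"
    proof (rule CB_SucI[where f' = "\<lambda>x v. dird v f x"])
      fix x assume x: "x \<in> ball a r"
      have "M \<le> C' * M" using M mult_right_mono[of 1 C' M] by (simp add: C'_def)
      moreover have "norm (f x) \<le> M" using b x m by simp
      ultimately show "norm (f x) \<le> C' * M" by linarith
      show "(f has_derivative (\<lambda>v. dird v f x)) (at x)" by (rule chol_has_derivative[OF f]) (use x m in auto)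
    next
      fix v
      have "CB k (C * (M / (R - m) * norm v)) (dird v f) (ball a r)"
      proof (rule C(2))
        show "chol (dird v f) (ball a m)" by (rule chol_subset[OF chol_dird[OF f]]) (use m in auto)
        show "0 \<le> M / (R - m) * norm v" using M m by simp
        fix w assume w: "w \<in> ball a m"
        have sub: "ball w (R - m) \<subseteq> ball a R" using w by (intro subsetI) (metis (no_types) add_less_cancel_left diff_add_cancel dist_triangle_lt add.commute dist_triangle_less_add mem_ball dist_commute)
        show "norm (dird v f w) \<le> M / (R - m) * norm v"
          by (rule chol_Cauchy_estimate[OF chol_subset[OF f sub]]) (use b m sub in auto)
      qed
      then show "CB k (C' * M * norm v) (dird v f) (ball a r)"
      proof (rule CB_mono)
        have "C * (M / (R - m) * norm v) = (C / (R - m)) * M * norm v" by simp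
        also have "\<dots> \<le> C' * M * norm v" using M by (intro mult_right_mono) (auto simp: C'_def)
        finally show "C * (M / (R - m) * norm v) \<le> C' * M * norm v" .
      qed simp
    qed simp
  qed
qed

lemma chol_lsm: assumes f: "chol f S" and op: "open S" shows "lsm f S"
  unfolding lsm_def
proof (intro conjI allI ballI op)
  fix k x assume "x \<in> S"
  then obtain e where e: "e > 0" "cball x e \<subseteq> S" using op open_contains_cball by blast
  have "bounded (f ` cball x e)"
    by (intro compact_imp_bounded compact_continuous_image continuous_on_subset[OF chol_continuous_on[OF f] e(2)]) simp
  then obtain M where "\<forall>y\<in>f ` cball x e. norm y \<le> M" by (meson bounded_iff)
  then have M: "\<And>w. w \<in> cball x e \<Longrightarrow> norm (f w) \<le> M" by blast
  have "norm (f x) \<le> M" using M[of x] e by simp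
  then have M0: "M \<ge> 0" using norm_ge_zero[of "f x"] by linarith
  have fe: "chol f (ball x e)" by (rule chol_subset[OF f]) (use e in auto)
  have "e / 2 < e" using e by simp
  from chol_CB[OF this, of x k] obtain C where "CB k (C * M) f (ball x (e/2))"
    using fe M M0 ball_subset_cball by blast
  then show "\<exists>r>0. \<exists>M. ball x r \<subseteq> S \<and> CB k M f (ball x r)"
    using e by (intro exI[of _ "e/2"] conjI exI[of _ "C * M"]) auto
qed

lemma CB_vec:
  fixes f :: "'a::real_normed_vector \<Rightarrow> complex^'m"
  assumes "open S" "\<And>i. CB k M (\<lambda>z. f z $ i) S"
  shows "CB k (real CARD('m) * M) f S"
proof -
  have "CB k (\<Sum>i\<in>(UNIV::'m set). 1 * M) (\<lambda>z. \<Sum>i\<in>UNIV. axis i (f z $ i)) S"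
    by (intro CB_sum CB_linear[OF _ bounded_linear_axis] assms)
      (auto simp: norm_vec_def L2_set_def axis_def if_distrib[of norm] if_distrib[of "\<lambda>x. x\<^sup>2"] cong: if_cong)
  then show ?thesis by (simp add: sum_axis)
qed

lemma holomorphic_map_CB:
  assumes "r < R"
  shows "\<exists>C\<ge>1. \<forall>(f :: complex^'n \<Rightarrow> complex^'m) M. holomorphic_map_on f (ball a R) \<longrightarrow> (\<forall>w\<in>ball a R. norm (f w) \<le> M) \<longrightarrow> M \<ge> 0 \<longrightarrow> CB k (C * M) f (ball a r)"
proof -
  obtain C where C: "C \<ge> 1" "\<And>(f :: complex^'n \<Rightarrow> complex) M. chol f (ball a R) \<Longrightarrow> (\<forall>w\<in>ball a R. norm (f w) \<le> M) \<Longrightarrow> M \<ge> 0 \<Longrightarrow> CB k (C * M) f (ball a r)"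
    using chol_CB[OF assms, of a k] by blast
  have "CB k (real CARD('m) * C * M) f (ball a r)" if f: "holomorphic_map_on f (ball a R)" and b: "\<forall>w\<in>ball a R. norm (f w) \<le> M" and M: "M \<ge> 0"
    for f :: "complex^'n \<Rightarrow> complex^'m" and M
  proof -
    have "\<forall>w\<in>ball a R. norm (f w $ i) \<le> M" for i
      using b Finite_Cartesian_Product.norm_nth_le[of "f _" i] order_trans by blast
    from CB_vec[OF _ C(2)[OF chol_comp_nth[OF f] this M]] show ?thesis by (simp add: mult.assoc)
  qed
  moreover have "1 \<le> real CARD('m) * C" using C(1) mult_mono[of 1 "real CARD('m)" 1 C] by simp
  ultimately show ?thesis by blast
qed

lemma lsm_vec:
  fixes f :: "'a::real_normed_vector \<Rightarrow> 'b::real_normed_vector^'m"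
  assumes "open S" "\<And>i. lsm (\<lambda>z. f z $ i) S" shows "lsm f S"
proof -
  have "lsm (\<lambda>z. \<Sum>i\<in>UNIV. axis i (f z $ i)) S"
    by (intro lsm_sum lsm_linear[OF bounded_linear_axis] assms)
  then show ?thesis by (simp add: sum_axis)
qed

lemma holomorphic_map_lsm: "holomorphic_map_on f S \<Longrightarrow> open S \<Longrightarrow> lsm f S"
  by (intro lsm_vec chol_lsm chol_comp_nth)

lemma holomorphic_map_dird: "holomorphic_map_on f S \<Longrightarrow> open S \<Longrightarrow> holomorphic_map_on (dird v f) S"
proof (rule holomorphic_map_from_components)
  fix i assume f: "holomorphic_map_on f S" and op: "open S"
  have "chol (dird v (\<lambda>z. f z $ i)) S" by (intro chol_dird chol_comp_nth f op)
  then show "chol (\<lambda>z. dird v f z $ i) S"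
    by (subst (asm) chol_cong[OF op, of _ "\<lambda>z. dird v f z $ i"]) (use dird_component[OF f] in auto)
qed

subsection \<open>Determinants\<close>

text \<open>A Hadamard-type inequality without singular values: if \<open>A\<close> is a strict contraction, its powers tend to \<open>0\<close> entrywise, so the
powers of \<open>det A\<close> tend to \<open>0\<close> as well and \<open>|det A| < 1\<close>. The general case follows by scaling.\<close>

lemma det_bound:
  fixes A :: "complex^'n^'n"
  assumes c: "c > 0" and A: "\<And>v. norm (A *v v) \<le> c * norm v"
  shows "norm (det A) \<le> c ^ CARD('n)"
proof -
  have contr: "norm (det B) < 1" if q: "0 < q" "q < 1" and B: "\<And>v. norm (B *v v) \<le> q * norm v" for B :: "complex^'n^'n" and q
  proof (rule ccontr)
    assume "\<not> norm (det B) < 1"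
    then have ge: "norm (det B) \<ge> 1" by simp
    define P where "P = rec_nat (mat 1 :: complex^'n^'n) (\<lambda>_ X. B ** X)"
    have P: "P 0 = mat 1" "P (Suc k) = B ** P k" for k by (simp_all add: P_def)
    have Pv: "norm (P k *v v) \<le> q ^ k * norm v" for k v
    proof (induction k)
      case (Suc k)
      have "norm (P (Suc k) *v v) \<le> q * norm (P k *v v)" using B by (simp add: P matrix_vector_mul_assoc[symmetric])
      also have "\<dots> \<le> q * (q ^ k * norm v)" using Suc q by (intro mult_left_mono) auto
      finally show ?case by simp
    qed (simp add: P)
    have entry: "norm (P k $ i $ j) \<le> q ^ k" for k i j
    proof -
      have "P k $ i $ j = (P k *v axis j 1) $ i"
        by (simp add: matrix_vector_mult_def axis_def if_distrib cong: if_cong)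
      then have "norm (P k $ i $ j) \<le> norm (P k *v axis j 1)"
        using Finite_Cartesian_Product.norm_nth_le by metis
      also have "\<dots> \<le> q ^ k * norm (axis j 1 :: complex^'n)" by (rule Pv)
      finally show ?thesis by simp
    qed
    have lim: "(\<lambda>k. P k $ i $ j) \<longlonglongrightarrow> 0" for i j
      by (rule Lim_null_comparison[OF _ LIMSEQ_power_zero[of q]]) (use entry q in auto)
    have "(\<lambda>k. det (P k)) \<longlonglongrightarrow> (\<Sum>p | p permutes (UNIV::'n set). of_int (sign p) * (\<Prod>i\<in>(UNIV::'n set). 0))"
      unfolding det_def by (intro tendsto_intros lim)
    then have "(\<lambda>k. det (P k)) \<longlonglongrightarrow> 0" by (simp add: zero_power)
    then have "(\<lambda>k. norm (det (P k))) \<longlonglongrightarrow> 0" by (rule tendsto_norm_zero)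
    moreover have "norm (det (P k)) = norm (det B) ^ k" for k
      by (induction k) (simp_all add: P det_mul norm_mult)
    ultimately have "(\<lambda>k. norm (det B) ^ k) \<longlonglongrightarrow> 0" by simp
    then have "\<forall>\<^sub>F k in sequentially. norm (det B) ^ k < 1" by (rule order_tendstoD) simp
    then obtain k where "norm (det B) ^ k < 1" by (metis eventually_sequentially order_refl)
    then show False using one_le_power[OF ge, of k] by simp
  qed
  have "norm (det A) \<le> d ^ CARD('n)" if d: "d > c" for d
  proof -
    define B where "B = (\<chi> i j. complex_of_real (1/d) * A $ i $ j)"
    have Bv: "B *v v = complex_of_real (1/d) *s (A *v v)" for v
      by (simp add: B_def vec_eq_iff matrix_vector_mult_def sum_distrib_left mult.assoc)
    have "norm (B *v v) \<le> c / d * norm v" for v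
      using A[of v] d c unfolding Bv norm_cscale by (simp add: divide_right_mono norm_divide)
    from contr[OF _ _ this] have 1: "norm (det B) < 1" using d c by simp
    have "det B = (\<Prod>i\<in>(UNIV::'n set). complex_of_real (1/d)) * det A"
      unfolding B_def using det_rows_mul[of "\<lambda>i. complex_of_real (1/d)" "\<lambda>i. A $ i"]
      by (simp add: vector_scalar_mult_def)
    then have "norm (det B) = (1/d) ^ CARD('n) * norm (det A)" using d c by (simp add: norm_mult norm_divide norm_power power_divide)
    then have "norm (det A) = norm (det B) * d ^ CARD('n)" using d c by (simp add: field_simps)
    also have "\<dots> \<le> 1 * d ^ CARD('n)" using 1 d c by (intro mult_right_mono) auto
    finally show ?thesis by simp
  qed
  then have "\<forall>\<^sub>F d in at_right c. norm (det A) \<le> d ^ CARD('n)"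
    using eventually_at_right_less[of c] by (rule eventually_mono[rotated])
  moreover have "((\<lambda>d. d ^ CARD('n)) \<longlongrightarrow> c ^ CARD('n)) (at_right c)" by (intro tendsto_intros)
  ultimately show ?thesis by (intro tendsto_lowerbound) auto
qed

text \<open>Expand the determinant row by row: a term in which two rows are multiples of \<open>v\<close> vanishes.\<close>

lemma det_identity_plus_rank_one:
  fixes u v :: "complex^'n"
  shows "det (\<chi> i j. (if i = j then 1 else 0) + u $ i * v $ j) = 1 + (\<Sum>i\<in>UNIV. u $ i * v $ i)"
proof -
  define R where "R S = (\<chi> i. if i \<in> S then axis i 1 + (u $ i) *s v else (axis i 1 :: complex^'n))" for S
  have "det (R S) = 1 + (\<Sum>i\<in>S. u $ i * v $ i)" if "finite S" for S
    using that
  proof (induction S rule: finite_induct)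
    case empty
    have "R {} = mat 1" by (simp add: R_def mat_def vec_eq_iff axis_def)
    then show ?case by simp
  next
    case (insert k S)
    define a where "a i = (if i \<in> S then axis i 1 + (u $ i) *s v else (axis i 1 :: complex^'n))" for i
    have "R (insert k S) = (\<chi> i. if i = k then axis k 1 + (u $ k) *s v else a i)"
      by (simp add: R_def a_def vec_eq_iff)
    then have "det (R (insert k S)) = det (\<chi> i. if i = k then axis k 1 else a i) + det (\<chi> i. if i = k then (u $ k) *s v else a i)"
      using det_row_add[of k "\<lambda>i. axis k 1" "\<lambda>i. (u $ k) *s v" a] by simp
    moreover have "(\<chi> i. if i = k then axis k 1 else a i) = R S" using insert(2) by (auto simp: R_def a_def vec_eq_iff)
    moreover have "det (\<chi> i. if i = k then (u $ k) *s v else a i) = u $ k * det (\<chi> i. if i = k then v else a i)"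
      using det_row_mul[of k "u $ k" "\<lambda>i. v" a] by simp
    moreover have "det (\<chi> i. if i = k then v else a i) = v $ k"
    proof -
      define c where "c T = (\<chi> i. if i = k then v else if i \<in> T then axis i 1 + (u $ i) *s v else (axis i 1 :: complex^'n))" for T
      have "det (c T) = det (c {})" if "finite T" "k \<notin> T" for T
        using that
      proof (induction T rule: finite_induct)
        case (insert l T)
        have lk: "l \<noteq> k" using insert by auto
        have "c (insert l T) = (\<chi> i. if i = l then row l (c T) + (u $ l) *s row k (c T) else row i (c T))"
          using lk insert(2) by (auto simp: c_def vec_eq_iff row_def)
        then show ?case using det_row_operation[OF lk, of "c T" "u $ l"] insert by simp
      qed simp
      from this[OF insert(1,2)] have "det (c S) = det (c {})" .
      moreover have "c S = (\<chi> i. if i = k then v else a i)" by (simp add: c_def a_def vec_eq_iff)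
      moreover have "det (c {}) = v $ k"
      proof -
        have vs: "v = (\<Sum>j\<in>UNIV. (v $ j) *s axis j 1)" by (simp add: vec_eq_iff axis_def if_distrib cong: if_cong)
        have "c {} = (\<chi> i. if i = k then (\<Sum>j\<in>UNIV. (v $ j) *s axis j 1) else axis i 1)"
          unfolding c_def vs[symmetric] by (simp cong: if_cong)
        also have "det \<dots> = (\<Sum>j\<in>UNIV. det (\<chi> i. if i = k then (v $ j) *s axis j 1 else (axis i 1 :: complex^'n)))"
          using det_linear_row_sum[of UNIV k "\<lambda>i j. (v $ j) *s axis j 1" "\<lambda>i. axis i 1"] by simp
        also have "\<dots> = (\<Sum>j\<in>UNIV. v $ j * det (\<chi> i. if i = k then axis j 1 else (axis i 1 :: complex^'n)))"
          using det_row_mul[of k _ "\<lambda>i. axis _ 1" "\<lambda>i. axis i 1"] by (intro sum.cong) auto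
        also have "\<dots> = (\<Sum>j\<in>UNIV. v $ j * (if j = k then 1 else 0))"
        proof (intro sum.cong refl)
          fix j
          show "v $ j * det (\<chi> i. if i = k then axis j 1 else (axis i 1 :: complex^'n)) = v $ j * (if j = k then 1 else 0)"
          proof (cases "j = k")
            case True
            then have "(\<chi> i. if i = k then axis j 1 else (axis i 1 :: complex^'n)) = mat 1" by (simp add: vec_eq_iff mat_def axis_def)
            then show ?thesis using True by simp
          next
            case False
            have "det (\<chi> i. if i = k then axis j 1 else (axis i 1 :: complex^'n)) = 0"
              by (rule det_identical_rows[of j k]) (use False in \<open>auto simp: row_def vec_eq_iff\<close>)
            then show ?thesis using False by simp
          qed
        qed
        finally show ?thesis by (simp add: if_distrib cong: if_cong)
      qed
      ultimately show ?thesis by simp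
    qed
    ultimately show ?case using insert by simp
  qed
  from this[of UNIV] have "det (R UNIV) = 1 + (\<Sum>i\<in>UNIV. u $ i * v $ i)" by simp
  moreover have "R UNIV = (\<chi> i j. (if i = j then 1 else 0) + u $ i * v $ j)"
    by (simp add: R_def vec_eq_iff axis_def)
  ultimately show ?thesis by simp
qed

definition Jac :: "(complex^'n \<Rightarrow> complex^'n) \<Rightarrow> complex^'n \<Rightarrow> complex" where
  "Jac f z = det (matrix (\<lambda>v. dird v f z))"

lemma holomorphic_map_matrix:
  assumes "holomorphic_map_on f S" "z \<in> S"
  shows "matrix (\<lambda>v. dird v f z) *v v = dird v f z"
proof -
  have "Vector_Spaces.linear (*s) (*s) (\<lambda>v. dird v f z)"
    using linear_add[OF holomorphic_map_linear[OF assms]] holomorphic_map_cscale[OF assms]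
    by unfold_locales (auto simp: algebra_simps vec_eq_iff)
  then show ?thesis using matrix_works by metis
qed

lemma Jac_chol: assumes f: "holomorphic_map_on f S" and op: "open S" shows "chol (Jac f) S"
  unfolding Jac_def det_def matrix_def
  using chol_comp_nth[OF holomorphic_map_dird[OF f op]]
  by (auto intro!: chol_sum chol_mult chol_const chol_prod)

lemma Jac_compose:
  assumes "holomorphic_map_on g T" "holomorphic_map_on f S" "z \<in> S" "f z \<in> T"
  shows "Jac (\<lambda>z. g (f z)) z = Jac g (f z) * Jac f z"
proof -
  have "(\<lambda>v. dird v (\<lambda>z. g (f z)) z) = (\<lambda>v. (matrix (\<lambda>v. dird v g (f z)) ** matrix (\<lambda>v. dird v f z)) *v v)"
    by (rule ext) (simp add: dird_map_compose[OF assms] matrix_vector_mul_assoc[symmetric] holomorphic_map_matrix[OF assms(1,4)] holomorphic_map_matrix[OF assms(2,3)])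
  then show ?thesis unfolding Jac_def by (simp add: det_mul)
qed

lemma Jac_bound:
  fixes f :: "complex^'n \<Rightarrow> complex^'n"
  assumes f: "holomorphic_map_on f S" "z \<in> S" and c: "c > 0" "\<And>v. norm (dird v f z) \<le> c * norm v"
  shows "norm (Jac f z) \<le> c ^ CARD('n)"
  unfolding Jac_def by (rule det_bound[OF c(1)]) (use c(2) holomorphic_map_matrix[OF f] in simp)

lemma Jac_id: "open S \<Longrightarrow> z \<in> S \<Longrightarrow> (\<And>w. w \<in> S \<Longrightarrow> f w = w) \<Longrightarrow> Jac f z = 1"
proof -
  assume *: "open S" "z \<in> S" "\<And>w. w \<in> S \<Longrightarrow> f w = w"
  have "(\<lambda>v. dird v f z) = id"
    using frechet_derivative_eq_open[OF *(1,2), of f "\<lambda>w. w"] *(3) by (auto simp: fun_eq_iff)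
  then show ?thesis unfolding Jac_def using matrix_id_mat_1 by simp
qed

subsection \<open>Holomorphic embeddings\<close>

lemma embedding_props:
  fixes f :: "complex^'n \<Rightarrow> complex^'n"
  assumes "holomorphic_embedding_on f \<Omega>" "open \<Omega>"
  shows "holomorphic_map_on f \<Omega>" "inj_on f \<Omega>" "open (f ` \<Omega>)"
proof -
  show f: "holomorphic_map_on f \<Omega>" using assms by (simp add: holomorphic_embedding_on_def)
  obtain g where "homeomorphism \<Omega> (f ` \<Omega>) f g" using assms unfolding holomorphic_embedding_on_def by blast
  then show i: "inj_on f \<Omega>" unfolding homeomorphism_def by (metis inj_on_inverseI)
  show "open (f ` \<Omega>)" using invariance_of_domain[OF holomorphic_map_continuous_on[OF f] assms(2) i] .
qed

text \<open>The inverse is differentiable by the inverse function theorem, and the inverse of a complex linear map is complex linear.\<close>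

lemma embedding_inverse_holomorphic:
  fixes f :: "complex^'n \<Rightarrow> complex^'n"
  assumes emb: "holomorphic_embedding_on f \<Omega>" and op: "open \<Omega>"
  shows "holomorphic_map_on (inv_into \<Omega> f) (f ` \<Omega>)"
proof -
  note p = embedding_props[OF emb op]
  show ?thesis unfolding holomorphic_map_on_def
  proof (intro ballI)
    fix w assume "w \<in> f ` \<Omega>"
    then obtain z where z: "z \<in> \<Omega>" "w = f z" by blast
    let ?D = "\<lambda>v. dird v f z"
    have lin: "linear ?D" using holomorphic_map_linear[OF p(1) z(1)] .
    have inj: "inj ?D" using emb z(1) unfolding holomorphic_embedding_on_def by (simp add: eta_contract_eq)
    obtain D' where D': "linear D'" "D' \<circ> ?D = id" "?D \<circ> D' = id"
      using linear_injective_isomorphism[OF lin inj] by (auto simp: fun_eq_iff)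
    have "(inv_into \<Omega> f has_derivative D') (at (f z))"
      by (rule has_derivative_inverse_strong[OF op z(1) holomorphic_map_continuous_on[OF p(1)] _ holomorphic_map_has_derivative[OF p(1) z(1)] D'(3)])
        (simp add: p(2))
    moreover have "D' (c *s v) = c *s D' v" for c v
    proof -
      have "?D (c *s D' v) = c *s v" using holomorphic_map_cscale[OF p(1) z(1)] D'(3) by (metis comp_apply id_apply)
      then show ?thesis using D'(2) by (metis comp_apply id_apply)
    qed
    ultimately show "\<exists>D. (inv_into \<Omega> f has_derivative D) (at w) \<and> (\<forall>c v. D (c *s v) = c *s D v)" using z(2) by blast
  qed
qed

lemma embedding_Jac_nonzero:
  assumes emb: "holomorphic_embedding_on f \<Omega>" and op: "open \<Omega>" and z: "z \<in> \<Omega>"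
  shows "Jac f z \<noteq> 0"
proof -
  note p = embedding_props[OF emb op]
  have "Jac (\<lambda>z. inv_into \<Omega> f (f z)) z = Jac (inv_into \<Omega> f) (f z) * Jac f z"
    by (rule Jac_compose[OF embedding_inverse_holomorphic[OF emb op] p(1) z]) (use z in simp)
  moreover have "Jac (\<lambda>z. inv_into \<Omega> f (f z)) z = 1" by (rule Jac_id[OF op z]) (use p in auto)
  ultimately show ?thesis by auto
qed

subsection \<open>Automorphisms of the ball\<close>

text \<open>The Hermitian inner product, linear in the first argument.\<close>

definition hip :: "complex^'n \<Rightarrow> complex^'n \<Rightarrow> complex" where
  "hip x y = (\<Sum>i\<in>UNIV. x $ i * cnj (y $ i))"

lemma hip_simps:
  "hip (x + y) z = hip x z + hip y z" "hip (x - y) z = hip x z - hip y z" "hip (c *s x) z = c * hip x z"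
  "hip z (x + y) = hip z x + hip z y" "hip z (x - y) = hip z x - hip z y" "hip z (c *s x) = cnj c * hip z x"
  "hip (- x) z = - hip x z" "hip 0 z = 0" "hip z 0 = 0"
  by (simp_all add: hip_def sum.distrib sum_subtractf sum_distrib_left algebra_simps sum_negf)

lemma hip_cnj: "cnj (hip x y) = hip y x" by (simp add: hip_def mult.commute)

lemma hip_self: "hip x x = of_real ((norm x)\<^sup>2)"
  by (simp add: hip_def norm_vec_def L2_set_def sum_nonneg complex_norm_square[symmetric] of_real_sum)

lemma hip_norm: "norm (hip x y) \<le> norm x * norm y"
proof -
  have "norm (hip x y) \<le> (\<Sum>i\<in>UNIV. norm (x $ i) * norm (y $ i))"
    unfolding hip_def by (rule order_trans[OF norm_sum]) (simp add: norm_mult)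
  also have "\<dots> \<le> norm x * norm y" unfolding norm_vec_def
    using L2_set_mult_ineq[of "\<lambda>i. norm (x $ i)" "\<lambda>i. norm (y $ i)" UNIV] by simp
  finally show ?thesis .
qed

definition bsq :: "complex^'n \<Rightarrow> real" where "bsq a = sqrt (1 - (norm a)\<^sup>2)"

text \<open>The involutive automorphism of the unit ball that exchanges \<open>a\<close> and \<open>0\<close>. In the usual formula the component of \<open>w\<close> along \<open>a\<close> is
\<open>(hip w a / |a|\<^sup>2) a\<close>; the form used here, with \<open>(1 - sqrt (1 - |a|\<^sup>2)) / |a|\<^sup>2 = 1 / (1 + sqrt (1 - |a|\<^sup>2))\<close> inserted, also covers \<open>a = 0\<close>.\<close>

definition ball_aut :: "complex^'n \<Rightarrow> complex^'n \<Rightarrow> complex^'n" where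
  "ball_aut a w = inverse (1 - hip w a) *s ((1 - hip w a / of_real (1 + bsq a)) *s a - of_real (bsq a) *s w)"

lemma bsq: "norm a < 1 \<Longrightarrow> 0 < bsq a" "norm a < 1 \<Longrightarrow> bsq a \<le> 1" "norm a < 1 \<Longrightarrow> (norm a)\<^sup>2 = 1 - (bsq a)\<^sup>2"
  by (auto simp: bsq_def power_less_one_iff abs_square_less_1 less_imp_le)

lemma bsq_complex:
  assumes a: "norm a < 1"
  shows "complex_of_real (bsq a) \<noteq> 0" "1 + complex_of_real (bsq a) \<noteq> 0" "hip a a = 1 - (complex_of_real (bsq a))\<^sup>2"
proof -
  have "1 + complex_of_real (bsq a) = of_real (1 + bsq a)" by simp
  then show "1 + complex_of_real (bsq a) \<noteq> 0" using bsq(1)[OF a] by (metis add_pos_pos less_irrefl of_real_eq_0_iff zero_less_one)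
  show "hip a a = 1 - (complex_of_real (bsq a))\<^sup>2" unfolding hip_self bsq(3)[OF a] by simp
qed (use bsq(1)[OF a] in simp)

lemma hip_ne1: "norm a < 1 \<Longrightarrow> norm w \<le> 1 \<Longrightarrow> 1 - hip w a \<noteq> 0"
proof
  assume a: "norm a < 1" "norm w \<le> 1" "1 - hip w a = 0"
  have "norm (hip w a) \<le> norm w * norm a" by (rule hip_norm)
  also have "\<dots> \<le> 1 * norm a" using a by (intro mult_right_mono) auto
  finally show False using a by simp
qed

lemma ball_aut_norm:
  assumes a: "norm a < 1" and w: "norm w < 1"
  shows "1 - (norm (ball_aut a w))\<^sup>2 = (1 - (norm a)\<^sup>2) * (1 - (norm w)\<^sup>2) / (norm (1 - hip w a))\<^sup>2"
proof -
  define s where "s = bsq a"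
  define c where "c = hip w a"
  define N where "N = (1 - c / of_real (1 + s)) *s a - of_real s *s w"
  have s: "0 < s" "(norm a)\<^sup>2 = 1 - s\<^sup>2" using bsq[OF a] by (auto simp: s_def)
  have cn: "hip a w = cnj c" by (simp add: c_def hip_cnj)
  have s1: "1 + complex_of_real s \<noteq> 0" using s by (metis add_pos_pos of_real_1 of_real_add of_real_eq_0_iff zero_less_one less_irrefl)
  have "hip N N = (1 - c / of_real (1 + s)) * (1 - cnj c / of_real (1 + s)) * of_real (1 - s\<^sup>2)
     - (1 - c / of_real (1 + s)) * of_real s * cnj c - of_real s * (1 - cnj c / of_real (1 + s)) * c + of_real (s\<^sup>2) * hip w w"
  proof -
    define k where "k = 1 - c / of_real (1 + s)"
    have k: "cnj k = 1 - cnj c / of_real (1 + s)" by (simp add: k_def)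
    define A where "A = complex_of_real (1 - s\<^sup>2)"
    have aA: "hip a a = A" by (simp add: hip_self s(2) A_def)
    have "hip (k *s a - of_real s *s w) (k *s a - of_real s *s w) = k * cnj k * A - k * of_real s * cnj c - of_real s * cnj k * c + of_real (s\<^sup>2) * hip w w"
      by (simp add: hip_simps cn c_def[symmetric] aA algebra_simps power2_eq_square)
    then show ?thesis unfolding N_def k_def[symmetric] k[symmetric] A_def .
  qed
  also have "\<dots> = 1 - c - cnj c + c * cnj c - of_real (s\<^sup>2) + of_real (s\<^sup>2) * hip w w"
  proof -
    define q where "q = inverse (1 + complex_of_real s)"
    define t where "t = complex_of_real s"
    have q: "q * (1 + t) = 1" using s1 by (simp add: q_def t_def)
    have "(1 - c * q) * (1 - cnj c * q) * (1 - t\<^sup>2) - (1 - c * q) * t * cnj c - t * (1 - cnj c * q) * c = 1 - c - cnj c + c * cnj c - t\<^sup>2"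
      using q by algebra
    then show ?thesis by (simp add: divide_inverse q_def t_def)
  qed
  finally have "hip N N = (1 - c) * cnj (1 - c) - of_real (s\<^sup>2) * (1 - hip w w)" by (simp add: algebra_simps)
  then have "complex_of_real ((norm N)\<^sup>2) = of_real ((norm (1 - c))\<^sup>2 - s\<^sup>2 * (1 - (norm w)\<^sup>2))"
    unfolding hip_self complex_norm_square[symmetric] by simp
  then have N: "(norm N)\<^sup>2 = (norm (1 - c))\<^sup>2 - s\<^sup>2 * (1 - (norm w)\<^sup>2)" using of_real_eq_iff by blast
  have "ball_aut a w = inverse (1 - c) *s N" by (simp add: ball_aut_def N_def c_def s_def)
  then have "(norm (ball_aut a w))\<^sup>2 = (norm N)\<^sup>2 / (norm (1 - c))\<^sup>2"
    by (simp add: norm_cscale norm_inverse norm_divide power_mult_distrib power_inverse power_divide divide_inverse mult.commute)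
  moreover have "norm (1 - c) \<noteq> 0" using hip_ne1[OF a, of w] w by (simp add: c_def)
  ultimately have "1 - (norm (ball_aut a w))\<^sup>2 = s\<^sup>2 * (1 - (norm w)\<^sup>2) / (norm (1 - c))\<^sup>2"
    unfolding N by (simp add: field_simps)
  moreover have "1 - (norm a)\<^sup>2 = s\<^sup>2" using s by simp
  ultimately show ?thesis by (simp add: c_def)
qed

lemma ball_aut_ball: "norm a < 1 \<Longrightarrow> norm w < 1 \<Longrightarrow> norm (ball_aut a w) < 1"
proof -
  assume a: "norm a < 1" "norm w < 1"
  have "1 - (norm (ball_aut a w))\<^sup>2 > 0" unfolding ball_aut_norm[OF a]
    using a hip_ne1[OF a(1), of w] by (auto intro!: divide_pos_pos mult_pos_pos simp: power_less_one_iff abs_square_less_1)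
  then show ?thesis by (simp add: abs_square_less_1)
qed

lemma ball_aut_self: "norm a < 1 \<Longrightarrow> ball_aut a a = 0"
proof -
  assume a: "norm a < 1"
  define s where "s = complex_of_real (bsq a)"
  note sp = bsq_complex[OF a, folded s_def]
  have "(1 - hip a a / (1 + s)) = s"
    unfolding sp(3) using sp(2) by (simp add: field_simps power2_eq_square)
  then have "(1 - hip a a / of_real (1 + bsq a)) = of_real (bsq a)" by (simp add: s_def)
  then show ?thesis by (simp add: ball_aut_def)
qed

lemma ball_aut_involution:
  assumes a: "norm a < 1" and w: "norm w < 1" shows "ball_aut a (ball_aut a w) = w"
proof -
  define s where "s = complex_of_real (bsq a)"
  define c where "c = hip w a"
  have s0: "s \<noteq> 0" "1 + s \<noteq> 0" and aa: "hip a a = 1 - s\<^sup>2"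
    using bsq_complex[OF a] by (simp_all add: s_def)
  have c1: "1 - c \<noteq> 0" using hip_ne1[OF a, of w] w by (simp add: c_def)
  have b: "ball_aut a w = inverse (1 - c) *s ((1 - c / (1 + s)) *s a - s *s w)" by (simp add: ball_aut_def c_def s_def)
  define c' where "c' = hip (ball_aut a w) a"
  have "c' = inverse (1 - c) * ((1 - c / (1 + s)) * (1 - s\<^sup>2) - s * c)"
    unfolding c'_def b by (simp only: hip_simps aa c_def)
  also have "(1 - c / (1 + s)) * (1 - s\<^sup>2) - s * c = 1 - s\<^sup>2 - c"
    using s0 by (simp add: field_simps power2_eq_square)
  finally have c': "c' = (1 - s\<^sup>2 - c) / (1 - c)" by (simp add: field_simps)
  have c'1: "1 - c' = s\<^sup>2 / (1 - c)" unfolding c' using c1 by (simp add: field_simps)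
  have k: "(1 - c' / (1 + s)) = s * (1 + s - c) / ((1 + s) * (1 - c))"
  proof -
    (* With names for the reciprocals the identity is polynomial. *)
    define q p where "q = inverse (1 + s)" and "p = inverse (1 - c)"
    have qp: "q * (1 + s) = 1" "p * (1 - c) = 1" using s0 c1 by (simp_all add: q_def p_def)
    have "1 - (1 - s\<^sup>2 - c) * p * q = s * (1 + s - c) * (q * p)" using qp by algebra
    then show ?thesis unfolding c' by (simp add: q_def p_def divide_inverse)
  qed
  have k2: "(1 - c / (1 + s)) = (1 + s - c) / (1 + s)" using s0 by (simp add: field_simps)
  have "ball_aut a (ball_aut a w) = inverse (1 - c') *s ((1 - c' / (1 + s)) *s a - s *s ball_aut a w)"
    by (simp add: ball_aut_def[of a "ball_aut a w"] c'_def s_def)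
  also have "\<dots> = w"
  proof -
    have "inverse (s\<^sup>2 / (1 - c)) * (s * (1 + s - c) / ((1 + s) * (1 - c)) * x - s * (inverse (1 - c) * ((1 + s - c) / (1 + s) * x - s * y))) = y" for x y
    proof -
      define q p r where "q = inverse (1 + s)" and "p = inverse (1 - c)" and "r = inverse s"
      have qp: "q * (1 + s) = 1" "p * (1 - c) = 1" "r * s = 1" using s0 c1 by (simp_all add: q_def p_def r_def)
      have "r * r * (1 - c) * (s * (1 + s - c) * (q * p) * x - s * (p * ((1 + s - c) * q * x - s * y))) = y" using qp by algebra
      moreover have e: "inverse (s\<^sup>2 / (1 - c)) = r * r * (1 - c)" by (simp add: r_def power2_eq_square divide_inverse)
      ultimately show ?thesis unfolding e by (simp add: q_def p_def divide_inverse)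
    qed
    then show ?thesis unfolding c'1 k b k2
      by (simp only: vec_eq_iff vector_smult_component vector_minus_component) blast
  qed
  finally show ?thesis .
qed

lemma ball_aut_holomorphic: assumes a: "norm a < 1" shows "holomorphic_map_on (ball_aut a) (ball 0 1)"
proof (rule holomorphic_map_from_components)
  fix i
  have h: "chol (\<lambda>w. hip w a) (ball 0 1)" unfolding hip_def by (intro chol_sum chol_mult chol_const chol_component)
  show "chol (\<lambda>w. ball_aut a w $ i) (ball 0 1)"
    unfolding ball_aut_def vector_smult_component vector_minus_component divide_inverse
    by (intro chol_mult chol_diff chol_inverse chol_const chol_component h) (use hip_ne1[OF a] in auto)
qed

text \<open>At \<open>a\<close> the numerator of the automorphism vanishes, so the derivative is that of the numerator divided by \<open>1 - |a|\<^sup>2\<close>, a multiple of the identity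
plus a matrix of rank one. The value is the density of the invariant volume of the ball, which explains the weight \<open>n + 1\<close> in \<open>logvol\<close>.\<close>

lemma ball_aut_Jac: 
  fixes a :: "complex^'n"
  assumes a: "norm a < 1" shows "(norm (Jac (ball_aut a) a))\<^sup>2 = 1 / (1 - (norm a)\<^sup>2) ^ Suc CARD('n)"
proof -
  define s where "s = complex_of_real (bsq a)"
  have s0: "s \<noteq> 0" "1 + s \<noteq> 0" and aa: "hip a a = 1 - s\<^sup>2" and s2: "norm s ^ 2 = 1 - (norm a)\<^sup>2"
    using bsq_complex[OF a] bsq[OF a] by (simp_all add: s_def)
  define Nf where "Nf w = (1 - hip w a / (1 + s)) *s a - s *s w" for w
  have N0: "Nf a = 0" unfolding Nf_def aa using s0 by (simp add: vec_eq_iff field_simps power2_eq_square)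
  define D where "D v = inverse (s\<^sup>2) *s (- (hip v a / (1 + s)) *s a - s *s v)" for v
  have aB: "a \<in> ball 0 1" using a by simp
  have "dird v (ball_aut a) a = D v" for v
  proof -
    have ch: "chol (\<lambda>w. hip w a) UNIV" unfolding hip_def by (intro chol_sum chol_mult chol_const chol_component)
    have hd: "((\<lambda>w. hip w a) has_derivative (\<lambda>v. hip v a)) (at a)"
      unfolding hip_def by (intro has_derivative_sum has_derivative_mult_left bounded_linear_imp_has_derivative bounded_linear_vec_nth)
    have inv: "((\<lambda>w. inverse (1 - hip w a)) has_derivative (\<lambda>v. - (inverse (1 - hip a a) * (0 - hip v a) * inverse (1 - hip a a)))) (at a)"
      by (intro Deriv.has_derivative_inverse has_derivative_diff has_derivative_const hd) (use hip_ne1[OF a, of a] a in auto)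
    have "dird v (ball_aut a) a $ i = D v $ i" for i
    proof -
      have Nd: "((\<lambda>w. Nf w $ i) has_derivative (\<lambda>v. (0 - hip v a * inverse (1 + s)) * a $ i - s * v $ i)) (at a)"
        unfolding Nf_def vector_smult_component vector_minus_component divide_inverse
        by (intro has_derivative_diff has_derivative_mult_left has_derivative_mult_right has_derivative_const hd bounded_linear_imp_has_derivative bounded_linear_vec_nth)
      have "((\<lambda>w. inverse (1 - hip w a) * Nf w $ i) has_derivative (\<lambda>v. inverse (1 - hip a a) * ((0 - hip v a * inverse (1 + s)) * a $ i - s * v $ i) +
         - (inverse (1 - hip a a) * (0 - hip v a) * inverse (1 - hip a a)) * Nf a $ i)) (at a)"
        by (rule has_derivative_mult[OF inv Nd])
      moreover have "(\<lambda>w. inverse (1 - hip w a) * Nf w $ i) = (\<lambda>w. ball_aut a w $ i)" by (simp only: ball_aut_def Nf_def s_def vector_smult_component vector_minus_component of_real_add of_real_1)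
      ultimately have "dird v (\<lambda>w. ball_aut a w $ i) a = inverse (1 - hip a a) * ((0 - hip v a * inverse (1 + s)) * a $ i - s * v $ i)"
        using dird_eqI[of "\<lambda>w. ball_aut a w $ i"] N0 by simp
      also have "\<dots> = D v $ i" unfolding D_def aa by (simp add: divide_inverse algebra_simps)
      finally show ?thesis using dird_component[OF ball_aut_holomorphic[OF a] aB] by simp
    qed
    then show ?thesis by (simp add: vec_eq_iff)
  qed
  then have J: "Jac (ball_aut a) a = det (matrix D)" by (simp add: Jac_def)
  let ?k = "- inverse s"
  have "matrix D = (\<chi> i. ?k *s (\<chi> j. (if i = j then 1 else 0) + (inverse (s * (1 + s)) *s a) $ i * (\<chi> j. cnj (a $ j)) $ j))"
  proof -
    have axis_nth_if: "axis j (1::complex) $ i = (if i = j then 1 else 0)" for i j :: 'n by (simp add: axis_def)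
    have "hip (axis j 1) a = cnj (a $ j)" for j
      by (simp add: hip_def axis_def if_distrib[of "\<lambda>x. x * _"] cong: if_cong)
    moreover have "inverse (s\<^sup>2) * (- (x / (1 + s)) * y - s * d) = - inverse s * (d + inverse (s * (1 + s)) * y * x)" for x y d
    proof -
      define q p where "q = inverse s" and "p = inverse (1 + s)"
      have "q * s = 1" using s0 by (simp add: q_def)
      then have "q * q * (- (x * p) * y - s * d) = - q * (d + q * p * y * x)" by algebra
      then show ?thesis by (simp add: q_def p_def divide_inverse power2_eq_square)
    qed
    ultimately show ?thesis unfolding matrix_def D_def vec_eq_iff
      by (simp only: vec_lambda_beta vector_smult_component vector_minus_component vector_uminus_component axis_nth_if) simp
  qed
  then have "det (matrix D) = (\<Prod>i\<in>(UNIV::'n set). ?k) * det (\<chi> i j. (if i = j then 1 else 0) + (inverse (s * (1 + s)) *s a) $ i * (\<chi> j. cnj (a $ j)) $ j)"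
    using det_rows_mul[of "\<lambda>i. ?k" "\<lambda>i. (\<chi> j. (if i = j then 1 else 0) + (inverse (s * (1 + s)) *s a) $ i * (\<chi> j. cnj (a $ j)) $ j)"] by simp
  also have "det (\<chi> i j. (if i = j then 1 else 0) + (inverse (s * (1 + s)) *s a) $ i * (\<chi> j. cnj (a $ j)) $ j) = 1 + inverse (s * (1 + s)) * hip a a"
    unfolding det_identity_plus_rank_one by (simp add: hip_def sum_distrib_left mult.assoc)
  also have "\<dots> = inverse s"
  proof -
    define q p where "q = inverse s" and "p = inverse (1 + s)"
    have "q * s = 1" "p * (1 + s) = 1" using s0 by (simp_all add: q_def p_def)
    then have "1 + q * p * (1 - s\<^sup>2) = q" by algebra
    then show ?thesis by (simp add: aa q_def p_def)
  qed
  finally have "norm (Jac (ball_aut a) a) = inverse (norm s) ^ Suc CARD('n)"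
    unfolding J by (simp add: norm_mult norm_power norm_inverse)
  then have "(norm (Jac (ball_aut a) a))\<^sup>2 = inverse ((norm s)\<^sup>2) ^ Suc CARD('n)" by (metis power_mult mult.commute power_inverse)
  then show ?thesis unfolding s2 by (simp add: divide_inverse power_inverse)
qed

section \<open>Comparing the Bergman potentials of two embeddings\<close>

text \<open>For small \<open>\<tau>\<close> these are the embeddings that witness a value of the squeezing function near 1, except that the point sent to the
origin is not recorded: the same embedding is used at many points.\<close>

definition wide :: "(complex^'n) set \<Rightarrow> real \<Rightarrow> (complex^'n \<Rightarrow> complex^'n) \<Rightarrow> bool" where
  "wide \<Omega> \<tau> f \<longleftrightarrow> holomorphic_embedding_on f \<Omega> \<and> f ` \<Omega> \<subseteq> ball 0 1 \<and> ball 0 (1 - \<tau>) \<subseteq> f ` \<Omega>"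

text \<open>The logarithm of the density of the invariant volume of the ball pulled back along \<open>f\<close>, a potential of the pulled back Bergman metric.
The first summand is pluriharmonic, but it is needed for comparing different embeddings.\<close>

definition logvol :: "(complex^'n \<Rightarrow> complex^'n) \<Rightarrow> complex^'n \<Rightarrow> real" where
  "logvol f z = ln ((norm (Jac f z))\<^sup>2) - real (Suc CARD('n)) * ln (1 - (norm (f z))\<^sup>2)"

lemma wide_mono: "wide \<Omega> \<tau> f \<Longrightarrow> \<tau> \<le> \<sigma> \<Longrightarrow> wide \<Omega> \<sigma> f"
  unfolding wide_def by (meson diff_left_mono order_trans subset_ball)

lemma wide_norm: "wide \<Omega> \<tau> f \<Longrightarrow> z \<in> \<Omega> \<Longrightarrow> norm (f z) < 1"
  unfolding wide_def by auto

lemma wide_inv: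
  assumes "wide \<Omega> \<tau> f" "norm w < 1 - \<tau>"
  shows "inv_into \<Omega> f w \<in> \<Omega>" "f (inv_into \<Omega> f w) = w"
proof -
  have "w \<in> f ` \<Omega>" using assms unfolding wide_def by (auto simp: subset_iff)
  then show "inv_into \<Omega> f w \<in> \<Omega>" "f (inv_into \<Omega> f w) = w" by (auto intro: inv_into_into f_inv_into_f)
qed

lemma wide_inv_holomorphic:
  fixes f :: "complex^'n \<Rightarrow> complex^'n"
  assumes "wide \<Omega> \<tau> f" "open \<Omega>"
  shows "holomorphic_map_on (inv_into \<Omega> f) (ball 0 (1 - \<tau>))"
  using holomorphic_map_subset[OF embedding_inverse_holomorphic] assms unfolding wide_def by metis

lemma wide_holomorphic: 
  fixes f :: "complex^'n \<Rightarrow> complex^'n"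
  shows "wide \<Omega> \<tau> f \<Longrightarrow> open \<Omega> \<Longrightarrow> holomorphic_map_on f \<Omega>"
  using embedding_props(1) unfolding wide_def by metis

lemma wide_inv_f: 
  fixes f :: "complex^'n \<Rightarrow> complex^'n"
  shows "wide \<Omega> \<tau> f \<Longrightarrow> open \<Omega> \<Longrightarrow> z \<in> \<Omega> \<Longrightarrow> inv_into \<Omega> f (f z) = z"
  using embedding_props(2) inv_into_f_f unfolding wide_def by metis

text \<open>Move the images of \<open>z\<close> under both embeddings to the origin by automorphisms of the ball. The resulting map is defined
on the ball of radius \<open>1 - 6 \<tau>\<close>, takes values in the unit ball, and the square of its Jacobian determinant at the origin is
\<open>exp (logvol f2 z - logvol f1 z)\<close>. The Schwarz lemma bounds it.\<close>

lemma logvol_le: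
  fixes f1 f2 :: "complex^'n \<Rightarrow> complex^'n"
  assumes op: "open \<Omega>" and f1: "wide \<Omega> \<tau> f1" and f2: "wide \<Omega> \<sigma> f2" and \<tau>: "0 \<le> \<tau>" "6 * \<tau> < 1"
    and z: "z \<in> \<Omega>" "norm (f1 z) \<le> 1/2"
  shows "logvol f2 z - logvol f1 z \<le> - 2 * real CARD('n) * ln (1 - 6 * \<tau>)"
proof -
  define a1 a2 where "a1 = f1 z" and "a2 = f2 z"
  have a: "norm a1 < 1" "norm a2 < 1" using wide_norm[OF f1 z(1)] wide_norm[OF f2 z(1)] by (auto simp: a1_def a2_def)
  note h1 = wide_holomorphic[OF f1 op] note h2 = wide_holomorphic[OF f2 op]
  (* As |a1| <= 1/2, the automorphism maps the ball of radius 1 - 6 \<tau> into the ball on which the inverse of f1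
     is defined: 1 - |.|^2 is multiplied by at least (3/4) / (3/2)^2 = 1/3. *)
  have img: "norm (ball_aut a1 v) < 1 - \<tau>" if v: "norm v < 1 - 6 * \<tau>" for v
  proof -
    have v1: "norm v < 1" using v \<tau> by simp
    have "norm (1 - hip v a1) \<le> 1 + norm (hip v a1)" using norm_triangle_ineq4[of 1 "hip v a1"] by simp
    also have "norm (hip v a1) \<le> norm v * norm a1" by (rule hip_norm)
    also have "\<dots> \<le> 1 * (1/2)" using v1 z by (intro mult_mono) (auto simp: a1_def)
    finally have "norm (1 - hip v a1) \<le> 3/2" by simp
    then have d: "(norm (1 - hip v a1))\<^sup>2 \<le> 9/4" using power_mono[of "norm (1 - hip v a1)" "3/2" 2] by (simp add: power2_eq_square)
    have d0: "(norm (1 - hip v a1))\<^sup>2 > 0" using hip_ne1[OF a(1), of v] v1 by simp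
    have "(norm a1)\<^sup>2 \<le> (1/2)\<^sup>2" using z by (intro power_mono) (auto simp: a1_def)
    then have e: "1 - (norm a1)\<^sup>2 \<ge> 3/4" by (simp add: power2_eq_square)
    have "(norm v)\<^sup>2 \<le> norm v" using v1 by (simp add: power2_eq_square mult_left_le_one_le)
    then have f: "1 - (norm v)\<^sup>2 > 6 * \<tau>" using v by linarith
    have "2 * \<tau> * (norm (1 - hip v a1))\<^sup>2 \<le> 2 * \<tau> * (9/4)" using d \<tau> by (intro mult_left_mono) auto
    also have "\<dots> = 3/4 * (6 * \<tau>)" by simp
    also have "\<dots> < 3/4 * (1 - (norm v)\<^sup>2)" using f by simp
    also have "\<dots> \<le> (1 - (norm a1)\<^sup>2) * (1 - (norm v)\<^sup>2)" using e f \<tau> by (intro mult_right_mono) auto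
    finally have "2 * \<tau> < 1 - (norm (ball_aut a1 v))\<^sup>2" unfolding ball_aut_norm[OF a(1) v1] using d0 by (simp add: pos_less_divide_eq)
    moreover have "(1 - \<tau>)\<^sup>2 = 1 - 2 * \<tau> + \<tau>\<^sup>2" by (simp add: power2_diff)
    ultimately have "(norm (ball_aut a1 v))\<^sup>2 < (1 - \<tau>)\<^sup>2" using zero_le_power2[of \<tau>] by linarith
    moreover have "0 \<le> 1 - \<tau>" using \<tau> by simp
    ultimately show ?thesis by (rule power2_less_imp_less)
  qed
  define R where "R = 1 - 6 * \<tau>"
  have R: "R > 0" "R \<le> 1" using \<tau> by (auto simp: R_def)
  define g where "g = inv_into \<Omega> f1"
  have b1: "holomorphic_map_on (ball_aut a1) (ball 0 R)" by (rule holomorphic_map_subset[OF ball_aut_holomorphic[OF a(1)]]) (use R in auto)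
  have b1i: "ball_aut a1 ` ball 0 R \<subseteq> ball 0 (1 - \<tau>)" using img by (auto simp: R_def)
  have gi: "g ` ball 0 (1 - \<tau>) \<subseteq> \<Omega>" using wide_inv[OF f1] by (auto simp: g_def)
  have gh: "holomorphic_map_on g (ball 0 (1 - \<tau>))" unfolding g_def by (rule wide_inv_holomorphic[OF f1 op])
  have m1: "holomorphic_map_on (\<lambda>v. g (ball_aut a1 v)) (ball 0 R)" by (rule holomorphic_map_compose[OF gh b1 b1i])
  have m1i: "(\<lambda>v. g (ball_aut a1 v)) ` ball 0 R \<subseteq> \<Omega>" using b1i gi by blast
  have m2: "holomorphic_map_on (\<lambda>v. f2 (g (ball_aut a1 v))) (ball 0 R)" by (rule holomorphic_map_compose[OF h2 m1 m1i])
  have m2i: "(\<lambda>v. f2 (g (ball_aut a1 v))) ` ball 0 R \<subseteq> ball 0 1" using m1i wide_norm[OF f2] by auto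
  define T where "T v = ball_aut a2 (f2 (g (ball_aut a1 v)))" for v
  have T: "holomorphic_map_on T (ball 0 R)" unfolding T_def by (rule holomorphic_map_compose[OF ball_aut_holomorphic[OF a(2)] m2 m2i])
  have "norm (T v) \<le> 1" if "v \<in> ball 0 R" for v
    using ball_aut_ball[OF a(2), of "f2 (g (ball_aut a1 v))"] m2i that unfolding T_def by fastforce
  from Cauchy_estimate_map[OF T R(1) this] have "norm (dird v T 0) \<le> 1 / R * norm v" for v .
  then have J: "norm (Jac T 0) \<le> (1 / R) ^ CARD('n)" by (intro Jac_bound[OF T]) (use R in auto)
  have z0: "ball_aut a1 0 = a1" using ball_aut_involution[OF a(1) a(1)] ball_aut_self[OF a(1)] by simp
  have ga: "g a1 = z" unfolding g_def a1_def by (rule wide_inv_f[OF f1 op z(1)])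
  have 0: "(0::complex^'n) \<in> ball 0 R" using R by simp
  have a1t: "a1 \<in> ball 0 (1 - \<tau>)" using b1i 0 z0 image_subset_iff by metis
  have "Jac T 0 = Jac (ball_aut a2) (f2 (g (ball_aut a1 0))) * Jac (\<lambda>v. f2 (g (ball_aut a1 v))) 0"
    unfolding T_def by (rule Jac_compose[OF ball_aut_holomorphic[OF a(2)] m2 0]) (use m2i 0 in blast)
  also have "Jac (\<lambda>v. f2 (g (ball_aut a1 v))) 0 = Jac f2 (g (ball_aut a1 0)) * Jac (\<lambda>v. g (ball_aut a1 v)) 0"
    by (rule Jac_compose[OF h2 m1 0]) (use m1i 0 in blast)
  also have "Jac (\<lambda>v. g (ball_aut a1 v)) 0 = Jac g (ball_aut a1 0) * Jac (ball_aut a1) 0"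
    by (rule Jac_compose[OF gh b1 0]) (use b1i 0 in blast)
  finally have JT: "Jac T 0 = Jac (ball_aut a2) a2 * (Jac f2 z * (Jac g a1 * Jac (ball_aut a1) 0))"
    by (simp add: z0 ga a2_def)
  have g1: "Jac g a1 * Jac f1 z = 1"
  proof -
    have "Jac (\<lambda>z. g (f1 z)) z = Jac g (f1 z) * Jac f1 z"
      by (rule Jac_compose[OF embedding_inverse_holomorphic[OF _ op, of f1, folded g_def] h1 z(1)])
        (use f1 z in \<open>auto simp: wide_def\<close>)
    moreover have "Jac (\<lambda>z. g (f1 z)) z = 1" by (rule Jac_id[OF op z(1)]) (simp add: g_def wide_inv_f[OF f1 op])
    ultimately show ?thesis by (simp add: a1_def)
  qed
  have g2: "Jac (ball_aut a1) 0 * Jac (ball_aut a1) a1 = 1"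
  proof -
    have "Jac (\<lambda>v. ball_aut a1 (ball_aut a1 v)) a1 = Jac (ball_aut a1) (ball_aut a1 a1) * Jac (ball_aut a1) a1"
      by (rule Jac_compose[OF ball_aut_holomorphic[OF a(1)] ball_aut_holomorphic[OF a(1)]]) (use a ball_aut_ball in auto)
    moreover have "Jac (\<lambda>v. ball_aut a1 (ball_aut a1 v)) a1 = 1"
      by (rule Jac_id[of "ball 0 1"]) (use a ball_aut_involution[OF a(1)] in auto)
    ultimately show ?thesis by (simp add: ball_aut_self[OF a(1)])
  qed
  have e: "exp (logvol f z) = (norm (Jac (ball_aut (f z)) (f z)))\<^sup>2 * (norm (Jac f z))\<^sup>2" if "wide \<Omega> s f" for f s
  proof -
    have nz: "Jac f z \<noteq> 0" using that embedding_Jac_nonzero[OF _ op z(1)] unfolding wide_def by blast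
    have l: "0 < 1 - (norm (f z))\<^sup>2" using wide_norm[OF that z(1)] by (simp add: abs_square_less_1)
    have "exp (logvol f z) = (norm (Jac f z))\<^sup>2 / (1 - (norm (f z))\<^sup>2) ^ Suc CARD('n)"
      unfolding logvol_def using nz l by (simp add: exp_diff exp_of_nat_mult del: of_nat_Suc power_Suc)
    then show ?thesis unfolding ball_aut_Jac[OF wide_norm[OF that z(1)]] by simp
  qed
  have "exp (logvol f2 z) = (norm (Jac T 0))\<^sup>2 * exp (logvol f1 z)"
  proof -
    have "Jac T 0 * (Jac (ball_aut a1) a1 * Jac f1 z) = Jac (ball_aut a2) a2 * Jac f2 z * (Jac g a1 * Jac f1 z) * (Jac (ball_aut a1) 0 * Jac (ball_aut a1) a1)"
      unfolding JT by (simp add: mult_ac)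
    then have "Jac T 0 * (Jac (ball_aut a1) a1 * Jac f1 z) = Jac (ball_aut a2) a2 * Jac f2 z" unfolding g1 g2 by simp
    then have "(norm (Jac (ball_aut a2) a2))\<^sup>2 * (norm (Jac f2 z))\<^sup>2 = (norm (Jac T 0))\<^sup>2 * ((norm (Jac (ball_aut a1) a1))\<^sup>2 * (norm (Jac f1 z))\<^sup>2)"
      by (metis norm_mult power_mult_distrib)
    then show ?thesis unfolding e[OF f1] e[OF f2] by (simp add: a1_def a2_def)
  qed
  then have "exp (logvol f2 z - logvol f1 z) = (norm (Jac T 0))\<^sup>2" by (simp add: exp_diff)
  also have "\<dots> \<le> ((1 / R) ^ CARD('n))\<^sup>2" by (intro power_mono J) simp
  also have "\<dots> = exp (- 2 * real CARD('n) * ln R)"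
  proof -
    have "exp (real (2 * CARD('n)) * ln R) = R ^ (2 * CARD('n))"
      unfolding exp_of_nat_mult using R by simp
    moreover have "- 2 * real CARD('n) * ln R = - (real (2 * CARD('n)) * ln R)" by simp
    moreover have "((1 / R) ^ CARD('n))\<^sup>2 = inverse (R ^ (2 * CARD('n)))"
      by (simp add: power_mult[symmetric] mult.commute divide_inverse power_inverse)
    ultimately show ?thesis by (simp only: exp_minus)
  qed
  finally show ?thesis by (simp add: R_def)
qed

section \<open>Logarithm, reciprocal and a bump function\<close>

lemma CB_inverse: "a > 0 \<Longrightarrow> \<exists>M\<ge>0. CB k M (inverse :: real \<Rightarrow> real) {a<..}"
proof (induction k)
  case 0
  have "norm (inverse x) \<le> inverse a" if "x \<in> {a<..}" for x using that 0 by (simp add: le_imp_inverse_le)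
  then show ?case using 0 by (intro exI[of _ "inverse a"]) simp
next
  case (Suc k)
  then obtain M where M: "M \<ge> 0" "CB k M (inverse :: real \<Rightarrow> real) {a<..}" by blast
  define N where "N = inverse a + 2 ^ k * (2 ^ k * (M * M))"
  have N: "N \<ge> 0" using M Suc.prems by (simp add: N_def)
  have "CB (Suc k) N (inverse :: real \<Rightarrow> real) {a<..}"
  proof (rule CB_SucI[where f' = "\<lambda>x v. - (inverse x * v * inverse x)"])
    fix x assume x: "x \<in> {a<..}"
    have "norm (inverse x) \<le> inverse a" using x Suc.prems by (simp add: le_imp_inverse_le)
    then show "norm (inverse x) \<le> N" using M by (simp add: N_def add_increasing2)
    show "(inverse has_derivative (\<lambda>v. - (inverse x * v * inverse x))) (at x)"
      using x Suc.prems has_derivative_inverse'[of x UNIV] by simp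
  next
    fix v
    have "CB k (2 ^ k * (norm v * (2 ^ k * (M * M)))) (\<lambda>x. v * (inverse x * inverse x)) {a<..}"
      using M by (intro CB_mult CB_const) auto
    from CB_minus[OF _ this] have "CB k (2 ^ k * (norm v * (2 ^ k * (M * M)))) (\<lambda>x. - (inverse x * v * inverse x)) {a<..}"
      by (simp add: mult_ac)
    then show "CB k (N * norm v) (\<lambda>x. - (inverse x * v * inverse x)) {a<..}"
      by (rule CB_mono) (use Suc.prems in \<open>auto simp: N_def algebra_simps\<close>)
  qed simp
  then show ?case using N by blast
qed

lemma CB_ln: assumes "0 < a" shows "\<exists>M\<ge>0. CB k M (ln :: real \<Rightarrow> real) {a<..<b}"
proof -
  obtain M where M: "M \<ge> 0" "CB k M (inverse :: real \<Rightarrow> real) {a<..}" using CB_inverse[OF assms] by blast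
  define N where "N = \<bar>ln a\<bar> + \<bar>ln b\<bar> + 2 ^ k * M"
  have "CB (Suc k) N (ln :: real \<Rightarrow> real) {a<..<b}"
  proof (rule CB_SucI[where f' = "\<lambda>x v. v * inverse x"])
    fix x assume x: "x \<in> {a<..<b}"
    have "ln a \<le> ln x" "ln x \<le> ln b" using x assms by auto
    then have "norm (ln x) \<le> \<bar>ln a\<bar> + \<bar>ln b\<bar>" by auto
    then show "norm (ln x) \<le> N" using M by (simp add: N_def add_increasing2)
    have "(ln has_field_derivative inverse x) (at x)" using x assms by (intro DERIV_ln) auto
    then show "(ln has_derivative (\<lambda>v. v * inverse x)) (at x)" 
      by (simp add: has_field_derivative_def mult.commute[of _ "inverse x"])
  next
    fix v
    have "CB k (2 ^ k * (norm v * M)) (\<lambda>x. v * inverse x) {a<..<b}"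
      using M by (intro CB_mult CB_const CB_mono[OF M(2)]) auto
    then show "CB k (N * norm v) (\<lambda>x. v * inverse x) {a<..<b}"
      by (rule CB_mono) (auto simp: N_def algebra_simps)
  qed simp
  then have "CB k N (ln :: real \<Rightarrow> real) {a<..<b}" by (rule CB_Suc_le)
  moreover have "N \<ge> 0" using M by (simp add: N_def)
  ultimately show ?thesis by blast
qed

lemma lsm_inverse: "lsm (inverse :: real \<Rightarrow> real) {0<..}"
  unfolding lsm_def
proof (intro conjI allI ballI)
  fix k and x :: real assume x: "x \<in> {0<..}"
  then obtain M where "CB k M (inverse :: real \<Rightarrow> real) {x/2<..}" using CB_inverse[of "x/2" k] by auto
  then have "CB k M (inverse :: real \<Rightarrow> real) (ball x (x/2))" by (rule CB_mono) (auto simp: ball_eq_greaterThanLessThan)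
  then show "\<exists>r>0. \<exists>M. ball x r \<subseteq> {0<..} \<and> CB k M inverse (ball x r)"
    using x by (intro exI[of _ "x/2"] conjI exI[of _ M]) (auto simp: ball_eq_greaterThanLessThan)
qed simp

lemma lsm_ln: "lsm (ln :: real \<Rightarrow> real) {0<..}"
  unfolding lsm_def
proof (intro conjI allI ballI)
  fix k and x :: real assume x: "x \<in> {0<..}"
  then obtain M where "CB k M (ln :: real \<Rightarrow> real) {x/2<..<2*x}" using CB_ln[of "x/2" k "2*x"] by auto
  then have "CB k M (ln :: real \<Rightarrow> real) (ball x (x/2))" by (rule CB_mono) (auto simp: ball_eq_greaterThanLessThan)
  then show "\<exists>r>0. \<exists>M. ball x r \<subseteq> {0<..} \<and> CB k M ln (ball x r)"
    using x by (intro exI[of _ "x/2"] conjI exI[of _ M]) (auto simp: ball_eq_greaterThanLessThan)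
qed simp

text \<open>For \<open>m = 0\<close> this is the standard smooth function that is positive exactly on the positive axis; the other members of the family express
its derivatives (\<open>flat_deriv\<close>).\<close>

definition flat :: "nat \<Rightarrow> real \<Rightarrow> real" where
  "flat m x = (if x \<le> 0 then 0 else inverse x ^ m * exp (- inverse x))"

lemma flat_tendsto: "(flat m \<longlongrightarrow> 0) (at 0)"
proof -
  have "((\<lambda>x. inverse x ^ m / exp (inverse x)) \<longlongrightarrow> (0::real)) (at_right 0)"
    using filterlim_compose[OF tendsto_power_div_exp_0[of m] filterlim_inverse_at_top_right] .
  moreover have "\<forall>\<^sub>F x in at_right 0. inverse x ^ m / exp (inverse x) = flat m x"
    using eventually_at_right_less[of 0] by (rule eventually_mono) (simp add: flat_def exp_minus divide_inverse)
  ultimately have 1: "(flat m \<longlongrightarrow> 0) (at_right 0)" using Lim_transform_eventually by blast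
  have "\<forall>\<^sub>F x in at_left 0. 0 = flat m x" 
    by (simp add: eventually_at_filter flat_def)
  then have 2: "(flat m \<longlongrightarrow> 0) (at_left 0)" using Lim_transform_eventually[OF tendsto_const] by blast
  show ?thesis using 1 2 filterlim_split_at by blast
qed

lemma flat_deriv: "(flat m has_field_derivative flat (m + 2) x - real m * flat (m + 1) x) (at x)"
proof -
  consider "x < 0" | "x = 0" | "x > 0" by linarith
  then show ?thesis
  proof cases
    case 1
    have "((\<lambda>x. 0) has_field_derivative 0) (at x)" by simp
    then have "(flat m has_field_derivative 0) (at x)"
      by (rule has_field_derivative_transform_within_open[of _ _ _ "{..<0}"]) (use 1 in \<open>auto simp: flat_def\<close>)
    then show ?thesis using 1 by (simp add: flat_def)
  next
    case 2
    have "((\<lambda>y. (flat m y - flat m 0) / (y - 0)) \<longlongrightarrow> 0) (at 0)"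
    proof (rule Lim_transform_eventually[OF flat_tendsto[of "Suc m"]])
      show "\<forall>\<^sub>F y in at 0. flat (Suc m) y = (flat m y - flat m 0) / (y - 0)"
        by (auto simp: eventually_at_filter flat_def divide_inverse)
    qed
    then have "(flat m has_field_derivative 0) (at 0)" by (simp add: has_field_derivative_iff)
    then show ?thesis using 2 by (simp add: flat_def)
  next
    case 3
    have "((\<lambda>x. inverse x ^ m * exp (- inverse x)) has_field_derivative flat (m + 2) x - real m * flat (m + 1) x) (at x)"
    proof (cases m)
      case 0
      then show ?thesis using 3 by (auto intro!: derivative_eq_intros simp: flat_def algebra_simps power2_eq_square)
    next
      case (Suc n)
      have "((\<lambda>x. inverse x ^ Suc n) has_field_derivative real (Suc n) * inverse x ^ n * - (inverse x * inverse x)) (at x)"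
        by (rule DERIV_cong, rule DERIV_power, rule DERIV_inverse'[of "\<lambda>x. x"]) (use 3 in \<open>auto simp: mult_ac\<close>)
      moreover have "((\<lambda>x. exp (- inverse x)) has_field_derivative exp (- inverse x) * (inverse x * inverse x)) (at x)"
        using 3 by (auto intro!: derivative_eq_intros)
      ultimately have "((\<lambda>x. inverse x ^ Suc n * exp (- inverse x)) has_field_derivative
        real (Suc n) * inverse x ^ n * - (inverse x * inverse x) * exp (- inverse x) + exp (- inverse x) * (inverse x * inverse x) * inverse x ^ Suc n) (at x)"
        by (rule DERIV_mult)
      then show ?thesis unfolding Suc by (rule DERIV_cong) (use 3 in \<open>simp add: flat_def algebra_simps\<close>)
    qed
    then show ?thesis
      by (rule has_field_derivative_transform_within_open[of _ _ _ "{0<..}"]) (use 3 in \<open>auto simp: flat_def\<close>)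
  qed
qed

lemma CB_flat: "\<exists>M\<ge>0. CB k M (flat m) (ball 0 R)"
proof (induction k arbitrary: m)
  case 0
  have "continuous_on (cball 0 R) (flat m)" 
    by (intro continuous_at_imp_continuous_on ballI DERIV_isCont[OF flat_deriv])
  then have "bounded (flat m ` cball 0 R)" by (intro compact_imp_bounded compact_continuous_image) auto
  then obtain M where "\<forall>y\<in>flat m ` cball 0 R. norm y \<le> M" by (meson bounded_iff)
  then have "\<forall>x\<in>ball 0 R. norm (flat m x) \<le> \<bar>M\<bar>" by (smt (verit) ball_subset_cball image_eqI subsetD)
  then show ?case by (intro exI[of _ "\<bar>M\<bar>"]) auto
next
  case (Suc k)
  obtain M1 M2 M3 where M: "M1 \<ge> 0" "CB k M1 (flat m) (ball 0 R)" "M2 \<ge> 0" "CB k M2 (flat (m+2)) (ball 0 R)" "M3 \<ge> 0" "CB k M3 (flat (m+1)) (ball 0 R)"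
    using Suc.IH by metis
  define C where "C = M2 + 2 ^ k * (real m * M3)"
  have 1: "CB k C (\<lambda>x. flat (m + 2) x - real m * flat (m + 1) x) (ball 0 R)"
    unfolding C_def by (intro CB_diff CB_mult CB_const M) auto
  have C: "C \<ge> 0" using M by (simp add: C_def)
  have "CB (Suc k) (M1 + 2 ^ k * C) (flat m) (ball 0 R)"
  proof (rule CB_SucI[where f' = "\<lambda>x v. v * (flat (m + 2) x - real m * flat (m + 1) x)"])
    fix x :: real assume "x \<in> ball 0 R"
    have "norm (flat m x) \<le> M1" by (rule CB_norm[OF M(2)]) fact
    then show "norm (flat m x) \<le> M1 + 2 ^ k * C" using C by (simp add: add_increasing2)
    show "(flat m has_derivative (\<lambda>v. v * (flat (m + 2) x - real m * flat (m + 1) x))) (at x)"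
      using flat_deriv[of m x] unfolding has_field_derivative_def by (simp add: mult.commute[of _ "_ - _"])
  next
    fix v
    have "CB k (2 ^ k * (norm v * C)) (\<lambda>x. v * (flat (m + 2) x - real m * flat (m + 1) x)) (ball 0 R)"
      by (intro CB_mult CB_const 1) (use C in auto)
    then show "CB k ((M1 + 2 ^ k * C) * norm v) (\<lambda>x. v * (flat (m + 2) x - real m * flat (m + 1) x)) (ball 0 R)"
      by (rule CB_mono) (use M in \<open>auto simp: algebra_simps\<close>)
  qed simp
  then show ?case using M C by (intro exI[of _ "M1 + 2 ^ k * C"]) auto
qed

lemma lsm_flat: "lsm (flat m) UNIV"
  unfolding lsm_def
proof (intro conjI allI ballI)
  fix k and x :: real
  obtain M where "CB k M (flat m) (ball 0 (\<bar>x\<bar> + 1))" using CB_flat by blast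
  then have "CB k M (flat m) (ball x 1)" by (rule CB_mono) (auto simp: dist_real_def)
  then show "\<exists>r>0. \<exists>M. ball x r \<subseteq> UNIV \<and> CB k M (flat m) (ball x r)" by (intro exI[of _ 1]) auto
qed simp

lemma flat_pos: "flat 0 x > 0 \<longleftrightarrow> x > 0" "flat m x \<ge> 0" "flat 0 x = 0 \<longleftrightarrow> x \<le> 0"
  by (auto simp: flat_def)

lemma flat_mono: "x \<le> y \<Longrightarrow> flat 0 x \<le> flat 0 y"
  by (auto simp: flat_def intro: le_imp_inverse_le)

section \<open>Error of the averaged potential in a chart\<close>

text \<open>Applied to \<open>|w|\<^sup>2\<close>, a weight that is positive for \<open>|w| < 1/16\<close> only.\<close>

definition bump :: "real \<Rightarrow> real" where "bump t = flat 0 (1/256 - t)"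

lemma bump_nonneg: "bump t \<ge> 0" and bump_eq_0: "bump t = 0 \<longleftrightarrow> t \<ge> 1/256"
  and bump_antimono: "s \<le> t \<Longrightarrow> bump t \<le> bump s"
  by (auto simp: bump_def flat_pos intro: flat_mono)

lemma bump_pos_near: "bump ((1/32)\<^sup>2) > 0"
  using bump_nonneg[of "(1/32)\<^sup>2"] bump_eq_0[of "(1/32)\<^sup>2"] by (simp add: power2_eq_square less_le)

lemma lsm_bump: "lsm bump UNIV"
  unfolding bump_def by (rule lsm_compose_real[OF lsm_diff[OF lsm_const lsm_id] lsm_flat]) auto

lemma CB_Lipschitz:
  assumes f: "CB (Suc k) M f (ball a r)" and M: "M \<ge> 0" and xy: "x \<in> ball a r" "y \<in> ball a r"
  shows "norm (f x - f y) \<le> M * norm (x - y)"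
proof (rule differentiable_bound[of "ball a r"])
  fix x assume x: "x \<in> ball a r"
  show "(f has_derivative (\<lambda>v. dird v f x)) (at x within ball a r)"
    using CB_has_derivative[OF f x] has_derivative_at_withinI by blast
  show "onorm (\<lambda>v. dird v f x) \<le> M"
    by (rule onorm_bound[OF M]) (rule CB_norm[OF CB_dird[OF f] x])
qed (use xy in auto)

text \<open>Balls of radius \<open>1/2\<close> around points of the ball of radius \<open>3/8\<close> stay in the domain, hence the constant 2.\<close>

lemma transition_Lipschitz:
  fixes T :: "complex^'n \<Rightarrow> complex^'m"
  assumes T: "holomorphic_map_on T (ball 0 (7/8))" "\<And>w. w \<in> ball 0 (7/8) \<Longrightarrow> norm (T w) \<le> 1"
  shows "x \<in> cball 0 (3/8) \<Longrightarrow> norm (dird v T x) \<le> 2 * norm v"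
    and "x \<in> cball 0 (3/8) \<Longrightarrow> y \<in> cball 0 (3/8) \<Longrightarrow> norm (T x - T y) \<le> 2 * norm (x - y)"
proof -
  have sub: "ball x (1/2) \<subseteq> ball 0 (7/8)" if "x \<in> cball 0 (3/8)" for x :: "complex^'n"
  proof
    fix y assume "y \<in> ball x (1/2)"
    then show "y \<in> ball 0 (7/8)" using dist_triangle[of 0 y x] that by simp
  qed
  have d: "norm (dird v T x) \<le> 2 * norm v" if "x \<in> cball 0 (3/8)" for x v
  proof -
    have "norm (dird v T x) \<le> 1 / (1/2) * norm v"
      by (rule Cauchy_estimate_map[OF holomorphic_map_subset[OF T(1) sub[OF that]]]) (use T(2) sub[OF that] in auto)
    then show ?thesis by simp
  qed
  show "norm (dird v T x) \<le> 2 * norm v" if "x \<in> cball 0 (3/8)" using d[OF that] .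
  show "norm (T x - T y) \<le> 2 * norm (x - y)" if "x \<in> cball 0 (3/8)" "y \<in> cball 0 (3/8)"
  proof (rule differentiable_bound[of "cball 0 (3/8)"])
    fix x :: "complex^'n" assume x: "x \<in> cball 0 (3/8)"
    show "(T has_derivative (\<lambda>v. dird v T x)) (at x within cball 0 (3/8))"
      by (rule has_derivative_at_withinI, rule holomorphic_map_has_derivative[OF T(1)]) (use x in auto)
    show "onorm (\<lambda>v. dird v T x) \<le> 2" by (rule onorm_bound) (use d[OF x] in auto)
  qed (use that in auto)
qed

lemma transition_map:
  fixes f1 f2 :: "complex^'n \<Rightarrow> complex^'n"
  assumes op: "open \<Omega>" and f1: "wide \<Omega> \<tau> f1" and f2: "holomorphic_map_on f2 \<Omega>" "f2 ` \<Omega> \<subseteq> ball 0 1" and t: "\<tau> \<le> 1/12"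
  shows "holomorphic_map_on (\<lambda>w. f2 (inv_into \<Omega> f1 w)) (ball 0 (7/8))"
    and "\<And>w. w \<in> ball 0 (7/8) \<Longrightarrow> norm (f2 (inv_into \<Omega> f1 w)) \<le> 1"
    and "\<And>x y. x \<in> cball 0 (3/8) \<Longrightarrow> y \<in> cball 0 (3/8) \<Longrightarrow> norm (f2 (inv_into \<Omega> f1 x) - f2 (inv_into \<Omega> f1 y)) \<le> 2 * norm (x - y)"
proof -
  have i: "inv_into \<Omega> f1 w \<in> \<Omega>" if "w \<in> ball 0 (7/8)" for w
    by (rule wide_inv(1)[OF f1]) (use that t in auto)
  have h: "holomorphic_map_on (inv_into \<Omega> f1) (ball 0 (7/8))"
    by (rule holomorphic_map_subset[OF wide_inv_holomorphic[OF f1 op]]) (use t in auto)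
  show 1: "holomorphic_map_on (\<lambda>w. f2 (inv_into \<Omega> f1 w)) (ball 0 (7/8))"
    by (rule holomorphic_map_compose[OF f2(1) h]) (use i in auto)
  show 2: "norm (f2 (inv_into \<Omega> f1 w)) \<le> 1" if "w \<in> ball 0 (7/8)" for w using f2(2) i[OF that] by auto
  show "norm (f2 (inv_into \<Omega> f1 x) - f2 (inv_into \<Omega> f1 y)) \<le> 2 * norm (x - y)" if "x \<in> cball 0 (3/8)" "y \<in> cball 0 (3/8)" for x y
    using transition_Lipschitz(2)[OF 1 2 that] .
qed

text \<open>In a chart the difference of two log-volumes is expressed by the transition map alone.\<close>

lemma logvol_transition:
  fixes f1 f2 :: "complex^'n \<Rightarrow> complex^'n"
  assumes op: "open \<Omega>" and f1: "wide \<Omega> \<tau> f1" and f2: "wide \<Omega> \<sigma> f2" and t: "\<tau> \<le> 1/12" and w: "w \<in> ball 0 (7/8)"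
  defines "T \<equiv> \<lambda>w. f2 (inv_into \<Omega> f1 w)"
  shows "Jac T w \<noteq> 0" "logvol f2 (inv_into \<Omega> f1 w) - logvol f1 (inv_into \<Omega> f1 w) =
    ln (inner (Jac T w) (Jac T w)) - real (Suc CARD('n)) * ln (1 - inner (T w) (T w)) + real (Suc CARD('n)) * ln (1 - inner w w)"
proof -
  define z where "z = inv_into \<Omega> f1 w"
  have z: "z \<in> \<Omega>" "f1 z = w" using wide_inv[OF f1, of w] w t by (auto simp: z_def)
  have f2i: "f2 ` \<Omega> \<subseteq> ball 0 1" using f2 by (simp add: wide_def)
  have T: "holomorphic_map_on T (ball 0 (7/8))" unfolding T_def
    by (rule transition_map(1)[OF op f1 wide_holomorphic[OF f2 op] f2i t])
  have "Jac (\<lambda>z. T (f1 z)) z = Jac T (f1 z) * Jac f1 z"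
    by (rule Jac_compose[OF T wide_holomorphic[OF f1 op] z(1)]) (use z w in simp)
  moreover have "Jac (\<lambda>z. T (f1 z)) z = Jac f2 z"
    unfolding Jac_def using frechet_derivative_eq_open[OF op z(1), of "\<lambda>z. T (f1 z)" f2] by (simp add: T_def wide_inv_f[OF f1 op])
  ultimately have J: "Jac f2 z = Jac T w * Jac f1 z" using z by simp
  have nz: "Jac f1 z \<noteq> 0" "Jac f2 z \<noteq> 0" using f1 f2 embedding_Jac_nonzero[OF _ op z(1)] unfolding wide_def by blast+
  then show "Jac T w \<noteq> 0" using J by auto
  then have "ln ((norm (Jac f2 z))\<^sup>2) = ln ((norm (Jac T w))\<^sup>2) + ln ((norm (Jac f1 z))\<^sup>2)"
    using nz unfolding J by (simp add: norm_mult power_mult_distrib ln_mult)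
  then show "logvol f2 (inv_into \<Omega> f1 w) - logvol f1 (inv_into \<Omega> f1 w) =
    ln (inner (Jac T w) (Jac T w)) - real (Suc CARD('n)) * ln (1 - inner (T w) (T w)) + real (Suc CARD('n)) * ln (1 - inner w w)"
    unfolding logvol_def z_def[symmetric] by (simp add: T_def z z_def[symmetric] dot_square_norm algebra_simps)
qed

lemma CB_ln_compose:
  assumes "0 < a"
  shows "\<exists>C\<ge>0. \<forall>f (S :: 'a::real_normed_vector set). open S \<longrightarrow> (\<forall>x\<in>S. a < f x \<and> f x < b) \<longrightarrow> CB k M f S \<longrightarrow> CB k C (\<lambda>x. ln (f x) :: real) S"
proof -
  obtain N where N: "CB k N (ln :: real \<Rightarrow> real) {a<..<b}" using CB_ln[OF assms] by blast
  obtain C where C: "C \<ge> 0" "\<forall>g f S T. open S \<longrightarrow> f ` S \<subseteq> T \<longrightarrow> CB k N g (T::real set) \<longrightarrow> CB k M f S \<longrightarrow> CB k C (\<lambda>x. g (f x) :: real) (S :: 'a set)"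
    using CB_compose_real[of k N M] by blast
  have "CB k C (\<lambda>x. ln (f x)) S" if "open S" "\<forall>x\<in>S. a < f x \<and> f x < b" "CB k M f S" for f and S :: "'a set"
    using C(2)[rule_format, OF that(1) _ N that(3)] that(2) by (simp add: image_subset_iff)
  then show ?thesis using C(1) by blast
qed

lemma CB_inverse_compose:
  assumes "0 < a"
  shows "\<exists>C\<ge>0. \<forall>f (S :: 'a::real_normed_vector set). open S \<longrightarrow> (\<forall>x\<in>S. a < f x) \<longrightarrow> CB k M f S \<longrightarrow> CB k C (\<lambda>x. inverse (f x) :: real) S"
proof -
  obtain N where N: "CB k N (inverse :: real \<Rightarrow> real) {a<..}" using CB_inverse[OF assms] by blast
  obtain C where C: "C \<ge> 0" "\<forall>g f S T. open S \<longrightarrow> f ` S \<subseteq> T \<longrightarrow> CB k N g (T::real set) \<longrightarrow> CB k M f S \<longrightarrow> CB k C (\<lambda>x. g (f x) :: real) (S :: 'a set)"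
    using CB_compose_real[of k N M] by blast
  have "CB k C (\<lambda>x. inverse (f x)) S" if "open S" "\<forall>x\<in>S. a < f x" "CB k M f S" for f and S :: "'a set"
    using C(2)[rule_format, OF that(1) _ N that(3)] that(2) by (simp add: image_subset_iff)
  then show ?thesis using C(1) by blast
qed

text \<open>Squared norms are written as inner products, which are polynomial in the coordinates.\<close>

lemma transition_CB:
  "\<exists>M\<ge>0. \<forall>T :: complex^'n \<Rightarrow> complex^'n. holomorphic_map_on T (ball 0 (7/8)) \<longrightarrow> (\<forall>w\<in>ball 0 (7/8). norm (T w) \<le> 1) \<longrightarrow>
     CB k M (\<lambda>w. inner (T w) (T w)) (ball 0 (1/64)) \<and> CB k M (\<lambda>w. inner (Jac T w) (Jac T w)) (ball 0 (1/64))"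
proof -
  obtain C where C: "C \<ge> 1" "\<forall>(f :: complex^'n \<Rightarrow> complex^'n) M. holomorphic_map_on f (ball 0 (7/8)) \<longrightarrow> (\<forall>w\<in>ball 0 (7/8). norm (f w) \<le> M) \<longrightarrow> M \<ge> 0 \<longrightarrow> CB k (C * M) f (ball 0 (1/64))"
    using holomorphic_map_CB[of "1/64" "7/8" 0 k] by auto
  obtain D where D: "D \<ge> 1" "\<forall>(f :: complex^'n \<Rightarrow> complex) M. chol f (ball 0 (3/8)) \<longrightarrow> (\<forall>w\<in>ball 0 (3/8). norm (f w) \<le> M) \<longrightarrow> M \<ge> 0 \<longrightarrow> CB k (D * M) f (ball 0 (1/64))"
    using chol_CB[of "1/64" "3/8" 0 k] by auto
  define E where "E = D * 2 ^ CARD('n)"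
  have E: "E \<ge> 0" using D by (simp add: E_def)
  define M where "M = 2 ^ k * (C * C) + 2 ^ k * (E * E)"
  have "CB k M (\<lambda>w. inner (T w) (T w)) (ball 0 (1/64)) \<and> CB k M (\<lambda>w. inner (Jac T w) (Jac T w)) (ball 0 (1/64))"
    if T: "holomorphic_map_on T (ball 0 (7/8))" "\<forall>w\<in>ball 0 (7/8). norm (T w) \<le> 1" for T :: "complex^'n \<Rightarrow> complex^'n"
  proof
    have "CB k (C * 1) T (ball 0 (1/64))" using C(2)[rule_format, OF T(1), of 1] T(2) by simp
    then have "CB k (2 ^ k * (C * C)) (\<lambda>w. inner (T w) (T w)) (ball 0 (1/64))"
      by (intro CB_inner) (use C in auto)
    then show "CB k M (\<lambda>w. inner (T w) (T w)) (ball 0 (1/64))" by (rule CB_mono) (use E in \<open>auto simp: M_def\<close>)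
    have J: "chol (Jac T) (ball 0 (7/8))" by (rule Jac_chol[OF T(1)]) simp
    have "norm (Jac T w) \<le> 2 ^ CARD('n)" if "w \<in> ball 0 (3/8)" for w
      by (rule Jac_bound[OF T(1)]) (use that transition_Lipschitz(1)[OF T(1)] T(2) in auto)
    moreover have "chol (Jac T) (ball 0 (3/8))" by (rule chol_subset[OF J]) auto
    ultimately have "CB k E (Jac T) (ball 0 (1/64))" using D(2) unfolding E_def by simp
    then have "CB k (2 ^ k * (E * E)) (\<lambda>w. inner (Jac T w) (Jac T w)) (ball 0 (1/64))"
      by (intro CB_inner E) auto
    then show "CB k M (\<lambda>w. inner (Jac T w) (Jac T w)) (ball 0 (1/64))" by (rule CB_mono) (use C in \<open>auto simp: M_def\<close>)
  qed
  moreover have "M \<ge> 0" using C E by (simp add: M_def)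
  ultimately show ?thesis by blast
qed

lemma transition_near:
  fixes f1 f2 :: "complex^'n \<Rightarrow> complex^'n"
  assumes op: "open \<Omega>" and f1: "wide \<Omega> \<tau> f1" and f2: "wide \<Omega> \<sigma> f2" and t: "\<tau> \<le> 1/12"
    and 0: "norm (f2 (inv_into \<Omega> f1 0)) < 1/8" and w: "w \<in> ball 0 (1/64)"
  shows "norm (f2 (inv_into \<Omega> f1 w)) < 1/4"
proof -
  have f2i: "f2 ` \<Omega> \<subseteq> ball 0 1" using f2 by (simp add: wide_def)
  have "norm (f2 (inv_into \<Omega> f1 w) - f2 (inv_into \<Omega> f1 0)) \<le> 2 * norm (w - 0)"
    by (rule transition_map(3)[OF op f1 wide_holomorphic[OF f2 op] f2i t]) (use w in auto)
  then show ?thesis using 0 w norm_triangle_sub[of "f2 (inv_into \<Omega> f1 w)" "f2 (inv_into \<Omega> f1 0)"] by simp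
qed

lemma logvol_difference_le:
  fixes f1 f2 :: "complex^'n \<Rightarrow> complex^'n"
  assumes op: "open \<Omega>" and f1: "wide \<Omega> \<tau> f1" and f2: "wide \<Omega> \<tau> f2" and t: "0 \<le> \<tau>" "\<tau> \<le> 1/12"
    and 0: "norm (f2 (inv_into \<Omega> f1 0)) < 1/8" and w: "w \<in> ball 0 (1/64)"
  shows "\<bar>logvol f2 (inv_into \<Omega> f1 w) - logvol f1 (inv_into \<Omega> f1 w)\<bar> \<le> - 2 * real CARD('n) * ln (1 - 6 * \<tau>)"
proof -
  let ?z = "inv_into \<Omega> f1 w"
  have z: "?z \<in> \<Omega>" "f1 ?z = w" using wide_inv[OF f1, of w] w t by auto
  have "norm (f2 ?z) \<le> 1/2" using transition_near[OF op f1 f2 t(2) 0 w] by simp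
  then have "logvol f1 ?z - logvol f2 ?z \<le> - 2 * real CARD('n) * ln (1 - 6 * \<tau>)"
    by (intro logvol_le[OF op f2 f1]) (use t z in auto)
  moreover have "logvol f2 ?z - logvol f1 ?z \<le> - 2 * real CARD('n) * ln (1 - 6 * \<tau>)"
    by (intro logvol_le[OF op f1 f2]) (use t z w in auto)
  ultimately show ?thesis by linarith
qed

text \<open>The only danger is the logarithm of the Jacobian of the transition map. That Jacobian stays away from \<open>0\<close> because of the two-sided
bound \<open>logvol_difference_le\<close>, here with the fixed value \<open>\<tau> = 1/12\<close>, for which \<open>1 - 6 \<tau> = 1/2\<close>.\<close>

lemma logvol_difference_CB:
  "\<exists>M\<ge>0. \<forall>\<Omega> (f1 :: complex^'n \<Rightarrow> complex^'n) f2. open \<Omega> \<longrightarrow> wide \<Omega> (1/12) f1 \<longrightarrow> wide \<Omega> (1/12) f2 \<longrightarrow> norm (f2 (inv_into \<Omega> f1 0)) < 1/8 \<longrightarrow>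
     CB k M (\<lambda>w. logvol f2 (inv_into \<Omega> f1 w) - logvol f1 (inv_into \<Omega> f1 w)) (ball 0 (1/64))"
proof -
  let ?B = "ball 0 (1/64) :: (complex^'n) set"
  let ?n = "real (Suc CARD('n))"
  obtain M where M: "M \<ge> 0" "\<forall>T :: complex^'n \<Rightarrow> complex^'n. holomorphic_map_on T (ball 0 (7/8)) \<longrightarrow> (\<forall>w\<in>ball 0 (7/8). norm (T w) \<le> 1) \<longrightarrow>
     CB k M (\<lambda>w. inner (T w) (T w)) ?B \<and> CB k M (\<lambda>w. inner (Jac T w) (Jac T w)) ?B"
    using transition_CB by blast
  obtain C1 where C1: "C1 \<ge> 0" "\<forall>f (S :: (complex^'n) set). open S \<longrightarrow> (\<forall>x\<in>S. 1/2 < f x \<and> f x < 2) \<longrightarrow> CB k (1 + M) f S \<longrightarrow> CB k C1 (\<lambda>x. ln (f x) :: real) S"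
    using CB_ln_compose[of "1/2" 2 k "1 + M"] by auto
  define s0 where "s0 = 2 * real CARD('n) * ln 2"
  define a where "a = exp (- s0 + ?n * ln (15/16)) / 2"
  have a: "a > 0" by (simp add: a_def)
  obtain C2 where C2: "C2 \<ge> 0" "\<forall>f (S :: (complex^'n) set). open S \<longrightarrow> (\<forall>x\<in>S. a < f x \<and> f x < M + 1) \<longrightarrow> CB k M f S \<longrightarrow> CB k C2 (\<lambda>x. ln (f x) :: real) S"
    using CB_ln_compose[OF a, of "M + 1" k M] by blast
  obtain C3 where C3: "C3 \<ge> 0" "\<forall>f (S :: (complex^'n) set). open S \<longrightarrow> (\<forall>x\<in>S. 1/2 < f x \<and> f x < 2) \<longrightarrow> CB k (1 + 2 ^ k * (1 * 1)) f S \<longrightarrow> CB k C3 (\<lambda>x. ln (f x) :: real) S"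
    using CB_ln_compose[of "1/2" 2 k "1 + 2 ^ k * (1 * 1)"] by auto
  define N where "N = C2 + 2 ^ k * (?n * C1) + 2 ^ k * (?n * C3)"
  have "CB k N (\<lambda>w. logvol f2 (inv_into \<Omega> f1 w) - logvol f1 (inv_into \<Omega> f1 w)) ?B"
    if op: "open \<Omega>" and f1: "wide \<Omega> (1/12) f1" and f2: "wide \<Omega> (1/12) f2" and 0: "norm (f2 (inv_into \<Omega> f1 0)) < 1/8"
    for \<Omega> and f1 f2 :: "complex^'n \<Rightarrow> complex^'n"
  proof -
    define T where "T w = f2 (inv_into \<Omega> f1 w)" for w
    have f2i: "f2 ` \<Omega> \<subseteq> ball 0 1" using f2 by (simp add: wide_def)
    note tm = transition_map[OF op f1 wide_holomorphic[OF f2 op] f2i]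
    have T: "holomorphic_map_on T (ball 0 (7/8))" "\<forall>w\<in>ball 0 (7/8). norm (T w) \<le> 1" unfolding T_def using tm(1,2) by auto
    have TM: "CB k M (\<lambda>w. inner (T w) (T w)) ?B" "CB k M (\<lambda>w. inner (Jac T w) (Jac T w)) ?B" using M(2) T by blast+
    have small: "inner (T w) (T w) \<le> 1/16" if "w \<in> ?B" for w
    proof -
      have "norm (T w) \<le> 1/4" using transition_near[OF op f1 f2 _ 0 that] by (simp add: T_def)
      then have "(norm (T w))\<^sup>2 \<le> (1/4)\<^sup>2" by (intro power_mono) auto
      then show ?thesis by (simp add: dot_square_norm power2_eq_square)
    qed
    have "CB k (1 + M) (\<lambda>w. 1 - inner (T w) (T w)) ?B" by (intro CB_diff CB_const TM) auto
    moreover have "1/2 < 1 - inner (T w) (T w) \<and> 1 - inner (T w) (T w) < 2" if "w \<in> ?B" for w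
      using small[OF that] inner_ge_zero[of "T w"] by linarith
    ultimately have 1: "CB k C1 (\<lambda>w. ln (1 - inner (T w) (T w))) ?B" using C1(2)[rule_format, of ?B "\<lambda>w. 1 - inner (T w) (T w)"] by simp
    have wsm: "inner w w \<le> 1/16" if "w \<in> ?B" for w :: "complex^'n"
    proof -
      have "norm w \<le> 1/4" using that by simp
      then have "(norm w)\<^sup>2 \<le> (1/4)\<^sup>2" by (intro power_mono) auto
      then show ?thesis by (simp add: dot_square_norm power2_eq_square)
    qed
    have "CB k (1 + 2 ^ k * (1 * 1)) (\<lambda>w. 1 - inner w w) ?B" by (intro CB_diff CB_const CB_inner CB_id) auto
    moreover have "1/2 < 1 - inner w w \<and> 1 - inner w w < 2" if "w \<in> ?B" for w :: "complex^'n"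
      using wsm[OF that] inner_ge_zero[of "w"] by linarith
    ultimately have 3: "CB k C3 (\<lambda>w. ln (1 - inner w w)) ?B" using C3(2)[rule_format, of ?B "\<lambda>w. 1 - inner w w"] by simp
    have "a < inner (Jac T w) (Jac T w) \<and> inner (Jac T w) (Jac T w) < M + 1" if w: "w \<in> ?B" for w
    proof
      have w7: "w \<in> ball 0 (7/8)" using w by simp
      note lt = logvol_transition[OF op f1 f2 _ w7, folded T_def]
      have pos: "inner (Jac T w) (Jac T w) > 0" using lt(1) by simp
      have "\<bar>logvol f2 (inv_into \<Omega> f1 w) - logvol f1 (inv_into \<Omega> f1 w)\<bar> \<le> s0"
        using logvol_difference_le[OF op f1 f2 _ _ 0 w] by (simp add: s0_def ln_div)
      moreover have "ln (1 - inner w w) \<le> 0" using wsm[OF w] inner_ge_zero[of w] by (subst ln_le_zero_iff) auto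
      then have "?n * ln (1 - inner w w) \<le> 0" by (simp add: mult_nonneg_nonpos)
      moreover have "ln (15/16) \<le> ln (1 - inner (T w) (T w))" using small[OF w] by (subst ln_le_cancel_iff) auto
      then have "?n * ln (15/16) \<le> ?n * ln (1 - inner (T w) (T w))" by (intro mult_left_mono) auto
      ultimately have "- s0 + ?n * ln (15/16) \<le> ln (inner (Jac T w) (Jac T w))"
        using lt(2) by linarith
      then have "exp (- s0 + ?n * ln (15/16)) \<le> inner (Jac T w) (Jac T w)" using pos by (metis exp_le_cancel_iff exp_ln)
      moreover have "exp (- s0 + ?n * ln (15/16)) > 0" by simp
      ultimately show "a < inner (Jac T w) (Jac T w)" unfolding a_def by linarith
      show "inner (Jac T w) (Jac T w) < M + 1" using CB_norm[OF TM(2) w] by simp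
    qed
    then have 2: "CB k C2 (\<lambda>w. ln (inner (Jac T w) (Jac T w))) ?B" using C2(2)[rule_format, of ?B "\<lambda>w. inner (Jac T w) (Jac T w)"] TM(2) by simp
    have "CB k N (\<lambda>w. ln (inner (Jac T w) (Jac T w)) - ?n * ln (1 - inner (T w) (T w)) + ?n * ln (1 - inner w w)) ?B"
      unfolding N_def by (intro CB_add CB_diff CB_mult CB_const 1 2 3) (use C1 C2 C3 in auto)
    then show ?thesis
      by (subst CB_cong[of ?B _ "\<lambda>w. ln (inner (Jac T w) (Jac T w)) - ?n * ln (1 - inner (T w) (T w)) + ?n * ln (1 - inner w w)"])
        (use logvol_transition(2)[OF op f1 f2, folded T_def] in auto)
  qed
  moreover have "N \<ge> 0" unfolding N_def using C1 C2 C3 by simp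
  ultimately show ?thesis by blast
qed

text \<open>Interpolation: the supremum norm is small by \<open>logvol_difference_le\<close> for small \<open>\<tau>\<close>, while \<open>logvol_difference_CB\<close> bounds one derivative more than is
needed, uniformly in \<open>\<tau>\<close>.\<close>

lemma logvol_difference_small:
  assumes "\<eta> > 0"
  shows "\<exists>\<tau>>0. \<tau> \<le> 1/12 \<and> (\<forall>\<Omega> (f1 :: complex^'n \<Rightarrow> complex^'n) f2. open \<Omega> \<longrightarrow> wide \<Omega> \<tau> f1 \<longrightarrow> wide \<Omega> \<tau> f2 \<longrightarrow> norm (f2 (inv_into \<Omega> f1 0)) < 1/8 \<longrightarrow>
     CB k \<eta> (\<lambda>w. logvol f2 (inv_into \<Omega> f1 w) - logvol f1 (inv_into \<Omega> f1 w)) (ball 0 (1/128)))"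
proof -
  obtain M where M: "M \<ge> 0" "\<forall>\<Omega> (f1 :: complex^'n \<Rightarrow> complex^'n) f2. open \<Omega> \<longrightarrow> wide \<Omega> (1/12) f1 \<longrightarrow> wide \<Omega> (1/12) f2 \<longrightarrow> norm (f2 (inv_into \<Omega> f1 0)) < 1/8 \<longrightarrow>
     CB (Suc k) M (\<lambda>w. logvol f2 (inv_into \<Omega> f1 w) - logvol f1 (inv_into \<Omega> f1 w)) (ball 0 (1/64))"
    using logvol_difference_CB by blast
  obtain d where d: "d > 0" "\<forall>f::complex^'n\<Rightarrow>real. CB (Suc k) M f (ball 0 (1/64)) \<longrightarrow> (\<forall>x\<in>ball 0 (1/64). \<bar>f x\<bar> \<le> d) \<longrightarrow> CB k \<eta> f (ball 0 (1/128))"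
    using CB_interpolation[OF M(1) assms, of "1/128" "1/64" k 0] by (auto simp del: CB.simps)
  define n where "n = real CARD('n)"
  have n: "n > 0" by (simp add: n_def)
  define \<tau> where "\<tau> = min (1/12) ((1 - exp (- d / (2 * n))) / 6)"
  have \<tau>: "\<tau> > 0" "\<tau> \<le> 1/12" using d n by (auto simp: \<tau>_def)
  have "\<tau> \<le> (1 - exp (- d / (2 * n))) / 6" unfolding \<tau>_def by (rule min.cobounded2)
  then have "6 * \<tau> \<le> 1 - exp (- d / (2 * n))" by simp
  then have "exp (- d / (2 * n)) \<le> 1 - 6 * \<tau>" by simp
  then have "- d / (2 * n) \<le> ln (1 - 6 * \<tau>)" using \<tau> by (subst ln_ge_iff) auto
  then have sm: "- 2 * n * ln (1 - 6 * \<tau>) \<le> d" using n by (simp add: field_simps)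
  have "CB k \<eta> (\<lambda>w. logvol f2 (inv_into \<Omega> f1 w) - logvol f1 (inv_into \<Omega> f1 w)) (ball 0 (1/128))"
    if "open \<Omega>" "wide \<Omega> \<tau> f1" "wide \<Omega> \<tau> f2" "norm (f2 (inv_into \<Omega> f1 0)) < 1/8" for \<Omega> and f1 f2 :: "complex^'n \<Rightarrow> complex^'n"
  proof (rule d(2)[rule_format])
    show "CB (Suc k) M (\<lambda>w. logvol f2 (inv_into \<Omega> f1 w) - logvol f1 (inv_into \<Omega> f1 w)) (ball 0 (1/64))"
      using M(2) that wide_mono[OF _ \<tau>(2)] by blast
    show "\<bar>logvol f2 (inv_into \<Omega> f1 w) - logvol f1 (inv_into \<Omega> f1 w)\<bar> \<le> d" if w: "w \<in> ball 0 (1/64)" for w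
      using logvol_difference_le[OF \<open>open \<Omega>\<close> \<open>wide \<Omega> \<tau> f1\<close> \<open>wide \<Omega> \<tau> f2\<close> _ \<tau>(2) \<open>norm (f2 (inv_into \<Omega> f1 0)) < 1/8\<close> w] \<tau> sm
      by (simp add: n_def)
  qed
  then show ?thesis using \<tau> by blast
qed

lemma bump_transition_CB:
  "\<exists>M\<ge>0. \<forall>T :: complex^'n \<Rightarrow> complex^'n. holomorphic_map_on T (ball 0 (7/8)) \<longrightarrow> (\<forall>w\<in>ball 0 (7/8). norm (T w) \<le> 1) \<longrightarrow>
     CB k M (\<lambda>w. bump ((norm (T w))\<^sup>2)) (ball 0 (1/64))"
proof -
  obtain M where M: "M \<ge> 0" "\<forall>T :: complex^'n \<Rightarrow> complex^'n. holomorphic_map_on T (ball 0 (7/8)) \<longrightarrow> (\<forall>w\<in>ball 0 (7/8). norm (T w) \<le> 1) \<longrightarrow>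
     CB k M (\<lambda>w. inner (T w) (T w)) (ball 0 (1/64)) \<and> CB k M (\<lambda>w. inner (Jac T w) (Jac T w)) (ball 0 (1/64))"
    using transition_CB by blast
  obtain N U where N: "CB k N bump U" "{0..1} \<subseteq> U"
    by (rule lsm_compact_CB[OF lsm_bump, of "{0..1}" k]) auto
  obtain C where C: "C \<ge> 0" "\<forall>g f S T. open S \<longrightarrow> f ` S \<subseteq> T \<longrightarrow> CB k N g (T::real set) \<longrightarrow> CB k M f S \<longrightarrow> CB k C (\<lambda>x. g (f x) :: real) (S :: (complex^'n) set)"
    using CB_compose_real[of k N M] by blast
  have "CB k C (\<lambda>w. bump (inner (T w) (T w))) (ball 0 (1/64))"
    if T: "holomorphic_map_on T (ball 0 (7/8))" "\<forall>w\<in>ball 0 (7/8). norm (T w) \<le> 1" for T :: "complex^'n \<Rightarrow> complex^'n"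
  proof (rule C(2)[rule_format, OF _ _ N(1)])
    have "inner (T w) (T w) \<in> {0..1}" if "w \<in> ball 0 (1/64)" for w
    proof -
      have "norm (T w) \<le> 1" using T(2) that by simp
      then show ?thesis by (simp add: dot_square_norm power_le_one)
    qed
    then show "(\<lambda>w. inner (T w) (T w)) ` ball 0 (1/64) \<subseteq> U" using N(2) by blast
  qed (use M(2) T in auto)
  then show ?thesis using C(1) by (auto simp: dot_square_norm)
qed

text \<open>The weighted mean of at most \<open>N\<close> potentials differs from the potential of the chart \<open>f\<close> itself by a mean of small differences. The
weights have bounded derivatives in the chart and their sum is bounded below at the centre, hence on a ball of fixed radius \<open>\<rho>\<close>. All constants have to
be independent of \<open>\<Omega>\<close>, the chart and the embeddings, because \<open>\<tau>\<close> is chosen first.\<close>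

lemma chart_error:
  fixes c0 \<epsilon> :: real and N :: nat
  assumes c0: "c0 > 0" and eps: "\<epsilon> > 0"
  shows "\<exists>\<tau>>0. \<tau> \<le> 1/12 \<and> (\<exists>\<rho>>0. \<rho> \<le> 1/128 \<and> (\<forall>\<Omega> (f :: complex^'n \<Rightarrow> complex^'n) (F :: 'j \<Rightarrow> complex^'n \<Rightarrow> complex^'n) J.
     open \<Omega> \<longrightarrow> wide \<Omega> \<tau> f \<longrightarrow> finite J \<longrightarrow> card J \<le> N \<longrightarrow> (\<forall>j\<in>J. wide \<Omega> \<tau> (F j) \<and> norm (F j (inv_into \<Omega> f 0)) < 1/8) \<longrightarrow>
     (\<Sum>j\<in>J. bump ((norm (F j (inv_into \<Omega> f 0)))\<^sup>2)) \<ge> c0 \<longrightarrow>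
     (\<forall>w\<in>ball 0 \<rho>. (\<Sum>j\<in>J. bump ((norm (F j (inv_into \<Omega> f w)))\<^sup>2)) > 0) \<and>
     CB 4 \<epsilon> (\<lambda>w. (\<Sum>j\<in>J. bump ((norm (F j (inv_into \<Omega> f w)))\<^sup>2) * (logvol (F j) (inv_into \<Omega> f w) - logvol f (inv_into \<Omega> f w)))
        * inverse (\<Sum>j\<in>J. bump ((norm (F j (inv_into \<Omega> f w)))\<^sup>2))) (ball 0 \<rho>)))"
proof -
  obtain M where M: "M \<ge> 0" "\<forall>T :: complex^'n \<Rightarrow> complex^'n. holomorphic_map_on T (ball 0 (7/8)) \<longrightarrow> (\<forall>w\<in>ball 0 (7/8). norm (T w) \<le> 1) \<longrightarrow>
     CB 4 M (\<lambda>w. bump ((norm (T w))\<^sup>2)) (ball 0 (1/64))"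
    using bump_transition_CB by blast
  obtain C where C: "C \<ge> 0" "\<forall>f (S :: (complex^'n) set). open S \<longrightarrow> (\<forall>x\<in>S. c0/4 < f x) \<longrightarrow> CB 4 (real N * M) f S \<longrightarrow> CB 4 C (\<lambda>x. inverse (f x) :: real) S"
    using CB_inverse_compose[of "c0/4" 4 "real N * M"] c0 by auto
  define K where "K = 2 ^ 4 * (real N * (2 ^ 4 * M) * C) + 1"
  have K: "K > 0" using M C by (simp add: K_def add_nonneg_pos)
  obtain \<tau> where \<tau>: "\<tau> > 0" "\<tau> \<le> 1/12" "\<forall>\<Omega> (f1 :: complex^'n \<Rightarrow> complex^'n) f2. open \<Omega> \<longrightarrow> wide \<Omega> \<tau> f1 \<longrightarrow> wide \<Omega> \<tau> f2 \<longrightarrow> norm (f2 (inv_into \<Omega> f1 0)) < 1/8 \<longrightarrow>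
     CB 4 (\<epsilon> / K) (\<lambda>w. logvol f2 (inv_into \<Omega> f1 w) - logvol f1 (inv_into \<Omega> f1 w)) (ball 0 (1/128))"
    using logvol_difference_small[of "\<epsilon> / K" 4] eps K by auto
  define \<rho> where "\<rho> = min (1/128) (c0 / (2 * (real N * M + 1)))"
  have NM: "real N * M \<ge> 0" using M by simp
  have \<rho>: "\<rho> > 0" "\<rho> \<le> 1/128" "\<rho> * (real N * M) \<le> c0 / 2"
  proof -
    show "\<rho> > 0" using c0 NM by (auto simp: \<rho>_def)
    show "\<rho> \<le> 1/128" unfolding \<rho>_def by (rule min.cobounded1)
    have "\<rho> * (real N * M) \<le> (c0 / (2 * (real N * M + 1))) * (real N * M + 1)"
      using c0 NM by (intro mult_mono) (auto simp: \<rho>_def)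
    also have "\<dots> = c0 / 2"
    proof -
      have "c0 / (2 * y) * y = c0 / 2" if "y \<noteq> 0" for y using that by simp
      then show ?thesis using NM by (metis add_nonneg_pos less_irrefl zero_less_one)
    qed
    finally show "\<rho> * (real N * M) \<le> c0 / 2" .
  qed
  let ?B = "ball 0 \<rho> :: (complex^'n) set"
  have "(\<forall>w\<in>?B. (\<Sum>j\<in>J. bump ((norm (F j (inv_into \<Omega> f w)))\<^sup>2)) > 0) \<and>
     CB 4 \<epsilon> (\<lambda>w. (\<Sum>j\<in>J. bump ((norm (F j (inv_into \<Omega> f w)))\<^sup>2) * (logvol (F j) (inv_into \<Omega> f w) - logvol f (inv_into \<Omega> f w)))
        * inverse (\<Sum>j\<in>J. bump ((norm (F j (inv_into \<Omega> f w)))\<^sup>2))) ?B"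
    if op: "open \<Omega>" and f: "wide \<Omega> \<tau> f" and J: "finite J" "card J \<le> N" and F: "\<forall>j\<in>J. wide \<Omega> \<tau> (F j) \<and> norm (F j (inv_into \<Omega> f 0)) < 1/8"
      and s: "(\<Sum>j\<in>J. bump ((norm (F j (inv_into \<Omega> f 0)))\<^sup>2)) \<ge> c0"
    for \<Omega> and f :: "complex^'n \<Rightarrow> complex^'n" and F :: "'j \<Rightarrow> complex^'n \<Rightarrow> complex^'n" and J
  proof -
    define X where "X j w = bump ((norm (F j (inv_into \<Omega> f w)))\<^sup>2)" for j w
    define U where "U j w = logvol (F j) (inv_into \<Omega> f w) - logvol f (inv_into \<Omega> f w)" for j w
    have X: "CB 4 M (X j) (ball 0 (1/64))" if "j \<in> J" for j
    proof -
      have w: "wide \<Omega> \<tau> (F j)" using F that by blast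
      then have i: "F j ` \<Omega> \<subseteq> ball 0 1" by (simp add: wide_def)
      show ?thesis unfolding X_def
        using M(2)[rule_format, of "\<lambda>w. F j (inv_into \<Omega> f w)"] transition_map(1,2)[OF op f wide_holomorphic[OF w op] i \<tau>(2)] by blast
    qed
    have cM: "real (card J) * M \<le> real N * M" using J M by (intro mult_right_mono) auto
    have S1: "CB 4 (real N * M) (\<lambda>w. \<Sum>j\<in>J. X j w) (ball 0 (1/64))"
    proof (rule CB_mono)
      show "CB 4 (\<Sum>j\<in>J. M) (\<lambda>w. \<Sum>j\<in>J. X j w) (ball 0 (1/64))" by (intro CB_sum J X) auto
    qed (use cM in auto)
    have S: "CB 4 (real N * M) (\<lambda>w. \<Sum>j\<in>J. X j w) ?B" by (rule CB_mono[OF S1]) (use \<rho> in auto)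
    have low: "c0 / 4 < (\<Sum>j\<in>J. X j w)" if w: "w \<in> ?B" for w
    proof -
      have "CB (Suc 3) (real N * M) (\<lambda>w. \<Sum>j\<in>J. X j w) (ball 0 (1/64))" using S1 by (simp add: eval_nat_numeral)
      then have "norm ((\<Sum>j\<in>J. X j w) - (\<Sum>j\<in>J. X j 0)) \<le> real N * M * norm (w - 0)"
        by (rule CB_Lipschitz) (use NM w \<rho> in auto)
      also have "\<dots> \<le> real N * M * \<rho>" using w NM by (intro mult_left_mono) auto
      also have "\<dots> \<le> c0 / 2" using \<rho>(3) by (simp add: mult.commute)
      finally show ?thesis using s c0 unfolding X_def real_norm_def abs_le_iff by linarith
    qed
    have I: "CB 4 C (\<lambda>w. inverse (\<Sum>j\<in>J. X j w)) ?B" using C(2) low S by simp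
    have U: "CB 4 (\<epsilon> / K) (U j) ?B" if "j \<in> J" for j
      unfolding U_def by (rule CB_mono[OF \<tau>(3)[rule_format, OF op f]]) (use F that \<rho> in auto)
    have XU: "CB 4 (\<Sum>j\<in>J. 2 ^ 4 * (M * (\<epsilon> / K))) (\<lambda>w. \<Sum>j\<in>J. X j w * U j w) ?B"
      by (intro CB_sum J CB_mult U CB_mono[OF X]) (use M eps K \<rho> in auto)
    have "CB 4 (2 ^ 4 * ((\<Sum>j\<in>J. 2 ^ 4 * (M * (\<epsilon> / K))) * C)) (\<lambda>w. (\<Sum>j\<in>J. X j w * U j w) * inverse (\<Sum>j\<in>J. X j w)) ?B"
      by (intro CB_mult XU I) (use M eps K C in \<open>auto intro!: sum_nonneg\<close>)
    moreover have "2 ^ 4 * ((\<Sum>j\<in>J. 2 ^ 4 * (M * (\<epsilon> / K))) * C) \<le> \<epsilon>"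
    proof -
      have "2 ^ 4 * ((\<Sum>j\<in>J. 2 ^ 4 * (M * (\<epsilon> / K))) * C) = (2 ^ 4 * (2 ^ 4 * (real (card J) * M) * C)) * (\<epsilon> / K)" by simp
      also have "\<dots> \<le> (2 ^ 4 * (2 ^ 4 * (real N * M) * C)) * (\<epsilon> / K)"
        using J M C eps K by (intro mult_right_mono mult_left_mono) auto
      also have "\<dots> \<le> K * (\<epsilon> / K)" using eps K by (intro mult_right_mono) (auto simp: K_def)
      finally show ?thesis using K by simp
    qed
    ultimately have "CB 4 \<epsilon> (\<lambda>w. (\<Sum>j\<in>J. X j w * U j w) * inverse (\<Sum>j\<in>J. X j w)) ?B" by (rule CB_mono) simp
    moreover have "\<forall>w\<in>?B. (\<Sum>j\<in>J. X j w) > 0" using low c0 by (metis divide_pos_pos order.strict_trans zero_less_numeral)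
    ultimately show ?thesis unfolding X_def U_def by blast
  qed
  then show ?thesis using \<tau>(1,2) \<rho>(1,2) by blast
qed

section \<open>Wirtinger derivatives\<close>

text \<open>Wirtinger derivatives in the direction of an arbitrary vector rather than of a coordinate, \<open>dz\<close> being complex linear and \<open>db\<close>
conjugate linear in \<open>v\<close>. This makes the chain rule for holomorphic maps free of indices (\<open>dz_compose\<close>).\<close>

definition dz :: "complex^'n \<Rightarrow> (complex^'n \<Rightarrow> complex) \<Rightarrow> complex^'n \<Rightarrow> complex" where
  "dz v u z = (dird v u z - \<i> * dird (\<i> *s v) u z) / 2"

definition db :: "complex^'n \<Rightarrow> (complex^'n \<Rightarrow> complex) \<Rightarrow> complex^'n \<Rightarrow> complex" where
  "db v u z = (dird v u z + \<i> * dird (\<i> *s v) u z) / 2"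

lemma wirtinger_dz_eq: "wirtinger_dz k f z = dz (axis k 1) f z"
  and wirtinger_dzbar_eq: "wirtinger_dzbar k f z = db (axis k 1) f z"
proof -
  have "\<i> *s axis k 1 = axis k \<i>" by (simp add: vec_eq_iff axis_def)
  then show "wirtinger_dz k f z = dz (axis k 1) f z" "wirtinger_dzbar k f z = db (axis k 1) f z"
    by (simp_all add: wirtinger_dz_def wirtinger_dzbar_def dz_def db_def)
qed

lemma dz_cong: "open S \<Longrightarrow> z \<in> S \<Longrightarrow> (\<And>w. w \<in> S \<Longrightarrow> u w = v w) \<Longrightarrow> dz a u z = dz a v z"
  and db_cong: "open S \<Longrightarrow> z \<in> S \<Longrightarrow> (\<And>w. w \<in> S \<Longrightarrow> u w = v w) \<Longrightarrow> db a u z = db a v z"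
  unfolding dz_def db_def using frechet_derivative_eq_open[of S z u v] by auto

lemma lsm_dz: "lsm u S \<Longrightarrow> lsm (dz v u) S" and lsm_db: "lsm u S \<Longrightarrow> lsm (db v u) S"
proof -
  assume u: "lsm u S"
  have op: "open S" using lsm_openD[OF u] .
  have "lsm (\<lambda>z. (1/2) * (dird v u z - \<i> * dird (\<i> *s v) u z)) S" "lsm (\<lambda>z. (1/2) * (dird v u z + \<i> * dird (\<i> *s v) u z)) S"
    by (intro lsm_mult lsm_diff lsm_add lsm_const op lsm_dird u)+
  then show "lsm (dz v u) S" "lsm (db v u) S" unfolding dz_def[abs_def] db_def[abs_def] by simp_all
qed

lemma CB_dz: 
  assumes op: "open S" and u: "CB (Suc k) M u S" 
  shows "CB k (M * norm v) (dz v u) S" "CB k (M * norm v) (db v u) S"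
proof -
  have 1: "CB k (M * norm v) (dird v u) S" using CB_dird[OF u] .
  have "CB k (M * norm (\<i> *s v)) (dird (\<i> *s v) u) S" using CB_dird[OF u] .
  then have 2: "CB k (M * norm v) (dird (\<i> *s v) u) S" by (simp add: norm_cscale)
  have 3: "CB k (M * norm v) (\<lambda>z. \<i> * dird (\<i> *s v) u z) S"
    using CB_linear[OF op bounded_linear_mult_right _ _ 2, of \<i> 1] by (simp add: norm_mult)
  have 4: "CB k (1/2 * (M * norm v + M * norm v)) (\<lambda>z. (1/2) * (dird v u z - \<i> * dird (\<i> *s v) u z)) S"
    by (rule CB_linear[OF op bounded_linear_mult_right _ _ CB_diff[OF op 1 3]]) (auto simp: norm_mult)
  have 5: "CB k (1/2 * (M * norm v + M * norm v)) (\<lambda>z. (1/2) * (dird v u z + \<i> * dird (\<i> *s v) u z)) S"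
    by (rule CB_linear[OF op bounded_linear_mult_right _ _ CB_add[OF op 1 3]]) (auto simp: norm_mult)
  show "CB k (M * norm v) (dz v u) S" "CB k (M * norm v) (db v u) S"
    unfolding dz_def[abs_def] db_def[abs_def] using 4 5 by simp_all
qed

lemma dird_cscale_expand:
  fixes u :: "complex^'n \<Rightarrow> complex"
  assumes "linear (\<lambda>v. dird v u z)"
  shows "dird (c *s v) u z = of_real (Re c) * dird v u z + of_real (Im c) * dird (\<i> *s v) u z"
proof -
  have "c *s v = Re c *\<^sub>R v + Im c *\<^sub>R (\<i> *s v)"
    unfolding cscale_of_real[symmetric] by (simp add: vec_eq_iff) (metis complex_eq distrib_right mult.assoc mult.commute)
  then show ?thesis using linear_add[OF assms] linear_cmul[OF assms] by (simp add: scaleR_conv_of_real)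
qed

lemma dz_linear:
  assumes u: "lsm u S" and z: "z \<in> S"
  shows "dz (v + w) u z = dz v u z + dz w u z" "dz (c *s v) u z = c * dz v u z"
    "db (v + w) u z = db v u z + db w u z" "db (c *s v) u z = cnj c * db v u z"
proof -
  note l = lsm_linear_dird[OF u z]
  have a: "\<i> *s (v + w) = \<i> *s v + \<i> *s w" by (simp add: vec_eq_iff algebra_simps)
  show "dz (v + w) u z = dz v u z + dz w u z" "db (v + w) u z = db v u z + db w u z"
    unfolding dz_def db_def a linear_add[OF l] by (simp_all add: algebra_simps add_divide_distrib diff_divide_distrib)
  have b: "\<i> *s (c *s v) = (\<i> * c) *s v" by (simp add: vec_eq_iff)
  have c: "c = of_real (Re c) + \<i> * of_real (Im c)" "cnj c = of_real (Re c) - \<i> * of_real (Im c)"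
    using complex_eq by (auto simp: complex_eq_iff)
  have k: "(r * a + m * b - \<i> * (- m * a + r * b)) / 2 = (r + \<i> * m) * ((a - \<i> * b) / 2)"
    "(r * a + m * b + \<i> * (- m * a + r * b)) / 2 = (r - \<i> * m) * ((a + \<i> * b) / 2)" for r m a b :: complex
    by (simp_all add: algebra_simps)
  have r: "complex_of_real (Re (\<i> * c)) = - of_real (Im c)" "Im (\<i> * c) = Re c" by simp_all
  show "dz (c *s v) u z = c * dz v u z" "db (c *s v) u z = cnj c * db v u z"
    unfolding dz_def db_def b dird_cscale_expand[OF l, of c] dird_cscale_expand[OF l, of "\<i> * c"] r k c[symmetric] by (rule refl)+
qed

lemma dz_zero: "lsm u S \<Longrightarrow> z \<in> S \<Longrightarrow> dz 0 u z = 0" and db_zero: "lsm u S \<Longrightarrow> z \<in> S \<Longrightarrow> db 0 u z = 0"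
  using dz_linear(2)[of u S z 0 0] dz_linear(4)[of u S z 0 0] by (auto simp: vector_smult_lzero)

lemma vec_basis_expansion: "v = (\<Sum>i\<in>UNIV. (v $ i) *s axis i (1::complex))"
  by (simp add: vec_eq_iff axis_def if_distrib cong: if_cong)

lemma dz_basis:
  assumes u: "lsm u S" and z: "z \<in> S"
  shows "dz v u z = (\<Sum>i\<in>UNIV. v $ i * dz (axis i 1) u z)" "db v u z = (\<Sum>i\<in>UNIV. cnj (v $ i) * db (axis i 1) u z)"
proof -
  have "dz (\<Sum>i\<in>I. (v $ i) *s axis i 1) u z = (\<Sum>i\<in>I. v $ i * dz (axis i 1) u z)" 
    "db (\<Sum>i\<in>I. (v $ i) *s axis i 1) u z = (\<Sum>i\<in>I. cnj (v $ i) * db (axis i 1) u z)" for I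
    by (induction I rule: infinite_finite_induct) (simp_all add: dz_zero[OF u z] db_zero[OF u z] dz_linear[OF u z])
  from this[of UNIV] show "dz v u z = (\<Sum>i\<in>UNIV. v $ i * dz (axis i 1) u z)" "db v u z = (\<Sum>i\<in>UNIV. cnj (v $ i) * db (axis i 1) u z)"
    by (simp_all only: vec_basis_expansion[symmetric])
qed

lemma dz_eqI: "(u has_derivative D) (at z) \<Longrightarrow> dz v u z = (D v - \<i> * D (\<i> *s v)) / 2"
  and db_eqI: "(u has_derivative D) (at z) \<Longrightarrow> db v u z = (D v + \<i> * D (\<i> *s v)) / 2"
  unfolding dz_def db_def by (simp_all add: dird_eqI)

lemma dz_const: "dz v (\<lambda>z. c) z = 0" "db v (\<lambda>z. c) z = 0"
  by (simp_all add: dz_def db_def)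

lemma dz_add:
  assumes "lsm u S" "lsm w S" "z \<in> S"
  shows "dz v (\<lambda>z. u z + w z) z = dz v u z + dz v w z" "db v (\<lambda>z. u z + w z) z = db v u z + db v w z"
proof -
  note h = has_derivative_add[OF lsm_has_derivative[OF assms(1,3)] lsm_has_derivative[OF assms(2,3)]]
  show "dz v (\<lambda>z. u z + w z) z = dz v u z + dz v w z" "db v (\<lambda>z. u z + w z) z = db v u z + db v w z"
    unfolding dz_eqI[OF h] db_eqI[OF h] by (simp_all add: dz_def db_def algebra_simps add_divide_distrib diff_divide_distrib)
qed

lemma dz_mult:
  assumes "lsm u S" "lsm w S" "z \<in> S"
  shows "dz v (\<lambda>z. u z * w z) z = dz v u z * w z + u z * dz v w z" "db v (\<lambda>z. u z * w z) z = db v u z * w z + u z * db v w z"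
proof -
  note h = has_derivative_mult[OF lsm_has_derivative[OF assms(1,3)] lsm_has_derivative[OF assms(2,3)]]
  show "dz v (\<lambda>z. u z * w z) z = dz v u z * w z + u z * dz v w z" "db v (\<lambda>z. u z * w z) z = db v u z * w z + u z * db v w z"
    unfolding dz_eqI[OF h] db_eqI[OF h] by (simp_all add: dz_def db_def algebra_simps add_divide_distrib diff_divide_distrib)
qed

lemma dz_cmult:
  assumes "lsm w S" "z \<in> S"
  shows "dz v (\<lambda>z. c * w z) z = c * dz v w z" "db v (\<lambda>z. c * w z) z = c * db v w z"
  using dz_mult[OF lsm_const[OF lsm_openD[OF assms(1)]] assms] by (simp_all add: dz_const)

lemma dz_sum:
  assumes "open S" "\<And>i. i \<in> I \<Longrightarrow> lsm (u i) S" "z \<in> S"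
  shows "dz v (\<lambda>z. \<Sum>i\<in>I. u i z) z = (\<Sum>i\<in>I. dz v (u i) z)" "db v (\<lambda>z. \<Sum>i\<in>I. u i z) z = (\<Sum>i\<in>I. db v (u i) z)"
  using assms(2)
  by (induction I rule: infinite_finite_induct) (auto simp: dz_const dz_add[OF _ lsm_sum[OF assms(1)] assms(3)])

lemma lsm_cnj: "lsm u S \<Longrightarrow> lsm (\<lambda>z. cnj (u z)) S"
  by (rule lsm_linear[OF bounded_linear_cnj])

lemma dz_cnj:
  assumes "lsm u S" "z \<in> S"
  shows "dz v (\<lambda>z. cnj (u z)) z = cnj (db v u z)" "db v (\<lambda>z. cnj (u z)) z = cnj (dz v u z)"
proof -
  note h = has_derivative_cnj[OF lsm_has_derivative[OF assms]]
  show "dz v (\<lambda>z. cnj (u z)) z = cnj (db v u z)" "db v (\<lambda>z. cnj (u z)) z = cnj (dz v u z)"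
    unfolding dz_eqI[OF h] db_eqI[OF h] by (simp_all add: dz_def db_def)
qed

lemma dz_chol:
  assumes "chol u S" "z \<in> S"
  shows "dz v u z = dird v u z" "db v u z = 0"
  unfolding dz_def db_def chol_cscale[OF assms] by (simp_all add: algebra_simps)

lemma dz_commute:
  assumes u: "lsm u S" and z: "z \<in> S"
  shows "dz a (dz b u) z = dz b (dz a u) z" "dz a (db b u) z = db b (dz a u) z" "db a (db b u) z = db b (db a u) z"
proof -
  have op: "open S" using lsm_openD[OF u] .
  have d: "(dz b u has_derivative (\<lambda>v. (dird v (dird b u) z - \<i> * dird v (dird (\<i> *s b) u) z) / 2)) (at z)"
     "(db b u has_derivative (\<lambda>v. (dird v (dird b u) z + \<i> * dird v (dird (\<i> *s b) u) z) / 2)) (at z)" for b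
  proof -
    note h = lsm_has_derivative[OF lsm_dird[OF u] z]
    have "((\<lambda>z. (1/2) * (dird b u z - \<i> * dird (\<i> *s b) u z)) has_derivative (\<lambda>v. (1/2) * (dird v (dird b u) z - \<i> * dird v (dird (\<i> *s b) u) z))) (at z)"
      "((\<lambda>z. (1/2) * (dird b u z + \<i> * dird (\<i> *s b) u z)) has_derivative (\<lambda>v. (1/2) * (dird v (dird b u) z + \<i> * dird v (dird (\<i> *s b) u) z))) (at z)"
      by (intro has_derivative_mult_right has_derivative_diff has_derivative_add h)+
    then show "(dz b u has_derivative (\<lambda>v. (dird v (dird b u) z - \<i> * dird v (dird (\<i> *s b) u) z) / 2)) (at z)"
     "(db b u has_derivative (\<lambda>v. (dird v (dird b u) z + \<i> * dird v (dird (\<i> *s b) u) z) / 2)) (at z)"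
      unfolding dz_def[abs_def] db_def[abs_def] by simp_all
  qed
  note c = dird_commute[OF u z]
  show "dz a (dz b u) z = dz b (dz a u) z" "dz a (db b u) z = db b (dz a u) z" "db a (db b u) z = db b (db a u) z"
    unfolding dz_eqI[OF d(1)] dz_eqI[OF d(2)] db_eqI[OF d(1)] db_eqI[OF d(2)] 
    c[of a b] c[of "\<i> *s a" b] c[of a "\<i> *s b"] c[of "\<i> *s a" "\<i> *s b"] by (simp_all add: algebra_simps diff_divide_distrib add_divide_distrib)
qed

text \<open>Induction on the order: by the chain rule the derivatives of the composite are combinations of composites of derivatives.\<close>

lemma lsm_holomorphic_compose:
  fixes u :: "complex^'n \<Rightarrow> complex"
  assumes u: "lsm u T" and f: "holomorphic_map_on f S" and op: "open S" and sub: "f ` S \<subseteq> T"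
  shows "lsm (\<lambda>z. u (f z)) S"
proof -
  have basis: "dird v u w = (\<Sum>b\<in>Basis. inner v b *\<^sub>R dird b u w)" if "lsm u T" "w \<in> T" for u :: "complex^'n \<Rightarrow> complex" and v w
  proof -
    note l = lsm_linear_dird[OF that]
    have "dird (\<Sum>b\<in>Basis. inner v b *\<^sub>R b) u w = (\<Sum>b\<in>Basis. inner v b *\<^sub>R dird b u w)"
      using linear_sum[OF l, of "\<lambda>b. inner v b *\<^sub>R b" Basis] linear_cmul[OF l] by simp
    then show ?thesis by (simp add: euclidean_representation)
  qed
  have base: "\<exists>r>0. \<exists>M. ball x r \<subseteq> S \<and> CB 0 M (\<lambda>z. u (f z)) (ball x r)" if "lsm u T" and x: "x \<in> S" for x and u :: "complex^'n \<Rightarrow> complex"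
  proof -
    have "continuous_on S (\<lambda>z. u (f z))"
      by (rule continuous_on_compose2[OF lsm_continuous_on[OF that(1)] holomorphic_map_continuous_on[OF f] sub])
    then have "isCont (\<lambda>z. u (f z)) x" using x op by (simp add: continuous_on_eq_continuous_at)
    then obtain d where d: "d > 0" "\<And>y. dist y x < d \<Longrightarrow> dist (u (f y)) (u (f x)) < 1"
      unfolding continuous_at_eps_delta by (metis zero_less_one)
    obtain e where e: "e > 0" "ball x e \<subseteq> S" using op x openE by blast
    have "norm (u (f y)) \<le> norm (u (f x)) + 1" if "y \<in> ball x (min d e)" for y
    proof -
      have "dist (u (f y)) (u (f x)) < 1" using d(2)[of y] that by (simp add: dist_commute)
      then show ?thesis using norm_triangle_sub[of "u (f y)" "u (f x)"] by (simp add: dist_norm)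
    qed
    then have "CB 0 (norm (u (f x)) + 1) (\<lambda>z. u (f z)) (ball x (min d e))" by simp
    moreover have "ball x (min d e) \<subseteq> S" using e by auto
    ultimately show ?thesis
      using d e by (metis min_less_iff_conj)
  qed
  have "\<forall>x\<in>S. \<exists>r>0. \<exists>M. ball x r \<subseteq> S \<and> CB k M (\<lambda>z. u (f z)) (ball x r)" if "lsm u T" for k and u :: "complex^'n \<Rightarrow> complex"
    using that
  proof (induction k arbitrary: u)
    case 0
    then show ?case using base by blast
  next
    case (Suc k)
    show ?case
    proof
      fix x assume x: "x \<in> S"
      have "\<forall>b. \<exists>r>0. \<exists>M. ball x r \<subseteq> S \<and> CB k M (\<lambda>z. dird b u (f z)) (ball x r)"
        using Suc.IH[OF lsm_dird[OF Suc.prems]] x by blast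
      then obtain r M where rM: "\<And>b. r b > 0 \<and> ball x (r b) \<subseteq> S \<and> CB k (M b) (\<lambda>z. dird b u (f z)) (ball x (r b))" by metis
      obtain r0 M0 where r0: "r0 > 0" "M0 \<ge> 0" "ball x r0 \<subseteq> S" "CB (Suc k) M0 f (ball x r0)"
        using lsmE[OF holomorphic_map_lsm[OF f op] x] by metis
      obtain r1 M1 where r1: "r1 > 0" "ball x r1 \<subseteq> S" "CB 0 M1 (\<lambda>z. u (f z)) (ball x r1)"
        using base[OF Suc.prems x] by blast
      define R where "R = Min (insert r0 (insert r1 (r ` Basis)))"
      have fin: "finite (insert r0 (insert r1 (r ` (Basis :: (complex^'n) set))))" by simp
      have R: "R > 0" "R \<le> r0" "R \<le> r1" "\<And>b. b \<in> Basis \<Longrightarrow> R \<le> r b"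
        unfolding R_def using r0(1) r1(1) rM by (subst Min_gr_iff[OF fin]; force) (rule Min_le[OF fin]; simp)+
      define N where "N = (\<Sum>b\<in>(Basis :: (complex^'n) set). 2 ^ k * (M0 * \<bar>M b\<bar>))"
      have N: "N \<ge> 0" unfolding N_def using r0 by (auto intro: sum_nonneg)
      have "CB (Suc k) (\<bar>M1\<bar> + N) (\<lambda>z. u (f z)) (ball x R)"
      proof (rule CB_SucI[where f' = "\<lambda>z v. \<Sum>b\<in>Basis. inner (dird v f z) b *\<^sub>R dird b u (f z)"])
        fix z assume z: "z \<in> ball x R"
        then have zS: "z \<in> S" using R r0 by auto
        have "norm (u (f z)) \<le> M1" using CB_norm[OF r1(3)] z R by auto
        then show "norm (u (f z)) \<le> \<bar>M1\<bar> + N" using N by linarith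
        have fz: "f z \<in> T" using sub zS by blast
        have "((\<lambda>z. u (f z)) has_derivative (\<lambda>v. dird (dird v f z) u (f z))) (at z)"
          by (intro has_derivative_dird_compose holomorphic_map_has_derivative[OF f zS] lsm_has_derivative[OF Suc.prems fz])
        then show "((\<lambda>z. u (f z)) has_derivative (\<lambda>v. \<Sum>b\<in>Basis. inner (dird v f z) b *\<^sub>R dird b u (f z))) (at z)"
          by (rule has_derivative_eq_rhs) (rule ext, rule basis[OF Suc.prems fz])
      next
        fix v
        have 1: "CB k (2 ^ k * ((M0 * norm v * norm b) * \<bar>M b\<bar>)) (\<lambda>z. inner (dird v f z) b *\<^sub>R dird b u (f z)) (ball x R)" if "b \<in> Basis" for b
        proof (intro CB_scaleR)
          have "CB k (M0 * norm v) (dird v f) (ball x R)" by (rule CB_mono[OF CB_dird[OF r0(4)]]) (use R in auto)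
          then have "CB k (norm b * (M0 * norm v)) (\<lambda>z. inner (dird v f z) b) (ball x R)"
            by (rule CB_linear[OF open_ball bounded_linear_inner_left, rotated 2]) (use Cauchy_Schwarz_ineq2 in \<open>auto simp: mult.commute\<close>)
          then show "CB k (M0 * norm v * norm b) (\<lambda>z. inner (dird v f z) b) (ball x R)" by (simp add: mult.commute)
          show "CB k \<bar>M b\<bar> (\<lambda>z. dird b u (f z)) (ball x R)"
            by (rule CB_mono[of _ "M b" _ "ball x (r b)"]) (use rM[of b] R(4)[OF that] in auto)
        qed (use r0 in auto)
        have "CB k (\<Sum>b\<in>(Basis :: (complex^'n) set). 2 ^ k * ((M0 * norm v * norm b) * \<bar>M b\<bar>)) (\<lambda>z. \<Sum>b\<in>Basis. inner (dird v f z) b *\<^sub>R dird b u (f z)) (ball x R)"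
          by (rule CB_sum) (use 1 in auto)
        then show "CB k ((\<bar>M1\<bar> + N) * norm v) (\<lambda>z. \<Sum>b\<in>Basis. inner (dird v f z) b *\<^sub>R dird b u (f z)) (ball x R)"
        proof (rule CB_mono)
          have "(\<Sum>b\<in>(Basis :: (complex^'n) set). 2 ^ k * ((M0 * norm v * norm b) * \<bar>M b\<bar>)) = N * norm v"
            unfolding N_def sum_distrib_right by (intro sum.cong) auto
          then show "(\<Sum>b\<in>(Basis :: (complex^'n) set). 2 ^ k * ((M0 * norm v * norm b) * \<bar>M b\<bar>)) \<le> (\<bar>M1\<bar> + N) * norm v"
            by (simp add: distrib_right)
        qed simp
      qed simp
      then show "\<exists>r>0. \<exists>M. ball x r \<subseteq> S \<and> CB (Suc k) M (\<lambda>z. u (f z)) (ball x r)"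
        using R r0 by (intro exI[of _ R] conjI exI) (auto simp del: CB.simps)
    qed
  qed
  from this[OF u] show ?thesis using op by (simp add: lsm_def[of "\<lambda>z. u (f z)"])
qed

lemma dz_compose:
  assumes u: "lsm u T" and f: "holomorphic_map_on f S" and z: "z \<in> S" "f z \<in> T"
  shows "dz v (\<lambda>z. u (f z)) z = dz (dird v f z) u (f z)" "db v (\<lambda>z. u (f z)) z = db (dird v f z) u (f z)"
proof -
  note h = has_derivative_dird_compose[OF holomorphic_map_has_derivative[OF f z(1)] lsm_has_derivative[OF u z(2)]]
  show "dz v (\<lambda>z. u (f z)) z = dz (dird v f z) u (f z)" "db v (\<lambda>z. u (f z)) z = db (dird v f z) u (f z)"
    unfolding dz_eqI[OF h] db_eqI[OF h] holomorphic_map_cscale[OF f z(1)] by (simp_all add: dz_def db_def)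
qed

section \<open>The Levi form of the squared length on the tangent bundle\<close>

text \<open>Let \<open>N(p, X) = h\<^sub>p(X, X)\<close> for the metric with potential \<open>u\<close>. This is the coefficient of \<open>|\<zeta>|\<^sup>2\<close> in \<open>N(p + \<zeta> Y, X + \<zeta> V)\<close>, that
is, the Levi form of \<open>N\<close> at \<open>(p, X)\<close> in the direction \<open>(Y, V)\<close>. Unlike the curvature it is linear in \<open>u\<close>.\<close>

definition lev :: "(complex^'n \<Rightarrow> complex) \<Rightarrow> complex^'n \<Rightarrow> complex^'n \<Rightarrow> complex^'n \<Rightarrow> complex^'n \<Rightarrow> complex" where
  "lev u p X Y V = dz Y (db Y (dz X (db X u))) p + dz Y (dz X (db V u)) p + db Y (dz V (db X u)) p + dz V (db V u) p"

lemma lsm_dzdb: "lsm u S \<Longrightarrow> lsm (dz a (db b u)) S"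
  by (intro lsm_dz lsm_db)

lemma dzdb_basis:
  assumes u: "lsm u S" and z: "z \<in> S"
  shows "dz a (db b u) z = (\<Sum>i\<in>UNIV. \<Sum>j\<in>UNIV. a $ i * cnj (b $ j) * dz (axis i 1) (db (axis j 1) u) z)"
proof -
  have op: "open S" using lsm_openD[OF u] .
  have "dz a (db b u) z = dz a (\<lambda>z. \<Sum>j\<in>UNIV. cnj (b $ j) * db (axis j 1) u z) z"
    by (rule dz_cong[OF op z]) (rule dz_basis(2)[OF u])
  also have "\<dots> = (\<Sum>j\<in>UNIV. cnj (b $ j) * dz a (db (axis j 1) u) z)"
    by (subst dz_sum(1)[OF op _ z]) (auto intro!: lsm_mult lsm_const lsm_db u op simp: dz_cmult(1)[OF lsm_db[OF u] z])
  also have "\<dots> = (\<Sum>j\<in>UNIV. \<Sum>i\<in>UNIV. a $ i * cnj (b $ j) * dz (axis i 1) (db (axis j 1) u) z)"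
    by (intro sum.cong refl, subst dz_basis(1)[OF lsm_db[OF u] z]) (simp add: sum_distrib_left mult_ac)
  finally show ?thesis by (subst sum.swap)
qed

lemma
  assumes u: "lsm u S" and z: "z \<in> S"
  shows dz_dzdb_basis: "dz c (dz a (db b u)) z = (\<Sum>i\<in>UNIV. \<Sum>j\<in>UNIV. a $ i * cnj (b $ j) * dz c (dz (axis i 1) (db (axis j 1) u)) z)"
    and db_dzdb_basis: "db c (dz a (db b u)) z = (\<Sum>i\<in>UNIV. \<Sum>j\<in>UNIV. a $ i * cnj (b $ j) * db c (dz (axis i 1) (db (axis j 1) u)) z)"
proof -
  have op: "open S" using lsm_openD[OF u] .
  let ?g = "\<lambda>z. \<Sum>i\<in>UNIV. \<Sum>j\<in>UNIV. a $ i * cnj (b $ j) * dz (axis i 1) (db (axis j 1) u) z"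
  have l: "lsm (dz (axis i 1) (db (axis j 1) u)) S" for i j by (rule lsm_dzdb[OF u])
  have "dz c (dz a (db b u)) z = dz c ?g z" "db c (dz a (db b u)) z = db c ?g z"
    by (rule dz_cong[OF op z dzdb_basis[OF u]], assumption, rule db_cong[OF op z dzdb_basis[OF u]])
  moreover have "dz c ?g z = (\<Sum>i\<in>UNIV. \<Sum>j\<in>UNIV. a $ i * cnj (b $ j) * dz c (dz (axis i 1) (db (axis j 1) u)) z)"
    by (simp add: dz_sum(1)[OF op _ z] dz_cmult(1)[OF l z] lsm_sum[OF op] lsm_mult lsm_const[OF op] l)
  moreover have "db c ?g z = (\<Sum>i\<in>UNIV. \<Sum>j\<in>UNIV. a $ i * cnj (b $ j) * db c (dz (axis i 1) (db (axis j 1) u)) z)"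
    by (simp add: dz_sum(2)[OF op _ z] dz_cmult(2)[OF l z] lsm_sum[OF op] lsm_mult lsm_const[OF op] l)
  ultimately show "dz c (dz a (db b u)) z = (\<Sum>i\<in>UNIV. \<Sum>j\<in>UNIV. a $ i * cnj (b $ j) * dz c (dz (axis i 1) (db (axis j 1) u)) z)"
    "db c (dz a (db b u)) z = (\<Sum>i\<in>UNIV. \<Sum>j\<in>UNIV. a $ i * cnj (b $ j) * db c (dz (axis i 1) (db (axis j 1) u)) z)" by simp_all
qed

lemma dz_db_dzdb_basis:
  assumes u: "lsm u S" and z: "z \<in> S"
  shows "dz d (db c (dz a (db b u))) z = (\<Sum>i\<in>UNIV. \<Sum>j\<in>UNIV. a $ i * cnj (b $ j) * dz d (db c (dz (axis i 1) (db (axis j 1) u))) z)"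
proof -
  have op: "open S" using lsm_openD[OF u] .
  let ?g = "\<lambda>z. \<Sum>i\<in>UNIV. \<Sum>j\<in>UNIV. a $ i * cnj (b $ j) * db c (dz (axis i 1) (db (axis j 1) u)) z"
  have l: "lsm (db c (dz (axis i 1) (db (axis j 1) u))) S" for i j by (rule lsm_db[OF lsm_dzdb[OF u]])
  have "dz d (db c (dz a (db b u))) z = dz d ?g z"
    by (rule dz_cong[OF op z db_dzdb_basis[OF u]])
  then show ?thesis
    by (simp add: dz_sum(1)[OF op _ z] dz_cmult(1)[OF l z] lsm_sum[OF op] lsm_mult lsm_const[OF op] l)
qed

text \<open>Expand in coordinates: the components of the derivative of \<open>f\<close> are holomorphic, so only the derivatives of \<open>u\<close> contribute.\<close>

lemma dzdb_compose:
  assumes u: "lsm u T" and f: "holomorphic_map_on f S" and op: "open S" and sub: "f ` S \<subseteq> T" and z: "z \<in> S"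
  shows "dz a (db b (\<lambda>z. u (f z))) z = dz (dird a f z) (db (dird b f z) u) (f z)"
proof -
  let ?e = "\<lambda>i. axis i (1::complex)"
  have fz: "f z \<in> T" using sub z by blast
  have fb: "chol (\<lambda>z. dird b f z $ j) S" for j by (rule chol_comp_nth[OF holomorphic_map_dird[OF f op]])
  have lb: "lsm (\<lambda>z. cnj (dird b f z $ j)) S" for j by (rule lsm_cnj[OF chol_lsm[OF fb op]])
  have lu: "lsm (\<lambda>z. db (?e j) u (f z)) S" for j by (rule lsm_holomorphic_compose[OF lsm_db[OF u] f op sub])
  have "dz a (db b (\<lambda>z. u (f z))) z = dz a (\<lambda>z. \<Sum>j\<in>UNIV. cnj (dird b f z $ j) * db (?e j) u (f z)) z"
  proof (rule dz_cong[OF op z])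
    fix w assume w: "w \<in> S"
    then have fw: "f w \<in> T" using sub by blast
    show "db b (\<lambda>z. u (f z)) w = (\<Sum>j\<in>UNIV. cnj (dird b f w $ j) * db (?e j) u (f w))"
      unfolding dz_compose(2)[OF u f w fw] by (rule dz_basis(2)[OF u fw])
  qed
  also have "\<dots> = (\<Sum>j\<in>UNIV. cnj (dird b f z $ j) * dz (dird a f z) (db (?e j) u) (f z))"
    by (subst dz_sum(1)[OF op _ z])
      (auto intro!: lsm_mult lb lu simp: dz_mult(1)[OF lb lu z] dz_cnj(1)[OF chol_lsm[OF fb op] z] dz_chol(2)[OF fb z] dz_compose(1)[OF lsm_db[OF u] f z fz])
  also have "\<dots> = dz (dird a f z) (db (dird b f z) u) (f z)"
  proof -
    have opT: "open T" using lsm_openD[OF u] .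
    have "dz (dird a f z) (db (dird b f z) u) (f z) = dz (dird a f z) (\<lambda>y. \<Sum>j\<in>UNIV. cnj (dird b f z $ j) * db (?e j) u y) (f z)"
      by (rule dz_cong[OF opT fz dz_basis(2)[OF u]])
    also have "\<dots> = (\<Sum>j\<in>UNIV. cnj (dird b f z $ j) * dz (dird a f z) (db (?e j) u) (f z))"
      by (subst dz_sum(1)[OF opT _ fz]) (auto intro!: lsm_mult lsm_const opT lsm_db u simp: dz_cmult(1)[OF lsm_db[OF u] fz])
    finally show ?thesis by simp
  qed
  finally show ?thesis .
qed

text \<open>The typical summand in the coordinate expansion of a derivative of \<open>u \<circ> f\<close>: a holomorphic factor, an antiholomorphic factor and a
derivative of \<open>u\<close> along \<open>f\<close>. Sums of such terms are stable under differentiation.\<close>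

lemma wirtinger_term:
  assumes u: "lsm u T" and f: "holomorphic_map_on f S" and op: "open S" and sub: "f ` S \<subseteq> T" and z: "z \<in> S"
    and A: "chol A S" and B: "chol B S"
  shows "dz v (\<lambda>z. A z * cnj (B z) * u (f z)) z = dird v A z * cnj (B z) * u (f z) + A z * cnj (B z) * dz (dird v f z) u (f z)"
    and "db v (\<lambda>z. A z * cnj (B z) * u (f z)) z = A z * cnj (dird v B z) * u (f z) + A z * cnj (B z) * db (dird v f z) u (f z)"
    and "lsm (\<lambda>z. A z * cnj (B z) * u (f z)) S"
proof -
  note lA = chol_lsm[OF A op] and lB = lsm_cnj[OF chol_lsm[OF B op]] and lu = lsm_holomorphic_compose[OF u f op sub]
  have fz: "f z \<in> T" using sub z by blast
  show "lsm (\<lambda>z. A z * cnj (B z) * u (f z)) S" by (intro lsm_mult lA lB lu)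
  have lAB: "lsm (\<lambda>z. A z * cnj (B z)) S" by (intro lsm_mult lA lB)
  have cB: "dz v (\<lambda>z. cnj (B z)) z = 0" "db v (\<lambda>z. cnj (B z)) z = cnj (dird v B z)"
    unfolding dz_cnj[OF chol_lsm[OF B op] z] dz_chol[OF B z] by (rule complex_cnj_zero, rule refl)
  have 1: "dz v (\<lambda>z. A z * cnj (B z)) z = dird v A z * cnj (B z)"
    unfolding dz_mult(1)[OF lA lB z] cB dz_chol[OF A z] by (simp only: mult_zero_right add_0_right)
  have 2: "db v (\<lambda>z. A z * cnj (B z)) z = A z * cnj (dird v B z)"
    unfolding dz_mult(2)[OF lA lB z] cB dz_chol[OF A z] by (simp only: mult_zero_left add_0_left)
  have "dz v (\<lambda>z. A z * cnj (B z) * u (f z)) z = dz v (\<lambda>z. A z * cnj (B z)) z * u (f z) + A z * cnj (B z) * dz v (\<lambda>z. u (f z)) z"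
    using dz_mult(1)[of "\<lambda>z. A z * cnj (B z)" S "\<lambda>z. u (f z)" z v] lAB lu z by blast
  then show "dz v (\<lambda>z. A z * cnj (B z) * u (f z)) z = dird v A z * cnj (B z) * u (f z) + A z * cnj (B z) * dz (dird v f z) u (f z)"
    by (simp only: 1 dz_compose(1)[OF u f z fz, of v])
  have "db v (\<lambda>z. A z * cnj (B z) * u (f z)) z = db v (\<lambda>z. A z * cnj (B z)) z * u (f z) + A z * cnj (B z) * db v (\<lambda>z. u (f z)) z"
    using dz_mult(2)[of "\<lambda>z. A z * cnj (B z)" S "\<lambda>z. u (f z)" z v] lAB lu z by blast
  then show "db v (\<lambda>z. A z * cnj (B z) * u (f z)) z = A z * cnj (dird v B z) * u (f z) + A z * cnj (B z) * db (dird v f z) u (f z)"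
    by (simp only: 2 dz_compose(2)[OF u f z fz, of v])
qed

text \<open>A holomorphic map \<open>f\<close> acts on the tangent bundle by \<open>(p, X) \<mapsto> (f p, f' X)\<close>; the derivative of this action in the
direction \<open>(Y, V)\<close> has the vertical component \<open>f' V + f''(X, Y)\<close>. So passing to a chart only shifts \<open>V\<close>, which is harmless as all \<open>V\<close> are
admitted. The four terms of \<open>lev\<close> are expanded in coordinates and collected.\<close>

lemma lev_compose:
  assumes u: "lsm u T" and f: "holomorphic_map_on f S" and op: "open S" and sub: "f ` S \<subseteq> T" and p: "p \<in> S"
  shows "lev (\<lambda>z. u (f z)) p X Y V = lev u (f p) (dird X f p) (dird Y f p) (dird V f p + dird Y (dird X f) p)"
proof -
  let ?e = "\<lambda>i. axis i (1::complex)"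
  define H where "H i j = dz (?e i) (db (?e j) u)" for i j
  have lH: "lsm (H i j) T" for i j unfolding H_def by (rule lsm_dzdb[OF u])
  define a where "a X i z = dird X f z $ i" for X i z
  define c where "c i z = dird Y (dird X f) z $ i" for i z
  have fX: "holomorphic_map_on (dird X f) S" for X by (rule holomorphic_map_dird[OF f op])
  have ca: "chol (a X i) S" for X i unfolding a_def by (rule chol_comp_nth[OF fX])
  have cc: "chol (c i) S" for i unfolding c_def by (rule chol_comp_nth[OF holomorphic_map_dird[OF fX op]])
  have da: "dird Y (a X i) z = c i z" if "z \<in> S" for i z 
    unfolding a_def c_def by (rule dird_component[OF fX that])
  define q where "q = f p"
  have q: "q \<in> T" using sub p by (auto simp: q_def)
  define X' Y' V' W where "X' = dird X f p" and "Y' = dird Y f p" and "V' = dird V f p" and "W = dird Y (dird X f) p"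
  have N: "dz A (db B (\<lambda>z. u (f z))) z = (\<Sum>i\<in>UNIV. \<Sum>j\<in>UNIV. a A i z * cnj (a B j z) * H i j (f z))" if "z \<in> S" for A B z
  proof -
    have "f z \<in> T" using sub that by blast
    then show ?thesis 
      by (simp only: dzdb_compose[OF u f op sub that] dzdb_basis[OF u \<open>f z \<in> T\<close>, where a = "dird A f z" and b = "dird B f z"] a_def H_def)
  qed
  note wt = wirtinger_term[OF lH f op sub]
  have T4: "dz V (db V (\<lambda>z. u (f z))) p = dz V' (db V' u) q" unfolding dzdb_compose[OF u f op sub p] V'_def q_def ..
  have T2: "dz Y (dz X (db V (\<lambda>z. u (f z)))) p = dz W (db V' u) q + dz Y' (dz X' (db V' u)) q"
  proof -
    have "dz Y (dz X (db V (\<lambda>z. u (f z)))) p = dz Y (\<lambda>z. \<Sum>i\<in>UNIV. \<Sum>j\<in>UNIV. a X i z * cnj (a V j z) * H i j (f z)) p"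
      by (rule dz_cong[OF op p N])
    also have "\<dots> = (\<Sum>i\<in>UNIV. \<Sum>j\<in>UNIV. c i p * cnj (a V j p) * H i j q + a X i p * cnj (a V j p) * dz Y' (H i j) q)"
      by (simp add: dz_sum(1)[OF op _ p] lsm_sum[OF op] wt(3)[OF p ca ca] wt(1)[OF p ca ca] da[OF p] Y'_def q_def)
    finally show ?thesis unfolding dzdb_basis[OF u q, where a = W and b = V'] dz_dzdb_basis[OF u q, where c = Y' and a = X' and b = V']
      by (simp add: sum.distrib a_def c_def H_def X'_def V'_def W_def)
  qed
  have T3: "db Y (dz V (db X (\<lambda>z. u (f z)))) p = dz V' (db W u) q + db Y' (dz V' (db X' u)) q"
  proof -
    have "db Y (dz V (db X (\<lambda>z. u (f z)))) p = db Y (\<lambda>z. \<Sum>i\<in>UNIV. \<Sum>j\<in>UNIV. a V i z * cnj (a X j z) * H i j (f z)) p"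
      by (rule db_cong[OF op p N])
    also have "\<dots> = (\<Sum>i\<in>UNIV. \<Sum>j\<in>UNIV. a V i p * cnj (c j p) * H i j q + a V i p * cnj (a X j p) * db Y' (H i j) q)"
      by (simp add: dz_sum(2)[OF op _ p] lsm_sum[OF op] wt(3)[OF p ca ca] wt(2)[OF p ca ca] da[OF p] Y'_def q_def)
    finally show ?thesis unfolding dzdb_basis[OF u q, where a = V' and b = W] db_dzdb_basis[OF u q, where c = Y' and a = V' and b = X']
      by (simp add: sum.distrib a_def c_def H_def X'_def V'_def W_def)
  qed
  (* The term with four derivatives. After the first differentiation the index l of the antiholomorphic
     derivative of u has to be made explicit, as its coefficient is differentiated again. *)
  have T1: "dz Y (db Y (dz X (db X (\<lambda>z. u (f z))))) p = dz W (db W u) q + dz Y' (dz X' (db W u)) q + db Y' (dz W (db X' u)) q + dz Y' (db Y' (dz X' (db X' u))) q"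
  proof -
    define y where "y l z = dird Y f z $ l" for l z
    have cy: "chol (y l) S" for l unfolding y_def by (rule chol_comp_nth[OF fX])
    have d1: "db Y (dz X (db X (\<lambda>z. u (f z)))) z = (\<Sum>i\<in>UNIV. \<Sum>j\<in>UNIV. a X i z * cnj (c j z) * H i j (f z) + (\<Sum>l\<in>UNIV. a X i z * cnj (a X j z * y l z) * db (?e l) (H i j) (f z)))"
      if z: "z \<in> S" for z
    proof -
      have fz: "f z \<in> T" using sub z by blast
      have "db Y (dz X (db X (\<lambda>z. u (f z)))) z = db Y (\<lambda>z. \<Sum>i\<in>UNIV. \<Sum>j\<in>UNIV. a X i z * cnj (a X j z) * H i j (f z)) z"
        by (rule db_cong[OF op z N])
      also have "\<dots> = (\<Sum>i\<in>UNIV. \<Sum>j\<in>UNIV. a X i z * cnj (c j z) * H i j (f z) + a X i z * cnj (a X j z) * db (dird Y f z) (H i j) (f z))"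
        by (simp add: dz_sum(2)[OF op _ z] lsm_sum[OF op] wt(3)[OF z ca ca] wt(2)[OF z ca ca] da[OF z])
      also have "\<dots> = (\<Sum>i\<in>UNIV. \<Sum>j\<in>UNIV. a X i z * cnj (c j z) * H i j (f z) + (\<Sum>l\<in>UNIV. a X i z * cnj (a X j z * y l z) * db (?e l) (H i j) (f z)))"
        unfolding dz_basis(2)[OF lH fz, of "dird Y f z"] by (simp add: y_def sum_distrib_left mult_ac)
      finally show ?thesis .
    qed
    have cay: "chol (\<lambda>z. a X j z * y l z) S" for j l by (rule chol_mult[OF ca cy])
    note wl = wirtinger_term[OF lsm_db[OF lH] f op sub]
    have "dz Y (db Y (dz X (db X (\<lambda>z. u (f z))))) p = dz Y (\<lambda>z. \<Sum>i\<in>UNIV. \<Sum>j\<in>UNIV. a X i z * cnj (c j z) * H i j (f z) + (\<Sum>l\<in>UNIV. a X i z * cnj (a X j z * y l z) * db (?e l) (H i j) (f z))) p"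
      by (rule dz_cong[OF op p d1])
    also have "\<dots> = (\<Sum>i\<in>UNIV. \<Sum>j\<in>UNIV. c i p * cnj (c j p) * H i j q + a X i p * cnj (c j p) * dz Y' (H i j) q +
       (\<Sum>l\<in>UNIV. c i p * cnj (a X j p * y l p) * db (?e l) (H i j) q + a X i p * cnj (a X j p * y l p) * dz Y' (db (?e l) (H i j)) q))"
    proof -
      have 1: "lsm (\<lambda>z. a X i z * cnj (c j z) * H i j (f z)) S" for i j by (rule wt(3)[OF p ca cc])
      have 2: "lsm (\<lambda>z. a X i z * cnj (a X j z * y l z) * db (?e l) (H i j) (f z)) S" for i j l by (rule wl(3)[OF p ca cay])
      have 3: "lsm (\<lambda>z. \<Sum>l\<in>UNIV. a X i z * cnj (a X j z * y l z) * db (?e l) (H i j) (f z)) S" for i j by (rule lsm_sum[OF op 2])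
      note 4 = lsm_add[OF 1 3]
      have 5: "lsm (\<lambda>z. \<Sum>j\<in>UNIV. a X i z * cnj (c j z) * H i j (f z) + (\<Sum>l\<in>UNIV. a X i z * cnj (a X j z * y l z) * db (?e l) (H i j) (f z))) S" for i by (rule lsm_sum[OF op 4])
      show ?thesis
        unfolding dz_sum(1)[OF op 5 p] dz_sum(1)[OF op 4 p] dz_add(1)[OF 1 3 p] dz_sum(1)[OF op 2 p] wt(1)[OF p ca cc] wl(1)[OF p ca cay] da[OF p]
        by (simp add: Y'_def q_def)
    qed
    also have "\<dots> = (\<Sum>i\<in>UNIV. \<Sum>j\<in>UNIV. c i p * cnj (c j p) * H i j q) + (\<Sum>i\<in>UNIV. \<Sum>j\<in>UNIV. a X i p * cnj (c j p) * dz Y' (H i j) q)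
      + (\<Sum>i\<in>UNIV. \<Sum>j\<in>UNIV. c i p * cnj (a X j p) * db Y' (H i j) q) + (\<Sum>i\<in>UNIV. \<Sum>j\<in>UNIV. a X i p * cnj (a X j p) * dz Y' (db Y' (H i j)) q)"
    proof -
      have 1: "db Y' (H i j) q = (\<Sum>l\<in>UNIV. cnj (y l p) * db (?e l) (H i j) q)" for i j
        using dz_basis(2)[OF lH q, of Y'] by (simp add: y_def Y'_def)
      have opT: "open T" using lsm_openD[OF u] .
      have 2: "dz Y' (db Y' (H i j)) q = (\<Sum>l\<in>UNIV. cnj (y l p) * dz Y' (db (?e l) (H i j)) q)" for i j
      proof -
        have "dz Y' (db Y' (H i j)) q = dz Y' (\<lambda>w. \<Sum>l\<in>UNIV. cnj (y l p) * db (?e l) (H i j) w) q"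
          by (rule dz_cong[OF opT q]) (use dz_basis(2)[OF lH, of _ Y'] in \<open>simp add: y_def Y'_def\<close>)
        also have "\<dots> = (\<Sum>l\<in>UNIV. cnj (y l p) * dz Y' (db (?e l) (H i j)) q)"
          by (subst dz_sum(1)[OF opT _ q]) (auto intro!: lsm_mult lsm_const opT lsm_db lH simp: dz_cmult(1)[OF lsm_db[OF lH] q])
        finally show ?thesis .
      qed
      show ?thesis unfolding 1 2 by (simp add: sum.distrib sum_distrib_left mult_ac)
    qed
    finally show ?thesis unfolding dzdb_basis[OF u q, where a = W and b = W] dz_dzdb_basis[OF u q, where c = Y' and a = X' and b = W]
        db_dzdb_basis[OF u q, where c = Y' and a = W and b = X'] dz_db_dzdb_basis[OF u q, where d = Y' and c = Y' and a = X' and b = X']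
      by (simp add: a_def c_def H_def X'_def W_def)
  qed
  have opT: "open T" using lsm_openD[OF u] .
  have *: "dz A (db (V' + W) u) y = dz A (db V' u) y + dz A (db W u) y" if "y \<in> T" for A y
  proof -
    have "dz A (db (V' + W) u) y = dz A (\<lambda>z. db V' u z + db W u z) y"
      by (rule dz_cong[OF opT that]) (rule dz_linear(3)[OF u])
    also have "\<dots> = dz A (db V' u) y + dz A (db W u) y" by (rule dz_add(1)[OF lsm_db[OF u] lsm_db[OF u] that])
    finally show ?thesis .
  qed
  have e1: "dz (V' + W) (db (V' + W) u) q = dz V' (db V' u) q + dz V' (db W u) q + (dz W (db V' u) q + dz W (db W u) q)"
    by (simp only: dz_linear(1)[OF lsm_db[OF u] q] *[OF q] ac_simps)
  have e2: "dz Y' (dz X' (db (V' + W) u)) q = dz Y' (dz X' (db V' u)) q + dz Y' (dz X' (db W u)) q"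
  proof -
    have "dz Y' (dz X' (db (V' + W) u)) q = dz Y' (\<lambda>y. dz X' (db V' u) y + dz X' (db W u) y) q"
      by (rule dz_cong[OF opT q]) (rule *)
    also have "\<dots> = dz Y' (dz X' (db V' u)) q + dz Y' (dz X' (db W u)) q" by (rule dz_add(1)[OF lsm_dzdb[OF u] lsm_dzdb[OF u] q])
    finally show ?thesis .
  qed
  have e3: "db Y' (dz (V' + W) (db X' u)) q = db Y' (dz V' (db X' u)) q + db Y' (dz W (db X' u)) q"
  proof -
    have "db Y' (dz (V' + W) (db X' u)) q = db Y' (\<lambda>y. dz V' (db X' u) y + dz W (db X' u) y) q"
      by (rule db_cong[OF opT q]) (rule dz_linear(1)[OF lsm_db[OF u]])
    also have "\<dots> = db Y' (dz V' (db X' u)) q + db Y' (dz W (db X' u)) q" by (rule dz_add(2)[OF lsm_dzdb[OF u] lsm_dzdb[OF u] q])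
    finally show ?thesis .
  qed
  show ?thesis
    unfolding lev_def T1 T2 T3 T4 X'_def[symmetric] Y'_def[symmetric] V'_def[symmetric] W_def[symmetric] q_def[symmetric] e1 e2 e3
    by simp
qed

section \<open>Kaehler metrics with a potential and their curvature\<close>

definition pot_metric :: "(complex^'n \<Rightarrow> complex) \<Rightarrow> complex^'n \<Rightarrow> complex^'n^'n" where
  "pot_metric u z = (\<chi> i j. dz (axis i 1) (db (axis j 1) u) z)"

lemma herm_form_pot_metric:
  assumes "lsm u S" "z \<in> S"
  shows "herm_form (pot_metric u z) X V = dz X (db V u) z"
  unfolding dzdb_basis[OF assms, where a = X and b = V] herm_form_def pot_metric_def by (simp add: mult_ac)

lemma dzdb_hermitian:
  assumes u: "lsm (\<lambda>z. complex_of_real (\<phi> z)) S" and z: "z \<in> S"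
  shows "cnj (dz a (db b (\<lambda>z. complex_of_real (\<phi> z))) z) = dz b (db a (\<lambda>z. complex_of_real (\<phi> z))) z"
proof -
  let ?u = "\<lambda>z. complex_of_real (\<phi> z)"
  have op: "open S" using lsm_openD[OF u] .
  have "db a ?u w = cnj (dz a ?u w)" if "w \<in> S" for w
    using dz_cnj(2)[OF u that, of a] by simp
  then have "dz b (db a ?u) z = dz b (\<lambda>w. cnj (dz a ?u w)) z" by (rule dz_cong[OF op z])
  also have "\<dots> = cnj (db b (dz a ?u) z)" by (rule dz_cnj(1)[OF lsm_dz[OF u] z])
  also have "db b (dz a ?u) z = dz a (db b ?u) z" using dz_commute(2)[OF u z] by simp
  finally show ?thesis by simp
qed

lemma lsm_pot_metric: "lsm u S \<Longrightarrow> lsm (pot_metric u) S"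
  by (rule lsm_vec[OF lsm_openD], assumption)+ (auto simp: pot_metric_def intro: lsm_dzdb)

lemma dird_eq_dz_db: "dird v u z = dz v u z + db v u z"
  by (simp add: dz_def db_def field_simps)

text \<open>Closedness of the fundamental form is the symmetry of the third derivatives of the potential.\<close>

lemma pot_metric_kaehler:
  assumes u: "lsm (\<lambda>z. complex_of_real (\<phi> z)) S" (is "lsm ?u S")
    and pos: "\<And>z X. z \<in> S \<Longrightarrow> X \<noteq> 0 \<Longrightarrow> 0 < Re (dz X (db X (\<lambda>z. complex_of_real (\<phi> z))) z)"
  shows "kaehler_metric_on S (pot_metric (\<lambda>z. complex_of_real (\<phi> z)))"
  unfolding kaehler_metric_on_def hermitian_metric_on_def
proof (intro conjI ballI allI impI)
  have op: "open S" using lsm_openD[OF u] .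
  show "smooth_on (pot_metric ?u) S" by (rule lsm_smooth_on[OF lsm_pot_metric[OF u]])
  show "pot_metric ?u z $ j $ i = cnj (pot_metric ?u z $ i $ j)" if "z \<in> S" for z i j
    by (simp add: pot_metric_def dzdb_hermitian[OF u that])
  show "0 < Re (herm_form (pot_metric ?u z) X X)" if "z \<in> S" "X \<noteq> 0" for z X
    unfolding herm_form_pot_metric[OF u that(1)] by (rule pos[OF that])
  show "ext_deriv2 (fundamental_form (pot_metric ?u)) z a b c = 0" if z: "z \<in> S" for z a b c
  proof -
    define g where "g x y = dz x (db y ?u)" for x y
    have lg: "lsm (g x y) S" for x y unfolding g_def by (rule lsm_dzdb[OF u])
    have ff: "fundamental_form (pot_metric ?u) w x y = - Im (g x y w)" if "w \<in> S" for w x y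
      unfolding fundamental_form_def herm_form_pot_metric[OF u that] g_def ..
    have D: "dird v (\<lambda>w. fundamental_form (pot_metric ?u) w x y) z = - Im (dird v (g x y) z)" for v x y
    proof -
      have "dird v (\<lambda>w. fundamental_form (pot_metric ?u) w x y) z = dird v (\<lambda>w. - Im (g x y w)) z"
        using frechet_derivative_eq_open[OF op z ff] by simp
      also have "\<dots> = - Im (dird v (g x y) z)"
        by (rule dird_eqI) (intro has_derivative_minus bounded_linear.has_derivative[OF bounded_linear_Im] lsm_has_derivative[OF lg z])
      finally show ?thesis .
    qed
    have sym: "cnj (dird v (g x y) z) = dird v (g y x) z" for v x y
    proof -
      have "dird v (g y x) z = dird v (\<lambda>w. cnj (g x y w)) z"
        using frechet_derivative_eq_open[OF op z, of "g y x" "\<lambda>w. cnj (g x y w)"] dzdb_hermitian[OF u] by (simp add: g_def)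
      also have "\<dots> = cnj (dird v (g x y) z)"
        by (rule dird_eqI) (intro has_derivative_cnj lsm_has_derivative[OF lg z])
      finally show ?thesis by simp
    qed
    have Im: "complex_of_real (Im (dird v (g x y) z)) = (dird v (g x y) z - dird v (g y x) z) / (2 * \<i>)" for v x y
    proof -
      have "complex_of_real (Im d) = (d - cnj d) / (2 * \<i>)" for d by (simp add: complex_diff_cnj algebra_simps)
      then show ?thesis unfolding sym[of x y v, symmetric] .
    qed
    define t where "t x y w = dz x (dz y (db w ?u)) z" for x y w
    define s where "s x y w = dz x (db y (db w ?u)) z" for x y w
    have Dg: "dird v (g x y) z = t v x y + s x v y" for v x y
      unfolding dird_eq_dz_db g_def t_def s_def by (simp add: dz_commute(2)[OF lsm_db[OF u] z])
    have ts: "t x y w = t y x w" for x y w unfolding t_def by (rule dz_commute(1)[OF lsm_db[OF u] z])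
    have ss: "s x y w = s x w y" for x y w unfolding s_def by (rule dz_cong[OF op z]) (rule dz_commute(3)[OF u])
    have "complex_of_real (ext_deriv2 (fundamental_form (pot_metric ?u)) z a b c) = 0"
      unfolding ext_deriv2_def D of_real_diff of_real_add of_real_minus Im
      unfolding Dg
      using ts[of a b c] ts[of a c b] ts[of b c a] ss[of a b c] ss[of b a c] ss[of c a b] by (simp add: field_simps)
    then show ?thesis by simp
  qed
qed

lemma sum_swap_into4:
  "(\<Sum>t\<in>T. \<Sum>i\<in>A. \<Sum>j\<in>B. \<Sum>k\<in>C. \<Sum>l\<in>D. f t i j k l) = (\<Sum>i\<in>A. \<Sum>j\<in>B. \<Sum>k\<in>C. \<Sum>l\<in>D. \<Sum>t\<in>T. f t i j k l)"
  by (simp only: sum.swap[where A = T])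

text \<open>The terms of \<open>lev\<close> that are linear in \<open>V\<close> are \<open>- 2 Re h(V, V\<^sub>0)\<close> for the vector \<open>V\<^sub>0\<close> that represents the derivative of the metric, and
\<open>h(V\<^sub>0, V\<^sub>0)\<close> is the quadratic term of the curvature tensor. Completing the square leaves minus the curvature.\<close>

lemma curv_tensor_lev:
  assumes u: "lsm (\<lambda>z. complex_of_real (\<phi> z)) S" (is "lsm ?u S")
    and pos: "\<And>X. X \<noteq> 0 \<Longrightarrow> 0 < Re (dz X (db X (\<lambda>z. complex_of_real (\<phi> z))) p)" and p: "p \<in> S"
  obtains V0 where "\<And>V. lev ?u p X Y V = - curv_tensor (pot_metric ?u) p X X Y Y + dz (V - V0) (db (V - V0) ?u) p"
proof -
  have op: "open S" using lsm_openD[OF u] .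
  let ?e = "\<lambda>i. axis i (1::complex)"
  define H where "H i j = dz (?e i) (db (?e j) ?u)" for i j
  define P where "P = pot_metric ?u p"
  define Q where "Q = matrix_inv P"
  have PH: "P $ i $ j = H i j p" for i j by (simp add: P_def pot_metric_def H_def)
  have hf: "dz A (db B ?u) p = (\<Sum>i\<in>UNIV. \<Sum>j\<in>UNIV. A $ i * cnj (B $ j) * P $ i $ j)" for A B
    unfolding dzdb_basis[OF u p, where a = A and b = B] PH H_def ..
  have inv: "invertible P"
  proof -
    have "\<forall>X. transpose P *v X = 0 \<longrightarrow> X = 0"
    proof (intro allI impI)
      fix X assume X: "transpose P *v X = 0"
      have "(\<Sum>i\<in>UNIV. P $ i $ j * X $ i) = 0" for j
        using X by (simp add: vec_eq_iff matrix_vector_mult_def transpose_def)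
      then have "(\<Sum>j\<in>UNIV. cnj (X $ j) * (\<Sum>i\<in>UNIV. P $ i $ j * X $ i)) = 0" by simp
      moreover have "dz X (db X ?u) p = (\<Sum>j\<in>UNIV. cnj (X $ j) * (\<Sum>i\<in>UNIV. P $ i $ j * X $ i))"
        unfolding hf by (subst sum.swap) (simp add: sum_distrib_left mult_ac)
      ultimately show "X = 0" using pos[of X] by force
    qed
    then have "invertible (transpose P)"
      by (simp add: matrix_left_invertible_ker invertible_left_inverse)
    then show ?thesis by (simp add: invertible_det_nz)
  qed
  have QP: "Q ** P = mat 1" unfolding Q_def matrix_inv_def using inv someI_ex[of "\<lambda>A'. P ** A' = mat 1 \<and> A' ** P = mat 1"] unfolding invertible_def by blast
  define b where "b t = dz Y (dz X (db (?e t) ?u)) p" for t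
  (* V0 is defined by h(V0, B) = - (the derivative of h(X, B) in direction Y) for all B. *)
  define V0 where "V0 = (\<chi> i. - (\<Sum>t\<in>UNIV. b t * Q $ t $ i))"
  have PV0: "(\<Sum>i\<in>UNIV. P $ i $ j * V0 $ i) = - b j" for j
  proof -
    have "(\<Sum>i\<in>UNIV. P $ i $ j * V0 $ i) = - (\<Sum>i\<in>UNIV. \<Sum>t\<in>UNIV. b t * (Q $ t $ i * P $ i $ j))"
      by (simp add: V0_def sum_distrib_left sum_negf mult_ac)
    also have "(\<Sum>i\<in>UNIV. \<Sum>t\<in>UNIV. b t * (Q $ t $ i * P $ i $ j)) = (\<Sum>t\<in>UNIV. b t * (Q ** P) $ t $ j)"
      by (subst sum.swap) (simp add: matrix_matrix_mult_def sum_distrib_left)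
    also have "\<dots> = b j" unfolding QP mat_def by (simp add: if_distrib cong: if_cong)
    finally show ?thesis .
  qed
  have hV0: "dz V0 (db B ?u) p = - (\<Sum>j\<in>UNIV. b j * cnj (B $ j))" for B
  proof -
    have "dz V0 (db B ?u) p = (\<Sum>j\<in>UNIV. cnj (B $ j) * (\<Sum>i\<in>UNIV. P $ i $ j * V0 $ i))"
      unfolding hf by (subst sum.swap) (simp add: sum_distrib_left mult_ac)
    then show ?thesis unfolding PV0 by (simp add: sum_negf mult.commute)
  qed
  note herm = dzdb_hermitian[OF u]
  have bH: "b t = (\<Sum>i\<in>UNIV. \<Sum>k\<in>UNIV. X $ i * Y $ k * dz (?e k) (H i t) p)" for t
  proof -
    have "b t = (\<Sum>i\<in>UNIV. \<Sum>j\<in>UNIV. X $ i * cnj (?e t $ j) * dz Y (H i j) p)"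
      unfolding b_def dz_dzdb_basis[OF u p, where c = Y and a = X and b = "?e t"] H_def ..
    also have "\<dots> = (\<Sum>i\<in>UNIV. X $ i * dz Y (H i t) p)"
      by (simp add: axis_def if_distrib[of cnj] if_distrib[of "\<lambda>x. x * _"] if_distrib[of "\<lambda>x. _ * x"] cong: if_cong)
    also have "\<dots> = (\<Sum>i\<in>UNIV. \<Sum>k\<in>UNIV. X $ i * Y $ k * dz (?e k) (H i t) p)"
      unfolding H_def dz_basis(1)[OF lsm_dzdb[OF u] p, of Y] by (simp add: sum_distrib_left mult_ac)
    finally show ?thesis .
  qed
  have bs: "cnj (b s) = db Y (dz (?e s) (db X ?u)) p" for s
  proof -
    have "db Y (dz (?e s) (db X ?u)) p = db Y (\<lambda>w. cnj (dz X (db (?e s) ?u) w)) p"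
      by (rule db_cong[OF op p]) (simp add: herm)
    then show ?thesis unfolding dz_cnj(2)[OF lsm_dzdb[OF u] p] b_def by simp
  qed
  have bsH: "cnj (b s) = (\<Sum>j\<in>UNIV. \<Sum>l\<in>UNIV. cnj (X $ j) * cnj (Y $ l) * db (?e l) (H s j) p)" for s
  proof -
    have "cnj (b s) = (\<Sum>i\<in>UNIV. \<Sum>j\<in>UNIV. ?e s $ i * cnj (X $ j) * db Y (H i j) p)"
      unfolding bs db_dzdb_basis[OF u p, where c = Y and a = "?e s" and b = X] H_def ..
    also have "\<dots> = (\<Sum>j\<in>UNIV. \<Sum>i\<in>UNIV. ?e s $ i * cnj (X $ j) * db Y (H i j) p)" by (rule sum.swap)
    also have "\<dots> = (\<Sum>j\<in>UNIV. cnj (X $ j) * db Y (H s j) p)"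
      by (simp add: axis_def if_distrib[of "\<lambda>x. x * _"] cong: if_cong)
    also have "\<dots> = (\<Sum>j\<in>UNIV. \<Sum>l\<in>UNIV. cnj (X $ j) * cnj (Y $ l) * db (?e l) (H s j) p)"
      unfolding H_def dz_basis(2)[OF lsm_dzdb[OF u] p, of Y] by (simp add: sum_distrib_left mult_ac)
    finally show ?thesis .
  qed
  define T1 where "T1 = dz Y (db Y (dz X (db X ?u))) p"
  have T1: "T1 = (\<Sum>i\<in>UNIV. \<Sum>j\<in>UNIV. \<Sum>k\<in>UNIV. \<Sum>l\<in>UNIV. X $ i * cnj (X $ j) * (Y $ k * cnj (Y $ l) * dz (?e k) (db (?e l) (H i j)) p))"
    unfolding T1_def dz_db_dzdb_basis[OF u p, where d = Y and c = Y and a = X and b = X] H_def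
    unfolding dzdb_basis[OF lsm_dzdb[OF u] p, where a = Y and b = Y] by (simp add: sum_distrib_left)
  have R2: "(\<Sum>s\<in>UNIV. \<Sum>t\<in>UNIV. Q $ t $ s * b t * cnj (b s)) = dz V0 (db V0 ?u) p"
  proof -
    have "(\<Sum>s\<in>UNIV. \<Sum>t\<in>UNIV. Q $ t $ s * b t * cnj (b s)) = - (\<Sum>s\<in>UNIV. cnj (b s) * V0 $ s)"
      by (simp add: V0_def sum_distrib_left sum_negf mult_ac)
    also have "\<dots> = cnj (dz V0 (db V0 ?u) p)" unfolding hV0 by (simp add: mult.commute)
    finally show ?thesis unfolding herm[OF p] .
  qed
  have curv: "curv_tensor (pot_metric ?u) p X X Y Y = - T1 + dz V0 (db V0 ?u) p"
  proof -
    have cc: "curv_coeff (pot_metric ?u) p i j k l = - dz (?e k) (db (?e l) (H i j)) p + (\<Sum>s\<in>UNIV. \<Sum>t\<in>UNIV. Q $ t $ s * dz (?e k) (H i t) p * db (?e l) (H s j) p)" for i j k l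
      unfolding curv_coeff_def wirtinger_dz_eq wirtinger_dzbar_eq inverse_coeff_def P_def[symmetric] Q_def[symmetric]
      by (simp add: wirtinger_dzbar_eq[abs_def] pot_metric_def H_def)
    have 1: "(\<Sum>i\<in>UNIV. \<Sum>j\<in>UNIV. \<Sum>k\<in>UNIV. \<Sum>l\<in>UNIV. (\<Sum>s\<in>UNIV. \<Sum>t\<in>UNIV. Q $ t $ s * dz (?e k) (H i t) p * db (?e l) (H s j) p) * X $ i * cnj (X $ j) * Y $ k * cnj (Y $ l))
      = (\<Sum>s\<in>UNIV. \<Sum>t\<in>UNIV. Q $ t $ s * b t * cnj (b s))"
    proof -
      have "(\<Sum>s\<in>UNIV. \<Sum>t\<in>UNIV. Q $ t $ s * b t * cnj (b s)) = 
        (\<Sum>s\<in>UNIV. \<Sum>t\<in>UNIV. \<Sum>i\<in>UNIV. \<Sum>j\<in>UNIV. \<Sum>k\<in>UNIV. \<Sum>l\<in>UNIV. Q $ t $ s * dz (?e k) (H i t) p * db (?e l) (H s j) p * X $ i * cnj (X $ j) * Y $ k * cnj (Y $ l))"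
      proof (intro sum.cong refl)
        fix s t
        have "b t * cnj (b s) = (\<Sum>i\<in>UNIV. \<Sum>j\<in>UNIV. (\<Sum>k\<in>UNIV. X $ i * Y $ k * dz (?e k) (H i t) p) * (\<Sum>l\<in>UNIV. cnj (X $ j) * cnj (Y $ l) * db (?e l) (H s j) p))"
          unfolding bsH bH[of t] by (rule sum_product)
        also have "\<dots> = (\<Sum>i\<in>UNIV. \<Sum>j\<in>UNIV. \<Sum>k\<in>UNIV. \<Sum>l\<in>UNIV. (X $ i * Y $ k * dz (?e k) (H i t) p) * (cnj (X $ j) * cnj (Y $ l) * db (?e l) (H s j) p))"
          unfolding sum_product ..
        finally show "Q $ t $ s * b t * cnj (b s) = (\<Sum>i\<in>UNIV. \<Sum>j\<in>UNIV. \<Sum>k\<in>UNIV. \<Sum>l\<in>UNIV. Q $ t $ s * dz (?e k) (H i t) p * db (?e l) (H s j) p * X $ i * cnj (X $ j) * Y $ k * cnj (Y $ l))"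
          unfolding mult.assoc by (simp add: sum_distrib_left mult_ac)
      qed
      also have "\<dots> = (\<Sum>s\<in>UNIV. \<Sum>i\<in>UNIV. \<Sum>j\<in>UNIV. \<Sum>k\<in>UNIV. \<Sum>l\<in>UNIV. \<Sum>t\<in>UNIV. Q $ t $ s * dz (?e k) (H i t) p * db (?e l) (H s j) p * X $ i * cnj (X $ j) * Y $ k * cnj (Y $ l))"
        by (rule sum.cong[OF refl]) (rule sum_swap_into4)
      also have "\<dots> = (\<Sum>i\<in>UNIV. \<Sum>j\<in>UNIV. \<Sum>k\<in>UNIV. \<Sum>l\<in>UNIV. \<Sum>s\<in>UNIV. \<Sum>t\<in>UNIV. Q $ t $ s * dz (?e k) (H i t) p * db (?e l) (H s j) p * X $ i * cnj (X $ j) * Y $ k * cnj (Y $ l))"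
        by (rule sum_swap_into4)
      finally show ?thesis by (simp add: sum_distrib_right)
    qed
    have "curv_tensor (pot_metric ?u) p X X Y Y = - T1 + (\<Sum>s\<in>UNIV. \<Sum>t\<in>UNIV. Q $ t $ s * b t * cnj (b s))"
      unfolding curv_tensor_def cc T1 1[symmetric] by (simp add: right_diff_distrib sum_subtractf mult_ac)
    then show ?thesis unfolding R2 .
  qed
  show ?thesis
  proof (rule that)
    fix V
    have T2: "dz Y (dz X (db V ?u)) p = - dz V0 (db V ?u) p"
    proof -
      have opS: "open S" by fact
      have "dz Y (dz X (db V ?u)) p = dz Y (\<lambda>z. \<Sum>j\<in>UNIV. cnj (V $ j) * dz X (db (?e j) ?u) z) p"
      proof (rule dz_cong[OF op p])
        fix w assume w: "w \<in> S"
        have "dz X (db V ?u) w = dz X (\<lambda>z. \<Sum>j\<in>UNIV. cnj (V $ j) * db (?e j) ?u z) w"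
          by (rule dz_cong[OF op w dz_basis(2)[OF u]])
        also have "\<dots> = (\<Sum>j\<in>UNIV. cnj (V $ j) * dz X (db (?e j) ?u) w)"
          by (subst dz_sum(1)[OF op _ w]) (auto intro!: lsm_mult lsm_const op lsm_db u simp: dz_cmult(1)[OF lsm_db[OF u] w])
        finally show "dz X (db V ?u) w = (\<Sum>j\<in>UNIV. cnj (V $ j) * dz X (db (?e j) ?u) w)" .
      qed
      also have "\<dots> = (\<Sum>j\<in>UNIV. cnj (V $ j) * b j)"
        by (subst dz_sum(1)[OF op _ p]) (auto intro!: lsm_mult lsm_const op lsm_dzdb u simp: dz_cmult(1)[OF lsm_dzdb[OF u] p] b_def)
      finally show ?thesis unfolding hV0 by (simp add: mult.commute)
    qed
    have T3: "db Y (dz V (db X ?u)) p = - dz V (db V0 ?u) p"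
    proof -
      have "db Y (dz V (db X ?u)) p = db Y (\<lambda>w. cnj (dz X (db V ?u) w)) p"
        by (rule db_cong[OF op p]) (simp add: herm)
      then have "db Y (dz V (db X ?u)) p = cnj (dz Y (dz X (db V ?u)) p)" unfolding dz_cnj(2)[OF lsm_dzdb[OF u] p] .
      then show ?thesis unfolding T2 by (simp add: herm[OF p])
    qed
    have sq: "dz (V - V0) (db (V - V0) ?u) p = dz V (db V ?u) p - dz V (db V0 ?u) p - dz V0 (db V ?u) p + dz V0 (db V0 ?u) p"
      unfolding hf by (simp add: sum.distrib sum_subtractf algebra_simps)
    show "lev ?u p X Y V = - curv_tensor (pot_metric ?u) p X X Y Y + dz (V - V0) (db (V - V0) ?u) p"
      unfolding lev_def T1_def[symmetric] T2 T3 curv sq by simp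
  qed
qed

lemma HBC_bounds:
  assumes u: "lsm (\<lambda>z. complex_of_real (\<phi> z)) S" (is "lsm ?u S")
    and pos: "\<And>X. X \<noteq> 0 \<Longrightarrow> 0 < Re (dz X (db X (\<lambda>z. complex_of_real (\<phi> z))) p)" and p: "p \<in> S"
    and XY: "X \<noteq> 0" "Y \<noteq> 0"
  shows "(\<And>V. c * (Re (dz X (db X ?u) p) * Re (dz Y (db Y ?u) p)) \<le> Re (lev ?u p X Y V)) \<Longrightarrow> HBC (pot_metric ?u) p X Y \<le> - c"
    and "Re (lev ?u p X Y V) \<le> C * (Re (dz X (db X ?u) p) * Re (dz Y (db Y ?u) p)) \<Longrightarrow> - C \<le> HBC (pot_metric ?u) p X Y"
proof -
  define h where "h X = Re (dz X (db X ?u) p)" for X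
  have hh: "herm_form (pot_metric ?u p) X X = of_real (h X)" for X
  proof -
    have "cnj (dz X (db X ?u) p) = dz X (db X ?u) p" by (rule dzdb_hermitian[OF u p])
    then show ?thesis unfolding herm_form_pot_metric[OF u p] h_def by (simp add: complex_eq_iff)
  qed
  have hp: "h X * h Y > 0" using pos XY by (simp add: h_def)
  define R where "R = Re (curv_tensor (pot_metric ?u) p X X Y Y)"
  have HBC: "HBC (pot_metric ?u) p X Y = R / (h X * h Y)"
    unfolding HBC_def hh R_def by (simp flip: of_real_mult)
  obtain V0 where V0: "\<And>V. lev ?u p X Y V = - curv_tensor (pot_metric ?u) p X X Y Y + dz (V - V0) (db (V - V0) ?u) p"
    using curv_tensor_lev[OF u pos p] by blast
  have z: "dz 0 (db 0 ?u) p = 0" by (rule dz_zero[OF lsm_db[OF u] p])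
  show "HBC (pot_metric ?u) p X Y \<le> - c" if "\<And>V. c * (Re (dz X (db X ?u) p) * Re (dz Y (db Y ?u) p)) \<le> Re (lev ?u p X Y V)"
  proof -
    have "c * (h X * h Y) \<le> - R" using that[of V0] unfolding V0 z[simplified] h_def[symmetric] R_def by (simp add: z)
    then show ?thesis unfolding HBC using hp by (simp add: divide_le_eq)
  qed
  show "- C \<le> HBC (pot_metric ?u) p X Y" if "Re (lev ?u p X Y V) \<le> C * (Re (dz X (db X ?u) p) * Re (dz Y (db Y ?u) p))"
  proof -
    have "0 \<le> Re (dz (V - V0) (db (V - V0) ?u) p)" using pos[of "V - V0"] z by (cases "V - V0 = 0") auto
    then have "- R \<le> C * (h X * h Y)" using that unfolding V0 h_def R_def by simp
    then show ?thesis unfolding HBC using hp by (simp add: le_divide_eq)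
  qed
qed

section \<open>Levi forms of the model potentials\<close>

lemma lev_add:
  assumes u: "lsm u S" and w: "lsm w S" and p: "p \<in> S"
  shows "lev (\<lambda>z. u z + w z) p X Y V = lev u p X Y V + lev w p X Y V"
    and "dz X (db V (\<lambda>z. u z + w z)) p = dz X (db V u) p + dz X (db V w) p"
proof -
  have op: "open S" using lsm_openD[OF u] .
  have 1: "dz A (db B (\<lambda>z. u z + w z)) z = dz A (db B u) z + dz A (db B w) z" if "z \<in> S" for A B z
    using dz_cong[OF op that, of "db B (\<lambda>z. u z + w z)" "\<lambda>z. db B u z + db B w z" A] dz_add(2)[OF u w] dz_add(1)[OF lsm_db[OF u] lsm_db[OF w] that] by simp
  have 2: "dz C (dz A (db B (\<lambda>z. u z + w z))) p = dz C (dz A (db B u)) p + dz C (dz A (db B w)) p" for A B C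
    using dz_cong[OF op p, of "dz A (db B (\<lambda>z. u z + w z))" "\<lambda>z. dz A (db B u) z + dz A (db B w) z" C] 1 dz_add(1)[OF lsm_dzdb[OF u] lsm_dzdb[OF w] p] by simp
  have 3: "db C (dz A (db B (\<lambda>z. u z + w z))) z = db C (dz A (db B u)) z + db C (dz A (db B w)) z" if "z \<in> S" for A B C z
    using db_cong[OF op that, of "dz A (db B (\<lambda>z. u z + w z))" "\<lambda>z. dz A (db B u) z + dz A (db B w) z" C] 1 dz_add(2)[OF lsm_dzdb[OF u] lsm_dzdb[OF w] that] by simp
  have 4: "dz D (db C (dz A (db B (\<lambda>z. u z + w z)))) p = dz D (db C (dz A (db B u))) p + dz D (db C (dz A (db B w))) p" for A B C D
    using dz_cong[OF op p, of "db C (dz A (db B (\<lambda>z. u z + w z)))" "\<lambda>z. db C (dz A (db B u)) z + db C (dz A (db B w)) z" D] 3 dz_add(1)[OF lsm_db[OF lsm_dzdb[OF u]] lsm_db[OF lsm_dzdb[OF w]] p] by simp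
  show "lev (\<lambda>z. u z + w z) p X Y V = lev u p X Y V + lev w p X Y V"
    unfolding lev_def 1[OF p] 2 3[OF p] 4 by simp
  show "dz X (db V (\<lambda>z. u z + w z)) p = dz X (db V u) p + dz X (db V w) p" by (rule 1[OF p])
qed

lemma lev_cmult:
  assumes u: "lsm u S" and p: "p \<in> S"
  shows "lev (\<lambda>z. c * u z) p X Y V = c * lev u p X Y V"
    and "dz X (db V (\<lambda>z. c * u z)) p = c * dz X (db V u) p"
proof -
  have op: "open S" using lsm_openD[OF u] .
  have 1: "dz A (db B (\<lambda>z. c * u z)) z = c * dz A (db B u) z" if "z \<in> S" for A B z
    using dz_cong[OF op that, of "db B (\<lambda>z. c * u z)" "\<lambda>z. c * db B u z" A] dz_cmult(2)[OF u] dz_cmult(1)[OF lsm_db[OF u] that] by simp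
  have 2: "dz C (dz A (db B (\<lambda>z. c * u z))) p = c * dz C (dz A (db B u)) p" for A B C
    using dz_cong[OF op p, of "dz A (db B (\<lambda>z. c * u z))" "\<lambda>z. c * dz A (db B u) z" C] 1 dz_cmult(1)[OF lsm_dzdb[OF u] p] by simp
  have 3: "db C (dz A (db B (\<lambda>z. c * u z))) z = c * db C (dz A (db B u)) z" if "z \<in> S" for A B C z
    using db_cong[OF op that, of "dz A (db B (\<lambda>z. c * u z))" "\<lambda>z. c * dz A (db B u) z" C] 1 dz_cmult(2)[OF lsm_dzdb[OF u] that] by simp
  have 4: "dz D (db C (dz A (db B (\<lambda>z. c * u z)))) p = c * dz D (db C (dz A (db B u))) p" for A B C D
    using dz_cong[OF op p, of "db C (dz A (db B (\<lambda>z. c * u z)))" "\<lambda>z. c * db C (dz A (db B u)) z" D] 3 dz_cmult(1)[OF lsm_db[OF lsm_dzdb[OF u]] p] by simp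
  show "lev (\<lambda>z. c * u z) p X Y V = c * lev u p X Y V"
    unfolding lev_def 1[OF p] 2 3[OF p] 4 by (simp add: algebra_simps)
  show "dz X (db V (\<lambda>z. c * u z)) p = c * dz X (db V u) p" by (rule 1[OF p])
qed

lemma lev_cong:
  assumes op: "open S" and p: "p \<in> S" and eq: "\<And>z. z \<in> S \<Longrightarrow> u z = w z"
  shows "lev u p X Y V = lev w p X Y V" and "dz X (db V u) p = dz X (db V w) p"
proof -
  have 1: "dz A (db B u) z = dz A (db B w) z" if "z \<in> S" for A B z
    by (rule dz_cong[OF op that db_cong[OF op _ eq]])
  have 3: "db C (dz A (db B u)) z = db C (dz A (db B w)) z" if "z \<in> S" for A B C z
    by (rule db_cong[OF op that 1])
  have 2: "dz C (dz A (db B u)) z = dz C (dz A (db B w)) z" if "z \<in> S" for A B C z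
    by (rule dz_cong[OF op that 1])
  have 4: "dz D (db C (dz A (db B u))) p = dz D (db C (dz A (db B w))) p" for A B C D
    by (rule dz_cong[OF op p 3])
  show "lev u p X Y V = lev w p X Y V" unfolding lev_def 1[OF p] 2[OF p] 3[OF p] 4 ..
  show "dz X (db V u) p = dz X (db V w) p" by (rule 1[OF p])
qed

lemma lev_zero: "lev (\<lambda>z. 0) p X Y V = 0"
  by (simp add: lev_def dz_const[abs_def])

text \<open>One application of \<open>CB\<close> with \<open>k = 4\<close> covers all four terms, the mixed ones by \<open>2 a b \<le> a\<^sup>2 + b\<^sup>2\<close>.\<close>

lemma lev_CB_bound:
  assumes op: "open S" and u: "CB 4 M u S" and p: "p \<in> S" and M: "M \<ge> 0"
  shows "norm (lev u p X Y V) \<le> 2 * M * ((norm X)\<^sup>2 * (norm Y)\<^sup>2 + (norm V)\<^sup>2)"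
    and "norm (dz X (db X u) p) \<le> M * (norm X)\<^sup>2"
proof -
  have u4: "CB (Suc (Suc (Suc (Suc 0)))) M u S" using u by (simp add: eval_nat_numeral del: CB.simps)
  have B: "CB (Suc (Suc 0)) (M * norm B * norm A) (dz A (db B u)) S" for A B
    by (intro CB_dz op u4)
  have h: "norm (dz A (db B u) p) \<le> M * norm B * norm A" for A B by (rule CB_norm[OF B p])
  have t: "norm (dz C (dz A (db B u)) p) \<le> M * norm B * norm A * norm C" "norm (db C (dz A (db B u)) p) \<le> M * norm B * norm A * norm C" for A B C
    by (rule CB_norm[OF _ p], rule CB_dz[OF op B])+
  have q: "norm (dz D (db C (dz A (db B u))) p) \<le> M * norm B * norm A * norm C * norm D" for A B C D
    by (rule CB_norm[OF CB_dz(1)[OF op CB_dz(2)[OF op B]] p])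
  show "norm (dz X (db X u) p) \<le> M * (norm X)\<^sup>2" using h[of X X] by (simp add: power2_eq_square mult.assoc)
  have "norm (lev u p X Y V) \<le> M * norm X * norm X * norm Y * norm Y + M * norm V * norm X * norm Y + M * norm X * norm V * norm Y + M * norm V * norm V"
    unfolding lev_def by (intro norm_triangle_mono q t h)
  also have "\<dots> = M * ((norm X * norm Y)\<^sup>2 + 2 * (norm X * norm Y) * norm V + (norm V)\<^sup>2)" by (simp add: power2_eq_square algebra_simps)
  also have "\<dots> \<le> M * (2 * ((norm X * norm Y)\<^sup>2 + (norm V)\<^sup>2))"
    using sum_squares_bound[of "norm X * norm Y" "norm V"] by (intro mult_left_mono M) auto
  finally show "norm (lev u p X Y V) \<le> 2 * M * ((norm X)\<^sup>2 * (norm Y)\<^sup>2 + (norm V)\<^sup>2)" by (simp add: power_mult_distrib mult_ac)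
qed

text \<open>For \<open>u = |A|\<^sup>2\<close> with \<open>A\<close> holomorphic, \<open>h(X, X) = |dA(X)|\<^sup>2\<close> is the square of the modulus of a holomorphic function on the tangent bundle.\<close>

lemma lev_square:
  assumes A: "chol A S" and op: "open S" and p: "p \<in> S"
  shows "lev (\<lambda>z. A z * cnj (A z)) p X Y V = of_real ((norm (dird Y (dird X A) p + dird V A p))\<^sup>2)"
    and "dz X (db V (\<lambda>z. A z * cnj (A z))) p = dird X A p * cnj (dird V A p)"
    and "lsm (\<lambda>z. A z * cnj (A z)) S"
proof -
  have AB: "dz v (\<lambda>z. B z * cnj (C z)) z = dird v B z * cnj (C z)" "db v (\<lambda>z. B z * cnj (C z)) z = B z * cnj (dird v C z)"
    if "chol B S" "chol C S" "z \<in> S" for v B C z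
    using that by (simp_all add: dz_mult[OF chol_lsm[OF _ op] lsm_cnj[OF chol_lsm[OF _ op]]] dz_cnj[OF chol_lsm[OF _ op]] dz_chol)
  have d: "chol (dird v B) S" if "chol B S" for v B by (rule chol_dird[OF that op])
  have 1: "dz a (db b (\<lambda>z. A z * cnj (A z))) z = dird a A z * cnj (dird b A z)" if "z \<in> S" for a b z
    by (rule trans[OF dz_cong[OF op that AB(2)[OF A A]] AB(1)[OF A d[OF A] that]])
  have 2: "dz c (dz a (db b (\<lambda>z. A z * cnj (A z)))) p = dird c (dird a A) p * cnj (dird b A p)" for a b c
    by (rule trans[OF dz_cong[OF op p 1] AB(1)[OF d[OF A] d[OF A] p]])
  have 3: "db c (dz a (db b (\<lambda>z. A z * cnj (A z)))) z = dird a A z * cnj (dird c (dird b A) z)" if "z \<in> S" for a b c z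
    by (rule trans[OF db_cong[OF op that 1] AB(2)[OF d[OF A] d[OF A] that]])
  have 4: "dz e (db c (dz a (db b (\<lambda>z. A z * cnj (A z))))) p = dird e (dird a A) p * cnj (dird c (dird b A) p)" for a b c e
    by (rule trans[OF dz_cong[OF op p 3] AB(1)[OF d[OF A] d[OF d[OF A]] p]])
  show "lev (\<lambda>z. A z * cnj (A z)) p X Y V = of_real ((norm (dird Y (dird X A) p + dird V A p))\<^sup>2)"
    unfolding lev_def 4 2 3[OF p] 1[OF p] complex_norm_square by (simp add: algebra_simps)
  show "dz X (db V (\<lambda>z. A z * cnj (A z))) p = dird X A p * cnj (dird V A p)" by (rule 1[OF p])
  show "lsm (\<lambda>z. A z * cnj (A z)) S" by (intro lsm_mult lsm_cnj chol_lsm A op)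
qed

lemma Re_hip: "Re (hip x y) = inner x y"
  by (simp add: hip_def inner_vec_def inner_complex_def)

lemma chol_hip: "chol (\<lambda>w. hip w a) S"
  unfolding hip_def by (intro chol_sum chol_mult chol_const chol_component)

lemma hip_cnj_right: "(\<lambda>w. hip a w) = (\<lambda>w. cnj (hip w a))"
  by (simp add: hip_cnj)

lemma bounded_linear_hip: "bounded_linear (\<lambda>w. hip w a)"
  unfolding hip_def by (intro bounded_linear_sum bounded_linear_mult_left[THEN bounded_linear_compose] bounded_linear_vec_nth)

lemma dz_hip:
  assumes "open S" "z \<in> S"
  shows "dz v (\<lambda>w. hip w a) z = hip v a" "db v (\<lambda>w. hip w a) z = 0"
    "dz v (\<lambda>w. hip a w) z = 0" "db v (\<lambda>w. hip a w) z = hip a v"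
proof -
  have d: "dird v (\<lambda>w. hip w a) z = hip v a" by (rule dird_eqI, rule bounded_linear_imp_has_derivative[OF bounded_linear_hip])
  show "dz v (\<lambda>w. hip w a) z = hip v a" "db v (\<lambda>w. hip w a) z = 0"
    using dz_chol[OF chol_hip assms(2)] d by simp_all
  show "dz v (\<lambda>w. hip a w) z = 0" "db v (\<lambda>w. hip a w) z = hip a v"
    unfolding hip_cnj_right[of a] dz_cnj[OF chol_lsm[OF chol_hip assms(1)] assms(2)] dz_chol[OF chol_hip assms(2)] d by (simp_all add: hip_cnj)
qed

lemma lsm_hip: "open S \<Longrightarrow> lsm (\<lambda>w. hip w a) S" "open S \<Longrightarrow> lsm (\<lambda>w. hip a w) S"
  unfolding hip_cnj_right[of a] by (intro lsm_cnj chol_lsm chol_hip, assumption)+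

text \<open>Up to the factor \<open>n + 1\<close> the potential of the Bergman metric. As charts are centred, its Levi form is only computed at the origin.\<close>

definition ball_pot :: "complex^'n \<Rightarrow> real" where "ball_pot w = - ln (1 - (norm w)\<^sup>2)"

lemma one_minus_inner_pos: "w \<in> ball 0 1 \<Longrightarrow> 0 < 1 - inner w w"
  by (simp add: dot_square_norm abs_square_less_1)

lemma lsm_of_real: "lsm f S \<Longrightarrow> lsm (\<lambda>z. complex_of_real (f z)) S"
  by (rule lsm_linear[OF bounded_linear_of_real])

lemma lsm_one_minus_inner: "lsm (\<lambda>w. 1 - inner w w) (ball 0 1)"
  by (intro lsm_diff lsm_const lsm_inner lsm_id) auto

lemma lsm_ball_pot: "lsm ball_pot (ball 0 1)"
proof -
  have "lsm (\<lambda>w. - ln (1 - inner w w)) (ball 0 1)"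
    by (intro lsm_minus lsm_compose_real[OF lsm_one_minus_inner lsm_ln]) (use one_minus_inner_pos in auto)
  then show ?thesis unfolding ball_pot_def[abs_def] by (simp add: dot_square_norm)
qed

lemma
  fixes X Y V :: "complex^'n"
  shows dzdb_ball_pot: "dz X (db V (\<lambda>w. complex_of_real (ball_pot w))) 0 = hip X V"
    and lev_ball_pot: "lev (\<lambda>w. complex_of_real (ball_pot w)) 0 X Y V = hip V V + hip X Y * hip Y X + hip X X * hip Y Y"
proof -
  let ?B = "ball 0 1 :: (complex^'n) set"
  let ?u = "\<lambda>w::complex^'n. complex_of_real (ball_pot w)"
  have op: "open ?B" by simp
  have 0: "0 \<in> ?B" by simp
  define G where "G w = complex_of_real (inverse (1 - inner w w))" for w :: "complex^'n"
  have lG: "lsm G ?B" unfolding G_def[abs_def]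
    by (intro lsm_of_real lsm_compose_real[OF lsm_one_minus_inner lsm_inverse]) (use one_minus_inner_pos in auto)
  have G0: "G 0 = 1" by (simp add: G_def)
  have two: "complex_of_real (2 * inner w v) = hip v w + hip w v" for v w :: "complex^'n"
  proof -
    have "hip v w + hip w v = hip v w + cnj (hip v w)" by (simp add: hip_cnj)
    also have "\<dots> = complex_of_real (2 * Re (hip v w))" by (rule complex_add_cnj)
    finally show ?thesis by (simp add: Re_hip inner_commute)
  qed
  have ii: "hip (\<i> *s v) w + hip w (\<i> *s v) = \<i> * hip v w - \<i> * hip w v" for v w :: "complex^'n"
    by (simp add: hip_simps)
  have dn: "((\<lambda>w. 1 - inner w w) has_derivative (\<lambda>v. - (2 * inner w v))) (at w)" for w :: "complex^'n"
    by (auto intro!: derivative_eq_intros simp: inner_commute)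
  have dG: "dz v G w = G w * G w * hip v w" "db v G w = G w * G w * hip w v" if w: "w \<in> ?B" for v w
  proof -
    have nz: "1 - inner w w \<noteq> 0" using one_minus_inner_pos[OF w] by simp
    have "((\<lambda>w. inverse (1 - inner w w)) has_derivative (\<lambda>v. - (inverse (1 - inner w w) * (- (2 * inner w v)) * inverse (1 - inner w w)))) (at w)"
      by (rule Deriv.has_derivative_inverse[OF nz dn])
    then have "(G has_derivative (\<lambda>v. complex_of_real (- (inverse (1 - inner w w) * (- (2 * inner w v)) * inverse (1 - inner w w))))) (at w)"
      unfolding G_def[abs_def] by (rule bounded_linear.has_derivative[OF bounded_linear_of_real])
    moreover have "complex_of_real (- (inverse (1 - inner w w) * (- (2 * inner w v)) * inverse (1 - inner w w))) = G w * G w * (hip v w + hip w v)" for v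
      unfolding two[symmetric] G_def by (simp add: mult_ac)
    ultimately have h: "(G has_derivative (\<lambda>v. G w * G w * (hip v w + hip w v))) (at w)" by simp
    show "dz v G w = G w * G w * hip v w" "db v G w = G w * G w * hip w v"
      unfolding dz_eqI[OF h] db_eqI[OF h] ii by (simp_all add: algebra_simps)
  qed
  have du: "dz v ?u w = G w * hip v w" "db v ?u w = G w * hip w v" if w: "w \<in> ?B" for v w
  proof -
    have p: "0 < 1 - inner w w" using one_minus_inner_pos[OF w] .
    have "((\<lambda>w. - ln (1 - inner w w)) has_derivative (\<lambda>v. - (inverse (1 - inner w w) * (- (2 * inner w v))))) (at w)"
      by (intro has_derivative_minus) (use has_derivative_ln[OF p dn] in \<open>simp add: divide_inverse mult_ac\<close>)
    then have "((\<lambda>w. complex_of_real (- ln (1 - inner w w))) has_derivative (\<lambda>v. complex_of_real (- (inverse (1 - inner w w) * (- (2 * inner w v)))))) (at w)"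
      by (rule bounded_linear.has_derivative[OF bounded_linear_of_real])
    moreover have "(\<lambda>w. complex_of_real (- ln (1 - inner w w))) = ?u" by (simp add: ball_pot_def dot_square_norm)
    moreover have "complex_of_real (- (inverse (1 - inner w w) * (- (2 * inner w v)))) = G w * (hip v w + hip w v)" for v
      unfolding two[symmetric] G_def by simp
    ultimately have h: "(?u has_derivative (\<lambda>v. G w * (hip v w + hip w v))) (at w)" by simp
    show "dz v ?u w = G w * hip v w" "db v ?u w = G w * hip w v"
      unfolding dz_eqI[OF h] db_eqI[OF h] ii by (simp_all add: algebra_simps)
  qed
  note L = lG lsm_hip[OF op] lsm_const[OF op]
  note R = dz_hip[OF op]
  have N: "dz A (db C ?u) w = G w * G w * (hip A w * hip w C) + G w * hip A C" if w: "w \<in> ?B" for A C w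
  proof -
    have "dz A (db C ?u) w = dz A (\<lambda>w. G w * hip w C) w" by (rule dz_cong[OF op w du(2)])
    also have "\<dots> = G w * G w * (hip A w * hip w C) + G w * hip A C"
      unfolding dz_mult(1)[OF lG lsm_hip(1)[OF op] w] dG[OF w] R[OF w] by (simp add: mult_ac)
    finally show ?thesis .
  qed
  have lGG: "lsm (\<lambda>w. G w * G w) ?B" by (intro lsm_mult L)
  have dGG: "dz v (\<lambda>w. G w * G w) w = 2 * (G w * G w * G w) * hip v w" "db v (\<lambda>w. G w * G w) w = 2 * (G w * G w * G w) * hip w v" if w: "w \<in> ?B" for v w
    unfolding dz_mult[OF lG lG w] dG[OF w] by (simp_all add: algebra_simps)
  have lhh: "lsm (\<lambda>w. hip A w * hip w C) ?B" for A C by (intro lsm_mult L)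
  have dhh: "dz v (\<lambda>w. hip A w * hip w C) w = hip A w * hip v C" "db v (\<lambda>w. hip A w * hip w C) w = hip A v * hip w C" if w: "w \<in> ?B" for v A C w
    unfolding dz_mult[OF lsm_hip(2)[OF op] lsm_hip(1)[OF op] w] R[OF w] by simp_all
  have l1: "lsm (\<lambda>w. G w * G w * (hip A w * hip w C)) ?B" for A C by (intro lsm_mult L)
  have l2: "lsm (\<lambda>w. G w * hip A C) ?B" for A C by (intro lsm_mult L)
  have dN: "dz v (\<lambda>w. G w * G w * (hip A w * hip w C) + G w * hip A C) w = 2 * (G w * G w * G w) * hip v w * (hip A w * hip w C) + G w * G w * (hip A w * hip v C) + G w * G w * hip v w * hip A C"
    "db v (\<lambda>w. G w * G w * (hip A w * hip w C) + G w * hip A C) w = 2 * (G w * G w * G w) * hip w v * (hip A w * hip w C) + G w * G w * (hip A v * hip w C) + G w * G w * hip w v * hip A C"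
    if w: "w \<in> ?B" for v A C w
    unfolding dz_add[OF l1 l2 w] dz_mult[OF lGG lhh w] dz_mult[OF lG lsm_const[OF op] w] dGG[OF w] dhh[OF w] dG[OF w] dz_const by simp_all
  show "dz X (db V ?u) 0 = hip X V" unfolding N[OF 0] by (simp add: G0 hip_simps)
  have T2: "dz Y (dz X (db V ?u)) 0 = 0"
    by (rule trans[OF dz_cong[OF op 0 N]]) (simp_all only: dN[OF 0], simp add: hip_simps)
  have T3: "db Y (dz V (db X ?u)) 0 = 0"
    by (rule trans[OF db_cong[OF op 0 N]]) (simp_all only: dN[OF 0], simp add: hip_simps)
  have T1: "dz Y (db Y (dz X (db X ?u))) 0 = hip X Y * hip Y X + hip X X * hip Y Y"
  proof -
    have 1: "db Y (dz X (db X ?u)) w = 2 * (G w * G w * G w) * hip w Y * (hip X w * hip w X) + G w * G w * (hip X Y * hip w X) + G w * G w * hip w Y * hip X X" if w: "w \<in> ?B" for w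
      using db_cong[OF op w N] dN(2)[OF w] by (rule trans)
    have a1: "lsm (\<lambda>w. 2 * (G w * G w * G w) * hip w Y * (hip X w * hip w X)) ?B" by (intro lsm_mult L)
    have a2: "lsm (\<lambda>w. G w * G w * (hip X Y * hip w X)) ?B" by (intro lsm_mult L)
    have a3: "lsm (\<lambda>w. G w * G w * hip w Y * hip X X) ?B" by (intro lsm_mult L)
    have b1: "lsm (\<lambda>w. 2 * (G w * G w * G w) * hip w Y) ?B" by (intro lsm_mult L)
    have b2: "lsm (\<lambda>w. hip X Y * hip w X) ?B" by (intro lsm_mult L)
    have b3: "lsm (\<lambda>w. G w * G w * hip w Y) ?B" by (intro lsm_mult L)
    have "dz Y (db Y (dz X (db X ?u))) 0 = dz Y (\<lambda>w. 2 * (G w * G w * G w) * hip w Y * (hip X w * hip w X) + G w * G w * (hip X Y * hip w X) + G w * G w * hip w Y * hip X X) 0"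
      by (rule dz_cong[OF op 0 1])
    also have "\<dots> = hip X Y * hip Y X + hip X X * hip Y Y"
      unfolding dz_add(1)[OF lsm_add[OF a1 a2] a3 0] dz_add(1)[OF a1 a2 0] dz_mult(1)[OF b1 lhh 0] dz_mult(1)[OF lGG b2 0] dz_mult(1)[OF b3 lsm_const[OF op] 0]
        dz_mult(1)[OF lGG lsm_hip(1)[OF op] 0] dz_mult(1)[OF lsm_const[OF op] lsm_hip(1)[OF op] 0] dz_const dGG[OF 0] dhh[OF 0] R[OF 0]
      by (simp add: G0 hip_simps)
    finally show ?thesis .
  qed
  show "lev ?u 0 X Y V = hip V V + hip X Y * hip Y X + hip X X * hip Y Y"
    unfolding lev_def T1 T2 T3 N[OF 0] by (simp add: G0 hip_simps)
qed

lemma lev_ball_pot_ge: "Re (lev (\<lambda>w. complex_of_real (ball_pot w)) 0 X Y V) \<ge> (norm X)\<^sup>2 * (norm Y)\<^sup>2 + (norm V)\<^sup>2"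
proof -
  have "hip X Y * hip Y X = complex_of_real ((norm (hip X Y))\<^sup>2)"
    using complex_norm_square[of "hip X Y"] by (simp add: hip_cnj)
  then show ?thesis unfolding lev_ball_pot hip_self by (simp flip: of_real_mult)
qed

lemma lsm_log_norm:
  assumes J: "chol J S" and nz: "\<And>z. z \<in> S \<Longrightarrow> J z \<noteq> 0" and op: "open S"
  shows "lsm (\<lambda>z. ln ((norm (J z))\<^sup>2)) S"
proof -
  have "lsm (\<lambda>z. ln (inner (J z) (J z))) S"
    by (intro lsm_compose_real[OF lsm_inner[OF chol_lsm[OF J op] chol_lsm[OF J op]] lsm_ln]) (use nz in auto)
  then show ?thesis by (simp add: dot_square_norm)
qed

text \<open>\<open>log |J|\<^sup>2\<close> is locally the real part of a holomorphic function; its antiholomorphic derivative is the conjugate of the holomorphic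
function \<open>J' / J\<close>.\<close>

lemma pluriharmonic_log:
  assumes J: "chol J S" and nz: "\<And>z. z \<in> S \<Longrightarrow> J z \<noteq> 0" and op: "open S" and p: "p \<in> S"
  defines "u \<equiv> \<lambda>z. complex_of_real (ln ((norm (J z))\<^sup>2))"
  shows "lev u p X Y V = 0" "dz X (db V u) p = 0"
proof -
  define q where "q v z = dird v J z * inverse (J z)" for v z
  have cq: "chol (q v) S" for v unfolding q_def by (intro chol_mult chol_dird[OF J op] chol_inverse[OF J nz])
  have d: "db v u z = cnj (q v z)" if z: "z \<in> S" for v z
  proof -
    have pos: "0 < inner (J z) (J z)" using nz[OF z] by simp
    have di: "((\<lambda>z. inner (J z) (J z)) has_derivative (\<lambda>v. 2 * inner (J z) (dird v J z))) (at z)"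
      using has_derivative_inner[OF chol_has_derivative[OF J z] chol_has_derivative[OF J z]] by (simp add: inner_commute)
    have "((\<lambda>z. ln (inner (J z) (J z))) has_derivative (\<lambda>v. 2 * inner (J z) (dird v J z) * inverse (inner (J z) (J z)))) (at z)"
      using has_derivative_ln[OF pos di] by (simp add: divide_inverse mult_ac)
    then have "((\<lambda>z. complex_of_real (ln (inner (J z) (J z)))) has_derivative (\<lambda>v. complex_of_real (2 * inner (J z) (dird v J z) * inverse (inner (J z) (J z))))) (at z)"
      by (rule bounded_linear.has_derivative[OF bounded_linear_of_real])
    moreover have "(\<lambda>z. complex_of_real (ln (inner (J z) (J z)))) = u" by (simp add: u_def dot_square_norm)
    moreover have "2 * inner (J z) b * inverse (inner (J z) (J z)) = 2 * Re (b * inverse (J z))" for b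
    proof -
      have "inner (J z) b * inverse (inner (J z) (J z)) = Re (b * cnj (J z)) / (norm (J z))\<^sup>2"
        unfolding dot_square_norm inner_complex_def by (simp add: divide_inverse mult.commute)
      also have "\<dots> = Re (b * inverse (J z))" 
        by (simp add: divide_inverse[symmetric] complex_div_cnj[of b "J z"] del: times_divide_eq_right) 
      finally show ?thesis by simp
    qed
    ultimately have h: "(u has_derivative (\<lambda>v. complex_of_real (2 * Re (q v z)))) (at z)" by (simp add: q_def)
    have "q (\<i> *s v) z = \<i> * q v z" unfolding q_def chol_cscale[OF J z] by simp
    then show ?thesis unfolding db_eqI[OF h] by (simp add: complex_eq_iff)
  qed
  have 1: "dz A (db B u) z = 0" if "z \<in> S" for A B z
  proof -
    have "dz A (db B u) z = dz A (\<lambda>z. cnj (q B z)) z" by (rule dz_cong[OF op that d])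
    then show ?thesis unfolding dz_cnj(1)[OF chol_lsm[OF cq op] that] dz_chol(2)[OF cq that] by simp
  qed
  show "dz X (db V u) p = 0" by (rule 1[OF p])
  have 2: "dz C (dz A (db B u)) p = 0" for A B C using dz_cong[OF op p 1] by (simp add: dz_const)
  have 3: "db C (dz A (db B u)) z = 0" if "z \<in> S" for A B C z using db_cong[OF op that 1] by (simp add: dz_const)
  have 4: "dz D (db C (dz A (db B u))) p = 0" for A B C D using dz_cong[OF op p 3] by (simp add: dz_const)
  show "lev u p X Y V = 0" unfolding lev_def 1[OF p] 2 3[OF p] 4 by simp
qed

lemma lev_sum:
  assumes op: "open S" and u: "\<And>i. i \<in> I \<Longrightarrow> lsm (u i) S" and p: "p \<in> S" and fin: "finite I"
  shows "lev (\<lambda>z. \<Sum>i\<in>I. u i z) p X Y V = (\<Sum>i\<in>I. lev (u i) p X Y V)"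
    and "dz X (db V (\<lambda>z. \<Sum>i\<in>I. u i z)) p = (\<Sum>i\<in>I. dz X (db V (u i)) p)"
  using fin u
proof (induction I rule: finite_induct)
  case empty
  { case 1 show ?case by (simp add: lev_zero) }
  { case 2 show ?case by (simp add: dz_const[abs_def]) }
next
  case (insert i I)
  have l: "lsm (u i) S" "lsm (\<lambda>z. \<Sum>i\<in>I. u i z) S" if "\<And>j. j \<in> insert i I \<Longrightarrow> lsm (u j) S" using that by (auto intro: lsm_sum[OF op])
  { case 1 then show ?case using insert lev_add(1)[OF l p] by simp }
  { case 2 then show ?case using insert lev_add(2)[OF l p] by simp }
qed

text \<open>The first summand alone has a flat metric. The second one, a sum of squares of monomials of degree two, makes \<open>lev\<close> positive in
\<open>X\<close> and \<open>Y\<close>.\<close>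

definition base_pot :: "real \<Rightarrow> complex^'n \<Rightarrow> real" where
  "base_pot \<kappa> z = (norm z)\<^sup>2 + \<kappa> * ((norm z)\<^sup>2)\<^sup>2"

lemma base_pot_expand:
  "complex_of_real (base_pot \<kappa> z) = (\<Sum>i\<in>UNIV. z $ i * cnj (z $ i)) + of_real \<kappa> * (\<Sum>i\<in>UNIV. \<Sum>j\<in>UNIV. (z $ i * z $ j) * cnj (z $ i * z $ j))"
proof -
  have 1: "complex_of_real ((norm z)\<^sup>2) = (\<Sum>i\<in>UNIV. z $ i * cnj (z $ i))" using hip_self[of z] by (simp add: hip_def)
  have "(\<Sum>i\<in>UNIV. \<Sum>j\<in>UNIV. (z $ i * z $ j) * cnj (z $ i * z $ j)) = (\<Sum>i\<in>UNIV. z $ i * cnj (z $ i)) * (\<Sum>i\<in>UNIV. z $ i * cnj (z $ i))"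
    unfolding sum_product by (simp add: mult_ac)
  then show ?thesis unfolding base_pot_def of_real_add of_real_mult of_real_power[of "(norm z)\<^sup>2" 2] 1 by (simp add: power2_eq_square)
qed

lemma lsm_base_pot: "open S \<Longrightarrow> lsm (base_pot \<kappa>) S"
proof -
  assume op: "open S"
  have "lsm (\<lambda>z. inner z z + \<kappa> * (inner z z * inner z z)) S" by (intro lsm_add lsm_mult lsm_const lsm_inner lsm_id op)
  then show ?thesis unfolding base_pot_def[abs_def] by (simp add: dot_square_norm power2_eq_square)
qed

lemma
  fixes p X Y V :: "complex^'n"
  shows lev_base_pot: "lev (\<lambda>z. complex_of_real (base_pot \<kappa> z)) p X Y V
      = of_real ((norm V)\<^sup>2 + \<kappa> * (\<Sum>i\<in>UNIV. \<Sum>j\<in>UNIV. (norm (X $ i * Y $ j + X $ j * Y $ i + (p $ i * V $ j + V $ i * p $ j)))\<^sup>2))"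
    and dzdb_base_pot: "dz X (db X (\<lambda>z. complex_of_real (base_pot \<kappa> z))) p = of_real ((norm X)\<^sup>2 + \<kappa> * (\<Sum>i\<in>UNIV. \<Sum>j\<in>UNIV. (norm (p $ i * X $ j + X $ i * p $ j))\<^sup>2))"
proof -
  have op: "open (UNIV :: (complex^'n) set)" and p: "p \<in> UNIV" by simp_all
  have c1: "chol (\<lambda>z. z $ i) (UNIV :: (complex^'n) set)" for i by (rule chol_component)
  have c2: "chol (\<lambda>z. z $ i * z $ j) (UNIV :: (complex^'n) set)" for i j by (intro chol_mult c1)
  have d1: "dird v (\<lambda>z. z $ i) z = v $ i" for v i and z :: "complex^'n"
    by (rule dird_eqI) (intro bounded_linear_imp_has_derivative bounded_linear_vec_nth)
  have d2: "dird v (\<lambda>z. z $ i * z $ j) z = z $ i * v $ j + v $ i * z $ j" for v i j and z :: "complex^'n"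
    by (rule dird_eqI) (intro has_derivative_mult bounded_linear_imp_has_derivative bounded_linear_vec_nth)
  have d11: "dird w (dird v (\<lambda>z. z $ i)) z = 0" for v w i and z :: "complex^'n"
    unfolding d1[abs_def] by simp
  have d22: "dird w (dird v (\<lambda>z. z $ i * z $ j)) z = w $ i * v $ j + v $ i * w $ j" for v w i j and z :: "complex^'n"
    unfolding d2[abs_def]
    by (rule dird_eqI) (intro has_derivative_add has_derivative_mult_left has_derivative_mult_right bounded_linear_imp_has_derivative bounded_linear_vec_nth)
  let ?A = "\<lambda>z::complex^'n. \<Sum>i\<in>UNIV. z $ i * cnj (z $ i)"
  let ?B = "\<lambda>z::complex^'n. \<Sum>i\<in>UNIV. \<Sum>j\<in>UNIV. (z $ i * z $ j) * cnj (z $ i * z $ j)"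
  note s1 = lev_square[OF c1 op p] and s2 = lev_square[OF c2 op p]
  have lA: "lsm ?A UNIV" by (intro lsm_sum s1 op)
  have lBi: "lsm (\<lambda>z::complex^'n. \<Sum>j\<in>UNIV. (z $ i * z $ j) * cnj (z $ i * z $ j)) UNIV" for i by (intro lsm_sum s2 op)
  have lB: "lsm ?B UNIV" by (intro lsm_sum lBi op)
  have lcB: "lsm (\<lambda>z. of_real \<kappa> * ?B z) UNIV" by (intro lsm_mult lsm_const lB op)
  have nV: "complex_of_real ((norm V)\<^sup>2) = (\<Sum>i\<in>UNIV. complex_of_real ((norm (V $ i))\<^sup>2))" for V :: "complex^'n"
    by (simp add: norm_vec_def L2_set_def sum_nonneg)
  have eq: "(\<lambda>z::complex^'n. complex_of_real (base_pot \<kappa> z)) = (\<lambda>z. ?A z + of_real \<kappa> * ?B z)"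
    by (rule ext) (rule base_pot_expand)
  have levA: "lev ?A p X Y V = of_real ((norm V)\<^sup>2)"
    unfolding lev_sum(1)[OF op s1(3) p finite] s1(1) d11 d1 nV by simp
  have levB: "lev ?B p X Y V = of_real (\<Sum>i\<in>UNIV. \<Sum>j\<in>UNIV. (norm (X $ i * Y $ j + X $ j * Y $ i + (p $ i * V $ j + V $ i * p $ j)))\<^sup>2)"
    unfolding lev_sum(1)[OF op lBi p finite] lev_sum(1)[OF op s2(3) p finite] s2(1) d22 unfolding d2 by (simp add: add_ac mult_ac)
  show "lev (\<lambda>z. complex_of_real (base_pot \<kappa> z)) p X Y V
      = of_real ((norm V)\<^sup>2 + \<kappa> * (\<Sum>i\<in>UNIV. \<Sum>j\<in>UNIV. (norm (X $ i * Y $ j + X $ j * Y $ i + (p $ i * V $ j + V $ i * p $ j)))\<^sup>2))"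
    unfolding eq lev_add(1)[OF lA lcB p] lev_cmult(1)[OF lB p] levA levB by simp
  have dA: "dz X (db X ?A) p = of_real ((norm X)\<^sup>2)"
    unfolding lev_sum(2)[OF op s1(3) p finite] s1(2) d1 nV complex_norm_square ..
  have dB: "dz X (db X ?B) p = of_real (\<Sum>i\<in>UNIV. \<Sum>j\<in>UNIV. (norm (p $ i * X $ j + X $ i * p $ j))\<^sup>2)"
    unfolding lev_sum(2)[OF op lBi p finite] lev_sum(2)[OF op s2(3) p finite] s2(2) d2 of_real_sum complex_norm_square ..
  show "dz X (db X (\<lambda>z. complex_of_real (base_pot \<kappa> z))) p = of_real ((norm X)\<^sup>2 + \<kappa> * (\<Sum>i\<in>UNIV. \<Sum>j\<in>UNIV. (norm (p $ i * X $ j + X $ i * p $ j))\<^sup>2))"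
    unfolding eq lev_add(2)[OF lA lcB p] lev_cmult(2)[OF lB p] dA dB by simp
qed

text \<open>The squares in \<open>lev_base_pot\<close> contain cross terms with \<open>V\<close> of size \<open>|p| |V|\<close>; for small \<open>\<kappa>\<close> half of \<open>|V|\<^sup>2\<close> absorbs them.\<close>

lemma base_pot_lev_ge:
  fixes p X Y V :: "complex^'n"
  assumes k: "0 < \<kappa>" "8 * \<kappa> * R\<^sup>2 \<le> 1" and p: "norm p \<le> R"
  shows "Re (lev (\<lambda>z. complex_of_real (base_pot \<kappa> z)) p X Y V) \<ge> (norm V)\<^sup>2 / 2 + \<kappa> * ((norm X)\<^sup>2 * (norm Y)\<^sup>2)"
proof -
  define s t where "s i j = X $ i * Y $ j + X $ j * Y $ i" and "t i j = p $ i * V $ j + V $ i * p $ j" for i j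
  have nn: "(norm a)\<^sup>2 = (\<Sum>i\<in>UNIV. (norm (a $ i))\<^sup>2)" for a :: "complex^'n"
    by (simp add: norm_vec_def L2_set_def sum_nonneg)
  have prod: "(\<Sum>i\<in>UNIV. \<Sum>j\<in>UNIV. (norm (a $ i * b $ j))\<^sup>2) = (norm a)\<^sup>2 * (norm b)\<^sup>2" for a b :: "complex^'n"
    unfolding nn sum_product by (simp add: norm_mult power_mult_distrib)
  have st: "(norm (s i j))\<^sup>2 \<le> 2 * (norm (s i j + t i j))\<^sup>2 + 2 * (norm (t i j))\<^sup>2" for i j
  proof -
    have "norm (s i j) \<le> norm (s i j + t i j) + norm (t i j)" using norm_triangle_ineq4[of "s i j + t i j" "t i j"] by simp
    then have "(norm (s i j))\<^sup>2 \<le> (norm (s i j + t i j) + norm (t i j))\<^sup>2" by (intro power_mono) auto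
    also have "\<dots> \<le> 2 * (norm (s i j + t i j))\<^sup>2 + 2 * (norm (t i j))\<^sup>2"
      using sum_squares_bound[of "norm (s i j + t i j)" "norm (t i j)"] by (simp add: power2_sum)
    finally show ?thesis .
  qed
  have tt: "(norm (t i j))\<^sup>2 \<le> 2 * (norm (p $ i * V $ j))\<^sup>2 + 2 * (norm (V $ i * p $ j))\<^sup>2" for i j
  proof -
    have "(norm (t i j))\<^sup>2 \<le> (norm (p $ i * V $ j) + norm (V $ i * p $ j))\<^sup>2" unfolding t_def by (intro power_mono norm_triangle_ineq) auto
    also have "\<dots> \<le> 2 * (norm (p $ i * V $ j))\<^sup>2 + 2 * (norm (V $ i * p $ j))\<^sup>2"
      using sum_squares_bound[of "norm (p $ i * V $ j)" "norm (V $ i * p $ j)"] by (simp add: power2_sum)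
    finally show ?thesis .
  qed
  have "(\<Sum>i\<in>UNIV. \<Sum>j\<in>UNIV. (norm (t i j))\<^sup>2) \<le> (\<Sum>i\<in>UNIV. \<Sum>j\<in>UNIV. 2 * (norm (p $ i * V $ j))\<^sup>2 + 2 * (norm (V $ i * p $ j))\<^sup>2)"
    by (intro sum_mono tt)
  also have "\<dots> = 4 * ((norm p)\<^sup>2 * (norm V)\<^sup>2)"
    unfolding sum.distrib sum_distrib_left[symmetric] prod by simp
  also have "\<dots> \<le> 4 * (R\<^sup>2 * (norm V)\<^sup>2)" using p by (intro mult_left_mono mult_right_mono power_mono) auto
  finally have T: "(\<Sum>i\<in>UNIV. \<Sum>j\<in>UNIV. (norm (t i j))\<^sup>2) \<le> 4 * (R\<^sup>2 * (norm V)\<^sup>2)" .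
  (* The cross terms in the symmetric product of X and Y sum up to 2 |<X, Y>|^2, so they do not hurt. *)
  have S: "(\<Sum>i\<in>UNIV. \<Sum>j\<in>UNIV. (norm (s i j))\<^sup>2) \<ge> 2 * ((norm X)\<^sup>2 * (norm Y)\<^sup>2)"
  proof -
    have e: "(norm (s i j))\<^sup>2 = (norm (X $ i * Y $ j))\<^sup>2 + (norm (Y $ i * X $ j))\<^sup>2 + 2 * Re ((X $ i * cnj (Y $ i)) * (Y $ j * cnj (X $ j)))" for i j
    proof -
      have "(norm (a + b))\<^sup>2 = (norm a)\<^sup>2 + (norm b)\<^sup>2 + 2 * Re (a * cnj b)" for a b :: complex
        by (simp add: cmod_power2 power2_sum algebra_simps)
      from this[of "X $ i * Y $ j" "X $ j * Y $ i"] show ?thesis unfolding s_def by (simp add: mult_ac)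
    qed
    have "(\<Sum>i\<in>UNIV. \<Sum>j\<in>UNIV. (norm (s i j))\<^sup>2) = (norm X)\<^sup>2 * (norm Y)\<^sup>2 + (norm Y)\<^sup>2 * (norm X)\<^sup>2 + 2 * Re (hip X Y * hip Y X)"
      unfolding e sum.distrib prod hip_def sum_product Re_sum by (simp add: sum_distrib_left)
    moreover have "Re (hip X Y * hip Y X) \<ge> 0"
    proof -
      have "hip X Y * hip Y X = complex_of_real ((norm (hip X Y))\<^sup>2)" using complex_norm_square[of "hip X Y"] by (simp add: hip_cnj)
      then show ?thesis by simp
    qed
    ultimately show ?thesis by (simp add: mult.commute)
  qed
  define S2 where "S2 = (\<Sum>i\<in>UNIV. \<Sum>j\<in>UNIV. (norm (s i j + t i j))\<^sup>2)"
  have "(\<Sum>i\<in>UNIV. \<Sum>j\<in>UNIV. (norm (s i j))\<^sup>2) \<le> (\<Sum>i\<in>UNIV. \<Sum>j\<in>UNIV. 2 * (norm (s i j + t i j))\<^sup>2 + 2 * (norm (t i j))\<^sup>2)"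
    by (intro sum_mono st)
  also have "\<dots> = 2 * S2 + 2 * (\<Sum>i\<in>UNIV. \<Sum>j\<in>UNIV. (norm (t i j))\<^sup>2)" unfolding S2_def by (simp add: sum.distrib sum_distrib_left)
  finally have "S2 \<ge> (norm X)\<^sup>2 * (norm Y)\<^sup>2 - 4 * (R\<^sup>2 * (norm V)\<^sup>2)" using S T by linarith
  then have "\<kappa> * S2 \<ge> \<kappa> * ((norm X)\<^sup>2 * (norm Y)\<^sup>2 - 4 * (R\<^sup>2 * (norm V)\<^sup>2))" using k by (intro mult_left_mono) auto
  moreover have "(8 * \<kappa> * R\<^sup>2) * (norm V)\<^sup>2 \<le> 1 * (norm V)\<^sup>2" using k by (intro mult_right_mono) auto
  ultimately have "(norm V)\<^sup>2 + \<kappa> * S2 \<ge> (norm V)\<^sup>2 / 2 + \<kappa> * ((norm X)\<^sup>2 * (norm Y)\<^sup>2)" by (simp add: algebra_simps)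
  then show ?thesis unfolding lev_base_pot S2_def s_def t_def by simp
qed

lemma dzdb_base_pot_ge:
  fixes p X :: "complex^'n"
  assumes "0 \<le> \<kappa>" shows "Re (dz X (db X (\<lambda>z. complex_of_real (base_pot \<kappa> z))) p) \<ge> (norm X)\<^sup>2"
  unfolding dzdb_base_pot using assms by (simp add: sum_nonneg)

section \<open>Nets of centred embeddings\<close>

lemma packing_bound:
  assumes "\<delta> > 0"
  shows "\<exists>N. \<forall>A \<subseteq> ball (0::complex^'n) 1. (\<forall>x\<in>A. \<forall>y\<in>A. x \<noteq> y \<longrightarrow> \<delta> \<le> dist x y) \<longrightarrow> finite A \<and> card A \<le> N"
proof -
  obtain T where T: "T \<subseteq> cball (0::complex^'n) 1" "finite T" "cball 0 1 \<subseteq> (\<Union>x\<in>T. ball x (\<delta>/2))"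
  proof (rule compactE_image[OF compact_cball, of "cball 0 1" "\<lambda>x. ball x (\<delta>/2)" "0::complex^'n" 1])
    show "cball 0 1 \<subseteq> (\<Union>x\<in>cball (0::complex^'n) 1. ball x (\<delta>/2))" using assms by force
  qed auto
  have "finite A \<and> card A \<le> card T" if A: "A \<subseteq> ball 0 1" and sep: "\<forall>x\<in>A. \<forall>y\<in>A. x \<noteq> y \<longrightarrow> \<delta> \<le> dist x y" for A :: "(complex^'n) set"
  proof -
    have "\<forall>x\<in>A. \<exists>t\<in>T. x \<in> ball t (\<delta>/2)" 
    proof
      fix x assume "x \<in> A"
      then have "x \<in> cball 0 1" using A by auto
      then show "\<exists>t\<in>T. x \<in> ball t (\<delta>/2)" using T(3) by blast
    qed
    then obtain c where c: "\<And>x. x \<in> A \<Longrightarrow> c x \<in> T \<and> x \<in> ball (c x) (\<delta>/2)" by metis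
    have inj: "inj_on c A"
    proof (rule inj_onI, rule ccontr)
      fix x y assume xy: "x \<in> A" "y \<in> A" "c x = c y" "x \<noteq> y"
      have "dist x y \<le> dist x (c x) + dist (c x) y" by (rule dist_triangle)
      also have "\<dots> < \<delta>/2 + \<delta>/2" using c[OF xy(1)] c[OF xy(2)] xy(3) by (intro add_strict_mono) (auto simp: dist_commute)
      finally show False using sep xy by fastforce
    qed
    have sub: "c ` A \<subseteq> T" using c by blast
    show ?thesis using inj_on_finite[OF inj sub T(2)] card_inj_on_le[OF inj sub T(2)] by simp
  qed
  then show ?thesis by blast
qed

text \<open>A maximal set of centres that are pairwise not too close in each other's charts. Closeness is not symmetric: maximality may yield
\<open>|F z j| < 1/64\<close> instead of \<open>|F j z| < 1/64\<close>, and exchanging the roles costs the Lipschitz constant 2 of transition maps.\<close>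

lemma centred_net_exists:
  fixes F :: "complex^'n \<Rightarrow> complex^'n \<Rightarrow> complex^'n"
  assumes op: "open \<Omega>" and t: "\<tau> \<le> 1/12" and G: "G \<subseteq> \<Omega>" and F: "\<And>p. p \<in> G \<Longrightarrow> wide \<Omega> \<tau> (F p) \<and> F p p = 0"
  obtains S where "S \<subseteq> G" "\<And>j k. j \<in> S \<Longrightarrow> k \<in> S \<Longrightarrow> j \<noteq> k \<Longrightarrow> 1/64 \<le> norm (F j k)" "\<And>z. z \<in> G \<Longrightarrow> \<exists>j\<in>S. norm (F j z) \<le> 1/32"
proof -
  define \<A> where "\<A> = {S. S \<subseteq> G \<and> (\<forall>j\<in>S. \<forall>k\<in>S. j \<noteq> k \<longrightarrow> 1/64 \<le> norm (F j k))}"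
  have "\<exists>M\<in>\<A>. \<forall>X\<in>\<A>. M \<subseteq> X \<longrightarrow> X = M"
  proof (rule subset_Zorn')
    fix C assume C: "subset.chain \<A> C"
    have CA: "X \<subseteq> G" "j \<in> X \<Longrightarrow> k \<in> X \<Longrightarrow> j \<noteq> k \<Longrightarrow> 1/64 \<le> norm (F j k)" if "X \<in> C" for X j k
      using C that unfolding subset_chain_def \<A>_def by blast+
    have "\<forall>j\<in>\<Union>C. \<forall>k\<in>\<Union>C. j \<noteq> k \<longrightarrow> 1/64 \<le> norm (F j k)"
    proof (intro ballI impI)
      fix j k assume jk: "j \<in> \<Union>C" "k \<in> \<Union>C" "j \<noteq> k"
      then obtain X Y where XY: "X \<in> C" "Y \<in> C" "j \<in> X" "k \<in> Y" by blast
      then have "X \<subseteq> Y \<or> Y \<subseteq> X" using C unfolding subset_chain_def by blast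
      then show "1/64 \<le> norm (F j k)" using XY CA(2)[of X j k] CA(2)[of Y j k] jk by blast
    qed
    then show "\<Union>C \<in> \<A>" unfolding \<A>_def using CA(1) by blast
  qed
  then obtain S where S: "S \<in> \<A>" "\<And>X. X \<in> \<A> \<Longrightarrow> S \<subseteq> X \<Longrightarrow> X = S" by blast
  have SG: "S \<subseteq> G" and sep: "\<And>j k. j \<in> S \<Longrightarrow> k \<in> S \<Longrightarrow> j \<noteq> k \<Longrightarrow> 1/64 \<le> norm (F j k)" using S(1) unfolding \<A>_def by blast+
  have "\<exists>j\<in>S. norm (F j z) \<le> 1/32" if z: "z \<in> G" for z
  proof (cases "z \<in> S")
    case True
    then show ?thesis using F[OF z] by (intro bexI[of _ z]) auto
  next
    case False
    then have "insert z S \<notin> \<A>" using S(2)[of "insert z S"] by blast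
    moreover have "insert z S \<subseteq> G" using SG z by blast
    ultimately have "\<not> (\<forall>j\<in>insert z S. \<forall>k\<in>insert z S. j \<noteq> k \<longrightarrow> 1/64 \<le> norm (F j k))" unfolding \<A>_def by blast
    then obtain j k where jk: "j \<in> insert z S" "k \<in> insert z S" "j \<noteq> k" "norm (F j k) < 1/64"
      unfolding not_le[symmetric] by blast
    then have "\<not> (j \<in> S \<and> k \<in> S)" using sep[of j k] by auto
    then obtain j where j: "j \<in> S" "norm (F j z) < 1/64 \<or> norm (F z j) < 1/64"
      using jk by blast
    from j(2) show ?thesis
    proof
      assume "norm (F j z) < 1/64" then show ?thesis using j(1) by (intro bexI[of _ j]) auto
    next
      assume small: "norm (F z j) < 1/64"
      have jG: "j \<in> G" using j SG by blast
      have wz: "wide \<Omega> \<tau> (F z)" and wj: "wide \<Omega> \<tau> (F j)" using F z jG by blast+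
      have i: "F j ` \<Omega> \<subseteq> ball 0 1" using wj by (simp add: wide_def)
      have "norm (F j (inv_into \<Omega> (F z) 0) - F j (inv_into \<Omega> (F z) (F z j))) \<le> 2 * norm (0 - F z j)"
        by (rule transition_map(3)[OF op wz wide_holomorphic[OF wj op] i t]) (use small in auto)
      moreover have "inv_into \<Omega> (F z) 0 = z" "inv_into \<Omega> (F z) (F z j) = j"
        using wide_inv_f[OF wz op, of z] wide_inv_f[OF wz op, of j] F[OF z] z jG G by auto
      ultimately show ?thesis using small F[OF jG] j(1) by (intro bexI[of _ j]) auto
    qed
  qed
  then show ?thesis using that SG sep by blast
qed

text \<open>View all centres involved in the chart of one of them. By the Lipschitz bound for transition maps they lie in a fixed ball there and are
\<open>1/128\<close>-separated, so the packing bound applies. This bound on the number of overlapping charts does not depend on \<open>\<tau>\<close>.\<close>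

lemma centred_net_count:
  fixes F :: "complex^'n \<Rightarrow> complex^'n \<Rightarrow> complex^'n"
  assumes op: "open \<Omega>" and t: "\<tau> \<le> 1/12" and S: "S \<subseteq> \<Omega>" and F: "\<And>p. p \<in> S \<Longrightarrow> wide \<Omega> \<tau> (F p) \<and> F p p = 0"
    and sep: "\<And>j k. j \<in> S \<Longrightarrow> k \<in> S \<Longrightarrow> j \<noteq> k \<Longrightarrow> 1/64 \<le> norm (F j k)"
    and N: "\<forall>A \<subseteq> ball (0::complex^'n) 1. (\<forall>x\<in>A. \<forall>y\<in>A. x \<noteq> y \<longrightarrow> 1/128 \<le> dist x y) \<longrightarrow> finite A \<and> card A \<le> N"
    and z: "z \<in> \<Omega>"
  shows "finite {j\<in>S. norm (F j z) < 1/8} \<and> card {j\<in>S. norm (F j z) < 1/8} \<le> N"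
proof (cases "{j\<in>S. norm (F j z) < 1/8} = {}")
  case True then show ?thesis by (simp only: finite.emptyI card.empty) simp
next
  case False
  then obtain m where m: "m \<in> S" "norm (F m z) < 1/8" by blast
  define J where "J = {j\<in>S. norm (F j z) < 1/8}"
  have lip: "norm (F k (inv_into \<Omega> (F j) x) - F k (inv_into \<Omega> (F j) y)) \<le> 2 * norm (x - y)"
    if "j \<in> S" "k \<in> S" "x \<in> cball 0 (3/8)" "y \<in> cball 0 (3/8)" for j k x y
  proof -
    have wz: "wide \<Omega> \<tau> (F j)" and wj: "wide \<Omega> \<tau> (F k)" using F that by blast+
    have i: "F k ` \<Omega> \<subseteq> ball 0 1" using wj by (simp add: wide_def)
    show ?thesis by (rule transition_map(3)[OF op wz wide_holomorphic[OF wj op] i t that(3,4)])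
  qed
  have inv: "inv_into \<Omega> (F j) (F j x) = x" if "j \<in> S" "x \<in> \<Omega>" for j x
    using wide_inv_f[OF _ op that(2)] F[OF that(1)] by blast
  have inv0: "inv_into \<Omega> (F j) 0 = j" if "j \<in> S" for j using inv[OF that, of j] F[OF that] S that by auto
  have near: "norm (F m j) \<le> 3/8" if "j \<in> J" for j
  proof -
    have j: "j \<in> S" "norm (F j z) < 1/8" using that by (auto simp: J_def)
    have "norm (F m (inv_into \<Omega> (F j) 0) - F m (inv_into \<Omega> (F j) (F j z))) \<le> 2 * norm (0 - F j z)"
      by (rule lip[OF j(1) m(1)]) (use j in auto)
    then have "norm (F m j - F m z) \<le> 2 * norm (F j z)" unfolding inv0[OF j(1)] inv[OF j(1) z] by simp
    then show ?thesis using j m norm_triangle_sub[of "F m j" "F m z"] by simp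
  qed
  have far: "1/128 \<le> dist (F m j) (F m k)" if jk: "j \<in> J" "k \<in> J" "j \<noteq> k" for j k
  proof -
    have S': "j \<in> S" "k \<in> S" using jk by (auto simp: J_def)
    have "norm (F j (inv_into \<Omega> (F m) (F m k)) - F j (inv_into \<Omega> (F m) (F m j))) \<le> 2 * norm (F m k - F m j)"
      by (rule lip[OF m(1) S'(1)]) (use near jk in auto)
    then have "norm (F j k) \<le> 2 * norm (F m k - F m j)" using inv[OF m(1), of j] inv[OF m(1), of k] S S' F[OF S'(1)] by (simp add: subset_iff)
    then show ?thesis using sep[OF S' jk(3)] by (simp add: dist_norm norm_minus_commute)
  qed
  have inj: "inj_on (F m) J" using far by (force intro: inj_onI)
  have "F m ` J \<subseteq> ball 0 1" using near by force
  moreover have "\<forall>x\<in>F m ` J. \<forall>y\<in>F m ` J. x \<noteq> y \<longrightarrow> 1/128 \<le> dist x y" using far by blast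
  ultimately have "finite (F m ` J) \<and> card (F m ` J) \<le> N" using N by blast
  then show ?thesis using inj finite_image_iff[OF inj] card_image[OF inj] by (simp add: J_def)
qed

text \<open>A finite sum of bumps supported in balls that cover \<open>K\<close>. It serves as an extra weight that keeps the denominator of the mean positive
where no centred embedding is close.\<close>

lemma smooth_cutoff:
  fixes K :: "(complex^'n) set"
  assumes K: "compact K" "K \<subseteq> \<Omega>" and op: "open \<Omega>"
  obtains cut K2 where "compact K2" "K2 \<subseteq> \<Omega>" "K \<subseteq> K2" "lsm cut UNIV" "\<And>z. cut z \<ge> (0::real)" "\<And>z. z \<in> K \<Longrightarrow> cut z > 0" "\<And>z. z \<notin> K2 \<Longrightarrow> cut z = 0"
proof -
  have "\<forall>x\<in>K. \<exists>r>0. cball x r \<subseteq> \<Omega>" using op K(2) open_contains_cball by (metis subsetD)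
  then obtain r where r: "\<And>x. x \<in> K \<Longrightarrow> r x > 0 \<and> cball x (r x) \<subseteq> \<Omega>" by metis
  obtain T where T: "T \<subseteq> K" "finite T" "K \<subseteq> (\<Union>x\<in>T. ball x (r x))"
    using compactE_image[OF K(1), of K "\<lambda>x. ball x (r x)"] r by (metis (no_types, lifting) UN_I centre_in_ball open_ball subsetI)
  define cut where "cut z = (\<Sum>x\<in>T. flat 0 ((r x)\<^sup>2 - inner (z - x) (z - x)))" for z
  define K2 where "K2 = (\<Union>x\<in>T. cball x (r x))"
  have nb: "flat 0 ((r x)\<^sup>2 - inner (z - x) (z - x)) > 0 \<longleftrightarrow> z \<in> ball x (r x)" if "x \<in> T" for x z
  proof -
    have "(norm (z - x))\<^sup>2 < (r x)\<^sup>2 \<longleftrightarrow> norm (z - x) < r x"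
      using power2_less_imp_less[of "norm (z - x)" "r x"] power_strict_mono[of "norm (z - x)" "r x" 2] r[of x] T(1) that by force
    then show ?thesis by (simp add: flat_pos dot_square_norm dist_norm norm_minus_commute)
  qed
  show ?thesis
  proof (rule that[of K2 cut])
    show "compact K2" unfolding K2_def using T(2) by (intro compact_UN) auto
    show "K2 \<subseteq> \<Omega>" unfolding K2_def using r T(1) by blast
    show "K \<subseteq> K2" unfolding K2_def using T(3) ball_subset_cball by blast
    show "lsm cut UNIV" unfolding cut_def
      by (intro lsm_sum lsm_compose_real[OF _ lsm_flat] lsm_diff lsm_const lsm_inner lsm_id) auto
    show "cut z \<ge> 0" for z unfolding cut_def by (intro sum_nonneg flat_pos)
    show "cut z > 0" if "z \<in> K" for z
    proof -
      obtain x where x: "x \<in> T" "z \<in> ball x (r x)" using T(3) \<open>z \<in> K\<close> by blast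
      show ?thesis unfolding cut_def by (rule sum_pos2[OF T(2) x(1)]) (use nb[OF x(1)] x(2) flat_pos in auto)
    qed
    show "cut z = 0" if "z \<notin> K2" for z
    proof -
      have "flat 0 ((r x)\<^sup>2 - inner (z - x) (z - x)) = 0" if "x \<in> T" for x
      proof -
        have "z \<notin> ball x (r x)" using \<open>z \<notin> K2\<close> that ball_subset_cball unfolding K2_def by blast
        then show ?thesis using nb[OF that, of z] flat_pos(2)[of 0 "(r x)\<^sup>2 - inner (z - x) (z - x)"] by linarith
      qed
      then show ?thesis unfolding cut_def by simp
    qed
  qed
qed

lemma lsm_logvol:
  fixes f :: "complex^'n \<Rightarrow> complex^'n"
  assumes op: "open \<Omega>" and f: "wide \<Omega> \<tau> f" shows "lsm (logvol f) \<Omega>"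
proof -
  note h = wide_holomorphic[OF f op]
  have nz: "Jac f z \<noteq> 0" if "z \<in> \<Omega>" for z using f embedding_Jac_nonzero[OF _ op that] unfolding wide_def by blast
  have p: "0 < 1 - inner (f z) (f z)" if "z \<in> \<Omega>" for z
    using wide_norm[OF f that] by (simp add: dot_square_norm abs_square_less_1)
  have lf: "lsm f \<Omega>" by (rule holomorphic_map_lsm[OF h op])
  have "lsm (\<lambda>z. ln ((norm (Jac f z))\<^sup>2) - real (Suc CARD('n)) * ln (1 - inner (f z) (f z))) \<Omega>"
    by (intro lsm_diff lsm_mult lsm_const op lsm_log_norm[OF Jac_chol[OF h op] nz op] 
        lsm_compose_real[OF lsm_diff[OF lsm_const[OF op] lsm_inner[OF lf lf]] lsm_ln]) (use p nz in auto)
  then show ?thesis unfolding logvol_def[abs_def] by (simp add: dot_square_norm)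
qed

section \<open>The averaged potential\<close>

text \<open>Outside the compact set \<open>K2\<close> every point has a centred embedding (\<open>chart\<close>) and is close to a centre of the net (\<open>cover\<close>). The last
assumption is the conclusion of \<open>chart_error\<close> for this net.\<close>

locale squeezing_net =
  fixes \<Omega> :: "(complex^'n) set" and \<tau> \<rho> :: real and F :: "complex^'n \<Rightarrow> complex^'n \<Rightarrow> complex^'n"
    and S K2 :: "(complex^'n) set" and cut :: "complex^'n \<Rightarrow> real" and N :: nat
  assumes op: "open \<Omega>" and \<tau>: "0 < \<tau>" "\<tau> \<le> 1/12" and \<rho>: "0 < \<rho>" "\<rho> \<le> 1/128"
    and wideF: "\<And>j. j \<in> S \<Longrightarrow> wide \<Omega> \<tau> (F j)"
    and count: "\<And>z. z \<in> \<Omega> \<Longrightarrow> finite {j\<in>S. norm (F j z) < 1/8} \<and> card {j\<in>S. norm (F j z) < 1/8} \<le> N"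
    and K2: "compact K2" "K2 \<subseteq> \<Omega>"
    and chart: "\<And>p. p \<in> \<Omega> - K2 \<Longrightarrow> \<exists>f. wide \<Omega> \<tau> f \<and> f p = 0"
    and cover: "\<And>p. p \<in> \<Omega> - K2 \<Longrightarrow> \<exists>j\<in>S. norm (F j p) \<le> 1/32"
    and cover': "\<And>p. p \<in> \<Omega> \<Longrightarrow> cut p > 0 \<or> (\<exists>j\<in>S. norm (F j p) \<le> 1/32)"
    and cut: "lsm cut \<Omega>" "\<And>z. cut z \<ge> 0" "\<And>z. z \<notin> K2 \<Longrightarrow> cut z = 0"
    and error: "\<And>f J. wide \<Omega> \<tau> f \<Longrightarrow> finite J \<Longrightarrow> card J \<le> N \<Longrightarrow> (\<forall>j\<in>J. wide \<Omega> \<tau> (F j) \<and> norm (F j (inv_into \<Omega> f 0)) < 1/8) \<Longrightarrow>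
     (\<Sum>j\<in>J. bump ((norm (F j (inv_into \<Omega> f 0)))\<^sup>2)) \<ge> bump ((1/32)\<^sup>2) \<Longrightarrow>
     (\<forall>w\<in>ball 0 \<rho>. (\<Sum>j\<in>J. bump ((norm (F j (inv_into \<Omega> f w)))\<^sup>2)) > 0) \<and>
     CB 4 (1/8) (\<lambda>w. (\<Sum>j\<in>J. bump ((norm (F j (inv_into \<Omega> f w)))\<^sup>2) * (logvol (F j) (inv_into \<Omega> f w) - logvol f (inv_into \<Omega> f w)))
        * inverse (\<Sum>j\<in>J. bump ((norm (F j (inv_into \<Omega> f w)))\<^sup>2))) (ball 0 \<rho>)"
begin

text \<open>Weights vanish already at \<open>|F j z| = 1/16\<close>; the larger radius in \<open>J\<close> leaves room to compare \<open>J\<close> at nearby points. In \<open>\<phi>\<close> the cutoff occurs in the denominator only,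
which amounts to averaging with the potential \<open>0\<close> on \<open>K2\<close>.\<close>

definition J where "J z = {j\<in>S. norm (F j z) < 1/8}"
definition X where "X j z = bump ((norm (F j z))\<^sup>2)"
definition \<phi> where "\<phi> z = (\<Sum>j\<in>J z. X j z * logvol (F j) z) * inverse (cut z + (\<Sum>j\<in>J z. X j z))"

lemma finJ: "z \<in> \<Omega> \<Longrightarrow> finite (J z)" "z \<in> \<Omega> \<Longrightarrow> card (J z) \<le> N"
  using count unfolding J_def by blast+

lemma X_nonneg: "X j z \<ge> 0" by (simp add: X_def bump_nonneg)

lemma X_zero: "1/16 \<le> norm (F j z) \<Longrightarrow> X j z = 0"
  using power_mono[of "1/16" "norm (F j z)" 2] by (simp add: X_def bump_eq_0 power2_eq_square)

lemma X_big: "norm (F j z) \<le> 1/32 \<Longrightarrow> X j z \<ge> bump ((1/32)\<^sup>2)"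
  unfolding X_def by (intro bump_antimono power_mono) auto

lemma sum_X_big:
  assumes z: "z \<in> \<Omega>" and j: "j \<in> S" "norm (F j z) \<le> 1/32"
  shows "(\<Sum>j\<in>J z. X j z) \<ge> bump ((1/32)\<^sup>2)"
proof -
  have "j \<in> J z" using j by (auto simp: J_def)
  then have "X j z \<le> (\<Sum>j\<in>J z. X j z)" using member_le_sum[of j "J z" "\<lambda>j. X j z"] finJ(1)[OF z] X_nonneg by auto
  then show ?thesis using X_big[OF j(2)] by linarith
qed

lemma den_pos: "z \<in> \<Omega> \<Longrightarrow> cut z + (\<Sum>j\<in>J z. X j z) > 0"
proof -
  assume z: "z \<in> \<Omega>"
  have "(\<Sum>j\<in>J z. X j z) \<ge> 0" by (intro sum_nonneg X_nonneg)
  moreover have "(\<Sum>j\<in>J z. X j z) > 0" if "j \<in> S" "norm (F j z) \<le> 1/32" for j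
    using sum_X_big[OF z that] bump_pos_near by linarith
  ultimately show ?thesis using cover'[OF z] cut(2)[of z] by (force intro: add_nonneg_pos add_pos_nonneg)
qed

text \<open>Cauchy estimates make the embeddings equicontinuous, so near a point only the finitely many that are relevant at this point contribute.\<close>

lemma local_sum:
  assumes z0: "z0 \<in> \<Omega>"
  obtains U where "open U" "z0 \<in> U" "U \<subseteq> \<Omega>" "\<And>z G. z \<in> U \<Longrightarrow> (\<Sum>j\<in>J z. X j z * G j) = (\<Sum>j\<in>J z0. X j z * G j :: real)"
proof -
  obtain d where d: "d > 0" "ball z0 d \<subseteq> \<Omega>" using op z0 openE by blast
  have lip: "norm (F j z - F j z0) < 1/16" if j: "j \<in> S" and z: "z \<in> ball z0 (d/32)" for j z
  proof -
    note h = wide_holomorphic[OF wideF[OF j] op]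
    have n1: "norm (F j w) \<le> 1" if "w \<in> \<Omega>" for w using wide_norm[OF wideF[OF j] that] by simp
    have "norm (F j z - F j z0) \<le> (1 / (d/2)) * norm (z - z0)"
    proof (rule differentiable_bound[of "ball z0 (d/2)"])
      fix x assume x: "x \<in> ball z0 (d/2)"
      have sub: "ball x (d/2) \<subseteq> \<Omega>"
      proof
        fix y assume "y \<in> ball x (d/2)"
        then have "dist z0 y < d" using x dist_triangle[of z0 y x] by simp
        then show "y \<in> \<Omega>" using d(2) by auto
      qed
      have xO: "x \<in> \<Omega>" using x d by auto
      show "(F j has_derivative (\<lambda>v. dird v (F j) x)) (at x within ball z0 (d/2))"
        using holomorphic_map_has_derivative[OF h xO] has_derivative_at_withinI by blast
      show "onorm (\<lambda>v. dird v (F j) x) \<le> 1 / (d/2)"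
      proof (rule onorm_bound)
        show "norm (dird v (F j) x) \<le> 1 / (d/2) * norm v" for v
          by (rule Cauchy_estimate_map[OF holomorphic_map_subset[OF h sub]]) (use d sub n1 in \<open>auto simp: subset_iff\<close>)
      qed (use d in auto)
    qed (use z d in auto)
    also have "\<dots> < (1 / (d/2)) * (d/32)" using z d by (intro mult_strict_left_mono) (auto simp: dist_norm norm_minus_commute)
    finally show ?thesis using d by simp
  qed
  show ?thesis
  proof (rule that[of "ball z0 (d/32)"])
    fix z and G :: "complex^'n \<Rightarrow> real" assume z: "z \<in> ball z0 (d/32)"
    then have zO: "z \<in> \<Omega>" using d by auto
    have "(\<Sum>j\<in>J z. X j z * G j) = (\<Sum>j\<in>J z \<union> J z0. X j z * G j)"
    proof (rule sum.mono_neutral_left)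
      show "\<forall>j\<in>J z \<union> J z0 - J z. X j z * G j = 0"
      proof
        fix j assume "j \<in> J z \<union> J z0 - J z"
        then have "1/8 \<le> norm (F j z)" by (auto simp: J_def)
        then show "X j z * G j = 0" using X_zero[of j z] by simp
      qed
    qed (use finJ(1)[OF zO] finJ(1)[OF z0] in auto)
    also have "\<dots> = (\<Sum>j\<in>J z0. X j z * G j)"
    proof (rule sum.mono_neutral_right)
      show "\<forall>j\<in>J z \<union> J z0 - J z0. X j z * G j = 0"
      proof
        fix j assume "j \<in> J z \<union> J z0 - J z0"
        then have j: "j \<in> S" "1/8 \<le> norm (F j z0)" by (auto simp: J_def)
        then have "1/16 \<le> norm (F j z)" using lip[OF j(1) z] norm_triangle_ineq2[of "F j z0" "F j z"] norm_minus_commute[of "F j z0" "F j z"] by linarith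
        then show "X j z * G j = 0" using X_zero by simp
      qed
    qed (use finJ(1)[OF zO] finJ(1)[OF z0] in auto)
    finally show "(\<Sum>j\<in>J z. X j z * G j) = (\<Sum>j\<in>J z0. X j z * G j)" .
  qed (use d in auto)
qed

lemma lsm_X: "j \<in> S \<Longrightarrow> lsm (X j) \<Omega>"
proof -
  assume j: "j \<in> S"
  have lf: "lsm (F j) \<Omega>" by (rule holomorphic_map_lsm[OF wide_holomorphic[OF wideF[OF j] op] op])
  have "lsm (\<lambda>z. bump (inner (F j z) (F j z))) \<Omega>" by (intro lsm_compose_real[OF lsm_inner[OF lf lf] lsm_bump]) auto
  then show ?thesis unfolding X_def[abs_def] by (simp add: dot_square_norm)
qed

lemma local_form:
  assumes z0: "z0 \<in> \<Omega>"
  obtains U where "open U" "z0 \<in> U" "U \<subseteq> \<Omega>" "\<And>z. z \<in> U \<Longrightarrow> \<phi> z = (\<Sum>j\<in>J z0. X j z * logvol (F j) z) * inverse (cut z + (\<Sum>j\<in>J z0. X j z))"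
    "\<And>z. z \<in> U \<Longrightarrow> cut z + (\<Sum>j\<in>J z0. X j z) > 0"
proof -
  obtain U where U: "open U" "z0 \<in> U" "U \<subseteq> \<Omega>" "\<And>z G. z \<in> U \<Longrightarrow> (\<Sum>j\<in>J z. X j z * G j) = (\<Sum>j\<in>J z0. X j z * G j :: real)"
    using local_sum[OF z0] by blast
  have s: "(\<Sum>j\<in>J z. X j z) = (\<Sum>j\<in>J z0. X j z)" if "z \<in> U" for z using U(4)[OF that, of "\<lambda>_. 1"] by simp
  show ?thesis
  proof (rule that[OF U(1,2,3)])
    fix z assume z: "z \<in> U"
    show "\<phi> z = (\<Sum>j\<in>J z0. X j z * logvol (F j) z) * inverse (cut z + (\<Sum>j\<in>J z0. X j z))"
      unfolding \<phi>_def s[OF z] U(4)[OF z] ..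
    show "cut z + (\<Sum>j\<in>J z0. X j z) > 0"
      using den_pos[of z] U(3) z unfolding s[OF z] by blast
  qed
qed

lemma lsm_\<phi>: "lsm \<phi> \<Omega>"
proof (rule lsm_local[OF op])
  fix z0 assume z0: "z0 \<in> \<Omega>"
  obtain U where U: "open U" "z0 \<in> U" "U \<subseteq> \<Omega>" "\<And>z. z \<in> U \<Longrightarrow> \<phi> z = (\<Sum>j\<in>J z0. X j z * logvol (F j) z) * inverse (cut z + (\<Sum>j\<in>J z0. X j z))"
    "\<And>z. z \<in> U \<Longrightarrow> cut z + (\<Sum>j\<in>J z0. X j z) > 0"
    using local_form[OF z0] by blast
  have lX: "lsm (X j) U" "lsm (logvol (F j)) U" if "j \<in> J z0" for j
    using lsm_subset[OF lsm_X U(1,3)] lsm_subset[OF lsm_logvol[OF op wideF] U(1,3)] that by (auto simp: J_def)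
  have lcut: "lsm cut U" by (rule lsm_subset[OF cut(1) U(1,3)])
  have "lsm (\<lambda>z. (\<Sum>j\<in>J z0. X j z * logvol (F j) z) * inverse (cut z + (\<Sum>j\<in>J z0. X j z))) U"
  proof (rule lsm_mult)
    show "lsm (\<lambda>z. \<Sum>j\<in>J z0. X j z * logvol (F j) z) U" by (rule lsm_sum[OF U(1)]) (rule lsm_mult[OF lX])
    have "lsm (\<lambda>z. \<Sum>j\<in>J z0. X j z) U" by (rule lsm_sum[OF U(1) lX(1)])
    from lsm_compose_real[OF lsm_add[OF lcut this] lsm_inverse]
    show "lsm (\<lambda>z. inverse (cut z + (\<Sum>j\<in>J z0. X j z))) U" using U(5) by auto
  qed
  then have "lsm \<phi> U" by (subst lsm_cong[OF U(4)])
  then show "\<exists>U. open U \<and> z0 \<in> U \<and> U \<subseteq> \<Omega> \<and> lsm \<phi> U" using U(1-3) by blast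
qed

text \<open>In the chart centred at \<open>p\<close> the averaged potential is \<open>n + 1\<close> times the potential of the ball plus a pluriharmonic function plus the error from
\<open>chart_error\<close>. Bounded by \<open>1/8\<close> in four derivatives, the error changes \<open>lev\<close> by at most a quarter of \<open>|A'|\<^sup>2 |B'|\<^sup>2 + |V'|\<^sup>2\<close>, which the ball dominates.\<close>

lemma chart_levi:
  assumes p: "p \<in> \<Omega> - K2"
  obtains f where "wide \<Omega> \<tau> f" "f p = 0"
    "\<And>A B V. let A' = dird A f p; B' = dird B f p; V' = dird V f p + dird B (dird A f) p in
       (norm A')\<^sup>2 * (norm B')\<^sup>2 / 2 \<le> Re (lev (\<lambda>z. complex_of_real (\<phi> z)) p A B V) \<and>
       (V' = 0 \<longrightarrow> Re (lev (\<lambda>z. complex_of_real (\<phi> z)) p A B V) \<le> (2 * real (Suc CARD('n)) + 1) * ((norm A')\<^sup>2 * (norm B')\<^sup>2))"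
    "\<And>A. (norm (dird A f p))\<^sup>2 / 2 \<le> Re (dz A (db A (\<lambda>z. complex_of_real (\<phi> z))) p)"
    "\<And>A. Re (dz A (db A (\<lambda>z. complex_of_real (\<phi> z))) p) \<le> (real (Suc CARD('n)) + 1) * (norm (dird A f p))\<^sup>2"
proof -
  have pO: "p \<in> \<Omega>" using p by blast
  obtain f where f: "wide \<Omega> \<tau> f" "f p = 0" using chart[OF p] by blast
  note hf = wide_holomorphic[OF f(1) op]
  define g where "g = inv_into \<Omega> f"
  have gf: "g (f z) = z" if "z \<in> \<Omega>" for z unfolding g_def by (rule wide_inv_f[OF f(1) op that])
  have g0: "g 0 = p" using gf[OF pO] f by simp
  define n where "n = real (Suc CARD('n))"
  have n: "n \<ge> 2" by (simp add: n_def Suc_leI)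
  define D where "D z = (\<Sum>j\<in>J p. X j z)" for z
  define v where "v z = (\<Sum>j\<in>J p. X j z * (logvol (F j) z - logvol f z)) * inverse (D z)" for z
  define e where "e w = v (g w)" for w
  have big: "D p \<ge> bump ((1/32)\<^sup>2)" unfolding D_def using cover[OF p] sum_X_big[OF pO] by blast
  have err: "(\<forall>w\<in>ball 0 \<rho>. D (g w) > 0) \<and> CB 4 (1/8) e (ball 0 \<rho>)"
    unfolding e_def v_def D_def X_def g_def
    by (rule error[OF f(1) finJ[OF pO]]) (use wideF big g0 in \<open>auto simp: J_def D_def X_def g_def\<close>)
  define W where "W = {z\<in>\<Omega>. D z > 0}"
  have lD: "lsm D \<Omega>" unfolding D_def[abs_def] by (intro lsm_sum op lsm_X) (auto simp: J_def)
  have oW: "open W"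
  proof -
    have "W = D -` {0<..} \<inter> \<Omega>" by (auto simp: W_def)
    then show ?thesis using continuous_open_preimage[OF lsm_continuous_on[OF lD] op, of "{0<..}"] by (simp add: Int_commute)
  qed
  have WO: "W \<subseteq> \<Omega>" by (auto simp: W_def)
  have lv: "lsm v W"
  proof -
    have l: "lsm (X j) W" "lsm (logvol (F j)) W" if "j \<in> J p" for j
      using lsm_subset[OF lsm_X oW WO] lsm_subset[OF lsm_logvol[OF op wideF] oW WO] that by (auto simp: J_def)
    show ?thesis unfolding v_def[abs_def]
    proof (rule lsm_mult)
      show "lsm (\<lambda>z. \<Sum>j\<in>J p. X j z * (logvol (F j) z - logvol f z)) W"
        by (rule lsm_sum[OF oW]) (rule lsm_mult[OF l(1) lsm_diff[OF l(2) lsm_subset[OF lsm_logvol[OF op f(1)] oW WO]]])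
      show "lsm (\<lambda>z. inverse (D z)) W"
        by (rule lsm_compose_real[OF lsm_subset[OF lD oW WO] lsm_inverse]) (auto simp: W_def)
    qed
  qed
  have hg: "holomorphic_map_on g (ball 0 \<rho>)" unfolding g_def
    by (rule holomorphic_map_subset[OF wide_inv_holomorphic[OF f(1) op]]) (use \<tau> \<rho> in auto)
  have gi: "g ` ball 0 \<rho> \<subseteq> W"
  proof
    fix y assume "y \<in> g ` ball 0 \<rho>"
    then obtain w where w: "w \<in> ball 0 \<rho>" "y = g w" by blast
    have "g w \<in> \<Omega>" unfolding g_def by (rule wide_inv(1)[OF f(1)]) (use w \<tau> \<rho> in auto)
    then show "y \<in> W" using err w by (auto simp: W_def)
  qed
  let ?e = "\<lambda>w. complex_of_real (e w)"
  have le: "lsm ?e (ball 0 \<rho>)" unfolding e_def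
    by (rule lsm_holomorphic_compose[OF lsm_of_real[OF lv] hg open_ball gi])
  have CBe: "CB 4 (1/8) ?e (ball 0 \<rho>)"
  proof -
    have "CB 4 (1 * (1/8)) ?e (ball 0 \<rho>)"
      by (rule CB_linear[OF open_ball bounded_linear_of_real]) (use err in auto)
    then show ?thesis by simp
  qed
  obtain U where U: "open U" "p \<in> U" "U \<subseteq> \<Omega>" "\<And>z. z \<in> U \<Longrightarrow> \<phi> z = (\<Sum>j\<in>J p. X j z * logvol (F j) z) * inverse (cut z + D z)"
    "\<And>z. z \<in> U \<Longrightarrow> cut z + D z > 0"
    using local_form[OF pO] unfolding D_def by blast
  (* On T the cutoff vanishes and the summation is over the fixed set J p. *)
  define T where "T = U \<inter> (- K2) \<inter> {z\<in>\<Omega>. f z \<in> ball 0 \<rho>}"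
  have oT: "open T"
  proof -
    have "{z\<in>\<Omega>. f z \<in> ball 0 \<rho>} = \<Omega> \<inter> f -` ball 0 \<rho>" by auto
    then have "open {z\<in>\<Omega>. f z \<in> ball 0 \<rho>}" using continuous_open_preimage[OF holomorphic_map_continuous_on[OF hf] op open_ball] by simp
    then show ?thesis unfolding T_def using U(1) compact_imp_closed[OF K2(1)] by (intro open_Int) auto
  qed
  have pT: "p \<in> T" using U p pO f(2) \<rho> by (auto simp: T_def)
  have TO: "T \<subseteq> \<Omega>" by (auto simp: T_def)
  have hfT: "holomorphic_map_on f T" by (rule holomorphic_map_subset[OF hf TO])
  have fT: "f ` T \<subseteq> ball 0 \<rho>" by (auto simp: T_def)
  have fT1: "f ` T \<subseteq> ball 0 1" using fT \<rho> by (auto simp: subset_iff)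
  have dec: "\<phi> z = ln ((norm (Jac f z))\<^sup>2) + (n * ball_pot (f z) + e (f z))" if z: "z \<in> T" for z
  proof -
    have zU: "z \<in> U" and zO: "z \<in> \<Omega>" and z0: "cut z = 0" using z cut(3) by (auto simp: T_def)
    have D0: "D z > 0" using U(5)[OF zU] z0 by simp
    have "(\<Sum>j\<in>J p. X j z * (logvol (F j) z - logvol f z)) = (\<Sum>j\<in>J p. X j z * logvol (F j) z) - D z * logvol f z"
      by (simp add: D_def right_diff_distrib sum_subtractf sum_distrib_right)
    then have "v z = \<phi> z - logvol f z" unfolding v_def U(4)[OF zU] z0 using D0 by (simp add: field_simps)
    then have "\<phi> z = logvol f z + e (f z)" unfolding e_def gf[OF zO] by simp
    then show ?thesis by (simp add: logvol_def n_def ball_pot_def)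
  qed
  let ?\<phi> = "\<lambda>z. complex_of_real (\<phi> z)"
  let ?J = "\<lambda>z. complex_of_real (ln ((norm (Jac f z))\<^sup>2))"
  let ?b = "\<lambda>w::complex^'n. complex_of_real (ball_pot w)"
  have chJ: "chol (Jac f) T" by (rule Jac_chol[OF hfT oT])
  have nzJ: "Jac f z \<noteq> 0" if "z \<in> T" for z using f(1) embedding_Jac_nonzero[OF _ op, of f z] that TO unfolding wide_def by blast
  note plh = pluriharmonic_log[OF chJ nzJ oT pT] and lJ = lsm_log_norm[OF chJ nzJ oT]
  have lb: "lsm ?b (ball 0 1)" by (rule lsm_of_real[OF lsm_ball_pot])
  have lbf: "lsm (\<lambda>z. ?b (f z)) T" by (rule lsm_holomorphic_compose[OF lb hfT oT fT1])
  have lnb: "lsm (\<lambda>z. of_real n * ?b (f z)) T" by (intro lsm_mult lsm_const oT lbf)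
  have lef: "lsm (\<lambda>z. ?e (f z)) T" by (rule lsm_holomorphic_compose[OF le hfT oT fT])
  have dec': "?\<phi> z = ?J z + (of_real n * ?b (f z) + ?e (f z))" if "z \<in> T" for z using dec[OF that] by simp
  have lev: "lev ?\<phi> p A B V = of_real n * lev ?b 0 (dird A f p) (dird B f p) (dird V f p + dird B (dird A f) p) + lev ?e 0 (dird A f p) (dird B f p) (dird V f p + dird B (dird A f) p)" for A B V
  proof -
    have "lev ?\<phi> p A B V = lev (\<lambda>z. ?J z + (of_real n * ?b (f z) + ?e (f z))) p A B V"
      by (rule lev_cong(1)[OF oT pT dec'])
    also have "\<dots> = lev ?J p A B V + lev (\<lambda>z. of_real n * ?b (f z) + ?e (f z)) p A B V"
      by (rule lev_add(1)[OF lsm_of_real[OF lJ] lsm_add[OF lnb lef] pT])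
    also have "lev ?J p A B V = 0" by (rule plh(1))
    also have "lev (\<lambda>z. of_real n * ?b (f z) + ?e (f z)) p A B V = lev (\<lambda>z. of_real n * ?b (f z)) p A B V + lev (\<lambda>z. ?e (f z)) p A B V"
      by (rule lev_add(1)[OF lnb lef pT])
    also have "lev (\<lambda>z. of_real n * ?b (f z)) p A B V = of_real n * lev (\<lambda>z. ?b (f z)) p A B V" by (rule lev_cmult(1)[OF lbf pT])
    finally show ?thesis
      using lev_compose[OF lb hfT oT fT1 pT, of A B V] lev_compose[OF le hfT oT fT pT, of A B V] f(2) by simp
  qed
  have met: "dz A (db A ?\<phi>) p = of_real n * dz (dird A f p) (db (dird A f p) ?b) 0 + dz (dird A f p) (db (dird A f p) ?e) 0" for A
  proof -
    have "dz A (db A ?\<phi>) p = dz A (db A (\<lambda>z. ?J z + (of_real n * ?b (f z) + ?e (f z)))) p"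
      by (rule lev_cong(2)[OF oT pT dec'])
    also have "\<dots> = dz A (db A ?J) p + dz A (db A (\<lambda>z. of_real n * ?b (f z) + ?e (f z))) p"
      by (rule lev_add(2)[OF lsm_of_real[OF lJ] lsm_add[OF lnb lef] pT])
    also have "dz A (db A ?J) p = 0" by (rule plh(2))
    also have "dz A (db A (\<lambda>z. of_real n * ?b (f z) + ?e (f z))) p = dz A (db A (\<lambda>z. of_real n * ?b (f z))) p + dz A (db A (\<lambda>z. ?e (f z))) p"
      by (rule lev_add(2)[OF lnb lef pT])
    also have "dz A (db A (\<lambda>z. of_real n * ?b (f z))) p = of_real n * dz A (db A (\<lambda>z. ?b (f z))) p" by (rule lev_cmult(2)[OF lbf pT])
    finally show ?thesis
      using dzdb_compose[OF lb hfT oT fT1 pT, of A A] dzdb_compose[OF le hfT oT fT pT, of A A] f(2) by simp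
  qed
  have 0: "0 \<in> ball (0::complex^'n) \<rho>" using \<rho> by simp
  have be: "\<bar>Re (lev ?e 0 A B V)\<bar> \<le> ((norm A)\<^sup>2 * (norm B)\<^sup>2 + (norm V)\<^sup>2) / 4" "\<bar>Re (dz A (db A ?e) 0)\<bar> \<le> (norm A)\<^sup>2 / 8" for A B V
    using lev_CB_bound(1)[OF open_ball CBe 0, of A B V] abs_Re_le_cmod[of "lev ?e 0 A B V"] lev_CB_bound(2)[OF open_ball CBe 0, of A] abs_Re_le_cmod[of "dz A (db A ?e) 0"]
    by simp_all
  have bb: "Re (of_real n * dz A (db A ?b) 0) = n * (norm A)\<^sup>2" for A unfolding dzdb_ball_pot hip_self by simp
  show ?thesis
  proof (rule that[OF f])
    fix A B V
    define A' B' V' where "A' = dird A f p" and "B' = dird B f p" and "V' = dird V f p + dird B (dird A f) p"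
    define q where "q = (norm A')\<^sup>2 * (norm B')\<^sup>2"
    have q: "q \<ge> 0" by (simp add: q_def)
    have L: "Re (lev ?\<phi> p A B V) = n * Re (lev ?b 0 A' B' V') + Re (lev ?e 0 A' B' V')" unfolding lev A'_def B'_def V'_def by simp
    have "n * (q + (norm V')\<^sup>2) \<le> n * Re (lev ?b 0 A' B' V')" using lev_ball_pot_ge[of A' B' V'] n by (intro mult_left_mono) (auto simp: q_def)
    moreover have "2 * (q + (norm V')\<^sup>2) \<le> n * (q + (norm V')\<^sup>2)" using n q by (intro mult_right_mono) auto
    ultimately have low: "q / 2 \<le> Re (lev ?\<phi> p A B V)" using abs_le_D2[OF be(1)[of A' B' V', folded q_def]] q zero_le_power2[of "norm V'"] unfolding L by argo
    have up: "Re (lev ?\<phi> p A B V) \<le> (2 * n + 1) * q" if V: "V' = 0"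
    proof -
      have "norm (hip A' B') * norm (hip A' B') \<le> (norm A' * norm B') * (norm A' * norm B')" by (intro mult_mono hip_norm) auto
      moreover have "Re (hip A' B' * hip B' A') = (norm (hip A' B'))\<^sup>2"
        using complex_norm_square[of "hip A' B'"] unfolding hip_cnj by (metis Re_complex_of_real)
      moreover have "Re (hip A' A' * hip B' B') = q" unfolding hip_self q_def by (simp flip: of_real_mult)
      ultimately have "Re (lev ?b 0 A' B' V') \<le> 2 * q" unfolding lev_ball_pot V by (simp add: hip_simps q_def power2_eq_square mult_ac)
      then have "n * Re (lev ?b 0 A' B' V') \<le> n * (2 * q)" using n by (intro mult_left_mono) auto
      then show ?thesis unfolding L using be(1)[of A' B' V'] q V by (simp add: abs_le_iff q_def[symmetric] algebra_simps)
    qed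
    show "let A' = dird A f p; B' = dird B f p; V' = dird V f p + dird B (dird A f) p in
       (norm A')\<^sup>2 * (norm B')\<^sup>2 / 2 \<le> Re (lev ?\<phi> p A B V) \<and>
       (V' = 0 \<longrightarrow> Re (lev ?\<phi> p A B V) \<le> (2 * real (Suc CARD('n)) + 1) * ((norm A')\<^sup>2 * (norm B')\<^sup>2))"
      unfolding Let_def A'_def[symmetric] B'_def[symmetric] V'_def[symmetric] n_def[symmetric] q_def[symmetric] using low up by blast
  next
    fix A
    define A' where "A' = dird A f p"
    have M: "Re (dz A (db A ?\<phi>) p) = n * (norm A')\<^sup>2 + Re (dz A' (db A' ?e) 0)" unfolding met A'_def[symmetric] by (simp add: bb[simplified])
    have "2 * (norm A')\<^sup>2 \<le> n * (norm A')\<^sup>2" using n by (intro mult_right_mono) auto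
    then show "(norm (dird A f p))\<^sup>2 / 2 \<le> Re (dz A (db A ?\<phi>) p)" "Re (dz A (db A ?\<phi>) p) \<le> (real (Suc CARD('n)) + 1) * (norm (dird A f p))\<^sup>2"
      unfolding M n_def[symmetric] A'_def[symmetric] using be(2)[of A'] zero_le_power2[of "norm A'"] by (simp_all add: abs_le_iff distrib_right)
  qed
qed

end

section \<open>Squeezing near the boundary\<close>

text \<open>Rescaling shows that there are embeddings at all, so that the supremum in the squeezing function is over a nonempty set.\<close>

lemma affine_embedding:
  fixes p :: "complex^'n"
  assumes R: "R > 0" 
  shows "holomorphic_embedding_on (\<lambda>z. (1/R) *\<^sub>R (z - p)) \<Omega>"
proof -
  let ?f = "\<lambda>z. (1/R) *\<^sub>R (z - p)"
  have d: "(?f has_derivative (\<lambda>v. (1/R) *\<^sub>R v)) (at z)" for z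
    by (auto intro!: derivative_eq_intros)
  have fd: "frechet_derivative ?f (at z) = (\<lambda>v. (1/R) *\<^sub>R v)" for z using frechet_derivative_at[OF d] by simp
  show "holomorphic_embedding_on ?f \<Omega>"
    unfolding holomorphic_embedding_on_def
  proof (intro conjI ballI)
    show "holomorphic_map_on ?f \<Omega>"
      by (rule holomorphic_mapI[OF d]) (simp flip: cscale_of_real add: vec_eq_iff)
    show "inj (frechet_derivative ?f (at z))" for z unfolding fd using R by (simp add: inj_on_def)
    have "homeomorphism \<Omega> (?f ` \<Omega>) ?f (\<lambda>w. R *\<^sub>R w + p)"
      using R by (auto simp: homeomorphism_def image_image intro!: continuous_intros)
    then show "\<exists>g. homeomorphism \<Omega> (?f ` \<Omega>) ?f g" by blast
  qed
qed

lemma squeezing_wide: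
  fixes \<Omega> :: "(complex^'n) set"
  assumes op: "open \<Omega>" and bd: "bounded \<Omega>" and p: "p \<in> \<Omega>" and s: "squeezing_function \<Omega> p > 1 - \<tau>"
  shows "\<exists>f. wide \<Omega> \<tau> f \<and> f p = 0"
proof -
  obtain R where R: "R > 0" "\<Omega> \<subseteq> ball p R" using bounded_subset_ballD[OF bd, of p] by blast
  have "(\<lambda>z. (1/R) *\<^sub>R (z - p)) ` \<Omega> \<subseteq> ball 0 1"
    using R by (auto simp: dist_norm norm_minus_commute subset_iff)
  then have ne: "squeezing_maps \<Omega> p \<noteq> {}"
    using affine_embedding[OF R(1), of p \<Omega>] unfolding squeezing_maps_def by force
  have "1 - \<tau> < Sup ((\<lambda>f. Sup {r. 0 < r \<and> ball 0 r \<subseteq> f ` \<Omega>}) ` squeezing_maps \<Omega> p)"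
    using s unfolding squeezing_function_def .
  then obtain f where f: "f \<in> squeezing_maps \<Omega> p" "1 - \<tau> < Sup {r. 0 < r \<and> ball 0 r \<subseteq> f ` \<Omega>}"
    using less_cSupE ne by (metis (no_types, lifting) image_iff image_is_empty)
  have emb: "holomorphic_embedding_on f \<Omega>" "f ` \<Omega> \<subseteq> ball 0 1" "f p = 0" using f(1) by (auto simp: squeezing_maps_def)
  have "open (f ` \<Omega>)" by (rule embedding_props(3)[OF emb(1) op])
  moreover have "0 \<in> f ` \<Omega>" using p emb(3) by force
  ultimately obtain e where "e > 0" "ball 0 e \<subseteq> f ` \<Omega>" using openE by blast
  then have "{r. 0 < r \<and> ball 0 r \<subseteq> f ` \<Omega>} \<noteq> {}" by blast
  then obtain r where r: "1 - \<tau> < r" "ball 0 r \<subseteq> f ` \<Omega>" using less_cSupE[OF f(2)] by blast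
  then have "ball 0 (1 - \<tau>) \<subseteq> f ` \<Omega>" using subset_ball[of "1 - \<tau>" r 0] by auto
  then show ?thesis using emb unfolding wide_def by blast
qed

text \<open>Remove from the compact set \<open>closure \<Omega>\<close> an open ball around each boundary point, on which the squeezing function exceeds \<open>1 - \<tau>\<close>.\<close>

lemma squeezing_compact:
  fixes \<Omega> :: "(complex^'n) set"
  assumes op: "open \<Omega>" and bd: "bounded \<Omega>" and lim: "\<forall>q\<in>frontier \<Omega>. (squeezing_function \<Omega> \<longlongrightarrow> 1) (at q within \<Omega>)" and \<tau>: "\<tau> > 0"
  obtains K where "compact K" "K \<subseteq> \<Omega>" "\<And>p. p \<in> \<Omega> - K \<Longrightarrow> \<exists>f. wide \<Omega> \<tau> f \<and> f p = 0"
proof -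
  have nO: "q \<notin> \<Omega>" if "q \<in> frontier \<Omega>" for q using that op by (simp add: frontier_def interior_open)
  have "\<forall>q\<in>frontier \<Omega>. \<exists>d>0. \<forall>x\<in>\<Omega>. dist x q < d \<longrightarrow> squeezing_function \<Omega> x > 1 - \<tau>"
  proof
    fix q assume q: "q \<in> frontier \<Omega>"
    have "\<forall>\<^sub>F x in at q within \<Omega>. squeezing_function \<Omega> x > 1 - \<tau>"
      using lim q \<tau> by (intro order_tendstoD(1)) auto
    then obtain d where "d > 0" "\<forall>x\<in>\<Omega>. x \<noteq> q \<and> dist x q < d \<longrightarrow> squeezing_function \<Omega> x > 1 - \<tau>" 
      unfolding eventually_at by blast
    moreover have "x \<noteq> q" if "x \<in> \<Omega>" for x using nO[OF q] that by auto
    ultimately show "\<exists>d>0. \<forall>x\<in>\<Omega>. dist x q < d \<longrightarrow> squeezing_function \<Omega> x > 1 - \<tau>"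
      by (intro exI[of _ d]) simp
  qed
  then obtain d where d: "\<And>q. q \<in> frontier \<Omega> \<Longrightarrow> d q > 0 \<and> (\<forall>x\<in>\<Omega>. dist x q < d q \<longrightarrow> squeezing_function \<Omega> x > 1 - \<tau>)" by metis
  define K where "K = closure \<Omega> - (\<Union>q\<in>frontier \<Omega>. ball q (d q))"
  show ?thesis
  proof (rule that[of K])
    show "compact K" unfolding K_def using bd by (intro compact_diff) (auto simp: compact_closure)
    show "K \<subseteq> \<Omega>"
    proof
      fix x assume x: "x \<in> K"
      then have "x \<notin> frontier \<Omega>" using d unfolding K_def by force
      then show "x \<in> \<Omega>" using x unfolding K_def frontier_def interior_open[OF op] by blast
    qed
    fix p assume p: "p \<in> \<Omega> - K"
    then obtain q where q: "q \<in> frontier \<Omega>" "p \<in> ball q (d q)" unfolding K_def using closure_subset by blast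
    then have "squeezing_function \<Omega> p > 1 - \<tau>" using d p by (auto simp: dist_commute)
    then show "\<exists>f. wide \<Omega> \<tau> f \<and> f p = 0" using squeezing_wide[OF op bd] p by blast
  qed
qed

section \<open>Completeness\<close>

text \<open>The last assumption says that \<open>h\<close> is, up to a constant, at least the Caratheodory metric. It gives distances from below by means of
holomorphic maps to the ball.\<close>

locale dominating_metric =
  fixes \<Omega> :: "(complex^'n) set" and h :: "complex^'n \<Rightarrow> complex^'n^'n" and C R :: real
  assumes op: "open \<Omega>" and conn: "connected \<Omega>" and R: "R > 0" "\<Omega> \<subseteq> ball 0 R" and C: "C > 0"
    and cont: "continuous_on \<Omega> h"
    and dom: "\<And>F p X. holomorphic_map_on F \<Omega> \<Longrightarrow> F ` \<Omega> \<subseteq> ball (0::complex^'n) 1 \<Longrightarrow> p \<in> \<Omega> \<Longrightarrow> (norm (dird X F p))\<^sup>2 \<le> C * Re (herm_form (h p) X X)"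
begin

text \<open>The competitors in the definition of the distance.\<close>

definition adm :: "complex^'n \<Rightarrow> complex^'n \<Rightarrow> (real \<Rightarrow> complex^'n) \<Rightarrow> bool" where
  "adm x y \<gamma> \<longleftrightarrow> valid_path \<gamma> \<and> path_image \<gamma> \<subseteq> \<Omega> \<and> pathstart \<gamma> = x \<and> pathfinish \<gamma> = y \<and> metric_speed h \<gamma> integrable_on {0..1}"

abbreviation len where "len \<gamma> \<equiv> integral {0..1} (metric_speed h \<gamma>)"
abbreviation d where "d \<equiv> metric_dist \<Omega> h"

lemma d_eq: "x \<in> \<Omega> \<Longrightarrow> y \<in> \<Omega> \<Longrightarrow> d x y = Inf (len ` {\<gamma>. adm x y \<gamma>})"
proof -
  assume "x \<in> \<Omega>" "y \<in> \<Omega>"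
  moreover have "{len \<gamma> | \<gamma>. valid_path \<gamma> \<and> path_image \<gamma> \<subseteq> \<Omega> \<and> pathstart \<gamma> = x \<and> pathfinish \<gamma> = y \<and> metric_speed h \<gamma> integrable_on {0..1}} = len ` {\<gamma>. adm x y \<gamma>}"
    by (auto simp: adm_def)
  ultimately show ?thesis by (simp add: metric_dist_def)
qed

lemma affine_ball: "(\<lambda>z. (1/R) *\<^sub>R (z - 0)) ` \<Omega> \<subseteq> ball (0::complex^'n) 1"
  using R by (auto simp: subset_iff)

lemma affine_hol: "holomorphic_map_on (\<lambda>z. (1/R) *\<^sub>R (z - 0)) \<Omega>"
  using affine_embedding[OF R(1)] holomorphic_embedding_on_def by blast

lemma herm_nonneg: "p \<in> \<Omega> \<Longrightarrow> 0 \<le> Re (herm_form (h p) X X)"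
proof -
  assume "p \<in> \<Omega>"
  from dom[OF affine_hol affine_ball this, of X] have "0 \<le> C * Re (herm_form (h p) X X)"
    using zero_le_power2 order_trans by blast
  then show ?thesis using C by (simp add: zero_le_mult_iff)
qed

lemma path_in: "adm x y \<gamma> \<Longrightarrow> t \<in> {0..1} \<Longrightarrow> \<gamma> t \<in> \<Omega>"
  by (auto simp: adm_def path_image_def)

lemma speed_nonneg: "adm x y \<gamma> \<Longrightarrow> t \<in> {0..1} \<Longrightarrow> 0 \<le> metric_speed h \<gamma> t"
  unfolding metric_speed_def using herm_nonneg[OF path_in] by auto

lemma len_nonneg: "adm x y \<gamma> \<Longrightarrow> 0 \<le> len \<gamma>"
proof -
  assume a: "adm x y \<gamma>"
  then have "metric_speed h \<gamma> integrable_on {0..1}" by (simp add: adm_def)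
  then show "0 \<le> len \<gamma>" by (rule integral_nonneg) (rule speed_nonneg[OF a])
qed

lemma speed_cont:
  assumes "continuous_on {0..1} \<gamma>" "\<gamma> ` {0..1} \<subseteq> \<Omega>" "continuous_on {0..1} v"
  shows "continuous_on {0..1} (\<lambda>t. sqrt (Re (herm_form (h (\<gamma> t)) (v t) (v t))))"
proof -
  have "continuous_on {0..1} (\<lambda>t. h (\<gamma> t))" by (rule continuous_on_compose2[OF cont assms(1,2)])
  then show ?thesis unfolding herm_form_def using assms(3) by (intro continuous_intros)
qed

text \<open>Polynomial paths have continuous derivatives, so their speed is integrable.\<close>

lemma adm_exists:
  assumes "x \<in> \<Omega>" "y \<in> \<Omega>" shows "\<exists>\<gamma>. adm x y \<gamma>"
proof -
  obtain \<gamma> where g: "polynomial_function \<gamma>" "path_image \<gamma> \<subseteq> \<Omega>" "pathstart \<gamma> = x" "pathfinish \<gamma> = y"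
    using connected_open_polynomial_connected[OF op conn assms] by blast
  obtain v where v: "polynomial_function v" "\<And>t. (\<gamma> has_vector_derivative v t) (at t)"
    using has_vector_derivative_polynomial_function[OF g(1)] by blast
  have vd: "vector_derivative \<gamma> (at t) = v t" for t using vector_derivative_at[OF v(2)] .
  have "continuous_on {0..1} (metric_speed h \<gamma>)" unfolding metric_speed_def[abs_def] vd
    by (rule speed_cont) (use g v in \<open>auto intro: continuous_on_polymonial_function simp: path_image_def\<close>)
  then have "metric_speed h \<gamma> integrable_on {0..1}" by (rule integrable_continuous_real)
  then show ?thesis unfolding adm_def using g valid_path_polynomial_function by blast
qed

lemma adm_ne: "x \<in> \<Omega> \<Longrightarrow> y \<in> \<Omega> \<Longrightarrow> len ` {\<gamma>. adm x y \<gamma>} \<noteq> {}"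
  using adm_exists by blast

lemma adm_bdd: "bdd_below (len ` {\<gamma>. adm x y \<gamma>})"
  by (rule bdd_belowI[of _ 0]) (auto dest: len_nonneg)

lemma d_le: "x \<in> \<Omega> \<Longrightarrow> y \<in> \<Omega> \<Longrightarrow> adm x y \<gamma> \<Longrightarrow> d x y \<le> len \<gamma>"
  unfolding d_eq by (rule cInf_lower[OF _ adm_bdd]) auto

lemma d_ge: "x \<in> \<Omega> \<Longrightarrow> y \<in> \<Omega> \<Longrightarrow> (\<And>\<gamma>. adm x y \<gamma> \<Longrightarrow> b \<le> len \<gamma>) \<Longrightarrow> b \<le> d x y"
  unfolding d_eq by (rule cInf_greatest[OF adm_ne]) auto

lemma d_nonneg: "0 \<le> d x y"
  using d_ge[of x y 0] len_nonneg by (cases "x \<in> \<Omega> \<and> y \<in> \<Omega>") (auto simp: metric_dist_def)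

lemma d_approx: assumes "x \<in> \<Omega>" "y \<in> \<Omega>" "e > 0" obtains \<gamma> where "adm x y \<gamma>" "len \<gamma> < d x y + e"
proof -
  have "Inf (len ` {\<gamma>. adm x y \<gamma>}) < d x y + e" using d_eq assms by simp
  then show ?thesis using cInf_lessD[OF adm_ne[OF assms(1,2)]] that by blast
qed

lemma valid_path_derivative:
  assumes "valid_path (\<gamma> :: real \<Rightarrow> complex^'n)"
  shows "\<exists>S. finite S \<and> (\<forall>t\<in>{0..1} - S. (\<gamma> has_vector_derivative vector_derivative \<gamma> (at t)) (at t)) \<and> continuous_on {0..1} \<gamma>"
proof -
  obtain S where "continuous_on {0..1} \<gamma>" "finite S" "\<gamma> C1_differentiable_on ({0..1} - S)"
    using assms unfolding valid_path_def piecewise_C1_differentiable_on_def by blast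
  then show ?thesis unfolding C1_differentiable_on_eq by (metis vector_derivative_works)
qed

text \<open>Holomorphic maps to the ball do not increase lengths by more than a constant factor.\<close>

lemma dominated_length:
  assumes F: "holomorphic_map_on F \<Omega>" "F ` \<Omega> \<subseteq> ball (0::complex^'n) 1" and \<gamma>: "adm x y \<gamma>"
  shows "norm (F y - F x) \<le> sqrt C * len \<gamma>"
proof -
  have vp: "valid_path \<gamma>" and sp: "metric_speed h \<gamma> integrable_on {0..1}" and e: "\<gamma> 0 = x" "\<gamma> 1 = y"
    using \<gamma> by (auto simp: adm_def pathstart_def pathfinish_def)
  obtain S where S: "finite S" "\<And>t. t \<in> {0..1} - S \<Longrightarrow> (\<gamma> has_vector_derivative vector_derivative \<gamma> (at t)) (at t)" "continuous_on {0..1} \<gamma>"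
    using valid_path_derivative[OF vp] by blast
  let ?D = "\<lambda>t. dird (vector_derivative \<gamma> (at t)) F (\<gamma> t)"
  have "(?D has_integral (F (\<gamma> 1) - F (\<gamma> 0))) {0..1}"
  proof (rule fundamental_theorem_of_calculus_strong[OF S(1), of 0 1 "\<lambda>t. F (\<gamma> t)"])
    fix t assume t: "t \<in> {0..1} - S"
    have gO: "\<gamma> t \<in> \<Omega>" using path_in[OF \<gamma>] t by auto
    have l: "linear (\<lambda>v. dird v F (\<gamma> t))" by (rule holomorphic_map_linear[OF F(1) gO])
    have "((\<lambda>t. F (\<gamma> t)) has_derivative (\<lambda>s. dird (s *\<^sub>R vector_derivative \<gamma> (at t)) F (\<gamma> t))) (at t)"
      by (rule has_derivative_compose[OF S(2)[OF t, unfolded has_vector_derivative_def] holomorphic_map_has_derivative[OF F(1) gO]])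
    then show "((\<lambda>t. F (\<gamma> t)) has_vector_derivative ?D t) (at t)"
      unfolding has_vector_derivative_def by (simp add: linear_cmul[OF l])
  next
    show "continuous_on {0..1} (\<lambda>t. F (\<gamma> t))"
      by (rule continuous_on_compose2[OF holomorphic_map_continuous_on[OF F(1)] S(3)]) (use path_in[OF \<gamma>] in auto)
  qed simp
  then have int: "?D integrable_on {0..1}" "integral {0..1} ?D = F y - F x" using e by (auto simp: has_integral_iff)
  have "norm (integral {0..1} ?D) \<le> integral {0..1} (\<lambda>t. sqrt C * metric_speed h \<gamma> t)"
  proof (rule integral_norm_bound_integral[OF int(1) integrable_on_mult_right[OF sp]])
    fix t :: real assume t: "t \<in> {0..1}"
    have "(norm (?D t))\<^sup>2 \<le> C * Re (herm_form (h (\<gamma> t)) (vector_derivative \<gamma> (at t)) (vector_derivative \<gamma> (at t)))"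
      by (rule dom[OF F path_in[OF \<gamma> t]])
    then have "sqrt ((norm (?D t))\<^sup>2) \<le> sqrt (C * Re (herm_form (h (\<gamma> t)) (vector_derivative \<gamma> (at t)) (vector_derivative \<gamma> (at t))))"
      by (rule real_sqrt_le_mono)
    then show "norm (?D t) \<le> sqrt C * metric_speed h \<gamma> t" by (simp add: metric_speed_def real_sqrt_mult)
  qed
  then show ?thesis unfolding int(2) by simp
qed

lemma dominated_dist:
  assumes F: "holomorphic_map_on F \<Omega>" "F ` \<Omega> \<subseteq> ball (0::complex^'n) 1" and xy: "x \<in> \<Omega>" "y \<in> \<Omega>"
  shows "norm (F y - F x) \<le> sqrt C * d x y"
proof -
  have "norm (F y - F x) / sqrt C \<le> d x y"
    by (rule d_ge[OF xy]) (use dominated_length[OF F] C in \<open>simp add: divide_le_eq mult.commute\<close>)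
  then show ?thesis using C by (simp add: divide_le_eq mult.commute)
qed

lemma euclid_le_d: "x \<in> \<Omega> \<Longrightarrow> y \<in> \<Omega> \<Longrightarrow> norm (y - x) \<le> R * (sqrt C * d x y)"
proof -
  assume xy: "x \<in> \<Omega>" "y \<in> \<Omega>"
  have "norm ((1/R) *\<^sub>R (y - 0) - (1/R) *\<^sub>R (x - 0)) \<le> sqrt C * d x y" by (rule dominated_dist[OF affine_hol affine_ball xy])
  then have "norm (y - x) / R \<le> sqrt C * d x y" using R(1) by (simp flip: scaleR_diff_right)
  then show ?thesis using R(1) by (simp add: divide_le_eq mult.commute)
qed

lemma herm_form_scaleR: "herm_form H (r *\<^sub>R X) (r *\<^sub>R X) = of_real (r\<^sup>2) * herm_form H X X"
  unfolding herm_form_def vector_scaleR_component scaleR_conv_of_real[where 'a=complex] complex_cnj_mult complex_cnj_complex_of_real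
  by (simp add: sum_distrib_left power2_eq_square mult_ac)

lemma speed_eq:
  assumes "(\<gamma> has_vector_derivative r *\<^sub>R v) (at t)"
  shows "metric_speed h \<gamma> t = \<bar>r\<bar> * sqrt (Re (herm_form (h (\<gamma> t)) v v))"
  unfolding metric_speed_def vector_derivative_at[OF assms] herm_form_scaleR by (simp add: real_sqrt_mult)

lemma adm_reverse:
  assumes \<gamma>: "adm x y \<gamma>" shows "adm y x (reversepath \<gamma>)" "len (reversepath \<gamma>) = len \<gamma>"
proof -
  have vp: "valid_path \<gamma>" and sp: "metric_speed h \<gamma> integrable_on {0..1}" using \<gamma> by (auto simp: adm_def)
  obtain S where S: "finite S" "\<And>t. t \<in> {0..1} - S \<Longrightarrow> (\<gamma> has_vector_derivative vector_derivative \<gamma> (at t)) (at t)" "continuous_on {0..1} \<gamma>"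
    using valid_path_derivative[OF vp] by blast
  have "(metric_speed h \<gamma> has_integral len \<gamma>) {0..1}" using sp by (rule integrable_integral)
  then have "(metric_speed h \<gamma> has_integral len \<gamma>) (cbox 0 1)" by simp
  from has_integral_affinity[OF this, of "-1" 1]
  have i: "((\<lambda>t. metric_speed h \<gamma> (1 - t)) has_integral len \<gamma>) {0..1}" by (simp add: image_affinity_atLeastAtMost_diff image_affinity_cbox)
  have eq: "metric_speed h (reversepath \<gamma>) t = metric_speed h \<gamma> (1 - t)" if t: "t \<in> {0..1} - (\<lambda>t. 1 - t) ` S" for t
  proof -
    have "1 - t \<notin> S"
    proof
      assume "1 - t \<in> S"
      then have "1 - (1 - t) \<in> (\<lambda>t. 1 - t) ` S" by (rule imageI)
      then show False using t by simp
    qed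
    then have t': "1 - t \<in> {0..1} - S" using t by simp
    have "((\<lambda>t. 1 - t) has_vector_derivative (-1)) (at t)" by (auto intro!: derivative_eq_intros simp: has_real_derivative_iff_has_vector_derivative[symmetric])
    from vector_diff_chain_at[OF this S(2)[OF t']]
    have "(reversepath \<gamma> has_vector_derivative (-1) *\<^sub>R vector_derivative \<gamma> (at (1 - t))) (at t)" by (simp add: reversepath_def o_def)
    from speed_eq[OF this] show ?thesis by (simp add: reversepath_def metric_speed_def)
  qed
  have "(metric_speed h (reversepath \<gamma>) has_integral len \<gamma>) {0..1}"
    by (rule has_integral_spike_finite[OF finite_imageI[OF S(1)] eq i])
  then show "len (reversepath \<gamma>) = len \<gamma>" "adm y x (reversepath \<gamma>)" using \<gamma> by (auto simp: adm_def has_integral_iff)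
qed

lemma adm_join:
  assumes \<gamma>: "adm x y \<gamma>" and \<delta>: "adm y z \<delta>" shows "adm x z (\<gamma> +++ \<delta>)" "len (\<gamma> +++ \<delta>) = len \<gamma> + len \<delta>"
proof -
  have vp: "valid_path \<gamma>" "valid_path \<delta>" and sp: "metric_speed h \<gamma> integrable_on {0..1}" "metric_speed h \<delta> integrable_on {0..1}" using \<gamma> \<delta> by (auto simp: adm_def)
  have e: "pathfinish \<gamma> = pathstart \<delta>" using \<gamma> \<delta> by (auto simp: adm_def)
  obtain S1 where S1: "finite S1" "\<And>t. t \<in> {0..1} - S1 \<Longrightarrow> (\<gamma> has_vector_derivative vector_derivative \<gamma> (at t)) (at t)" "continuous_on {0..1} \<gamma>"
    using valid_path_derivative[OF vp(1)] by blast
  obtain S2 where S2: "finite S2" "\<And>t. t \<in> {0..1} - S2 \<Longrightarrow> (\<delta> has_vector_derivative vector_derivative \<delta> (at t)) (at t)" "continuous_on {0..1} \<delta>"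
    using valid_path_derivative[OF vp(2)] by blast
  have "(metric_speed h \<gamma> has_integral len \<gamma>) (cbox 0 1)" using integrable_integral[OF sp(1)] by simp
  from has_integral_mult_right[OF has_integral_affinity[OF this, of 2 0], of 2]
  have i1: "((\<lambda>t. 2 * metric_speed h \<gamma> (2 * t)) has_integral len \<gamma>) {0..1/2}" by (simp add: image_affinity_cbox cbox_interval image_mult_atLeastAtMost image_divide_atLeastAtMost)
  have "(metric_speed h \<delta> has_integral len \<delta>) (cbox 0 1)" using integrable_integral[OF sp(2)] by simp
  from has_integral_mult_right[OF has_integral_affinity[OF this, of 2 "-1"], of 2]
  have i2: "((\<lambda>t. 2 * metric_speed h \<delta> (2 * t - 1)) has_integral len \<delta>) {1/2..1}" by (simp add: image_affinity_cbox cbox_interval image_affinity_atLeastAtMost_div)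
  let ?j = "\<gamma> +++ \<delta>"
  have e1: "metric_speed h ?j t = 2 * metric_speed h \<gamma> (2 * t)" if t: "t \<in> {0..1/2} - insert (1/2) ((\<lambda>t. t/2) ` S1)" for t
  proof -
    have "2 * t \<notin> S1"
    proof
      assume "2 * t \<in> S1"
      then have "(2 * t) / 2 \<in> (\<lambda>t. t/2) ` S1" by (rule imageI)
      then show False using t by simp
    qed
    then have t': "2 * t \<in> {0..1} - S1" using t by simp
    have "((\<lambda>t. 2 * t) has_vector_derivative 2) (at t)" by (auto intro!: derivative_eq_intros simp: has_real_derivative_iff_has_vector_derivative[symmetric])
    from vector_diff_chain_at[OF this S1(2)[OF t']]
    have "((\<lambda>t. \<gamma> (2 * t)) has_vector_derivative 2 *\<^sub>R vector_derivative \<gamma> (at (2 * t))) (at t)" by (simp add: o_def)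
    then have "(?j has_vector_derivative 2 *\<^sub>R vector_derivative \<gamma> (at (2 * t))) (at t)"
      by (rule has_vector_derivative_transform_within_open[of _ _ _ "{..<1/2}"]) (use t in \<open>auto simp: joinpaths_def\<close>)
    from speed_eq[OF this] show ?thesis using t by (simp add: joinpaths_def metric_speed_def)
  qed
  have e2: "metric_speed h ?j t = 2 * metric_speed h \<delta> (2 * t - 1)" if t: "t \<in> {1/2..1} - insert (1/2) ((\<lambda>t. (t + 1)/2) ` S2)" for t
  proof -
    have "2 * t - 1 \<notin> S2"
    proof
      assume "2 * t - 1 \<in> S2"
      then have "((2 * t - 1) + 1) / 2 \<in> (\<lambda>t. (t + 1)/2) ` S2" by (rule imageI)
      then show False using t by simp
    qed
    then have t': "2 * t - 1 \<in> {0..1} - S2" using t by simp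
    have "((\<lambda>t. 2 * t - 1) has_vector_derivative 2) (at t)" by (auto intro!: derivative_eq_intros simp: has_real_derivative_iff_has_vector_derivative[symmetric])
    from vector_diff_chain_at[OF this S2(2)[OF t']]
    have "((\<lambda>t. \<delta> (2 * t - 1)) has_vector_derivative 2 *\<^sub>R vector_derivative \<delta> (at (2 * t - 1))) (at t)" by (simp add: o_def)
    then have "(?j has_vector_derivative 2 *\<^sub>R vector_derivative \<delta> (at (2 * t - 1))) (at t)"
      by (rule has_vector_derivative_transform_within_open[of _ _ _ "{1/2<..}"]) (use t in \<open>auto simp: joinpaths_def\<close>)
    from speed_eq[OF this] show ?thesis using t by (simp add: joinpaths_def metric_speed_def)
  qed
  have "(metric_speed h ?j has_integral len \<gamma>) {0..1/2}"
    by (rule has_integral_spike_finite[OF _ e1 i1, of "insert (1/2) ((\<lambda>t. t/2) ` S1)"]) (use S1(1) in simp)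
  moreover have "(metric_speed h ?j has_integral len \<delta>) {1/2..1}"
    by (rule has_integral_spike_finite[OF _ e2 i2, of "insert (1/2) ((\<lambda>t. (t+1)/2) ` S2)"]) (use S2(1) in simp)
  ultimately have "(metric_speed h ?j has_integral (len \<gamma> + len \<delta>)) {0..1}"
    by (intro has_integral_combine[of 0 "1/2" 1]) auto
  moreover have "valid_path ?j" using vp e by (simp add: valid_path_join)
  ultimately show "adm x z ?j" "len ?j = len \<gamma> + len \<delta>"
    using \<gamma> \<delta> e by (auto simp: adm_def has_integral_iff path_image_join)
qed

lemma d_sym: "d x y = d y x"
proof (cases "x \<in> \<Omega> \<and> y \<in> \<Omega>")
  case True
  have "d x y \<le> d y x" if "x \<in> \<Omega>" "y \<in> \<Omega>" for x y
    by (rule d_ge[OF that(2,1)]) (use d_le[OF that] adm_reverse in metis)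
  then show ?thesis using True by (meson order_antisym)
qed (auto simp: metric_dist_def)

lemma d_triangle: assumes "x \<in> \<Omega>" "y \<in> \<Omega>" "z \<in> \<Omega>" shows "d x z \<le> d x y + d y z"
proof (rule field_le_epsilon)
  fix e :: real assume e: "e > 0"
  obtain \<gamma> where \<gamma>: "adm x y \<gamma>" "len \<gamma> < d x y + e/2" using d_approx[OF assms(1,2), of "e/2"] e by auto
  obtain \<delta> where \<delta>: "adm y z \<delta>" "len \<delta> < d y z + e/2" using d_approx[OF assms(2,3), of "e/2"] e by auto
  have "d x z \<le> len \<gamma> + len \<delta>" using d_le[OF assms(1,3) adm_join(1)[OF \<gamma>(1) \<delta>(1)]] adm_join(2)[OF \<gamma>(1) \<delta>(1)] by simp
  then show "d x z \<le> d x y + d y z + e" using \<gamma>(2) \<delta>(2) by simp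
qed

text \<open>Near \<open>x\<close> the length of a segment is at most a constant times its Euclidean length. Together with \<open>euclid_le_d\<close> the distance is
compatible with the topology.\<close>

lemma d_upper:
  assumes x: "x \<in> \<Omega>" obtains e M where "e > 0" "M > 0" "ball x e \<subseteq> \<Omega>" "\<And>y. y \<in> ball x e \<Longrightarrow> d x y \<le> M * norm (y - x)"
proof -
  obtain e where e: "e > 0" "cball x e \<subseteq> \<Omega>" using op x open_contains_cball by blast
  have "bounded (h ` cball x e)"
    by (intro compact_imp_bounded compact_continuous_image continuous_on_subset[OF cont e(2)]) simp
  then obtain B where "\<forall>H\<in>h ` cball x e. norm H \<le> B" by (meson bounded_iff)
  then have B: "norm (h z) \<le> B" if "z \<in> cball x e" for z using that by blast
  define M where "M = (real CARD('n))\<^sup>2 * \<bar>B\<bar> + 1"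
  have M: "M \<ge> 1" by (simp add: M_def)
  have hb: "Re (herm_form (h z) X X) \<le> M * (norm X)\<^sup>2" if "z \<in> cball x e" for z X
  proof -
    have "norm (herm_form (h z) X X) \<le> (\<Sum>i\<in>UNIV. \<Sum>j\<in>UNIV. norm (h z $ i $ j * X $ i * cnj (X $ j)))"
      unfolding herm_form_def by (rule order_trans[OF norm_sum sum_mono[OF norm_sum]])
    also have "\<dots> \<le> (\<Sum>i\<in>(UNIV::'n set). \<Sum>j\<in>(UNIV::'n set). \<bar>B\<bar> * norm X * norm X)"
    proof (intro sum_mono)
      fix i j
      have "norm (h z $ i $ j) \<le> norm (h z)" using Finite_Cartesian_Product.norm_nth_le[of "h z" i] Finite_Cartesian_Product.norm_nth_le[of "h z $ i" j] by linarith
      then have "norm (h z $ i $ j) \<le> \<bar>B\<bar>" using B[OF that] by linarith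
      then show "norm (h z $ i $ j * X $ i * cnj (X $ j)) \<le> \<bar>B\<bar> * norm X * norm X"
        unfolding norm_mult complex_mod_cnj by (intro mult_mono Finite_Cartesian_Product.norm_nth_le) auto
    qed
    also have "\<dots> = ((real CARD('n))\<^sup>2 * \<bar>B\<bar>) * (norm X)\<^sup>2" by (simp add: power2_eq_square)
    also have "\<dots> \<le> M * (norm X)\<^sup>2" by (intro mult_right_mono) (auto simp: M_def)
    finally show ?thesis using complex_Re_le_cmod order_trans by blast
  qed
  have "d x y \<le> sqrt M * norm (y - x)" if y: "y \<in> ball x e" for y
  proof -
    let ?l = "linepath x y"
    have seg: "closed_segment x y \<subseteq> cball x e" using e y by (intro closed_segment_subset) auto
    have yO: "y \<in> \<Omega>" using y e by auto
    have sp: "metric_speed h ?l = (\<lambda>t. sqrt (Re (herm_form (h (?l t)) (y - x) (y - x))))"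
      unfolding metric_speed_def[abs_def] by (simp add: vector_derivative_linepath_at)
    have im: "?l t \<in> cball x e" if "t \<in> {0..1}" for t using seg linepath_in_path[OF that] by blast
    have "continuous_on {0..1} (metric_speed h ?l)" unfolding sp
      by (rule speed_cont) (use im e in \<open>auto intro!: continuous_intros continuous_on_linepath\<close>)
    then have int: "metric_speed h ?l integrable_on {0..1}" by (rule integrable_continuous_real)
    have "adm x y ?l" unfolding adm_def using int seg e by auto
    then have "d x y \<le> len ?l" by (rule d_le[OF x yO])
    also have "\<dots> \<le> integral {0..1} (\<lambda>t::real. sqrt M * norm (y - x))"
    proof (rule integral_le[OF int])
      fix t :: real assume t: "t \<in> {0..1}"
      have "sqrt (Re (herm_form (h (?l t)) (y - x) (y - x))) \<le> sqrt (M * (norm (y - x))\<^sup>2)" by (intro real_sqrt_le_mono hb im t)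
      then show "metric_speed h ?l t \<le> sqrt M * norm (y - x)" unfolding sp by (simp add: real_sqrt_mult)
    qed (intro integrable_continuous_real continuous_intros)
    finally show ?thesis by simp
  qed
  moreover have "ball x e \<subseteq> \<Omega>" using e by auto
  ultimately show ?thesis using that[of e "sqrt M"] e(1) M by simp
qed

lemma metric_space: "Metric_space \<Omega> d"
proof
  show "0 \<le> d x y" for x y by (rule d_nonneg)
  show "d x y = d y x" for x y by (rule d_sym)
  show "d x z \<le> d x y + d y z" if "x \<in> \<Omega>" "y \<in> \<Omega>" "z \<in> \<Omega>" for x y z by (rule d_triangle[OF that])
  show "(d x y = 0) = (x = y)" if "x \<in> \<Omega>" "y \<in> \<Omega>" for x y
  proof
    assume "d x y = 0" then show "x = y" using euclid_le_d[OF that] by simp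
  next
    assume xy: "x = y"
    obtain e M where eM: "e > 0" "M > 0" "ball x e \<subseteq> \<Omega>" "\<And>y. y \<in> ball x e \<Longrightarrow> d x y \<le> M * norm (y - x)" by (rule d_upper[OF \<open>x \<in> \<Omega>\<close>]) (rule that)
    from eM(4)[of x] eM(1) show "d x y = 0" using d_nonneg[of x x] xy by simp
  qed
qed

text \<open>Balls of one fixed radius \<open>r\<close> are relatively compact: around points of \<open>K\<close> because the distance dominates the Euclidean one, elsewhere
because the centred embedding maps the ball into the ball of radius \<open>1/2\<close>, whose preimage is compact. A Cauchy sequence eventually stays in
such a ball.\<close>

lemma complete:
  assumes K: "compact K" "K \<subseteq> \<Omega>" and chart: "\<And>p. p \<in> \<Omega> - K \<Longrightarrow> \<exists>f. wide \<Omega> (1/12) f \<and> f p = 0"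
  shows "complete_metric_on \<Omega> h"
proof -
  interpret Metric_space \<Omega> d by (rule metric_space)
  obtain \<delta> where \<delta>: "\<delta> > 0" "(\<Union>x\<in>K. cball x \<delta>) \<subseteq> \<Omega>" using compact_subset_open_imp_cball_epsilon_subset[OF K(1) op K(2)] by blast
  define r where "r = min (1 / (2 * sqrt C)) (\<delta> / (R * sqrt C))"
  have r: "r > 0" "r * sqrt C \<le> 1/2" "r * (R * sqrt C) \<le> \<delta>"
  proof -
    have s: "sqrt C > 0" using C by simp
    show "r > 0" using s R(1) \<delta>(1) by (simp add: r_def)
    have "r * sqrt C \<le> (1 / (2 * sqrt C)) * sqrt C" using s by (intro mult_right_mono) (auto simp: r_def)
    then show "r * sqrt C \<le> 1/2" using s by simp
    have "r * (R * sqrt C) \<le> (\<delta> / (R * sqrt C)) * (R * sqrt C)" using s R(1) by (intro mult_right_mono) (auto simp: r_def)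
    then show "r * (R * sqrt C) \<le> \<delta>" using s R(1) by simp
  qed
  have ball_compact: "\<exists>B. compact B \<and> B \<subseteq> \<Omega> \<and> (\<forall>q\<in>\<Omega>. d p q < r \<longrightarrow> q \<in> B)" if p: "p \<in> \<Omega>" for p
  proof (cases "p \<in> K")
    case True
    have "q \<in> cball p \<delta>" if q: "q \<in> \<Omega>" "d p q < r" for q
    proof -
      have "norm (q - p) \<le> R * (sqrt C * d p q)" by (rule euclid_le_d[OF p q(1)])
      also have "\<dots> = d p q * (R * sqrt C)" by simp
      also have "\<dots> \<le> r * (R * sqrt C)" using q(2) R(1) C by (intro mult_right_mono) auto
      finally show ?thesis using r(3) by (simp add: dist_norm norm_minus_commute)
    qed
    then show ?thesis using \<delta>(2) True by (intro exI[of _ "cball p \<delta>"]) auto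
  next
    case False
    then obtain f where f: "wide \<Omega> (1/12) f" "f p = 0" using chart p by blast
    define g where "g = inv_into \<Omega> f"
    have hg: "holomorphic_map_on g (ball 0 (1 - 1/12))" unfolding g_def by (rule wide_inv_holomorphic[OF f(1) op])
    have sub: "cball 0 (1/2) \<subseteq> ball (0::complex^'n) (1 - 1/12)" by auto
    have "compact (g ` cball 0 (1/2))"
      by (intro compact_continuous_image continuous_on_subset[OF holomorphic_map_continuous_on[OF hg] sub]) simp
    moreover have "g ` cball 0 (1/2) \<subseteq> \<Omega>" unfolding g_def using wide_inv(1)[OF f(1)] sub by auto
    moreover have "q \<in> g ` cball 0 (1/2)" if q: "q \<in> \<Omega>" "d p q < r" for q
    proof -
      have "norm (f q - f p) \<le> sqrt C * d p q"
        by (rule dominated_dist[OF wide_holomorphic[OF f(1) op] _ p q(1)]) (use f(1) in \<open>simp add: wide_def\<close>)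
      also have "\<dots> \<le> sqrt C * r" using q(2) C by (intro mult_left_mono) auto
      finally have "f q \<in> cball 0 (1/2)" using r(2) f(2) by (simp add: mult.commute)
      moreover have "q = g (f q)" unfolding g_def by (rule wide_inv_f[OF f(1) op q(1), symmetric])
      ultimately show ?thesis by blast
    qed
    ultimately show ?thesis by blast
  qed
  have "mcomplete"
    unfolding mcomplete_def
  proof (intro allI impI)
    fix \<sigma> assume \<sigma>: "MCauchy \<sigma>"
    have range: "\<sigma> n \<in> \<Omega>" for n using \<sigma> by (auto simp: MCauchy_def)
    obtain N where N: "\<And>n n'. N \<le> n \<Longrightarrow> N \<le> n' \<Longrightarrow> d (\<sigma> n) (\<sigma> n') < r" using \<sigma> r(1) unfolding MCauchy_def by blast
    obtain B where B: "compact B" "B \<subseteq> \<Omega>" "\<And>q. q \<in> \<Omega> \<Longrightarrow> d (\<sigma> N) q < r \<Longrightarrow> q \<in> B" using ball_compact[OF range] by metis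
    have "\<forall>n. \<sigma> (N + n) \<in> B" using B(3)[OF range N] by simp
    then obtain x s where x: "x \<in> B" "strict_mono s" "((\<lambda>n. \<sigma> (N + n)) \<circ> s) \<longlonglongrightarrow> x"
      using B(1)[unfolded compact_eq_seq_compact_metric seq_compact_def, rule_format, of "\<lambda>n. \<sigma> (N + n)"] by blast
    have xO: "x \<in> \<Omega>" using x B by blast
    obtain e M where eM: "e > 0" "M > 0" "\<And>y. y \<in> ball x e \<Longrightarrow> d x y \<le> M * norm (y - x)" using d_upper[OF xO] by metis
    define t where "t n = N + s n" for n
    have t: "strict_mono t" using x(2) by (simp add: t_def strict_mono_def)
    have "limitin mtopology (\<sigma> \<circ> t) x sequentially"
      unfolding limit_metric_sequentially
    proof (intro conjI allI impI xO)
      fix \<epsilon> :: real assume eps: "\<epsilon> > 0"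
      have "min e (\<epsilon> / M) > 0" using eM eps by simp
      then obtain n0 where n0: "\<And>n. n \<ge> n0 \<Longrightarrow> dist (\<sigma> (t n)) x < min e (\<epsilon> / M)"
        using x(3) unfolding lim_sequentially t_def o_def by blast
      show "\<exists>N. \<forall>n\<ge>N. (\<sigma> \<circ> t) n \<in> \<Omega> \<and> d ((\<sigma> \<circ> t) n) x < \<epsilon>"
      proof (intro exI[of _ n0] allI impI conjI)
        fix n assume n: "n0 \<le> n"
        show "(\<sigma> \<circ> t) n \<in> \<Omega>" using range by simp
        have "d x (\<sigma> (t n)) \<le> M * norm (\<sigma> (t n) - x)" by (rule eM(3)) (use n0[OF n] in \<open>simp add: dist_commute\<close>)
        also have "\<dots> < M * (\<epsilon> / M)" using n0[OF n] eM(2) by (intro mult_strict_left_mono) (auto simp: dist_norm)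
        finally show "d ((\<sigma> \<circ> t) n) x < \<epsilon>" using eM(2) d_sym by simp
      qed
    qed
    then show "\<exists>x. limitin mtopology \<sigma> x sequentially" using MCauchy_convergent_subsequence[OF \<sigma> t] by blast
  qed
  then show ?thesis unfolding complete_metric_on_def .
qed

end

section \<open>The metric\<close>

lemma base_pot_inner: "base_pot \<kappa> z = inner z z + \<kappa> * (inner z z * inner z z)"
  unfolding base_pot_def power2_norm_eq_inner by (simp add: power2_eq_square)

text \<open>The inverse of a chart is a bounded holomorphic map, so in charts the base potential has bounded derivatives.\<close>

lemma base_chart_CB:
  assumes R: "R \<ge> 0"
  shows "\<exists>M\<ge>0. \<forall>g :: complex^'n \<Rightarrow> complex^'n. holomorphic_map_on g (ball 0 (7/8)) \<longrightarrow> (\<forall>w\<in>ball 0 (7/8). norm (g w) \<le> R) \<longrightarrow>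
     CB 4 M (\<lambda>w. complex_of_real (base_pot \<kappa> (g w))) (ball 0 (1/64))"
proof -
  have lt: "(1/64::real) < 7/8" by simp
  from holomorphic_map_CB[OF lt, where a="0::complex^'n" and k=4 and ?'m='n]
  obtain C where C: "C \<ge> 1" "\<forall>(g :: complex^'n \<Rightarrow> complex^'n) M. holomorphic_map_on g (ball 0 (7/8)) \<longrightarrow> (\<forall>w\<in>ball 0 (7/8). norm (g w) \<le> M) \<longrightarrow> M \<ge> 0 \<longrightarrow> CB 4 (C * M) g (ball 0 (1/64))"
    by blast
  define A where "A = C * R"
  have A: "A \<ge> 0" using C(1) R by (simp add: A_def)
  define M1 where "M1 = 2 ^ 4 * (A * A)"
  have M1: "M1 \<ge> 0" using A by (simp add: M1_def)
  define M where "M = 1 * (M1 + \<bar>\<kappa>\<bar> * (2 ^ 4 * (M1 * M1)))"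
  show ?thesis
  proof (intro exI[of _ M] conjI allI impI)
    show "0 \<le> M" using M1 by (simp add: M_def)
    fix g :: "complex^'n \<Rightarrow> complex^'n"
    assume g: "holomorphic_map_on g (ball 0 (7/8))" "\<forall>w\<in>ball 0 (7/8). norm (g w) \<le> R"
    have "CB 4 A g (ball 0 (1/64))" unfolding A_def using C(2) g R by blast
    then have i: "CB 4 M1 (\<lambda>w. inner (g w) (g w)) (ball 0 (1/64))"
      unfolding M1_def by (intro CB_inner A) auto
    have ii: "CB 4 (2 ^ 4 * (M1 * M1)) (\<lambda>w. inner (g w) (g w) * inner (g w) (g w)) (ball 0 (1/64))"
      by (rule CB_mult[OF open_ball M1 M1 i i])
    have "CB 4 (\<bar>\<kappa>\<bar> * (2 ^ 4 * (M1 * M1))) (\<lambda>w. \<kappa> * (inner (g w) (g w) * inner (g w) (g w))) (ball 0 (1/64))"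
      by (rule CB_linear[OF open_ball bounded_linear_mult_right _ _ ii]) (simp_all add: abs_mult)
    from CB_add[OF open_ball i this]
    have "CB 4 (M1 + \<bar>\<kappa>\<bar> * (2 ^ 4 * (M1 * M1))) (\<lambda>w. base_pot \<kappa> (g w)) (ball 0 (1/64))"
      by (simp add: base_pot_inner)
    then show "CB 4 M (\<lambda>w. complex_of_real (base_pot \<kappa> (g w))) (ball 0 (1/64))"
      unfolding M_def by (intro CB_linear[OF open_ball bounded_linear_of_real]) simp_all
  qed
qed

text \<open>The comparison quantity \<open>n X\<close> is the squared Euclidean length of \<open>X\<close>, measured in \<open>\<complex>\<^sup>n\<close> or in a chart.\<close>

lemma HBC_frame:
  fixes n :: "complex^'n \<Rightarrow> real"
  assumes u: "lsm (\<lambda>z. complex_of_real (\<phi> z)) S" and p: "p \<in> S"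
    and n: "\<And>X. X \<noteq> 0 \<Longrightarrow> 0 < n X" and abc: "a > 0" "b > 0" "c > 0" "e \<ge> 0"
    and lo: "\<And>X. a * n X \<le> Re (dz X (db X (\<lambda>z. complex_of_real (\<phi> z))) p)" and up: "\<And>X. Re (dz X (db X (\<lambda>z. complex_of_real (\<phi> z))) p) \<le> b * n X"
    and L: "\<And>X Y V. c * (n X * n Y) \<le> Re (lev (\<lambda>z. complex_of_real (\<phi> z)) p X Y V)" and U: "\<And>X Y. \<exists>V. Re (lev (\<lambda>z. complex_of_real (\<phi> z)) p X Y V) \<le> e * (n X * n Y)"
    and XY: "X \<noteq> 0" "Y \<noteq> 0"
  shows "- (e / a\<^sup>2) \<le> HBC (pot_metric (\<lambda>z. complex_of_real (\<phi> z))) p X Y" "HBC (pot_metric (\<lambda>z. complex_of_real (\<phi> z))) p X Y \<le> - (c / b\<^sup>2)"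
proof -
  let ?u = "\<lambda>z. complex_of_real (\<phi> z)"
  have pos: "0 < Re (dz X (db X ?u) p)" if "X \<noteq> 0" for X
    using lo[of X] mult_pos_pos[OF abc(1) n[OF that]] by linarith
  have nX: "0 < n X" "0 < n Y" using n XY by auto
  let ?h = "Re (dz X (db X ?u) p) * Re (dz Y (db Y ?u) p)"
  have h1: "?h \<le> (b * n X) * (b * n Y)" using up pos[OF XY(2)] nX abc by (intro mult_mono) (auto intro: less_imp_le)
  have h2: "(a * n X) * (a * n Y) \<le> ?h" using lo pos[OF XY(1)] nX abc by (intro mult_mono) (auto intro: less_imp_le)
  obtain V where V: "Re (lev ?u p X Y V) \<le> e * (n X * n Y)" using U by blast
  have "e * (n X * n Y) = e / a\<^sup>2 * ((a * n X) * (a * n Y))" using abc by (simp add: power2_eq_square)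
  also have "\<dots> \<le> e / a\<^sup>2 * ?h" using h2 abc by (intro mult_left_mono) auto
  finally have le: "Re (lev ?u p X Y V) \<le> e / a\<^sup>2 * ?h" using V by simp
  show "- (e / a\<^sup>2) \<le> HBC (pot_metric ?u) p X Y" by (rule HBC_bounds(2)[OF u pos p XY]) (assumption | rule le)+
  have "c / b\<^sup>2 * ?h \<le> c / b\<^sup>2 * ((b * n X) * (b * n Y))" using h1 abc by (intro mult_left_mono) auto
  also have "\<dots> = c * (n X * n Y)" using abc by (simp add: power2_eq_square)
  finally have "c / b\<^sup>2 * ?h \<le> c * (n X * n Y)" .
  then show "HBC (pot_metric ?u) p X Y \<le> - (c / b\<^sup>2)" using order_trans[OF _ L] by (intro HBC_bounds(1)[OF u pos p XY]) auto
qed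

context squeezing_net
begin

abbreviation pot :: "real \<Rightarrow> real \<Rightarrow> complex^'n \<Rightarrow> real" where
  "pot m \<kappa> \<equiv> \<lambda>z. \<phi> z + m * base_pot \<kappa> z"

lemma lsm_pot: "lsm (\<lambda>z. complex_of_real (pot m \<kappa> z)) \<Omega>"
  by (intro lsm_of_real lsm_add lsm_\<phi> lsm_mult lsm_const op lsm_base_pot)

lemma lev_pot:
  fixes X Y V :: "complex^'n"
  assumes p: "p \<in> \<Omega>"
  shows "Re (lev (\<lambda>z. complex_of_real (pot m \<kappa> z)) p X Y V) = Re (lev (\<lambda>z. complex_of_real (\<phi> z)) p X Y V) + m * Re (lev (\<lambda>z. complex_of_real (base_pot \<kappa> z)) p X Y V)"
    and "Re (dz X (db V (\<lambda>z. complex_of_real (pot m \<kappa> z))) p) = Re (dz X (db V (\<lambda>z. complex_of_real (\<phi> z))) p) + m * Re (dz X (db V (\<lambda>z. complex_of_real (base_pot \<kappa> z))) p)"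
proof -
  have b: "lsm (\<lambda>z. complex_of_real (base_pot \<kappa> z)) \<Omega>" by (intro lsm_of_real lsm_base_pot op)
  have mb: "lsm (\<lambda>z. complex_of_real m * complex_of_real (base_pot \<kappa> z)) \<Omega>" by (intro lsm_mult lsm_const op b)
  show "Re (lev (\<lambda>z. complex_of_real (pot m \<kappa> z)) p X Y V) = Re (lev (\<lambda>z. complex_of_real (\<phi> z)) p X Y V) + m * Re (lev (\<lambda>z. complex_of_real (base_pot \<kappa> z)) p X Y V)"
    unfolding of_real_add of_real_mult lev_add(1)[OF lsm_of_real[OF lsm_\<phi>] mb p] lev_cmult(1)[OF b p] by simp
  show "Re (dz X (db V (\<lambda>z. complex_of_real (pot m \<kappa> z))) p) = Re (dz X (db V (\<lambda>z. complex_of_real (\<phi> z))) p) + m * Re (dz X (db V (\<lambda>z. complex_of_real (base_pot \<kappa> z))) p)"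
    unfolding of_real_add of_real_mult lev_add(2)[OF lsm_of_real[OF lsm_\<phi>] mb p] lev_cmult(2)[OF b p] by simp
qed

text \<open>The chart is used on the neighbourhood \<open>W\<close> of \<open>p\<close> that it maps into the ball of radius \<open>7/8 < 1 - \<tau>\<close>.\<close>

lemma chart_facts:
  assumes f: "wide \<Omega> \<tau> f" "f p = 0" and p: "p \<in> \<Omega>" and g_def: "g = inv_into \<Omega> f"
  obtains W where "holomorphic_map_on g (ball 0 (7/8))" "\<And>w. w \<in> ball 0 (7/8) \<Longrightarrow> g w \<in> \<Omega>" "\<And>w. w \<in> ball 0 (7/8) \<Longrightarrow> f (g w) = w"
    "g 0 = p" "open W" "p \<in> W" "W \<subseteq> \<Omega>" "f ` W \<subseteq> ball 0 (7/8)" "\<And>z. z \<in> W \<Longrightarrow> g (f z) = z"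
    "holomorphic_map_on f \<Omega>"
    "\<And>v. dird (dird v g 0) f p = v"
    "\<And>X. X \<noteq> 0 \<Longrightarrow> 0 < (norm (dird X f p))\<^sup>2"
proof -
  have sub: "ball 0 (7/8) \<subseteq> ball (0::complex^'n) (1 - \<tau>)" using \<tau> by (intro subset_ball) simp
  have hg: "holomorphic_map_on g (ball 0 (7/8))" unfolding g_def by (rule holomorphic_map_subset[OF wide_inv_holomorphic[OF f(1) op] sub])
  have gO: "g w \<in> \<Omega>" "f (g w) = w" if "w \<in> ball 0 (7/8)" for w
    using wide_inv[OF f(1), of w] that sub unfolding g_def by auto
  have hf: "holomorphic_map_on f \<Omega>" by (rule wide_holomorphic[OF f(1) op])
  have gf: "g (f z) = z" if "z \<in> \<Omega>" for z unfolding g_def by (rule wide_inv_f[OF f(1) op that])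
  have g0: "g 0 = p" using gf[OF p] f(2) by simp
  define W where "W = \<Omega> \<inter> f -` ball 0 (7/8)"
  have W: "open W" unfolding W_def by (intro continuous_open_preimage holomorphic_map_continuous_on[OF hf] op) simp
  have inv: "dird (dird v g 0) f p = v" for v
  proof -
    have "dird v (\<lambda>w. f (g w)) 0 = dird (dird v g 0) f (g 0)"
      by (rule dird_map_compose[OF hf hg]) (use g0 p in auto)
    moreover have "frechet_derivative (\<lambda>w. f (g w)) (at 0) = frechet_derivative (\<lambda>w. w) (at 0)"
      by (rule frechet_derivative_eq_open[of "ball 0 (7/8)"]) (use gO in auto)
    moreover have "dird v (\<lambda>w::complex^'n. w) 0 = v" by (rule dird_eqI) (rule has_derivative_ident)
    ultimately show ?thesis using g0 by simp
  qed
  have inj: "0 < (norm (dird X f p))\<^sup>2" if "X \<noteq> 0" for X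
  proof -
    have "inj (frechet_derivative f (at p))" using f(1) p by (auto simp: wide_def holomorphic_embedding_on_def)
    moreover have "dird 0 f p = 0" by (rule linear_0[OF holomorphic_map_linear[OF hf p]])
    ultimately have "dird X f p \<noteq> 0" using that by (metis injD)
    then show ?thesis by simp
  qed
  show ?thesis
    by (rule that[of W, OF hg gO g0 W _ _ _ _ hf inv inj]) (use p f(2) gf in \<open>auto simp: W_def\<close>)
qed

text \<open>Off \<open>K2\<close> everything is measured in the chart centred at \<open>p\<close>. The averaged potential alone gives the lower bounds, since the base potential only adds
nonnegative terms; the upper bounds use \<open>base_chart_CB\<close> and a vector \<open>V\<close> whose vertical component vanishes in the chart.\<close>

lemma far_estimates:
  assumes p: "p \<in> \<Omega> - K2" and R: "\<And>z. z \<in> \<Omega> \<Longrightarrow> norm z \<le> R" and k: "0 < \<kappa>" "8 * \<kappa> * R\<^sup>2 \<le> 1" and m: "m \<ge> 0"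
    and M: "M \<ge> 0" "\<And>g :: complex^'n \<Rightarrow> complex^'n. holomorphic_map_on g (ball 0 (7/8)) \<Longrightarrow> (\<And>w. w \<in> ball 0 (7/8) \<Longrightarrow> norm (g w) \<le> R) \<Longrightarrow>
     CB 4 M (\<lambda>w. complex_of_real (base_pot \<kappa> (g w))) (ball 0 (1/64))"
  obtains n where "\<And>X. X \<noteq> 0 \<Longrightarrow> 0 < n X"
    "\<And>X. 1/2 * n X \<le> Re (dz X (db X (\<lambda>z. complex_of_real (pot m \<kappa> z))) p)"
    "\<And>X. Re (dz X (db X (\<lambda>z. complex_of_real (pot m \<kappa> z))) p) \<le> (real (Suc CARD('n)) + 1 + m * M) * n X"
    "\<And>X Y V. 1/2 * (n X * n Y) \<le> Re (lev (\<lambda>z. complex_of_real (pot m \<kappa> z)) p X Y V)"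
    "\<And>X Y. \<exists>V. Re (lev (\<lambda>z. complex_of_real (pot m \<kappa> z)) p X Y V) \<le> (2 * real (Suc CARD('n)) + 1 + m * (2 * M)) * (n X * n Y)"
    "\<And>F X. holomorphic_map_on F \<Omega> \<Longrightarrow> F ` \<Omega> \<subseteq> ball (0::complex^'n) 1 \<Longrightarrow> (norm (dird X F p))\<^sup>2 \<le> 2 * n X"
proof -
  have pO: "p \<in> \<Omega>" using p by blast
  let ?b = "\<lambda>z::complex^'n. complex_of_real (base_pot \<kappa> z)" and ?q = "\<lambda>z. complex_of_real (\<phi> z)"
  obtain f where f: "wide \<Omega> \<tau> f" "f p = 0"
    and lev: "\<And>A B V. let A' = dird A f p; B' = dird B f p; V' = dird V f p + dird B (dird A f) p in
       (norm A')\<^sup>2 * (norm B')\<^sup>2 / 2 \<le> Re (lev (\<lambda>z. complex_of_real (\<phi> z)) p A B V) \<and>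
       (V' = 0 \<longrightarrow> Re (lev (\<lambda>z. complex_of_real (\<phi> z)) p A B V) \<le> (2 * real (Suc CARD('n)) + 1) * ((norm A')\<^sup>2 * (norm B')\<^sup>2))"
    and h1: "\<And>A. (norm (dird A f p))\<^sup>2 / 2 \<le> Re (dz A (db A (\<lambda>z. complex_of_real (\<phi> z))) p)"
    and h2: "\<And>A. Re (dz A (db A (\<lambda>z. complex_of_real (\<phi> z))) p) \<le> (real (Suc CARD('n)) + 1) * (norm (dird A f p))\<^sup>2"
    by (rule chart_levi[OF p]) (rule that)
  define g where "g = inv_into \<Omega> f"
  obtain W where hg: "holomorphic_map_on g (ball 0 (7/8))" and gO: "\<And>w. w \<in> ball 0 (7/8) \<Longrightarrow> g w \<in> \<Omega>" and fg: "\<And>w. w \<in> ball 0 (7/8) \<Longrightarrow> f (g w) = w"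
    and g0: "g 0 = p" and W: "open W" "p \<in> W" "W \<subseteq> \<Omega>" "f ` W \<subseteq> ball 0 (7/8)" and gf: "\<And>z. z \<in> W \<Longrightarrow> g (f z) = z"
    and hf: "holomorphic_map_on f \<Omega>" and inv: "\<And>v. dird (dird v g 0) f p = v" and inj: "\<And>X. X \<noteq> 0 \<Longrightarrow> 0 < (norm (dird X f p))\<^sup>2"
    by (rule chart_facts[OF f pO g_def]) (rule that)
  define u where "u w = ?b (g w)" for w
  have uCB: "CB 4 M u (ball 0 (1/64))" unfolding u_def by (rule M(2)[OF hg]) (use gO R in blast)
  have ul: "lsm u (ball 0 (7/8))" unfolding u_def
    by (rule lsm_holomorphic_compose[OF lsm_of_real[OF lsm_base_pot[OF open_UNIV]] hg]) auto
  have hfW: "holomorphic_map_on f W" by (rule holomorphic_map_subset[OF hf W(3)])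
  have bu: "?b z = u (f z)" if "z \<in> W" for z using gf[OF that] by (simp add: u_def)
  have 0: "(0::complex^'n) \<in> ball 0 (1/64)" by simp
  have dzb: "norm (dz X (db X ?b) p) \<le> M * (norm (dird X f p))\<^sup>2" for X
  proof -
    have "dz X (db X ?b) p = dz X (db X (\<lambda>z. u (f z))) p" by (rule lev_cong(2)[OF W(1,2) bu])
    also have "\<dots> = dz (dird X f p) (db (dird X f p) u) 0"
      using dzdb_compose[OF ul hfW W(1,4,2)] f(2) by simp
    finally show ?thesis using lev_CB_bound(2)[OF open_ball uCB 0 M(1)] by simp
  qed
  have levb: "norm (lev ?b p X Y V) \<le> 2 * M * ((norm (dird X f p))\<^sup>2 * (norm (dird Y f p))\<^sup>2)"
    if V: "dird V f p + dird Y (dird X f) p = 0" for X Y V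
  proof -
    have "lev ?b p X Y V = lev (\<lambda>z. u (f z)) p X Y V" by (rule lev_cong(1)[OF W(1,2) bu])
    also have "\<dots> = lev u 0 (dird X f p) (dird Y f p) 0"
      using lev_compose[OF ul hfW W(1,4,2)] f(2) V by simp
    finally show ?thesis using lev_CB_bound(1)[OF open_ball uCB 0 M(1), of "dird X f p" "dird Y f p" 0] by simp
  qed
  have b_ge: "Re (lev ?b p X Y V) \<ge> 0" for X Y V
  proof -
    have "0 \<le> (norm V)\<^sup>2 / 2 + \<kappa> * ((norm X)\<^sup>2 * (norm Y)\<^sup>2)" using k(1) by simp
    also have "\<dots> \<le> Re (lev ?b p X Y V)" by (rule base_pot_lev_ge[OF k R[OF pO]])
    finally show ?thesis .
  qed
  have db_ge: "Re (dz X (db X ?b) p) \<ge> 0" for X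
    using order_trans[OF zero_le_power2 dzdb_base_pot_ge[of \<kappa> X p]] k(1) by simp
  show ?thesis
  proof (rule that[of "\<lambda>X. (norm (dird X f p))\<^sup>2"])
    fix X :: "complex^'n" assume "X \<noteq> 0" then show "0 < (norm (dird X f p))\<^sup>2" by (rule inj)
  next
    fix X :: "complex^'n"
    show "1/2 * (norm (dird X f p))\<^sup>2 \<le> Re (dz X (db X (\<lambda>z. complex_of_real (pot m \<kappa> z))) p)"
      unfolding lev_pot(2)[OF pO] using h1[of X] mult_nonneg_nonneg[OF m db_ge[of X]] by simp
    have "Re (dz X (db X ?b) p) \<le> M * (norm (dird X f p))\<^sup>2" using dzb[of X] complex_Re_le_cmod order_trans by blast
    from mult_left_mono[OF this m] h2[of X]
    show "Re (dz X (db X (\<lambda>z. complex_of_real (pot m \<kappa> z))) p) \<le> (real (Suc CARD('n)) + 1 + m * M) * (norm (dird X f p))\<^sup>2"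
      unfolding lev_pot(2)[OF pO] by (simp add: algebra_simps)
  next
    fix X Y V :: "complex^'n"
    show "1/2 * ((norm (dird X f p))\<^sup>2 * (norm (dird Y f p))\<^sup>2) \<le> Re (lev (\<lambda>z. complex_of_real (pot m \<kappa> z)) p X Y V)"
      unfolding lev_pot(1)[OF pO] using lev[of X Y V] mult_nonneg_nonneg[OF m b_ge[of X Y V]] by (simp add: Let_def)
  next
    fix X Y :: "complex^'n"
    (* This choice cancels the second derivative of the chart in lev_compose. *)
    define V where "V = dird (- dird Y (dird X f) p) g 0"
    have V: "dird V f p + dird Y (dird X f) p = 0" by (simp add: V_def inv)
    have "Re (lev ?b p X Y V) \<le> 2 * M * ((norm (dird X f p))\<^sup>2 * (norm (dird Y f p))\<^sup>2)" using levb[OF V] complex_Re_le_cmod order_trans by blast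
    from mult_left_mono[OF this m] 
    have "m * Re (lev ?b p X Y V) \<le> m * (2 * M) * ((norm (dird X f p))\<^sup>2 * (norm (dird Y f p))\<^sup>2)" by (simp add: mult.assoc)
    moreover have "Re (lev ?q p X Y V) \<le> (2 * real (Suc CARD('n)) + 1) * ((norm (dird X f p))\<^sup>2 * (norm (dird Y f p))\<^sup>2)"
      using lev[of X Y V] V by (simp add: Let_def)
    ultimately have "Re (lev (\<lambda>z. complex_of_real (pot m \<kappa> z)) p X Y V) \<le> (2 * real (Suc CARD('n)) + 1 + m * (2 * M)) * ((norm (dird X f p))\<^sup>2 * (norm (dird Y f p))\<^sup>2)"
      unfolding lev_pot(1)[OF pO] by (simp only: distrib_right)
    then show "\<exists>V. Re (lev (\<lambda>z. complex_of_real (pot m \<kappa> z)) p X Y V) \<le> (2 * real (Suc CARD('n)) + 1 + m * (2 * M)) * ((norm (dird X f p))\<^sup>2 * (norm (dird Y f p))\<^sup>2)"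
      by blast
  next
    fix F :: "complex^'n \<Rightarrow> complex^'n" and X assume F: "holomorphic_map_on F \<Omega>" "F ` \<Omega> \<subseteq> ball 0 1"
    have hFg: "holomorphic_map_on (\<lambda>w. F (g w)) (ball 0 (7/8))" by (rule holomorphic_map_compose[OF F(1) hg]) (use gO in blast)
    have "norm (dird v (\<lambda>w. F (g w)) 0) \<le> 1 / (7/8) * norm v" for v
      by (rule Cauchy_estimate_map[OF hFg]) (use F(2) gO in \<open>auto simp: subset_iff intro: less_imp_le\<close>)
    note this[of "dird X f p"]
    moreover have "dird X F p = dird X (\<lambda>z. (\<lambda>w. F (g w)) (f z)) p"
      using frechet_derivative_eq_open[OF W(1,2), of F "\<lambda>z. F (g (f z))"] gf by simp
    moreover have "dird X (\<lambda>z. (\<lambda>w. F (g w)) (f z)) p = dird (dird X f p) (\<lambda>w. F (g w)) (f p)"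
      by (rule dird_map_compose[OF hFg hfW W(2)]) (use W in blast)
    ultimately have "norm (dird X F p) \<le> 8/7 * norm (dird X f p)" using f(2) by simp
    then have "(norm (dird X F p))\<^sup>2 \<le> (8/7 * norm (dird X f p))\<^sup>2" by (rule power_mono) simp
    also have "\<dots> \<le> 2 * (norm (dird X f p))\<^sup>2" by (simp add: power_mult_distrib power2_eq_square)
    finally show "(norm (dird X F p))\<^sup>2 \<le> 2 * (norm (dird X f p))\<^sup>2" .
  qed
qed

text \<open>On \<open>K2\<close> nothing is known about the averaged potential except that its derivatives are bounded, and \<open>m\<close> is chosen so that the base potential
dominates it: \<open>m \<kappa> = 4 M + 2\<close> for the terms in \<open>X\<close> and \<open>Y\<close>, and \<open>m \<ge> 4 M + 2\<close> for those in \<open>V\<close>.\<close>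

lemma near_estimates:
  fixes X Y V :: "complex^'n"
  assumes p: "p \<in> K2" and R: "\<And>z. z \<in> \<Omega> \<Longrightarrow> norm z \<le> R" and k: "0 < \<kappa>" "\<kappa> \<le> 1" "8 * \<kappa> * R\<^sup>2 \<le> 1" 
    and U: "open U" "K2 \<subseteq> U" and M: "M \<ge> 0" "CB 4 M (\<lambda>z. complex_of_real (\<phi> z)) U" 
    and U': "open U'" "K2 \<subseteq> U'" and M': "M' \<ge> 0" "CB 4 M' (\<lambda>z. complex_of_real (base_pot \<kappa> z)) U'"
    and m: "m = 2 * (2 * M + 1) / \<kappa>"
  shows "1 * (norm X)\<^sup>2 \<le> Re (dz X (db X (\<lambda>z. complex_of_real (pot m \<kappa> z))) p)"
    "Re (dz X (db X (\<lambda>z. complex_of_real (pot m \<kappa> z))) p) \<le> (M + m * M' + 1) * (norm X)\<^sup>2"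
    "1 * ((norm X)\<^sup>2 * (norm Y)\<^sup>2) \<le> Re (lev (\<lambda>z. complex_of_real (pot m \<kappa> z)) p X Y V)"
    "\<exists>V. Re (lev (\<lambda>z. complex_of_real (pot m \<kappa> z)) p X Y V) \<le> (2 * M + m * (2 * M')) * ((norm X)\<^sup>2 * (norm Y)\<^sup>2)"
proof -
  have pO: "p \<in> \<Omega>" and pU: "p \<in> U" "p \<in> U'" using p K2 U U' by auto
  let ?b = "\<lambda>z::complex^'n. complex_of_real (base_pot \<kappa> z)" and ?q = "\<lambda>z. complex_of_real (\<phi> z)"
  have mk: "m * \<kappa> = 4 * M + 2" using k(1) by (simp add: m)
  have m0: "m \<ge> 0" using M(1) k(1) by (simp add: m)
  have "m * \<kappa> \<le> m * 1" by (rule mult_left_mono[OF k(2) m0])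
  then have m1: "m \<ge> 4 * M + 2" using mk by simp
  have q1: "\<bar>Re (dz X (db X ?q) p)\<bar> \<le> M * (norm X)\<^sup>2"
    using order_trans[OF abs_Re_le_cmod lev_CB_bound(2)[OF U(1) M(2) pU(1) M(1)]] .
  have b1: "\<bar>Re (dz X (db X ?b) p)\<bar> \<le> M' * (norm X)\<^sup>2"
    using order_trans[OF abs_Re_le_cmod lev_CB_bound(2)[OF U'(1) M'(2) pU(2) M'(1)]] .
  have q2: "\<bar>Re (lev ?q p X Y V)\<bar> \<le> 2 * M * ((norm X)\<^sup>2 * (norm Y)\<^sup>2 + (norm V)\<^sup>2)" for V
    using order_trans[OF abs_Re_le_cmod lev_CB_bound(1)[OF U(1) M(2) pU(1) M(1)]] .
  have b2: "\<bar>Re (lev ?b p X Y V)\<bar> \<le> 2 * M' * ((norm X)\<^sup>2 * (norm Y)\<^sup>2 + (norm V)\<^sup>2)" for V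
    using order_trans[OF abs_Re_le_cmod lev_CB_bound(1)[OF U'(1) M'(2) pU(2) M'(1)]] .
  have "(4 * M + 2) * (norm X)\<^sup>2 \<le> m * (norm X)\<^sup>2" using m1 by (intro mult_right_mono) auto
  also have "\<dots> \<le> m * Re (dz X (db X ?b) p)" using dzdb_base_pot_ge[of \<kappa> X p] k(1) m0 by (intro mult_left_mono) auto
  finally have "(4 * M + 2) * (norm X)\<^sup>2 \<le> m * Re (dz X (db X ?b) p)" .
  moreover have "(M + 1) * (norm X)\<^sup>2 \<le> (4 * M + 2) * (norm X)\<^sup>2" using M(1) by (intro mult_right_mono) auto
  moreover have "(M + 1) * (norm X)\<^sup>2 = M * (norm X)\<^sup>2 + (norm X)\<^sup>2" by (simp add: distrib_right)
  ultimately show "1 * (norm X)\<^sup>2 \<le> Re (dz X (db X (\<lambda>z. complex_of_real (pot m \<kappa> z))) p)"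
    unfolding lev_pot(2)[OF pO] using abs_le_D2[OF q1] by linarith
  have "m * Re (dz X (db X ?b) p) \<le> m * (M' * (norm X)\<^sup>2)" using abs_le_D1[OF b1] m0 by (intro mult_left_mono) auto
  moreover have "(M + m * M' + 1) * (norm X)\<^sup>2 = M * (norm X)\<^sup>2 + m * (M' * (norm X)\<^sup>2) + (norm X)\<^sup>2" by (simp add: distrib_right)
  ultimately show "Re (dz X (db X (\<lambda>z. complex_of_real (pot m \<kappa> z))) p) \<le> (M + m * M' + 1) * (norm X)\<^sup>2"
    unfolding lev_pot(2)[OF pO] using abs_le_D1[OF q1] zero_le_power2[of "norm X"] by linarith
  let ?N = "(norm X)\<^sup>2 * (norm Y)\<^sup>2" and ?v = "(norm V)\<^sup>2"
  have "m * (?v / 2 + \<kappa> * ?N) \<le> m * Re (lev ?b p X Y V)"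
    using base_pot_lev_ge[OF k(1,3) R[OF pO]] m0 by (intro mult_left_mono) auto
  moreover have "m * (?v / 2 + \<kappa> * ?N) = m * (?v / 2) + (m * \<kappa>) * ?N" by (simp add: distrib_left)
  moreover have "(4 * M + 2) * (?v / 2) \<le> m * (?v / 2)" using m1 by (intro mult_right_mono) auto
  moreover have "(4 * M + 2) * (?v / 2) = 2 * M * ?v + ?v" by (simp add: field_simps)
  moreover have "(m * \<kappa>) * ?N = 4 * (M * ?N) + 2 * ?N" by (simp add: mk distrib_right)
  moreover have "2 * M * (?N + ?v) = 2 * (M * ?N) + 2 * M * ?v" by (simp add: distrib_left)
  moreover have "0 \<le> M * ?N" "0 \<le> ?N" "0 \<le> ?v" using M(1) by auto
  ultimately show "1 * ?N \<le> Re (lev (\<lambda>z. complex_of_real (pot m \<kappa> z)) p X Y V)"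
    unfolding lev_pot(1)[OF pO] using abs_le_D2[OF q2[of V]] by linarith
  have "m * Re (lev ?b p X Y 0) \<le> m * (2 * M' * ?N)" using abs_le_D1[OF b2[of 0]] m0 by (intro mult_left_mono) auto
  moreover have "(2 * M + m * (2 * M')) * ?N = 2 * M * ?N + m * (2 * M' * ?N)" by (simp add: distrib_right)
  ultimately have "Re (lev (\<lambda>z. complex_of_real (pot m \<kappa> z)) p X Y 0) \<le> (2 * M + m * (2 * M')) * ?N"
    unfolding lev_pot(1)[OF pO] using abs_le_D1[OF q2[of 0]] by simp
  then show "\<exists>V. Re (lev (\<lambda>z. complex_of_real (pot m \<kappa> z)) p X Y V) \<le> (2 * M + m * (2 * M')) * ?N" by blast
qed

lemma metric_exists:
  assumes conn: "connected \<Omega>" and bd: "bounded \<Omega>"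
  shows "\<exists>h. kaehler_metric_on \<Omega> h \<and> complete_metric_on \<Omega> h \<and> negatively_pinched_HBC_on \<Omega> h"
proof -
  obtain R where R: "R > 0" "\<Omega> \<subseteq> ball 0 R" using bounded_subset_ballD[OF bd, of 0] by blast
  have RO: "norm z \<le> R" if "z \<in> \<Omega>" for z using R(2) that by (auto simp: subset_iff intro: less_imp_le)
  define \<kappa> where "\<kappa> = 1 / (8 * R\<^sup>2 + 1)"
  have den: "8 * R\<^sup>2 + 1 > 0" by (simp add: add_nonneg_pos)
  have k: "0 < \<kappa>" "\<kappa> \<le> 1" "8 * \<kappa> * R\<^sup>2 \<le> 1" using den by (simp_all add: \<kappa>_def divide_simps)
  obtain M2 U2 where M2: "M2 \<ge> 0" "open U2" "K2 \<subseteq> U2" "U2 \<subseteq> \<Omega>" "CB 4 M2 (\<lambda>z. complex_of_real (\<phi> z)) U2"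
    by (rule lsm_compact_CB[OF lsm_of_real[OF lsm_\<phi>] K2]) (rule that)
  obtain M3 U3 where M3: "M3 \<ge> 0" "open U3" "K2 \<subseteq> U3" "U3 \<subseteq> \<Omega>" "CB 4 M3 (\<lambda>z. complex_of_real (base_pot \<kappa> z)) U3"
    by (rule lsm_compact_CB[OF lsm_of_real[OF lsm_base_pot[OF op]] K2]) (rule that)
  have "\<exists>M\<ge>0. \<forall>g :: complex^'n \<Rightarrow> complex^'n. holomorphic_map_on g (ball 0 (7/8)) \<longrightarrow> (\<forall>w\<in>ball 0 (7/8). norm (g w) \<le> R) \<longrightarrow>
     CB 4 M (\<lambda>w. complex_of_real (base_pot \<kappa> (g w))) (ball 0 (1/64))" by (rule base_chart_CB) (use R in simp)
  then obtain M4 where M4: "M4 \<ge> 0" "\<And>g :: complex^'n \<Rightarrow> complex^'n. holomorphic_map_on g (ball 0 (7/8)) \<Longrightarrow> (\<And>w. w \<in> ball 0 (7/8) \<Longrightarrow> norm (g w) \<le> R) \<Longrightarrow>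
     CB 4 M4 (\<lambda>w. complex_of_real (base_pot \<kappa> (g w))) (ball 0 (1/64))" by blast
  define m where "m = 2 * (2 * M2 + 1) / \<kappa>"
  have m0: "m \<ge> 0" using M2(1) k(1) by (simp add: m_def)
  let ?u = "\<lambda>z. complex_of_real (pot m \<kappa> z)"
  let ?h = "pot_metric ?u"
  note near = near_estimates[OF _ RO k M2(2,3,1,5) M3(2,3,1,5) m_def]
  obtain d where d: "d > 0" "(\<Union>x\<in>K2. cball x d) \<subseteq> \<Omega>" using compact_subset_open_imp_cball_epsilon_subset[OF K2(1) op K2(2)] by blast
  (* Off K2 the factor 4 suffices by the far estimates; on K2 the Cauchy estimate on balls of radius d gives 1 / d^2. *)
  define C where "C = 4 + 1 / d\<^sup>2"
  have C: "C \<ge> 4" "C \<ge> 1 / d\<^sup>2" "C > 0" using d(1) by (auto simp: C_def add_pos_nonneg)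
  define b1 where "b1 = real (Suc CARD('n)) + 1 + m * M4"
  define e1 where "e1 = 2 * real (Suc CARD('n)) + 1 + m * (2 * M4)"
  define b2 where "b2 = M2 + m * M3 + 1"
  define e2 where "e2 = 2 * M2 + m * (2 * M3)"
  have be: "b1 > 0" "e1 \<ge> 0" "b2 > 0" "e2 \<ge> 0" using m0 M2(1) M3(1) M4(1) by (auto simp: b1_def e1_def b2_def e2_def add_pos_nonneg add_nonneg_pos)
  have pos: "0 < Re (dz X (db X ?u) p)" if p: "p \<in> \<Omega>" and X: "X \<noteq> 0" for p X
  proof (cases "p \<in> K2")
    case True
    have "0 < (norm X)\<^sup>2" using X by simp
    then show ?thesis using near(1)[OF True, of X] by linarith
  next
    case False
    then have p': "p \<in> \<Omega> - K2" using p by blast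
    show ?thesis
    proof (rule far_estimates[OF p' RO k(1,3) m0 M4])
      fix n :: "complex^'n \<Rightarrow> real" assume "\<And>X. X \<noteq> 0 \<Longrightarrow> 0 < n X" "\<And>X. 1/2 * n X \<le> Re (dz X (db X ?u) p)"
      from this(1)[OF X] this(2)[of X] show ?thesis by linarith
    qed
  qed
  have kaehler: "kaehler_metric_on \<Omega> ?h" by (rule pot_metric_kaehler[OF lsm_pot pos])
  have dom: "(norm (dird X F p))\<^sup>2 \<le> C * Re (herm_form (?h p) X X)"
    if F: "holomorphic_map_on F \<Omega>" "F ` \<Omega> \<subseteq> ball (0::complex^'n) 1" and p: "p \<in> \<Omega>" for F p X
    unfolding herm_form_pot_metric[OF lsm_pot p]
  proof (cases "p \<in> K2")
    case True
    have "cball p d \<subseteq> \<Omega>" using d(2) True by blast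
    then have sub: "ball p d \<subseteq> \<Omega>" using ball_subset_cball by (rule order_trans[rotated])
    have "norm (dird X F p) \<le> 1 / d * norm X"
      by (rule Cauchy_estimate_map[OF holomorphic_map_subset[OF F(1) sub] d(1)]) (use F(2) sub in \<open>auto simp: subset_iff intro: less_imp_le\<close>)
    then have "(norm (dird X F p))\<^sup>2 \<le> (1 / d * norm X)\<^sup>2" by (rule power_mono) simp
    also have "\<dots> = 1 / d\<^sup>2 * (norm X)\<^sup>2" by (simp add: power_mult_distrib power_divide)
    also have "\<dots> \<le> C * Re (dz X (db X ?u) p)" using near(1)[OF True, of X] C by (intro mult_mono) auto
    finally show "(norm (dird X F p))\<^sup>2 \<le> C * Re (dz X (db X ?u) p)" .
  next
    case False
    then have p': "p \<in> \<Omega> - K2" using p by blast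
    show "(norm (dird X F p))\<^sup>2 \<le> C * Re (dz X (db X ?u) p)"
    proof (rule far_estimates[OF p' RO k(1,3) m0 M4])
      fix n :: "complex^'n \<Rightarrow> real" assume n: "\<And>X. X \<noteq> 0 \<Longrightarrow> 0 < n X" "\<And>X. 1/2 * n X \<le> Re (dz X (db X ?u) p)"
        and nF: "\<And>F X. holomorphic_map_on F \<Omega> \<Longrightarrow> F ` \<Omega> \<subseteq> ball (0::complex^'n) 1 \<Longrightarrow> (norm (dird X F p))\<^sup>2 \<le> 2 * n X"
      have 1: "(norm (dird X F p))\<^sup>2 \<le> 4 * Re (dz X (db X ?u) p)" using nF[OF F, of X] n(2)[of X] by linarith
      then have "0 \<le> Re (dz X (db X ?u) p)" using zero_le_power2[of "norm (dird X F p)"] by linarith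
      from mult_right_mono[OF C(1) this] 1 show ?thesis by linarith
    qed
  qed
  have cont: "continuous_on \<Omega> ?h" by (rule lsm_continuous_on[OF lsm_pot_metric[OF lsm_pot]])
  interpret dominating_metric \<Omega> ?h C R
    by unfold_locales (use op conn R C cont dom in auto)
  have complete: "complete_metric_on \<Omega> ?h"
    by (rule complete[OF K2]) (use chart wide_mono \<tau>(2) in blast)
  have "- (e1 / (1/2)\<^sup>2 + e2 / 1\<^sup>2 + 1) \<le> HBC ?h p X Y \<and> HBC ?h p X Y \<le> - min (1/2 / b1\<^sup>2) (1 / b2\<^sup>2)"
    if p: "p \<in> \<Omega>" and XY: "X \<noteq> 0" "Y \<noteq> 0" for p X Y
  proof (cases "p \<in> K2")
    case True
    have "- (e2 / 1\<^sup>2) \<le> HBC ?h p X Y" "HBC ?h p X Y \<le> - (1 / b2\<^sup>2)"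
      by (rule HBC_frame[OF lsm_pot p, of "\<lambda>X. (norm X)\<^sup>2" 1 b2 1 e2]; use near[OF True] be XY in \<open>simp add: b2_def e2_def\<close>)+
    moreover have "e1 / (1/2)\<^sup>2 \<ge> 0" using be by simp
    ultimately show ?thesis by auto
  next
    case False
    then have p': "p \<in> \<Omega> - K2" using p by blast
    have "- (e1 / (1/2)\<^sup>2) \<le> HBC ?h p X Y \<and> HBC ?h p X Y \<le> - (1/2 / b1\<^sup>2)"
    proof (rule far_estimates[OF p' RO k(1,3) m0 M4])
      fix n :: "complex^'n \<Rightarrow> real" assume n: "\<And>X. X \<noteq> 0 \<Longrightarrow> 0 < n X" "\<And>X. 1/2 * n X \<le> Re (dz X (db X ?u) p)"
         "\<And>X. Re (dz X (db X ?u) p) \<le> (real (Suc CARD('n)) + 1 + m * M4) * n X"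
         "\<And>X Y V. 1/2 * (n X * n Y) \<le> Re (lev ?u p X Y V)"
         "\<And>X Y. \<exists>V. Re (lev ?u p X Y V) \<le> (2 * real (Suc CARD('n)) + 1 + m * (2 * M4)) * (n X * n Y)"
      have "(0::real) < 1/2" by simp
      note HBC_frame[OF lsm_pot p n(1) this be(1)[unfolded b1_def] this be(2)[unfolded e1_def] n(2-5) XY]
      then show ?thesis unfolding b1_def e1_def by blast
    qed
    moreover have "e2 / 1\<^sup>2 \<ge> 0" using be by simp
    ultimately show ?thesis by auto
  qed
  moreover have "0 < min (1/2 / b1\<^sup>2) (1 / b2\<^sup>2)" "0 < e1 / (1/2)\<^sup>2 + e2 / 1\<^sup>2 + 1" using be by (auto simp: add_nonneg_pos)
  ultimately have "negatively_pinched_HBC_on \<Omega> ?h" unfolding negatively_pinched_HBC_on_def by blast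
  then show ?thesis using kaehler complete by blast
qed

end

theorem corollary4p4p1:
  fixes \<Omega> :: "(complex^'n) set"
  assumes "open \<Omega>" and "connected \<Omega>" and "\<Omega> \<noteq> {}" and "bounded \<Omega>"
    and "\<forall>q\<in>frontier \<Omega>. (squeezing_function \<Omega> \<longlongrightarrow> 1) (at q within \<Omega>)"
  shows "\<exists>h. kaehler_metric_on \<Omega> h \<and> complete_metric_on \<Omega> h \<and> negatively_pinched_HBC_on \<Omega> h"
proof -
  obtain N where N: "\<forall>A \<subseteq> ball (0::complex^'n) 1. (\<forall>x\<in>A. \<forall>y\<in>A. x \<noteq> y \<longrightarrow> 1/128 \<le> dist x y) \<longrightarrow> finite A \<and> card A \<le> N"
    using packing_bound[of "1/128", where ?'n='n] by auto
  have eps: "(0::real) < 1/8" by simp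
  from chart_error[OF bump_pos_near eps, where N=N and ?'n='n and ?'j="complex^'n"]
  (* The order of choices matters: N does not depend on \<tau>, which in turn is fixed before the compact set and the net. *)
  obtain \<tau> \<rho> where \<tau>: "0 < \<tau>" "\<tau> \<le> 1/12" and \<rho>: "0 < \<rho>" "\<rho> \<le> 1/128" 
    and err: "\<forall>\<Omega> (f :: complex^'n \<Rightarrow> complex^'n) (F :: complex^'n \<Rightarrow> complex^'n \<Rightarrow> complex^'n) J.
     open \<Omega> \<longrightarrow> wide \<Omega> \<tau> f \<longrightarrow> finite J \<longrightarrow> card J \<le> N \<longrightarrow> (\<forall>j\<in>J. wide \<Omega> \<tau> (F j) \<and> norm (F j (inv_into \<Omega> f 0)) < 1/8) \<longrightarrow>
     (\<Sum>j\<in>J. bump ((norm (F j (inv_into \<Omega> f 0)))\<^sup>2)) \<ge> bump ((1/32)\<^sup>2) \<longrightarrow>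
     (\<forall>w\<in>ball 0 \<rho>. (\<Sum>j\<in>J. bump ((norm (F j (inv_into \<Omega> f w)))\<^sup>2)) > 0) \<and>
     CB 4 (1/8) (\<lambda>w. (\<Sum>j\<in>J. bump ((norm (F j (inv_into \<Omega> f w)))\<^sup>2) * (logvol (F j) (inv_into \<Omega> f w) - logvol f (inv_into \<Omega> f w)))
        * inverse (\<Sum>j\<in>J. bump ((norm (F j (inv_into \<Omega> f w)))\<^sup>2))) (ball 0 \<rho>)"
    by (elim exE conjE) (rule that)
  obtain K where K: "compact K" "K \<subseteq> \<Omega>" "\<And>p. p \<in> \<Omega> - K \<Longrightarrow> \<exists>f. wide \<Omega> \<tau> f \<and> f p = 0"
    by (rule squeezing_compact[OF assms(1,4,5) \<tau>(1)]) (rule that)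
  define G where "G = {p\<in>\<Omega>. \<exists>f. wide \<Omega> \<tau> f \<and> f p = 0}"
  have "\<forall>p\<in>G. \<exists>f. wide \<Omega> \<tau> f \<and> f p = 0" by (simp add: G_def)
  then obtain F where F: "\<And>p. p \<in> G \<Longrightarrow> wide \<Omega> \<tau> (F p) \<and> F p p = 0" by metis
  have GO: "G \<subseteq> \<Omega>" by (auto simp: G_def)
  obtain S where S: "S \<subseteq> G" "\<And>j k. j \<in> S \<Longrightarrow> k \<in> S \<Longrightarrow> j \<noteq> k \<Longrightarrow> 1/64 \<le> norm (F j k)" "\<And>z. z \<in> G \<Longrightarrow> \<exists>j\<in>S. norm (F j z) \<le> 1/32"
    by (rule centred_net_exists[OF assms(1) \<tau>(2) GO F]) (assumption | rule that)+
  have FS: "wide \<Omega> \<tau> (F j) \<and> F j j = 0" if "j \<in> S" for j using F S(1) that by blast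
  have SO: "S \<subseteq> \<Omega>" using S(1) GO by blast
  obtain cut K2 where K2: "compact K2" "K2 \<subseteq> \<Omega>" "K \<subseteq> K2" and cut: "lsm cut UNIV" "\<And>z. cut z \<ge> (0::real)" "\<And>z. z \<in> K \<Longrightarrow> cut z > 0" "\<And>z. z \<notin> K2 \<Longrightarrow> cut z = 0"
    by (rule smooth_cutoff[OF K(1,2) assms(1)]) (rule that)
  have out: "p \<in> G" if "p \<in> \<Omega> - K" for p using K(3)[OF that] that by (simp add: G_def)
  interpret squeezing_net \<Omega> \<tau> \<rho> F S K2 cut N
  proof
    show "open \<Omega>" "0 < \<tau>" "\<tau> \<le> 1/12" "0 < \<rho>" "\<rho> \<le> 1/128" "compact K2" "K2 \<subseteq> \<Omega>" by (fact assms(1) \<tau> \<rho> K2)+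
    show "wide \<Omega> \<tau> (F j)" if "j \<in> S" for j using FS[OF that] by blast
    show "finite {j\<in>S. norm (F j z) < 1/8} \<and> card {j\<in>S. norm (F j z) < 1/8} \<le> N" if "z \<in> \<Omega>" for z
      by (rule centred_net_count[OF assms(1) \<tau>(2) SO FS S(2) N that])
    show "\<exists>f. wide \<Omega> \<tau> f \<and> f p = 0" if "p \<in> \<Omega> - K2" for p using K(3)[of p] that K2(3) by blast
    show "\<exists>j\<in>S. norm (F j p) \<le> 1/32" if "p \<in> \<Omega> - K2" for p using S(3)[OF out[of p]] that K2(3) by blast
    show "0 < cut p \<or> (\<exists>j\<in>S. norm (F j p) \<le> 1/32)" if "p \<in> \<Omega>" for p using S(3)[OF out[of p]] cut(3)[of p] that by blast
    show "lsm cut \<Omega>" by (rule lsm_subset[OF cut(1) assms(1)]) simp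
    show "0 \<le> cut z" for z by (rule cut(2))
    show "cut z = 0" if "z \<notin> K2" for z by (rule cut(4)[OF that])
  next
    fix f :: "complex^'n \<Rightarrow> complex^'n" and J
    assume "wide \<Omega> \<tau> f" "finite J" "card J \<le> N" "\<forall>j\<in>J. wide \<Omega> \<tau> (F j) \<and> norm (F j (inv_into \<Omega> f 0)) < 1/8"
       "(\<Sum>j\<in>J. bump ((norm (F j (inv_into \<Omega> f 0)))\<^sup>2)) \<ge> bump ((1/32)\<^sup>2)"
    then show "(\<forall>w\<in>ball 0 \<rho>. (\<Sum>j\<in>J. bump ((norm (F j (inv_into \<Omega> f w)))\<^sup>2)) > 0) \<and>
     CB 4 (1/8) (\<lambda>w. (\<Sum>j\<in>J. bump ((norm (F j (inv_into \<Omega> f w)))\<^sup>2) * (logvol (F j) (inv_into \<Omega> f w) - logvol f (inv_into \<Omega> f w)))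
        * inverse (\<Sum>j\<in>J. bump ((norm (F j (inv_into \<Omega> f w)))\<^sup>2))) (ball 0 \<rho>)"
      using err[THEN spec[of _ \<Omega>], THEN spec[of _ f], THEN spec[of _ F], THEN spec[of _ J]] assms(1) by (elim impE) simp_all
  qed
  show ?thesis by (rule metric_exists[OF assms(2,4)])
qed

end
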